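(* Let $\alpha>0$, $\alpha\neq1$, let $u\in L^\infty(U^\alpha)$, and let $T=T_u=PM_u$ be the Toeplitz operator on $A^2(U^\alpha)$ with symbol $u$. Then $T$ is compact if and only if $\lim_{d(z,0)\to1}\|Tk_z\|=0$.
   Context: $U^\alpha=\{z=(z_1,z_2)\in\mathbb C^2: |z_1|^{2/\alpha}+|z_2|^2<1\}$; $\langle\cdot,\cdot\rangle$ and $\|\cdot\|$ are the inner product and norm of $L^2(U^\alpha)$ with respect to Lebesgue measure. $A^2(U^\alpha)$ is the Bergman space, the closed subspace of holomorphic functions in $L^2(U^\alpha)$; $P:L^2(U^\alpha)\to A^2(U^\alpha)$ is the orthogonal (Bergman) projection; $M_u$ is multiplication by $u$. $K_z=K_{U^\alpha}(\cdot;\bar z)$ is the reproducing kernel of $A^2(U^\alpha)$ at $z$, and $k_z=K_z/\|K_z\|$. The Skwarczyński distance is $d(z,w)=(1-|\langle k_z,k_w\rangle|)^{1/2}$; on $U^\alpha$, $d(z,0)\to1$ means that $z$ approaches the boundary of $U^\alpha$. *)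

theory Defs
  imports "HOL-Analysis.Analysis" "HOL-Library.Going_To_Filter"
begin

definition U_dom :: "real \<Rightarrow> (complex \<times> complex) set" where
  "U_dom \<alpha> = {z. norm (fst z) powr (2 / \<alpha>) + (norm (snd z))\<^sup>2 < 1}"

text \<open>Elements of \<open>L\<^sup>2\<close> and \<open>L\<^sup>\<infinity>\<close> are represented by functions, whose values off
  the domain are irrelevant; classes modulo almost everywhere equality are not formed.\<close>

definition L2_space :: "(complex \<times> complex) set \<Rightarrow> (complex \<times> complex \<Rightarrow> complex) set" where
  "L2_space \<Omega> = {f \<in> borel_measurable (lebesgue_on \<Omega>).
     integrable (lebesgue_on \<Omega>) (\<lambda>z. (norm (f z))\<^sup>2)}"

definition Linf_space :: "(complex \<times> complex) set \<Rightarrow> (complex \<times> complex \<Rightarrow> complex) set" where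
  "Linf_space \<Omega> = {u \<in> borel_measurable (lebesgue_on \<Omega>).
     \<exists>C. AE z in lebesgue_on \<Omega>. norm (u z) \<le> C}"

definition L2_inner ::
    "(complex \<times> complex) set \<Rightarrow> (complex \<times> complex \<Rightarrow> complex) \<Rightarrow> (complex \<times> complex \<Rightarrow> complex) \<Rightarrow> complex" where
  "L2_inner \<Omega> f g = (LINT z|lebesgue_on \<Omega>. f z * cnj (g z))"

definition L2_norm_on :: "(complex \<times> complex) set \<Rightarrow> (complex \<times> complex \<Rightarrow> complex) \<Rightarrow> real" where
  "L2_norm_on \<Omega> f = sqrt (LINT z|lebesgue_on \<Omega>. (norm (f z))\<^sup>2)"

text \<open>Holomorphy in two variables: the real Frechet derivative exists and is complex linear.\<close>

definition holomorphic2_on ::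
    "(complex \<times> complex \<Rightarrow> complex) \<Rightarrow> (complex \<times> complex) set \<Rightarrow> bool" where
  "holomorphic2_on f \<Omega> \<longleftrightarrow>
     (\<forall>z\<in>\<Omega>. \<exists>a b. (f has_derivative (\<lambda>h. a * fst h + b * snd h)) (at z))"

text \<open>The convention \<open>f = 0\<close> off the open set \<open>\<Omega>\<close> makes each element of the Bergman space a
  single HOL function, so that the \<open>L\<^sup>2\<close> distance is a genuine metric on \<open>bergman_space \<Omega>\<close>
  and the definite descriptions below denote uniquely.\<close>

definition bergman_space :: "(complex \<times> complex) set \<Rightarrow> (complex \<times> complex \<Rightarrow> complex) set" where
  "bergman_space \<Omega> = {f \<in> L2_space \<Omega>. holomorphic2_on f \<Omega> \<and> (\<forall>z. z \<notin> \<Omega> \<longrightarrow> f z = 0)}"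

definition bergman_proj ::
    "(complex \<times> complex) set \<Rightarrow> (complex \<times> complex \<Rightarrow> complex) \<Rightarrow> (complex \<times> complex \<Rightarrow> complex)" where
  "bergman_proj \<Omega> f = (THE h. h \<in> bergman_space \<Omega> \<and>
     (\<forall>g\<in>bergman_space \<Omega>. L2_inner \<Omega> (\<lambda>z. f z - h z) g = 0))"

definition toeplitz ::
    "(complex \<times> complex) set \<Rightarrow> (complex \<times> complex \<Rightarrow> complex) \<Rightarrow>
     (complex \<times> complex \<Rightarrow> complex) \<Rightarrow> (complex \<times> complex \<Rightarrow> complex)" where
  "toeplitz \<Omega> u f = bergman_proj \<Omega> (\<lambda>z. u z * f z)"

definition bergman_kernel ::
    "(complex \<times> complex) set \<Rightarrow> complex \<times> complex \<Rightarrow> (complex \<times> complex \<Rightarrow> complex)" where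
  "bergman_kernel \<Omega> z = (THE K. K \<in> bergman_space \<Omega> \<and>
     (\<forall>f\<in>bergman_space \<Omega>. L2_inner \<Omega> f K = f z))"

definition normalized_kernel ::
    "(complex \<times> complex) set \<Rightarrow> complex \<times> complex \<Rightarrow> (complex \<times> complex \<Rightarrow> complex)" where
  "normalized_kernel \<Omega> z =
     (\<lambda>w. bergman_kernel \<Omega> z w / complex_of_real (L2_norm_on \<Omega> (bergman_kernel \<Omega> z)))"

definition skwarczynski_dist ::
    "(complex \<times> complex) set \<Rightarrow> complex \<times> complex \<Rightarrow> complex \<times> complex \<Rightarrow> real" where
  "skwarczynski_dist \<Omega> z w =
     sqrt (1 - norm (L2_inner \<Omega> (normalized_kernel \<Omega> z) (normalized_kernel \<Omega> w)))"

definition bergman_dist ::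
    "(complex \<times> complex) set \<Rightarrow> (complex \<times> complex \<Rightarrow> complex) \<Rightarrow> (complex \<times> complex \<Rightarrow> complex) \<Rightarrow> real" where
  "bergman_dist \<Omega> f g = L2_norm_on \<Omega> (\<lambda>z. f z - g z)"

definition compact_on_bergman ::
    "(complex \<times> complex) set \<Rightarrow>
     ((complex \<times> complex \<Rightarrow> complex) \<Rightarrow> (complex \<times> complex \<Rightarrow> complex)) \<Rightarrow> bool" where
  "compact_on_bergman \<Omega> T \<longleftrightarrow>
     (let X = Metric_space.mtopology (bergman_space \<Omega>) (bergman_dist \<Omega>)
      in \<forall>B. Metric_space.mbounded (bergman_space \<Omega>) (bergman_dist \<Omega>) B \<longrightarrow>
           T ` B \<subseteq> bergman_space \<Omega> \<and> compactin X (X closure_of (T ` B)))"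

end

theory Submission
  imports Defs "HOL-Complex_Analysis.Complex_Analysis" "HOL-Real_Asymp.Real_Asymp"
begin

text \<open>
  The Bergman kernel \<open>G\<close> of the domain is explicit, and a weight \<open>h\<close> satisfies a Schur estimate
  \<open>\<integral> \<bar>G z w\<bar> h w \<le> C h z\<close>. Outside a near region (bounded distance between \<open>z\<close> and \<open>w\<close> in terms of
  \<open>\<bar>A\<bar>\<^sup>2 / (x\<^sub>z x\<^sub>w)\<close> and \<open>\<bar>1 - s\<bar>\<^sup>2 / ((1 - \<tau>\<^sub>z) (1 - \<tau>\<^sub>w))\<close>) the same integral is at most \<open>\<epsilon> h z\<close>, while
  inside it the weight is controlled by \<open>\<integral> h\<^sup>2 \<le> C' (h z)\<^sup>2 / G z z\<close>.

  If \<open>T\<close> is compact, then \<open>\<parallel>T k\<^sub>z\<parallel> \<longrightarrow> 0\<close> because \<open>k\<^sub>z\<close> tends weakly to \<open>0\<close> at the boundary. Conversely,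
  Cauchy--Schwarz in the near region and the Schur estimate in the far region turn \<open>\<parallel>T k\<^sub>z\<parallel> \<longrightarrow> 0\<close> into
  \<open>\<integral> \<bar>(T K\<^sub>z) w\<bar> h w \<le> \<epsilon> h z\<close> for \<open>z\<close> near the boundary. By Schur's test the adjoint of \<open>T\<close>, restricted to
  the part of the domain near the boundary, has small norm, so it maps bounded pointwise null
  sequences to norm null ones, and hence so does \<open>T\<close>. Since every bounded sequence of the Bergman space has a
  pointwise convergent subsequence, \<open>T\<close> is compact.

  The domain has automorphisms lying over the Moebius maps of the disc of second coordinates. They
  reduce the reproducing formula to the mean value property in the second variable and to a weighted reproducing formula on the disc in the first.
\<close>

section \<open>Change of variables in the plane\<close>

text \<open>The maps \<open>Phi\<close> preserve \<open>tau\<close>, so they cannot carry every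
  point to the origin, and an estimate at one point does not spread by translation; all kernel
  estimates are therefore proved uniformly in z. This works because the Schur bound has room in its
  exponents: in \<open>N = N powr (1 - k) * N powr k\<close> the far region makes the second factor
  small, while the first is still Schur bounded. The weight \<open>h\<close> is not a power of the
  diagonal kernel: its exponent in \<open>1 - tau\<close> is -1/2, since half the diagonal exponent,
  -3/2, would not be integrable on the fibres. Approach to the boundary is measured by kernel norms
  alone: \<open>G z 0\<close> is constant in z, so the distance from z to 0 tends to 1 exactly when
  the norm of \<open>K z\<close> tends to infinity. Projection and kernel are definite descriptions;
  they are evaluated only once the explicit integral operator is known to be bounded, self-adjoint
  and the identity on the Bergman space.\<close>

definition c2v :: "complex \<Rightarrow> real^2" where "c2v z = vector [Re z, Im z]"
definition v2c :: "real^2 \<Rightarrow> complex" where "v2c x = Complex (x$1) (x$2)"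

lemma c2v_v2c [simp]: "c2v (v2c x) = x" "v2c (c2v z) = z"
  by (simp_all add: c2v_def v2c_def vec_eq_iff forall_2)

lemma c2v_nth [simp]: "c2v z $ 1 = Re z" "c2v z $ 2 = Im z"
  by (simp_all add: c2v_def)

lemma v2c_sel [simp]: "Re (v2c x) = x$1" "Im (v2c x) = x$2"
  by (simp_all add: v2c_def)

lemma linear_c2v: "linear c2v"
  by (rule linearI) (simp_all add: vec_eq_iff forall_2)
lemma linear_v2c: "linear v2c"
  by (rule linearI) (simp_all add: complex_eq_iff)

lemma bounded_linear_c2v: "bounded_linear c2v" and bounded_linear_v2c: "bounded_linear v2c"
  using linear_c2v linear_v2c linear_conv_bounded_linear by blast+

lemma borel_measurable_v2c [measurable]: "v2c \<in> borel_measurable borel"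
  by (intro borel_measurable_continuous_onI linear_continuous_on bounded_linear_v2c)

text \<open>Planar area is carried to \<open>real^2\<close>, where determinants and the vector
  change-of-variables formula are stated. Agreement on boxes identifies the measure.\<close>

lemma distr_v2c: "distr lborel borel v2c = (lborel :: complex measure)"
proof (rule lborel_eqI[symmetric])
  fix l u :: complex
  assume le: "\<And>b. b \<in> Basis \<Longrightarrow> l \<bullet> b \<le> u \<bullet> b"
  have le': "Re l \<le> Re u" "Im l \<le> Im u"
    using le[of 1] le[of \<i>] by (auto simp: Basis_complex_def)
  have B: "(Basis :: (real^2) set) = {axis 1 1, axis 2 1}"
    unfolding Basis_vec_def by (auto simp: UNIV_2)
  have ne: "axis 1 (1::real) \<noteq> (axis 2 1 :: real^2)"
    by (simp add: axis_eq_axis)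
  have v: "v2c -` box l u = box (c2v l) (c2v u)"
    by (auto simp: box_def Basis_complex_def B inner_axis)
  have "emeasure (distr lborel borel v2c) (box l u) = emeasure lborel (box (c2v l) (c2v u))"
    by (subst emeasure_distr) (auto simp: v)
  also have "\<dots> = (\<Prod>b\<in>Basis. (c2v u - c2v l) \<bullet> b)"
    by (rule emeasure_lborel_box) (use le' in \<open>auto simp: B inner_axis\<close>)
  also have "(\<Prod>b\<in>Basis. (c2v u - c2v l) \<bullet> b) = (\<Prod>b\<in>Basis. (u - l) \<bullet> b)"
    using ne by (simp add: B Basis_complex_def inner_axis)
  finally show "emeasure (distr lborel borel v2c) (box l u) = (\<Prod>b\<in>Basis. (u - l) \<bullet> b)" .
qed simp

lemma emeasure_v2c: "A \<in> sets borel \<Longrightarrow> emeasure lborel (v2c -` A) = emeasure lborel A"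
  by (subst distr_v2c[symmetric]) (simp add: emeasure_distr)

text \<open>Compact sets suffice, both because every set below is handled by monotone limits and because
  compactness makes all integrals in the vector change-of-variables formula finite.\<close>

lemma emeasure_holomorphic_image_compact:
  fixes f :: "complex \<Rightarrow> complex"
  assumes f: "f holomorphic_on S" "open S" and inj: "inj_on f S" and K: "compact K" "K \<subseteq> S"
  shows "emeasure lborel (f ` K) = (\<integral>\<^sup>+z\<in>K. ennreal ((norm (deriv f z))\<^sup>2) \<partial>lborel)"
proof -
  define F where "F = c2v \<circ> f \<circ> v2c"
  define F' where "F' x = (\<lambda>h. c2v (deriv f (v2c x) * v2c h))" for x
  define K' where "K' = c2v ` K"
  have K': "compact K'" unfolding K'_def
    by (intro compact_continuous_image linear_continuous_on bounded_linear_c2v K)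
  have K'v: "K' = v2c -` K"
    by (force simp: K'_def image_iff)
  have der: "(F has_derivative F' x) (at x within K')" if "x \<in> K'" for x
  proof -
    have "v2c x \<in> S" using that K by (auto simp: K'_def)
    then have "(f has_field_derivative deriv f (v2c x)) (at (v2c x))"
      using f holomorphic_derivI by blast
    then have 1: "(f has_derivative (\<lambda>h. deriv f (v2c x) * h)) (at (v2c x))"
      by (simp add: has_field_derivative_def)
    have 2: "(v2c has_derivative v2c) (at x within K')" for x
      using bounded_linear_v2c by (rule bounded_linear_imp_has_derivative)
    have 3: "(c2v has_derivative c2v) (at x)" for x
      using bounded_linear_c2v by (rule bounded_linear_imp_has_derivative)
    show ?thesis unfolding F_def F'_def comp_def
      by (rule has_derivative_compose[OF has_derivative_compose[OF 2 1] 3])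
  qed
  \<comment> \<open>Cauchy-Riemann: multiplication by a complex number c is a rotation followed by a
    dilation, so its real determinant is the squared modulus of c.\<close>
  have det: "det (matrix (F' x)) = (norm (deriv f (v2c x)))\<^sup>2" for x
    unfolding cmod_power2
    by (simp add: det_2 matrix_def F'_def axis_def power2_eq_square)
  have injF: "inj_on F K'"
    using inj K(2) unfolding F_def K'_def inj_on_def by (metis (no_types, lifting) c2v_v2c(2) comp_apply image_iff subsetD)
  have cont: "continuous_on K (\<lambda>z. (norm (deriv f z))\<^sup>2)"
    by (intro continuous_intros holomorphic_on_imp_continuous_on holomorphic_on_subset[OF holomorphic_deriv[OF f] K(2)])
  have contK': "continuous_on K' (\<lambda>x. (norm (deriv f (v2c x)))\<^sup>2)"
    by (rule continuous_on_compose2[OF cont linear_continuous_on[OF bounded_linear_v2c]]) (auto simp: K'_def)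
  have ai: "integrable lborel (\<lambda>x. indicator K' x *\<^sub>R (norm (deriv f (v2c x)))\<^sup>2)"
    using borel_integrable_compact[OF K' contK'] by simp
  then have "((\<lambda>x. \<bar>det (matrix (F' x))\<bar>) has_integral integral K' (\<lambda>x. (norm (deriv f (v2c x)))\<^sup>2)) K'"
    using set_borel_integral_eq_integral(1)[of K' "\<lambda>x. (norm (deriv f (v2c x)))\<^sup>2"]
    by (simp add: det set_integrable_def integrable_integral)
  then have m: "F ` K' \<in> lmeasurable \<and> measure lebesgue (F ` K') = integral K' (\<lambda>x. (norm (deriv f (v2c x)))\<^sup>2)"
    by (subst has_measure_differentiable_image[OF _ der injF]) (use K' in \<open>auto intro: fmeasurableD lmeasurable_compact\<close>)
  have FK: "F ` K' = v2c -` (f ` K)"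
  proof -
    have "c2v ` X = v2c -` X" for X by (force simp: image_iff)
    then have "c2v ` (f ` K) = v2c -` (f ` K)" .
    moreover have "F ` K' = c2v ` (f ` K)" by (simp add: F_def K'_def image_comp o_def)
    ultimately show ?thesis by simp
  qed
  have cfK: "compact (f ` K)"
    by (intro compact_continuous_image holomorphic_on_imp_continuous_on holomorphic_on_subset[OF f(1) K(2)] K(1))
  have "emeasure lborel (f ` K) = emeasure lborel (F ` K')"
    unfolding FK by (rule emeasure_v2c[symmetric]) (use cfK in \<open>auto intro: borel_compact\<close>)
  also have "\<dots> = emeasure lebesgue (F ` K')"
    using measurable_sets[OF borel_measurable_v2c borel_compact[OF cfK]] by (simp add: FK)
  also have "\<dots> = ennreal (integral K' (\<lambda>x. (norm (deriv f (v2c x)))\<^sup>2))"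
    using m emeasure_eq_measure2[of "F ` K'" lebesgue] by (metis (no_types, lifting))
  also have "integral K' (\<lambda>x. (norm (deriv f (v2c x)))\<^sup>2) = integral\<^sup>L lborel (\<lambda>x. indicator K' x *\<^sub>R (norm (deriv f (v2c x)))\<^sup>2)"
    using ai set_borel_integral_eq_integral(2)[of K' "\<lambda>x. (norm (deriv f (v2c x)))\<^sup>2"]
    by (simp add: set_integrable_def set_lebesgue_integral_def)
  also have "ennreal \<dots> = (\<integral>\<^sup>+x. ennreal (indicator K' x *\<^sub>R (norm (deriv f (v2c x)))\<^sup>2) \<partial>lborel)"
    by (rule nn_integral_eq_integral[symmetric, OF ai]) simp
  also have "\<dots> = (\<integral>\<^sup>+x. ennreal (indicator K (v2c x) *\<^sub>R (norm (deriv f (v2c x)))\<^sup>2) \<partial>lborel)"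
    by (simp add: K'v indicator_def)
  also have "\<dots> = (\<integral>\<^sup>+z. ennreal (indicator K z *\<^sub>R (norm (deriv f z))\<^sup>2) \<partial>lborel)"
  proof -
    have "(\<lambda>z. indicator K z *\<^sub>R (norm (deriv f z))\<^sup>2) \<in> borel_measurable borel"
      by (rule borel_measurable_continuous_on_indicator[OF _ cont]) (use K in \<open>auto intro: borel_compact\<close>)
    then have "(\<lambda>z. ennreal (indicator K z *\<^sub>R (norm (deriv f z))\<^sup>2)) \<in> borel_measurable borel"
      by simp
    then show ?thesis
      by (subst distr_v2c[symmetric]) (simp add: nn_integral_distr)
  qed
  also have "\<dots> = (\<integral>\<^sup>+z\<in>K. ennreal ((norm (deriv f z))\<^sup>2) \<partial>lborel)"
    by (intro nn_integral_cong) (auto simp: indicator_def)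
  finally show ?thesis .
qed

text \<open>A compact \<open>K\<close> inside the open set of injectivity keeps all masses finite.
  Open discs are treated by taking \<open>K\<close> closed and putting the indicator of the open
  disc into the integrand.\<close>

locale area_map =
  fixes f :: "complex \<Rightarrow> complex" and S K :: "complex set"
  assumes hol: "f holomorphic_on S" and opS: "open S" and inj: "inj_on f S"
    and K: "compact K" "K \<subseteq> S"
begin

lemma cont: "continuous_on K f" "continuous_on K (deriv f)"
  by (intro holomorphic_on_imp_continuous_on holomorphic_on_subset[OF _ K(2)] hol holomorphic_deriv opS)+

lemma compact_fK: "compact (f ` K)"
  by (intro compact_continuous_image cont K)

lemma meas_f: "(\<lambda>z. if z \<in> K then f z else 0) \<in> borel_measurable borel"
proof -
  have "(\<lambda>z. indicator K z *\<^sub>R f z) \<in> borel_measurable borel"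
    by (rule borel_measurable_continuous_on_indicator) (use cont K in \<open>auto intro: borel_compact\<close>)
  moreover have "(\<lambda>z. indicator K z *\<^sub>R f z) = (\<lambda>z. if z \<in> K then f z else 0)"
    by (auto simp: indicator_def)
  ultimately show ?thesis by simp
qed

lemma meas_d: "(\<lambda>z. indicator K z * (norm (deriv f z))\<^sup>2) \<in> borel_measurable borel"
proof -
  have "(\<lambda>z. indicator K z *\<^sub>R (norm (deriv f z))\<^sup>2) \<in> borel_measurable borel"
    by (rule borel_measurable_continuous_on_indicator) (use cont K in \<open>auto intro!: continuous_intros borel_compact\<close>)
  then show ?thesis by simp
qed

text \<open>Closed sets form an intersection-stable generator, and the part of \<open>K\<close>
  mapped into a closed set is compact, so the area formula for compact images decides equality. The
  density vanishes off \<open>K\<close>, where the map takes the default value 0.\<close>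

lemma measure_eq:
  "density lborel (indicator (f ` K)) =
   distr (density lborel (\<lambda>z. ennreal (indicator K z * (norm (deriv f z))\<^sup>2))) borel (\<lambda>z. if z \<in> K then f z else 0)"
  (is "?M = ?N")
proof (rule measure_eqI_generator_eq[where E = "Collect closed" and A = "\<lambda>_. UNIV" and \<Omega> = UNIV])
  note [measurable] = meas_f meas_d
  have [measurable]: "f ` K \<in> sets borel" "K \<in> sets borel"
    using compact_fK K by (auto intro: borel_compact)
  show "Int_stable (Collect closed :: complex set set)" by (auto simp: Int_stable_def)
  show "sets ?M = sigma_sets UNIV (Collect closed)" "sets ?N = sigma_sets UNIV (Collect closed)"
    by (simp_all add: borel_eq_closed)
  show eq: "emeasure ?M X = emeasure ?N X" if "X \<in> Collect closed" for X
  proof -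
    have X: "closed X" and [measurable]: "X \<in> sets borel" using that by auto
    define C where "C = K \<inter> f -` X"
    have "closed C" unfolding C_def
      using continuous_on_closed_vimage[of K f] cont(1) X K(1) by (metis compact_imp_closed inf_commute)
    then have C: "compact C" "C \<subseteq> S" using K compact_Int_closed[of K C]
      by (auto simp: C_def Int_absorb1 Int_assoc) 
    have "emeasure ?M X = emeasure lborel (f ` C)"
    proof -
      have "emeasure ?M X = (\<integral>\<^sup>+z. indicator (f ` K) z * indicator X z \<partial>lborel)"
        by (subst emeasure_density) auto
      also have "\<dots> = (\<integral>\<^sup>+z. indicator (f ` C) z \<partial>lborel)"
        by (intro nn_integral_cong) (auto simp: C_def indicator_def)
      also have "f ` C \<in> sets borel"
        using C cont(1) by (intro borel_compact compact_continuous_image) (auto simp: C_def elim: continuous_on_subset)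
      then have "(\<integral>\<^sup>+z. indicator (f ` C) z \<partial>lborel) = emeasure lborel (f ` C)" by simp
      finally show ?thesis .
    qed
    also have "\<dots> = (\<integral>\<^sup>+z\<in>C. ennreal ((norm (deriv f z))\<^sup>2) \<partial>lborel)"
      by (rule emeasure_holomorphic_image_compact[OF hol opS inj C])
    also have "\<dots> = emeasure ?N X"
    proof -
      have "emeasure ?N X = emeasure (density lborel (\<lambda>z. ennreal (indicator K z * (norm (deriv f z))\<^sup>2)))
         ((\<lambda>z. if z \<in> K then f z else 0) -` X)"
        by (subst emeasure_distr) auto
      also have "\<dots> = (\<integral>\<^sup>+z. ennreal (indicator K z * (norm (deriv f z))\<^sup>2) * indicator ((\<lambda>z. if z \<in> K then f z else 0) -` X) z \<partial>lborel)"
        by (subst emeasure_density) (use measurable_sets[OF meas_f, of X] in auto)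
      also have "\<dots> = (\<integral>\<^sup>+z\<in>C. ennreal ((norm (deriv f z))\<^sup>2) \<partial>lborel)"
        by (intro nn_integral_cong) (auto simp: C_def indicator_def)
      finally show ?thesis by simp
    qed
    finally show ?thesis .
  qed
  have "emeasure ?M UNIV = emeasure lborel (f ` K)"
    by (subst emeasure_density) auto
  then show "emeasure ?M UNIV \<noteq> \<infinity>" for i :: nat
    using emeasure_compact_finite[OF compact_fK] by simp
qed auto

lemma nn_integral:
  assumes [measurable]: "g \<in> borel_measurable borel"
  shows "(\<integral>\<^sup>+w. indicator (f ` K) w * g w \<partial>lborel) =
    (\<integral>\<^sup>+z. indicator K z * (ennreal ((norm (deriv f z))\<^sup>2) * g (f z)) \<partial>lborel)"
proof -
  note [measurable] = meas_f meas_d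
  have [measurable]: "f ` K \<in> sets borel" "K \<in> sets borel"
    using compact_fK K by (auto intro: borel_compact)
  have "(\<integral>\<^sup>+w. indicator (f ` K) w * g w \<partial>lborel) = integral\<^sup>N (density lborel (indicator (f ` K))) g"
    by (subst nn_integral_density) auto
  also have "\<dots> = (\<integral>\<^sup>+z. ennreal (indicator K z * (norm (deriv f z))\<^sup>2) * g (if z \<in> K then f z else 0) \<partial>lborel)"
    unfolding measure_eq by (subst nn_integral_distr) (auto simp: nn_integral_density)
  also have "\<dots> = (\<integral>\<^sup>+z. indicator K z * (ennreal ((norm (deriv f z))\<^sup>2) * g (f z)) \<partial>lborel)"
    by (intro nn_integral_cong) (auto simp: indicator_def)
  finally show ?thesis .
qed

lemma integral:
  fixes g :: "complex \<Rightarrow> complex"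
  assumes [measurable]: "g \<in> borel_measurable borel"
  shows "(\<integral>w. indicator (f ` K) w *\<^sub>R g w \<partial>lborel) =
    (\<integral>z. indicator K z *\<^sub>R ((norm (deriv f z))\<^sup>2 *\<^sub>R g (f z)) \<partial>lborel)"
proof -
  note [measurable] = meas_f meas_d
  have [measurable]: "f ` K \<in> sets borel" "K \<in> sets borel"
    using compact_fK K by (auto intro: borel_compact)
  have "(\<integral>w. indicator (f ` K) w *\<^sub>R g w \<partial>lborel) = integral\<^sup>L (density lborel (\<lambda>w. ennreal (indicator (f ` K) w))) g"
    by (subst integral_density) auto
  also have "\<dots> = integral\<^sup>L (density lborel (indicator (f ` K))) g"
    by (simp add: ennreal_indicator)
  also have "\<dots> = (\<integral>z. (indicator K z * (norm (deriv f z))\<^sup>2) *\<^sub>R g (if z \<in> K then f z else 0) \<partial>lborel)"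
    unfolding measure_eq by (subst integral_distr) (auto simp: integral_density)
  also have "\<dots> = (\<integral>z. indicator K z *\<^sub>R ((norm (deriv f z))\<^sup>2 *\<^sub>R g (f z)) \<partial>lborel)"
    by (intro Bochner_Integration.integral_cong) (auto simp: indicator_def)
  finally show ?thesis .
qed

end

lemma area_disc_nn:
  fixes c :: complex
  assumes a: "r \<ge> 0" "c \<noteq> 0" and [measurable]: "g \<in> borel_measurable borel"
  shows "(\<integral>\<^sup>+w. indicator (ball 0 (norm c * r)) w * g w \<partial>lborel) =
    (\<integral>\<^sup>+z. indicator (ball 0 r) z * (ennreal ((norm c)\<^sup>2) * g (c * z)) \<partial>lborel)"
proof -
  interpret area_map "\<lambda>z. c * z" UNIV "cball 0 r"
    by unfold_locales (use a in \<open>auto intro!: holomorphic_intros inj_onI\<close>)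
  have [measurable]: "ball (0::complex) s \<in> sets borel" for s by auto
  have d: "deriv ((*) c) z = c" for z :: complex
    by (rule DERIV_imp_deriv) (auto intro!: derivative_eq_intros)
  have im: "w \<in> ball 0 (norm c * r) \<Longrightarrow> w \<in> (*) c ` cball 0 r" for w
    by (rule image_eqI[of _ _ "w / c"]) (use a in \<open>auto simp: norm_divide field_simps\<close>)
  have "(\<integral>\<^sup>+w. indicator (ball 0 (norm c * r)) w * g w \<partial>lborel) =
     (\<integral>\<^sup>+w. indicator ((*) c ` cball 0 r) w * (indicator (ball 0 (norm c * r)) w * g w) \<partial>lborel)"
    by (intro nn_integral_cong) (use im in \<open>auto simp: indicator_def\<close>)
  also have "\<dots> = (\<integral>\<^sup>+z. indicator (cball 0 r) z * (ennreal ((norm c)\<^sup>2) * (indicator (ball 0 (norm c * r)) (c*z) * g (c * z))) \<partial>lborel)"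
    by (subst nn_integral) (auto simp: d)
  also have "\<dots> = (\<integral>\<^sup>+z. indicator (ball 0 r) z * (ennreal ((norm c)\<^sup>2) * g (c * z)) \<partial>lborel)"
    by (intro nn_integral_cong) (use a in \<open>auto simp: indicator_def norm_mult\<close>)
  finally show ?thesis .
qed

lemma area_disc:
  fixes c :: complex and g :: "complex \<Rightarrow> complex"
  assumes a: "r \<ge> 0" "c \<noteq> 0" and [measurable]: "g \<in> borel_measurable borel"
  shows "(\<integral>w. indicator (ball 0 (norm c * r)) w *\<^sub>R g w \<partial>lborel) =
    (\<integral>z. indicator (ball 0 r) z *\<^sub>R ((norm c)\<^sup>2 *\<^sub>R g (c * z)) \<partial>lborel)"
proof -
  interpret area_map "\<lambda>z. c * z" UNIV "cball 0 r"
    by unfold_locales (use a in \<open>auto intro!: holomorphic_intros inj_onI\<close>)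
  have [measurable]: "ball (0::complex) s \<in> sets borel" for s by auto
  have d: "deriv ((*) c) z = c" for z :: complex
    by (rule DERIV_imp_deriv) (auto intro!: derivative_eq_intros)
  have im: "w \<in> ball 0 (norm c * r) \<Longrightarrow> w \<in> (*) c ` cball 0 r" for w
    by (rule image_eqI[of _ _ "w / c"]) (use a in \<open>auto simp: norm_divide field_simps\<close>)
  have "(\<integral>w. indicator (ball 0 (norm c * r)) w *\<^sub>R g w \<partial>lborel) =
     (\<integral>w. indicator ((*) c ` cball 0 r) w *\<^sub>R (indicator (ball 0 (norm c * r)) w *\<^sub>R g w) \<partial>lborel)"
    by (intro Bochner_Integration.integral_cong) (use im in \<open>auto simp: indicator_def\<close>)
  also have "\<dots> = (\<integral>z. indicator (cball 0 r) z *\<^sub>R ((norm c)\<^sup>2 *\<^sub>R (indicator (ball 0 (norm c * r)) (c*z) *\<^sub>R g (c * z))) \<partial>lborel)"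
    by (subst integral) (auto simp: d)
  also have "\<dots> = (\<integral>z. indicator (ball 0 r) z *\<^sub>R ((norm c)\<^sup>2 *\<^sub>R g (c * z)) \<partial>lborel)"
    by (intro Bochner_Integration.integral_cong) (use a in \<open>auto simp: indicator_def norm_mult\<close>)
  finally show ?thesis .
qed

section \<open>Moebius maps of the unit disc\<close>

definition moeb :: "complex \<Rightarrow> complex \<Rightarrow> complex" where
  "moeb a v = (v + a) / (1 + cnj a * v)"

lemma norm_lt_1_re: "norm (q::complex) < 1 \<Longrightarrow> Re (1 - q) > 0"
  using complex_Re_le_cmod[of q] by simp

lemma moeb_den: assumes "norm a < 1" "norm v \<le> 1" shows "1 + cnj a * v \<noteq> 0"
proof -
  have "norm (cnj a * v) < 1" using assms 
    by (metis complex_mod_cnj mult_le_one mult_less_le_imp_less norm_ge_zero norm_mult order_le_less_trans mult.right_neutral mult_left_mono)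
  then show ?thesis by (metis add.commute add_eq_0_iff less_irrefl norm_minus_cancel norm_one)
qed

text \<open>The Schwarz-Pick identity. The invariance of \<open>hdelta\<close>, the fibre radius
  rule \<open>chi_rho\<close> and the mapping of the disc into itself all come from it.\<close>

lemma moeb_ident:
  assumes "1 + cnj a * v \<noteq> 0"
  shows "1 - (norm (moeb a v))\<^sup>2 = (1 - (norm a)\<^sup>2) * (1 - (norm v)\<^sup>2) / (norm (1 + cnj a * v))\<^sup>2"
proof -
  have "(norm (1 + cnj a * v))\<^sup>2 - (norm (v + a))\<^sup>2 = (1 - (norm a)\<^sup>2) * (1 - (norm v)\<^sup>2)"
    unfolding cmod_power2 by (simp add: algebra_simps power2_eq_square)
  then show ?thesis using assms by (simp add: moeb_def norm_divide power_divide field_simps)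
qed

lemma moeb_deriv:
  assumes "1 + cnj a * v \<noteq> 0"
  shows "(moeb a has_field_derivative (1 - (norm a)\<^sup>2) / (1 + cnj a * v)\<^sup>2) (at v)"
  unfolding moeb_def
  by (rule derivative_eq_intros refl assms | simp)+
     (simp add: field_simps power2_eq_square complex_norm_square[symmetric] flip: complex_norm_square)

lemma moeb_inj: "norm a < 1 \<Longrightarrow> inj_on (moeb a) {v. 1 + cnj a * v \<noteq> 0}"
proof (rule inj_onI)
  fix v w assume a: "norm a < 1" and vw: "v \<in> {v. 1 + cnj a * v \<noteq> 0}" "w \<in> {v. 1 + cnj a * v \<noteq> 0}"
    and eq: "moeb a v = moeb a w"
  have "(v + a) * (1 + cnj a * w) - (w + a) * (1 + cnj a * v) = 0"
    using eq vw by (simp add: moeb_def frac_eq_eq)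
  moreover have "(v + a) * (1 + cnj a * w) - (w + a) * (1 + cnj a * v) = (v - w) * (1 - a * cnj a)"
    by (simp add: algebra_simps)
  moreover have "a * cnj a \<noteq> 1"
    using a by (metis complex_mod_mult_cnj norm_one power_one power2_eq_1_iff less_irrefl norm_ge_zero not_one_le_zero neg_0_le_iff_le)
  ultimately show "v = w" by simp
qed

lemma moeb_inverse:
  assumes "norm a < 1" "norm w \<le> 1"
  shows "moeb a (moeb (-a) w) = w" "1 + cnj a * moeb (-a) w \<noteq> 0"
    "1 + cnj a * moeb (-a) w = (1 - (norm a)\<^sup>2) / (1 - cnj a * w)"
proof -
  have d: "1 - cnj a * w \<noteq> 0" using moeb_den[of "-a" w] assms by simp
  have e: "1 - a * cnj a \<noteq> 0" using assms(1)
    by (metis complex_mod_mult_cnj norm_one power_one power2_eq_1_iff less_irrefl norm_ge_zero not_one_le_zero neg_0_le_iff_le eq_iff_diff_eq_0)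
  have m: "moeb (-a) w = (w - a) / (1 - cnj a * w)" by (simp add: moeb_def)
  have 1: "1 + cnj a * moeb (-a) w = (1 - a * cnj a) / (1 - cnj a * w)"
    using d by (simp add: m field_simps)
  then show "1 + cnj a * moeb (-a) w = (1 - (norm a)\<^sup>2) / (1 - cnj a * w)"
    by (simp only: of_real_diff complex_norm_square of_real_1)
  show 2: "1 + cnj a * moeb (-a) w \<noteq> 0" using 1 d e by simp
  have "moeb (-a) w + a = w * ((1 - a * cnj a) / (1 - cnj a * w))"
    using d by (simp add: m field_simps)
  then show "moeb a (moeb (-a) w) = w" using 1 2 by (simp add: moeb_def[of a])
qed

lemma moeb_ball_iff:
  assumes "norm a < 1" "norm v \<le> 1"
  shows "norm (moeb a v) < 1 \<longleftrightarrow> norm v < 1" "norm (moeb a v) \<le> 1"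
proof -
  have d: "1 + cnj a * v \<noteq> 0" by (rule moeb_den[OF assms])
  have "1 - (norm a)\<^sup>2 > 0" using assms by (simp add: abs_square_less_1)
  then have "1 - (norm (moeb a v))\<^sup>2 > 0 \<longleftrightarrow> 1 - (norm v)\<^sup>2 > 0" 
    unfolding moeb_ident[OF d] using d by (auto simp: zero_less_divide_iff zero_less_mult_iff)
  then show "norm (moeb a v) < 1 \<longleftrightarrow> norm v < 1" by (simp add: abs_square_less_1)
  have "1 - (norm v)\<^sup>2 \<ge> 0" using assms by (simp add: abs_square_le_1)
  then have "1 - (norm (moeb a v))\<^sup>2 \<ge> 0" 
    unfolding moeb_ident[OF d] using \<open>1 - (norm a)\<^sup>2 > 0\<close> by simp
  then show "norm (moeb a v) \<le> 1" by (simp add: abs_square_le_1)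
qed

lemma moeb_image: "norm a < 1 \<Longrightarrow> moeb a ` cball 0 1 = cball 0 1"
proof (intro equalityI subsetI)
  fix w :: complex assume "norm a < 1" "w \<in> cball 0 1"
  then show "w \<in> moeb a ` cball 0 1"
    using moeb_inverse(1)[of a w] moeb_ball_iff(2)[of "-a" w] by (intro image_eqI[of _ _ "moeb (-a) w"]) auto
qed (use moeb_ball_iff(2) in auto)

lemma area_map_moeb: "norm a < 1 \<Longrightarrow> area_map (moeb a) {v. 1 + cnj a * v \<noteq> 0} (cball 0 1)"
proof unfold_locales
  assume a: "norm a < 1"
  show op: "open {v. 1 + cnj a * v \<noteq> 0}"
    by (intro open_Collect_neq continuous_intros)
  show "moeb a holomorphic_on {v. 1 + cnj a * v \<noteq> 0}"
    unfolding moeb_def by (intro holomorphic_intros) auto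
  show "inj_on (moeb a) {v. 1 + cnj a * v \<noteq> 0}" by (rule moeb_inj[OF a])
  show "cball 0 1 \<subseteq> {v. 1 + cnj a * v \<noteq> 0}" using moeb_den[OF a] by auto
qed auto

lemma norm_deriv_moeb:
  assumes "norm a < 1" "norm v \<le> 1"
  shows "norm (deriv (moeb a) v) = (1 - (norm a)\<^sup>2) / (norm (1 + cnj a * v))\<^sup>2"
proof -
  have "deriv (moeb a) v = of_real (1 - (norm a)\<^sup>2) / (1 + cnj a * v)\<^sup>2"
    using moeb_deriv[OF moeb_den[OF assms]] by (simp add: DERIV_imp_deriv)
  moreover have "1 - (norm a)\<^sup>2 \<ge> 0" using assms by (simp add: abs_square_le_1)
  ultimately show ?thesis by (simp add: norm_divide norm_power del: of_real_diff)
qed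

lemma area_moeb_nn:
  assumes a: "norm a < 1" and [measurable]: "g \<in> borel_measurable borel"
  shows "(\<integral>\<^sup>+w. indicator (ball 0 1) w * g w \<partial>lborel) =
    (\<integral>\<^sup>+v. indicator (ball 0 1) v * (ennreal (((1 - (norm a)\<^sup>2) / (norm (1 + cnj a * v))\<^sup>2)\<^sup>2) * g (moeb a v)) \<partial>lborel)"
proof -
  interpret area_map "moeb a" "{v. 1 + cnj a * v \<noteq> 0}" "cball 0 1" by (rule area_map_moeb[OF a])
  have [measurable]: "ball (0::complex) s \<in> sets borel" for s by auto
  have "(\<integral>\<^sup>+w. indicator (ball 0 1) w * g w \<partial>lborel) =
     (\<integral>\<^sup>+w. indicator (moeb a ` cball 0 1) w * (indicator (ball 0 1) w * g w) \<partial>lborel)"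
    by (intro nn_integral_cong) (auto simp: indicator_def moeb_image[OF a])
  also have "\<dots> = (\<integral>\<^sup>+z. indicator (cball 0 1) z * (ennreal ((norm (deriv (moeb a) z))\<^sup>2) * (indicator (ball 0 1) (moeb a z) * g (moeb a z))) \<partial>lborel)"
    by (subst nn_integral) auto
  also have "\<dots> = (\<integral>\<^sup>+v. indicator (ball 0 1) v * (ennreal (((1 - (norm a)\<^sup>2) / (norm (1 + cnj a * v))\<^sup>2)\<^sup>2) * g (moeb a v)) \<partial>lborel)"
    by (intro nn_integral_cong) (auto simp: indicator_def moeb_ball_iff[OF a] norm_deriv_moeb[OF a])
  finally show ?thesis .
qed

text \<open>The disc of radius sqrt x has area pi x, so the squared norm spreads area uniformly over
  the unit interval; half-lines determine the measure.\<close>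

lemma distr_norm_square:
  "distr (density lborel (indicator (ball (0::complex) 1))) borel (\<lambda>w. (norm w)\<^sup>2) =
    density lborel (\<lambda>y. ennreal pi * indicator {0..<1} y)" (is "?M = ?N")
proof (rule measure_eqI_generator_eq[where E = "range atMost" and A = "\<lambda>i. {..real i}" and \<Omega> = UNIV])
  have [measurable]: "ball (0::complex) s \<in> sets borel" for s by auto
  show "Int_stable (range atMost :: real set set)" by (auto simp: Int_stable_def)
  show "sets ?M = sigma_sets UNIV (range atMost)" "sets ?N = sigma_sets UNIV (range atMost)"
    by (simp_all add: borel_eq_atMost)
  show "(\<Union>i. {..real i}) = UNIV" by (auto intro: real_arch_simple)
  have M: "emeasure ?M {..x} = emeasure lborel ({w::complex. (norm w)\<^sup>2 \<le> x} \<inter> ball 0 1)" for x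
  proof -
    have S: "{w::complex. (norm w)\<^sup>2 \<le> x} \<in> sets borel" by measurable
    have "{w::complex. (norm w)\<^sup>2 \<le> x} = (\<lambda>w. (norm w)\<^sup>2) -` {..x}" by auto
    then have "emeasure ?M {..x} = emeasure (density lborel (indicator (ball (0::complex) 1))) {w. (norm w)\<^sup>2 \<le> x}"
      by (subst emeasure_distr) auto
    also have "\<dots> = (\<integral>\<^sup>+w. indicator (ball 0 1) w * indicator {w::complex. (norm w)\<^sup>2 \<le> x} w \<partial>lborel)"
      by (rule emeasure_density) (use S in auto)
    also have "\<dots> = (\<integral>\<^sup>+w. indicator ({w::complex. (norm w)\<^sup>2 \<le> x} \<inter> ball 0 1) w \<partial>lborel)"
      by (intro nn_integral_cong) (auto simp: indicator_def)
    also have "\<dots> = emeasure lborel ({w::complex. (norm w)\<^sup>2 \<le> x} \<inter> ball 0 1)"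
      by (rule nn_integral_indicator) measurable
    finally show ?thesis .
  qed
  have N: "emeasure ?N {..x} = ennreal pi * emeasure lborel ({..x} \<inter> {0..<1})" for x
  proof -
    have "emeasure ?N {..x} = (\<integral>\<^sup>+y. ennreal pi * indicator ({..x} \<inter> {0..<1}) y \<partial>lborel)"
      by (subst emeasure_density) (auto intro!: nn_integral_cong simp: indicator_def)
    then show ?thesis by (simp add: nn_integral_cmult)
  qed
  show "emeasure ?M X = emeasure ?N X" if "X \<in> range atMost" for X
  proof -
    from that obtain x where X: "X = {..x}" by auto
    consider "x < 0" | "0 \<le> x" "x < 1" | "x \<ge> 1" by linarith
    then show ?thesis
    proof cases
      case 1
      then have "\<not> (norm w)\<^sup>2 \<le> x" for w :: complex by (meson not_le order_less_le_trans zero_le_power2)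
      moreover have "{..x} \<inter> {0..<1} = {}" using 1 by auto
      ultimately show ?thesis unfolding X M N by simp
    next
      case 2
      have "(norm w)\<^sup>2 \<le> x \<longleftrightarrow> norm w \<le> sqrt x" for w :: complex
        by (metis abs_norm_cancel real_sqrt_abs real_sqrt_le_iff)
      then have "{w::complex. (norm w)\<^sup>2 \<le> x} \<inter> ball 0 1 = cball 0 (sqrt x)"
        using 2 by (auto simp: cball_def) (meson order_le_less_trans real_sqrt_lt_1_iff)
      moreover have "{..x} \<inter> {0..<1} = {0..x}" using 2 by auto
      ultimately show ?thesis unfolding X M N
        using 2 by (simp add: emeasure_cball unit_ball_vol_2 ennreal_mult'[symmetric])
    next
      case 3
      have "(norm w)\<^sup>2 \<le> x" if "norm w < 1" for w :: complex
        using that 3 by (meson less_eq_real_def norm_ge_zero order.trans power_le_one)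
      then have "{w::complex. (norm w)\<^sup>2 \<le> x} \<inter> ball 0 1 = ball 0 1" by auto
      moreover have "{..x} \<inter> {0..<1} = {0..<1}" using 3 by auto
      ultimately show ?thesis unfolding X M N
        by (simp add: emeasure_ball unit_ball_vol_2)
    qed
  qed
  show "emeasure ?M {..real i} \<noteq> \<infinity>" for i
  proof -
    have "emeasure ?M {..real i} \<le> emeasure lborel (ball (0::complex) 1)"
      unfolding M by (rule emeasure_mono) auto
    then show ?thesis using emeasure_ball[of 1 "0::complex"] by (auto simp: top_unique)
  qed
qed auto

lemma radial_nn:
  assumes [measurable]: "g \<in> borel_measurable borel"
  shows "(\<integral>\<^sup>+w. indicator (ball (0::complex) 1) w * g ((norm w)\<^sup>2) \<partial>lborel) =
    ennreal pi * (\<integral>\<^sup>+y. indicator {0<..<1} y * g y \<partial>lborel)"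
proof -
  have [measurable]: "ball (0::complex) s \<in> sets borel" for s by auto
  have "(\<integral>\<^sup>+w. indicator (ball (0::complex) 1) w * g ((norm w)\<^sup>2) \<partial>lborel) =
    integral\<^sup>N (distr (density lborel (indicator (ball (0::complex) 1))) borel (\<lambda>w. (norm w)\<^sup>2)) g"
    by (subst nn_integral_distr) (auto simp: nn_integral_density)
  also have "\<dots> = (\<integral>\<^sup>+y. ennreal pi * (indicator {0..<1} y * g y) \<partial>lborel)"
    unfolding distr_norm_square by (subst nn_integral_density) (auto simp: mult.assoc)
  also have "\<dots> = ennreal pi * (\<integral>\<^sup>+y. indicator {0..<1} y * g y \<partial>lborel)"
    by (rule nn_integral_cmult) auto
  also have "(\<integral>\<^sup>+y. indicator {0..<1} y * g y \<partial>lborel) = (\<integral>\<^sup>+y. indicator {0<..<1} y * g y \<partial>lborel)"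
    by (intro nn_integral_cong_AE, rule AE_mp[OF AE_lborel_singleton[of 0]]) (auto simp: indicator_def)
  finally show ?thesis .
qed

lemma radial_nn':
  assumes [measurable]: "g \<in> borel_measurable borel"
  shows "(\<integral>\<^sup>+w. indicator (ball (0::complex) 1) w * g (1 - (norm w)\<^sup>2) \<partial>lborel) =
    ennreal pi * (\<integral>\<^sup>+y. indicator {0<..<1} y * g y \<partial>lborel)"
proof -
  have "(\<integral>\<^sup>+y. indicator {0<..<1} y * g y \<partial>lborel) = (\<integral>\<^sup>+y. indicator {0<..<1} (1 - y) * g (1 - y) \<partial>lborel)"
    using nn_integral_real_affine[of "\<lambda>y. indicator {0<..<1} y * g y" "-1" 1] by simp
  also have "\<dots> = (\<integral>\<^sup>+y. indicator {0<..<1} y * g (1 - y) \<partial>lborel)"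
    by (intro nn_integral_cong) (auto simp: indicator_def)
  finally show ?thesis
    using radial_nn[of "\<lambda>y. g (1 - y)"] by simp
qed

text \<open>One minus the squared pseudo-hyperbolic distance of \<open>a\<close> and
  \<open>w\<close>: the Moebius-invariant quantity in which the integrals over the second coordinate
  become radial.\<close>

definition hdelta :: "complex \<Rightarrow> complex \<Rightarrow> real" where
  "hdelta a w = (1 - (norm a)\<^sup>2) * (1 - (norm w)\<^sup>2) / (norm (1 - cnj a * w))\<^sup>2"

lemma hdelta_moeb:
  assumes a: "norm a < 1" and v: "norm v < 1"
  shows "hdelta a (moeb a v) = 1 - (norm v)\<^sup>2"
proof -
  have d: "1 + cnj a * v \<noteq> 0" using moeb_den a v by simp
  have p: "1 - (norm a)\<^sup>2 > 0" using a by (simp add: abs_square_less_1)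
  have "1 - cnj a * moeb a v = (1 - cnj a * a) / (1 + cnj a * v)"
    using d by (simp add: moeb_def field_simps)
  also have "1 - cnj a * a = of_real (1 - (norm a)\<^sup>2)"
    using complex_norm_square[of a] by (simp add: mult.commute)
  finally have "norm (1 - cnj a * moeb a v) = (1 - (norm a)\<^sup>2) / norm (1 + cnj a * v)"
    using p by (simp add: norm_divide del: of_real_diff)
  moreover have "P * (P * V / m\<^sup>2) / (P / m)\<^sup>2 = V" if "P > 0" "m \<noteq> 0" for P m V :: real
    using that by (simp add: power2_eq_square)
  ultimately show ?thesis unfolding hdelta_def moeb_ident[OF d]
    using p d by simp
qed

text \<open>Area divided by \<open>(1 - (norm w)\<^sup>2)\<^sup>2\<close> is Moebius invariant, so
  \<open>a\<close> may be moved to the origin, where \<open>hdelta\<close> depends on the modulus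
  only.\<close>

lemma invariant_radial_nn:
  assumes a: "norm a < 1" and [measurable]: "g \<in> borel_measurable borel"
  shows "(\<integral>\<^sup>+w. indicator (ball 0 1) w * (ennreal (1 / (1 - (norm w)\<^sup>2)\<^sup>2) * g (hdelta a w)) \<partial>lborel) =
    ennreal pi * (\<integral>\<^sup>+y. indicator {0<..<1} y * (ennreal (1 / y\<^sup>2) * g y) \<partial>lborel)"
proof -
  have [measurable]: "ball (0::complex) s \<in> sets borel" for s by auto
  have [measurable]: "hdelta a \<in> borel_measurable borel" unfolding hdelta_def by measurable
  have p: "1 - (norm a)\<^sup>2 > 0" using a by (simp add: abs_square_less_1)
  \<comment> \<open>The Jacobian of the Moebius map cancels against the change of the invariant
    density.\<close>
  have J: "((1 - (norm a)\<^sup>2) / (norm (1 + cnj a * v))\<^sup>2)\<^sup>2 * (1 / (1 - (norm (moeb a v))\<^sup>2)\<^sup>2) = 1 / (1 - (norm v)\<^sup>2)\<^sup>2"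
    if v: "norm v < 1" for v
  proof -
    have d: "1 + cnj a * v \<noteq> 0" using moeb_den a v by simp
    have "(P / m\<^sup>2)\<^sup>2 * (1 / (P * V / m\<^sup>2)\<^sup>2) = 1 / V\<^sup>2" if "P > 0" "m \<noteq> 0" for P m V :: real
      using that by (simp add: power_mult_distrib power_divide)
    then show ?thesis unfolding moeb_ident[OF d] using p d by simp
  qed
  have "(\<integral>\<^sup>+w. indicator (ball 0 1) w * (ennreal (1 / (1 - (norm w)\<^sup>2)\<^sup>2) * g (hdelta a w)) \<partial>lborel) =
    (\<integral>\<^sup>+v. indicator (ball 0 1) v * (ennreal (((1 - (norm a)\<^sup>2) / (norm (1 + cnj a * v))\<^sup>2)\<^sup>2) * 
       (ennreal (1 / (1 - (norm (moeb a v))\<^sup>2)\<^sup>2) * g (hdelta a (moeb a v)))) \<partial>lborel)"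
    by (rule area_moeb_nn[OF a]) measurable
  also have "\<dots> = (\<integral>\<^sup>+v. indicator (ball (0::complex) 1) v * (ennreal (1 / (1 - (norm v)\<^sup>2)\<^sup>2) * g (1 - (norm v)\<^sup>2)) \<partial>lborel)"
  proof (intro nn_integral_cong)
    fix v :: complex
    show "indicator (ball 0 1) v * (ennreal (((1 - (norm a)\<^sup>2) / (norm (1 + cnj a * v))\<^sup>2)\<^sup>2) *
        (ennreal (1 / (1 - (norm (moeb a v))\<^sup>2)\<^sup>2) * g (hdelta a (moeb a v)))) =
      indicator (ball 0 1) v * (ennreal (1 / (1 - (norm v)\<^sup>2)\<^sup>2) * g (1 - (norm v)\<^sup>2))"
    proof (cases "norm v < 1")
      case True
      show ?thesis unfolding J[OF True, symmetric] hdelta_moeb[OF a True]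
        by (subst ennreal_mult') (auto simp: mult.assoc)
    qed auto
  qed
  also have "\<dots> = ennreal pi * (\<integral>\<^sup>+y. indicator {0<..<1} y * (ennreal (1 / y\<^sup>2) * g y) \<partial>lborel)"
    by (rule radial_nn'[of "\<lambda>y. ennreal (1 / y\<^sup>2) * g y"]) measurable
  finally show ?thesis .
qed

section \<open>Square integrable functions\<close>

definition sqint :: "'a measure \<Rightarrow> ('a \<Rightarrow> complex) \<Rightarrow> bool" where
  "sqint M f \<longleftrightarrow> f \<in> borel_measurable M \<and> integrable M (\<lambda>x. (norm (f x))\<^sup>2)"

definition l2norm :: "'a measure \<Rightarrow> ('a \<Rightarrow> complex) \<Rightarrow> real" where
  "l2norm M f = sqrt (\<integral>x. (norm (f x))\<^sup>2 \<partial>M)"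

lemma l2norm_nonneg [simp]: "l2norm M f \<ge> 0"
  by (simp add: l2norm_def)

lemma l2norm_square: "(l2norm M f)\<^sup>2 = (\<integral>x. (norm (f x))\<^sup>2 \<partial>M)"
  by (simp add: l2norm_def)

lemma sqint_measD [measurable_dest]: "sqint M f \<Longrightarrow> f \<in> borel_measurable M"
  by (simp add: sqint_def)

lemma nn_integral_sqint: "sqint M f \<Longrightarrow> (\<integral>\<^sup>+x. ennreal ((norm (f x))\<^sup>2) \<partial>M) = ennreal ((l2norm M f)\<^sup>2)"
  unfolding l2norm_square sqint_def by (rule nn_integral_eq_integral) auto

lemma sqintI_bounded:
  assumes "f \<in> borel_measurable M" "(\<integral>\<^sup>+x. ennreal ((norm (f x))\<^sup>2) \<partial>M) \<le> ennreal c" "c \<ge> 0"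
  shows "sqint M f" "(l2norm M f)\<^sup>2 \<le> c"
proof -
  have "integrable M (\<lambda>x. (norm (f x))\<^sup>2)"
    by (rule integrableI_nonneg) (use assms in \<open>auto simp: le_less_trans\<close>)
  then show "sqint M f" using assms by (simp add: sqint_def)
  from nn_integral_sqint[OF this] assms show "(l2norm M f)\<^sup>2 \<le> c" by simp
qed

lemma sqint_mult_nn:
  assumes f: "sqint M f" and g: "sqint M g"
  shows "(\<integral>\<^sup>+x. ennreal (norm (f x)) * ennreal (norm (g x)) \<partial>M) \<le> ennreal (l2norm M f * l2norm M g)"
proof -
  note [measurable] = sqint_measD[OF f] sqint_measD[OF g]
  have "(\<integral>\<^sup>+x. ennreal (norm (f x)) * ennreal (norm (g x)) \<partial>M)\<^sup>2 \<le>
    (\<integral>\<^sup>+x. ennreal (norm (f x)) ^ 2 \<partial>M) * (\<integral>\<^sup>+x. ennreal (norm (g x)) ^ 2 \<partial>M)"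
    by (rule Cauchy_Schwarz_nn_integral) measurable
  also have "\<dots> = ennreal ((l2norm M f * l2norm M g)\<^sup>2)"
    by (simp add: ennreal_power nn_integral_sqint f g power_mult_distrib ennreal_mult)
  finally have le: "(\<integral>\<^sup>+x. ennreal (norm (f x)) * ennreal (norm (g x)) \<partial>M)\<^sup>2 \<le> ennreal ((l2norm M f * l2norm M g)\<^sup>2)" .
  show ?thesis
  proof (cases "\<integral>\<^sup>+x. ennreal (norm (f x)) * ennreal (norm (g x)) \<partial>M")
    case (real r)
    then have "ennreal (r\<^sup>2) \<le> ennreal ((l2norm M f * l2norm M g)\<^sup>2)" using le by (simp add: ennreal_power)
    then have "r\<^sup>2 \<le> (l2norm M f * l2norm M g)\<^sup>2" by (simp add: ennreal_le_iff)
    then have "r \<le> l2norm M f * l2norm M g" by (rule power2_le_imp_le) simp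
    then show ?thesis using real by (simp add: ennreal_leI)
  next
    case top
    then show ?thesis using le by (simp add: power2_eq_square ennreal_top_mult top_unique)
  qed
qed

lemma sqint_mult:
  assumes f: "sqint M f" and g: "sqint M g"
  shows "integrable M (\<lambda>x. f x * g x)" "norm (\<integral>x. f x * g x \<partial>M) \<le> l2norm M f * l2norm M g"
    "(\<integral>x. norm (f x) * norm (g x) \<partial>M) \<le> l2norm M f * l2norm M g"
    "integrable M (\<lambda>x. norm (f x) * norm (g x))"
proof -
  note [measurable] = sqint_measD[OF f] sqint_measD[OF g]
  have *: "(\<integral>\<^sup>+x. ennreal (norm (f x * g x)) \<partial>M) \<le> ennreal (l2norm M f * l2norm M g)"
    using sqint_mult_nn[OF f g] by (simp add: norm_mult ennreal_mult)
  show i: "integrable M (\<lambda>x. f x * g x)"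
    by (rule integrableI_bounded) (use * in \<open>auto simp: le_less_trans\<close>)
  show j: "integrable M (\<lambda>x. norm (f x) * norm (g x))"
    using integrable_norm[OF i] by (simp add: norm_mult)
  have "ennreal (\<integral>x. norm (f x) * norm (g x) \<partial>M) = (\<integral>\<^sup>+x. ennreal (norm (f x * g x)) \<partial>M)"
    unfolding norm_mult by (rule nn_integral_eq_integral[symmetric, OF j]) auto
  also note *
  finally show k: "(\<integral>x. norm (f x) * norm (g x) \<partial>M) \<le> l2norm M f * l2norm M g" by simp
  have "norm (\<integral>x. f x * g x \<partial>M) \<le> (\<integral>x. norm (f x * g x) \<partial>M)" by (rule integral_norm_bound)
  with k show "norm (\<integral>x. f x * g x \<partial>M) \<le> l2norm M f * l2norm M g" by (simp add: norm_mult)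
qed

lemma borel_measurable_cnj [measurable]: "cnj \<in> borel_measurable borel"
  by (intro borel_measurable_continuous_onI continuous_intros)

lemma sqint_cnj: "sqint M f \<Longrightarrow> sqint M (\<lambda>x. cnj (f x))"
  unfolding sqint_def by (auto intro: measurable_compose[OF _ borel_measurable_cnj])

lemma l2norm_cnj [simp]: "l2norm M (\<lambda>x. cnj (f x)) = l2norm M f"
  by (simp add: l2norm_def)

lemma sqint_add:
  assumes f: "sqint M f" and g: "sqint M g"
  shows "sqint M (\<lambda>x. f x + g x)" "l2norm M (\<lambda>x. f x + g x) \<le> l2norm M f + l2norm M g"
proof -
  note [measurable] = sqint_measD[OF f] sqint_measD[OF g]
  have i: "integrable M (\<lambda>x. (norm (f x))\<^sup>2 + 2 * (norm (f x) * norm (g x)) + (norm (g x))\<^sup>2)"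
    using f g sqint_mult(4)[OF f g] by (auto simp: sqint_def)
  have le: "(norm (f x + g x))\<^sup>2 \<le> (norm (f x))\<^sup>2 + 2 * (norm (f x) * norm (g x)) + (norm (g x))\<^sup>2" for x
  proof -
    have "(norm (f x + g x))\<^sup>2 \<le> (norm (f x) + norm (g x))\<^sup>2" by (intro power_mono norm_triangle_ineq) auto
    then show ?thesis by (simp add: power2_sum algebra_simps)
  qed
  have j: "integrable M (\<lambda>x. (norm (f x + g x))\<^sup>2)"
    by (rule Bochner_Integration.integrable_bound[OF i]) (use le in \<open>auto intro: order.trans\<close>)
  then show s: "sqint M (\<lambda>x. f x + g x)" by (simp add: sqint_def)
  have "(l2norm M (\<lambda>x. f x + g x))\<^sup>2 \<le> (\<integral>x. (norm (f x))\<^sup>2 + 2 * (norm (f x) * norm (g x)) + (norm (g x))\<^sup>2 \<partial>M)"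
    unfolding l2norm_square by (rule integral_mono[OF j i le])
  also have "\<dots> = (l2norm M f)\<^sup>2 + 2 * (\<integral>x. norm (f x) * norm (g x) \<partial>M) + (l2norm M g)\<^sup>2"
    using f g sqint_mult(4)[OF f g] by (simp add: sqint_def l2norm_square)
  also have "\<dots> \<le> (l2norm M f + l2norm M g)\<^sup>2"
    using sqint_mult(3)[OF f g] by (simp add: power2_sum algebra_simps)
  finally show "l2norm M (\<lambda>x. f x + g x) \<le> l2norm M f + l2norm M g"
    by (rule power2_le_imp_le) simp
qed

lemma sqint_bounded_mult:
  assumes f: "sqint M f" and [measurable]: "u \<in> borel_measurable M" and u: "\<And>x. norm (u x) \<le> c"
  shows "sqint M (\<lambda>x. u x * f x)" "l2norm M (\<lambda>x. u x * f x) \<le> c * l2norm M f"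
proof -
  note [measurable] = sqint_measD[OF f]
  have c: "c \<ge> 0" using u[of undefined] norm_ge_zero order.trans by blast
  have le: "(norm (u x * f x))\<^sup>2 \<le> c\<^sup>2 * (norm (f x))\<^sup>2" for x
    unfolding norm_mult power_mult_distrib[symmetric] by (intro power_mono mult_right_mono u) auto
  have i: "integrable M (\<lambda>x. c\<^sup>2 * (norm (f x))\<^sup>2)" using f by (simp add: sqint_def)
  have j: "integrable M (\<lambda>x. (norm (u x * f x))\<^sup>2)"
    by (rule Bochner_Integration.integrable_bound[OF i]) (use le in \<open>auto intro: order.trans\<close>)
  then show "sqint M (\<lambda>x. u x * f x)" by (simp add: sqint_def)
  have "(l2norm M (\<lambda>x. u x * f x))\<^sup>2 \<le> (c * l2norm M f)\<^sup>2"
    unfolding l2norm_square power_mult_distrib using integral_mono[OF j i le] by simp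
  then show "l2norm M (\<lambda>x. u x * f x) \<le> c * l2norm M f"
    by (rule power2_le_imp_le) (use c in simp)
qed

lemma sqint_cmult:
  assumes f: "sqint M f"
  shows "sqint M (\<lambda>x. c * f x)" "l2norm M (\<lambda>x. c * f x) = norm c * l2norm M f"
proof -
  show "sqint M (\<lambda>x. c * f x)" by (rule sqint_bounded_mult[OF f, of _ "norm c"]) auto
  show "l2norm M (\<lambda>x. c * f x) = norm c * l2norm M f"
    by (simp add: l2norm_def norm_mult power_mult_distrib real_sqrt_mult)
qed

lemma sqint_diff:
  assumes f: "sqint M f" and g: "sqint M g"
  shows "sqint M (\<lambda>x. f x - g x)" "l2norm M (\<lambda>x. f x - g x) \<le> l2norm M f + l2norm M g"
  using sqint_add[OF f sqint_cmult(1)[OF g, of "-1"]] sqint_cmult(2)[OF g, of "-1"] by simp_all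

lemma l2norm_minus_commute: "l2norm M (\<lambda>x. f x - g x) = l2norm M (\<lambda>x. g x - f x)"
  by (simp add: l2norm_def norm_minus_commute)

text \<open>The sets \<open>A m\<close> on which the sequence is
  bounded by \<open>m\<close> exhaust the space, so the test function may be cut off outside one of them.\<close>

lemma weakly_null:
  assumes f: "\<And>n::nat. sqint M (f n)" and fM: "\<And>n. l2norm M (f n) \<le> B" and lim: "\<And>x. (\<lambda>n. f n x) \<longlonglongrightarrow> 0"
    and g: "sqint M g" and gi: "integrable M g"
  shows "(\<lambda>n. \<integral>x. f n x * g x \<partial>M) \<longlonglongrightarrow> 0"
proof -
  note [measurable] = sqint_measD[OF f] sqint_measD[OF g]
  define A where "A m = {x \<in> space M. \<forall>n. norm (f n x) \<le> real m}" for m :: nat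
  have [measurable]: "A m \<in> sets M" for m unfolding A_def by measurable
  define gc where "gc m x = indicator (- A m) x * g x" for m x
  have gc: "sqint M (gc m)" for m
    unfolding gc_def by (rule sqint_bounded_mult[OF g, of _ 1]) (auto simp: indicator_def)
  have cov: "\<exists>m0. \<forall>m\<ge>m0. x \<in> A m" if "x \<in> space M" for x
  proof -
    obtain K where "norm (f n x) \<le> K" for n
      using convergent_imp_Bseq[OF convergentI[OF lim[of x]]] by (auto simp: Bseq_def)
    moreover obtain m0 :: nat where "K \<le> m0" using real_arch_simple by blast
    ultimately have "norm (f n x) \<le> real m" if "m \<ge> m0" for m n
      using that by (meson of_nat_mono order.trans)
    then have "x \<in> A m" if "m \<ge> m0" for m
      unfolding A_def using that \<open>x \<in> space M\<close> by blast
    then show ?thesis by blast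
  qed
  have "(\<lambda>m. \<integral>x. (norm (gc m x))\<^sup>2 \<partial>M) \<longlonglongrightarrow> (\<integral>x. 0 \<partial>M)"
  proof (rule integral_dominated_convergence[where w = "\<lambda>x. (norm (g x))\<^sup>2"])
    show "integrable M (\<lambda>x. (norm (g x))\<^sup>2)" using g by (simp add: sqint_def)
    show "AE x in M. (\<lambda>i. (norm (gc i x))\<^sup>2) \<longlonglongrightarrow> 0"
    proof (rule AE_I2, rule tendsto_eventually)
      fix x assume "x \<in> space M"
      then obtain m0 where "\<forall>m\<ge>m0. x \<in> A m" using cov by blast
      then show "\<forall>\<^sub>F i in sequentially. (norm (gc i x))\<^sup>2 = 0"
        unfolding eventually_sequentially by (intro exI[of _ m0]) (auto simp: gc_def)
    qed
    show "(\<lambda>x. (norm (gc i x))\<^sup>2) \<in> borel_measurable M" for i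
      using sqint_measD[OF gc[of i]] by measurable
    show "AE x in M. norm ((norm (gc i x))\<^sup>2) \<le> (norm (g x))\<^sup>2" for i
    proof (rule AE_I2)
      fix x show "norm ((norm (gc i x))\<^sup>2) \<le> (norm (g x))\<^sup>2"
        by (cases "x \<in> A i") (simp_all add: gc_def)
    qed
    show "(\<lambda>x. 0::real) \<in> borel_measurable M" by (rule borel_measurable_const)
  qed
  then have "(\<lambda>m. sqrt (\<integral>x. (norm (gc m x))\<^sup>2 \<partial>M)) \<longlonglongrightarrow> 0"
    using tendsto_real_sqrt[of _ 0] by simp
  then have gc0: "(\<lambda>m. B * l2norm M (gc m)) \<longlonglongrightarrow> 0"
    unfolding l2norm_def by (rule tendsto_mult_right_zero)
  show ?thesis
  proof (rule LIMSEQ_I)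
    fix e :: real assume e: "e > 0"
    obtain m where m: "B * l2norm M (gc m) < e / 2"
      using order_tendstoD(2)[OF gc0, of "e/2"] e by (auto simp: eventually_sequentially)
    \<comment> \<open>On \<open>A m\<close> the sequence is bounded by m, so m times the norm of
      \<open>g\<close> dominates; this is where integrability of \<open>g\<close> itself, and not of
      its square, enters.\<close>
    have "(\<lambda>n. \<integral>x. f n x * (indicator (A m) x * g x) \<partial>M) \<longlonglongrightarrow> (\<integral>x. 0 \<partial>M)"
    proof (rule integral_dominated_convergence[where w = "\<lambda>x. real m * norm (g x)"])
      show "integrable M (\<lambda>x. real m * norm (g x))" using gi by simp
      show "AE x in M. (\<lambda>i. f i x * (indicator (A m) x * g x)) \<longlonglongrightarrow> 0"
        by (rule AE_I2) (rule tendsto_mult_left_zero[OF lim])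
      show "AE x in M. norm (f i x * (indicator (A m) x * g x)) \<le> real m * norm (g x)" for i
      proof (rule AE_I2)
        fix x assume "x \<in> space M"
        show "norm (f i x * (indicator (A m) x * g x)) \<le> real m * norm (g x)"
          by (cases "x \<in> A m") (simp_all add: norm_mult A_def mult_right_mono)
      qed
    qed auto
    then obtain n0 where n0: "\<And>n. n \<ge> n0 \<Longrightarrow> norm (\<integral>x. f n x * (indicator (A m) x * g x) \<partial>M) < e / 2"
      using LIMSEQ_D[of "\<lambda>n. \<integral>x. f n x * (indicator (A m) x * g x) \<partial>M" "0::complex" "e/2"] e by auto
    show "\<exists>no. \<forall>n\<ge>no. norm ((\<integral>x. f n x * g x \<partial>M) - 0) < e"
    proof (intro exI[of _ n0] allI impI)
      fix n assume n: "n \<ge> n0"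
      have s1: "sqint M (\<lambda>x. indicator (A m) x * g x)"
        by (rule sqint_bounded_mult[OF g, of _ 1]) (auto simp: indicator_def)
      have "(\<integral>x. f n x * g x \<partial>M) = (\<integral>x. f n x * (indicator (A m) x * g x) + f n x * gc m x \<partial>M)"
        by (intro Bochner_Integration.integral_cong) (auto simp: gc_def indicator_def)
      also have "\<dots> = (\<integral>x. f n x * (indicator (A m) x * g x) \<partial>M) + (\<integral>x. f n x * gc m x \<partial>M)"
        by (rule Bochner_Integration.integral_add[OF sqint_mult(1)[OF f s1] sqint_mult(1)[OF f gc]])
      finally have "norm (\<integral>x. f n x * g x \<partial>M) \<le> norm (\<integral>x. f n x * (indicator (A m) x * g x) \<partial>M) + norm (\<integral>x. f n x * gc m x \<partial>M)"
        by (simp add: norm_triangle_ineq)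
      also have "norm (\<integral>x. f n x * gc m x \<partial>M) \<le> l2norm M (f n) * l2norm M (gc m)"
        by (rule sqint_mult(2)[OF f gc])
      also have "\<dots> \<le> B * l2norm M (gc m)" by (intro mult_right_mono fM) auto
      finally show "norm ((\<integral>x. f n x * g x \<partial>M) - 0) < e" using n0[OF n] m by simp
    qed
  qed
qed

text \<open>Write \<open>k f\<close> as the product of the square roots of \<open>k h\<close> and of
  k times the squared \<open>f\<close> over \<open>h\<close>. Cauchy-Schwarz uses the row bound, and
  after exchanging integrals the column bound finishes. The two bounds enter as a product, so it is
  enough that one of them is small and the other finite. Columns are bounded over
  \<open>\<Omega>\<close>, which contains the support of \<open>f\<close>.\<close>

lemma schur_test:
  fixes k :: "'a \<Rightarrow> 'b \<Rightarrow> real" and f h :: "'b \<Rightarrow> real" and h' :: "'a \<Rightarrow> real"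
  assumes M: "sigma_finite_measure M" and N: "sigma_finite_measure N"
    and [measurable]: "(\<lambda>(z, w). k z w) \<in> borel_measurable (M \<Otimes>\<^sub>M N)" "h \<in> borel_measurable N" "h' \<in> borel_measurable M"
       "f \<in> borel_measurable N"
    and k0: "\<And>z w. k z w \<ge> 0" and f0: "\<And>w. f w \<ge> 0" "\<And>w. w \<notin> \<Omega> \<Longrightarrow> f w = 0"
    and h0: "\<And>w. w \<in> \<Omega> \<Longrightarrow> h w > 0" "\<And>z. h' z \<ge> 0"
    and a: "\<And>z. (\<integral>\<^sup>+w. ennreal (k z w * h w) \<partial>N) \<le> ennreal (a * h' z)" "a \<ge> 0"
    and b: "\<And>w. w \<in> \<Omega> \<Longrightarrow> (\<integral>\<^sup>+z. ennreal (k z w * h' z) \<partial>M) \<le> ennreal (b * h w)" "b \<ge> 0"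
  shows "(\<integral>\<^sup>+z. (\<integral>\<^sup>+w. ennreal (k z w * f w) \<partial>N)\<^sup>2 \<partial>M) \<le> ennreal (a * b) * (\<integral>\<^sup>+w. ennreal ((f w)\<^sup>2) \<partial>N)"
proof -
  interpret M: sigma_finite_measure M by fact
  interpret N: sigma_finite_measure N by fact
  interpret P: pair_sigma_finite M N ..
  \<comment> \<open>The quotient gets the value 0 where \<open>f\<close> vanishes, since positivity
    of \<open>h\<close> is known only on \<open>\<Omega>\<close>.\<close>
  define q where "q w = (if w \<in> space N then (if f w = 0 then 0 else (f w)\<^sup>2 / h w) else 0)" for w
  have [measurable]: "q \<in> borel_measurable N" unfolding q_def by measurable
  have q0: "q w \<ge> 0" for w unfolding q_def using f0(2)[of w] h0(1)[of w] by (cases "w \<in> \<Omega>") auto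
  have 1: "(\<integral>\<^sup>+w. ennreal (k z w * f w) \<partial>N)\<^sup>2 \<le> ennreal (a * h' z) * (\<integral>\<^sup>+w. ennreal (k z w * q w) \<partial>N)" if "z \<in> space M" for z
  proof -
    have [measurable]: "k z \<in> borel_measurable N" using that by measurable
    have eq: "ennreal (k z w * f w) = ennreal (sqrt (k z w * \<bar>h w\<bar>)) * ennreal (sqrt (k z w * q w))" if "w \<in> space N" for w
    proof (cases "f w = 0")
      case True then show ?thesis using that by (simp add: q_def)
    next
      case False
      then have h: "h w > 0" using f0 h0 by blast
      have "(k z w * \<bar>h w\<bar>) * (k z w * q w) = (k z w * f w)\<^sup>2"
        using h False that by (simp add: q_def power2_eq_square)
      then have "sqrt (k z w * \<bar>h w\<bar>) * sqrt (k z w * q w) = sqrt ((k z w * f w)\<^sup>2)"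
        by (simp only: real_sqrt_mult[symmetric])
      also have "\<dots> = k z w * f w" using k0 f0 by simp
      finally show ?thesis by (simp add: ennreal_mult'[symmetric] k0 q0)
    qed
    have eq': "ennreal (k z w * f w) = ennreal (sqrt (k z w * \<bar>h w\<bar>) * indicator {w. f w \<noteq> 0} w) * ennreal (sqrt (k z w * q w))"
      if "w \<in> space N" for w
    proof (cases "f w = 0")
      case True then show ?thesis using that by simp
    next
      case False then show ?thesis using eq[OF that] by simp
    qed
    have "(\<integral>\<^sup>+w. ennreal (k z w * f w) \<partial>N)\<^sup>2 = (\<integral>\<^sup>+w. ennreal (sqrt (k z w * \<bar>h w\<bar>) * indicator {w. f w \<noteq> 0} w) * ennreal (sqrt (k z w * q w)) \<partial>N)\<^sup>2"
      by (intro arg_cong[where f = "\<lambda>x. x\<^sup>2"] nn_integral_cong) (simp add: eq' )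
    also have "\<dots> \<le> (\<integral>\<^sup>+w. (ennreal (sqrt (k z w * \<bar>h w\<bar>) * indicator {w. f w \<noteq> 0} w))\<^sup>2 \<partial>N) * (\<integral>\<^sup>+w. (ennreal (sqrt (k z w * q w)))\<^sup>2 \<partial>N)"
      by (rule Cauchy_Schwarz_nn_integral) measurable
    also have "(\<integral>\<^sup>+w. (ennreal (sqrt (k z w * \<bar>h w\<bar>) * indicator {w. f w \<noteq> 0} w))\<^sup>2 \<partial>N) \<le> (\<integral>\<^sup>+w. ennreal (k z w * h w) \<partial>N)"
    proof (rule nn_integral_mono)
      fix w show "(ennreal (sqrt (k z w * \<bar>h w\<bar>) * indicator {w. f w \<noteq> 0} w))\<^sup>2 \<le> ennreal (k z w * h w)"
        using f0(2)[of w] h0(1)[of w] k0[of z w]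
        by (cases "w \<in> \<Omega>") (auto simp: indicator_def ennreal_power power_mult_distrib)
    qed
    also note a(1)[of z]
    also have "(\<integral>\<^sup>+w. (ennreal (sqrt (k z w * q w)))\<^sup>2 \<partial>N) = (\<integral>\<^sup>+w. ennreal (k z w * q w) \<partial>N)"
      by (simp add: ennreal_power k0 q0)
    finally show ?thesis by (simp add: mult_right_mono)
  qed
  have "(\<integral>\<^sup>+z. (\<integral>\<^sup>+w. ennreal (k z w * f w) \<partial>N)\<^sup>2 \<partial>M) \<le> (\<integral>\<^sup>+z. ennreal (a * h' z) * (\<integral>\<^sup>+w. ennreal (k z w * q w) \<partial>N) \<partial>M)"
    by (rule nn_integral_mono) (rule 1)
  also have "\<dots> = (\<integral>\<^sup>+z. (\<integral>\<^sup>+w. ennreal (a * h' z) * ennreal (k z w * q w) \<partial>N) \<partial>M)"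
    by (intro nn_integral_cong nn_integral_cmult[symmetric]) measurable
  also have "\<dots> = (\<integral>\<^sup>+w. (\<integral>\<^sup>+z. ennreal (a * h' z) * ennreal (k z w * q w) \<partial>M) \<partial>N)"
    by (rule P.Fubini'[symmetric]) measurable
  also have "\<dots> = (\<integral>\<^sup>+w. (\<integral>\<^sup>+z. ennreal (a * q w) * ennreal (k z w * h' z) \<partial>M) \<partial>N)"
    by (intro nn_integral_cong) (simp add: ennreal_mult'[symmetric] a(2) q0 k0 h0 mult_ac)
  also have "\<dots> = (\<integral>\<^sup>+w. ennreal (a * q w) * (\<integral>\<^sup>+z. ennreal (k z w * h' z) \<partial>M) \<partial>N)"
    by (intro nn_integral_cong nn_integral_cmult) measurable
  also have "\<dots> \<le> (\<integral>\<^sup>+w. ennreal (a * b) * ennreal ((f w)\<^sup>2) \<partial>N)"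
  proof (rule nn_integral_mono)
    fix w assume w: "w \<in> space N"
    show "ennreal (a * q w) * (\<integral>\<^sup>+z. ennreal (k z w * h' z) \<partial>M) \<le> ennreal (a * b) * ennreal ((f w)\<^sup>2)"
    proof (cases "f w = 0")
      case False
      then have O: "w \<in> \<Omega>" and h: "h w > 0" using f0 h0 by blast+
      have "ennreal (a * q w) * (\<integral>\<^sup>+z. ennreal (k z w * h' z) \<partial>M) \<le> ennreal (a * q w) * ennreal (b * h w)"
        by (intro mult_left_mono b O) auto
      also have "\<dots> = ennreal (a * b * (q w * h w))"
        using a(2) b(2) q0 h by (subst ennreal_mult'[symmetric]) (auto simp: mult_ac)
      also have "q w * h w = (f w)\<^sup>2" using h w False by (simp add: q_def)
      finally show ?thesis using a(2) b(2) by (simp add: ennreal_mult')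
    qed (simp add: q_def)
  qed
  also have "\<dots> = ennreal (a * b) * (\<integral>\<^sup>+w. ennreal ((f w)\<^sup>2) \<partial>N)"
    by (rule nn_integral_cmult) measurable
  finally show ?thesis .
qed

section \<open>Holomorphic functions of two variables\<close>

text \<open>Holomorphy at a single point, so that sum, product, quotient and chain rules can be
  applied pointwise.\<close>

definition cdiff2 :: "(complex \<times> complex \<Rightarrow> complex) \<Rightarrow> complex \<times> complex \<Rightarrow> bool" where
  "cdiff2 f z \<longleftrightarrow> (\<exists>a b. (f has_derivative (\<lambda>h. a * fst h + b * snd h)) (at z))"

lemma holomorphic2_on_iff: "holomorphic2_on f \<Omega> \<longleftrightarrow> (\<forall>z\<in>\<Omega>. cdiff2 f z)"
  by (simp add: holomorphic2_on_def cdiff2_def)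

lemma cdiff2_const: "cdiff2 (\<lambda>_. c) z"
  unfolding cdiff2_def by (intro exI[of _ 0]) (auto intro!: derivative_eq_intros)

lemma cdiff2_fst: "cdiff2 fst z"
  unfolding cdiff2_def by (intro exI[of _ 1] exI[of _ 0]) (auto intro!: derivative_eq_intros)

lemma cdiff2_snd: "cdiff2 snd z"
  unfolding cdiff2_def by (intro exI[of _ 1] exI[of _ 0]) (auto intro!: derivative_eq_intros)

lemma cdiff2_add: "cdiff2 f z \<Longrightarrow> cdiff2 g z \<Longrightarrow> cdiff2 (\<lambda>z. f z + g z) z"
  unfolding cdiff2_def
proof (elim exE)
  fix a b c d assume 1: "(f has_derivative (\<lambda>h. a * fst h + b * snd h)) (at z)"
    and 2: "(g has_derivative (\<lambda>h. c * fst h + d * snd h)) (at z)"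
  show "\<exists>a b. ((\<lambda>z. f z + g z) has_derivative (\<lambda>h. a * fst h + b * snd h)) (at z)"
    by (intro exI[of _ "a + c"] exI[of _ "b + d"] has_derivative_eq_rhs[OF has_derivative_add[OF 1 2]])
       (auto simp: algebra_simps)
qed

lemma cdiff2_mult: "cdiff2 f z \<Longrightarrow> cdiff2 g z \<Longrightarrow> cdiff2 (\<lambda>z. f z * g z) z"
  unfolding cdiff2_def
proof (elim exE)
  fix a b c d assume 1: "(f has_derivative (\<lambda>h. a * fst h + b * snd h)) (at z)"
    and 2: "(g has_derivative (\<lambda>h. c * fst h + d * snd h)) (at z)"
  show "\<exists>a b. ((\<lambda>z. f z * g z) has_derivative (\<lambda>h. a * fst h + b * snd h)) (at z)"
    by (intro exI[of _ "f z * c + a * g z"] exI[of _ "f z * d + b * g z"] has_derivative_eq_rhs[OF has_derivative_mult[OF 1 2]])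
       (auto simp: algebra_simps)
qed

lemma cdiff2_compose:
  assumes "cdiff2 f z" "g field_differentiable (at (f z))"
  shows "cdiff2 (\<lambda>z. g (f z)) z"
proof -
  obtain a b where 1: "(f has_derivative (\<lambda>h. a * fst h + b * snd h)) (at z)"
    using assms(1) by (auto simp: cdiff2_def)
  obtain d where "(g has_field_derivative d) (at (f z))"
    using assms(2) by (auto simp: field_differentiable_def)
  then have 2: "(g has_derivative (\<lambda>h. d * h)) (at (f z))" by (simp add: has_field_derivative_def)
  show ?thesis unfolding cdiff2_def
    by (intro exI[of _ "d * a"] exI[of _ "d * b"] has_derivative_eq_rhs[OF has_derivative_compose[OF 1 2]])
       (auto simp: algebra_simps)
qed

lemma cdiff2_minus: "cdiff2 f z \<Longrightarrow> cdiff2 (\<lambda>z. - f z) z"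
  using cdiff2_mult[OF cdiff2_const[of "-1"]] by simp

lemma cdiff2_diff: "cdiff2 f z \<Longrightarrow> cdiff2 g z \<Longrightarrow> cdiff2 (\<lambda>z. f z - g z) z"
  using cdiff2_add[OF _ cdiff2_minus] by fastforce

lemma cdiff2_inverse: "cdiff2 f z \<Longrightarrow> f z \<noteq> 0 \<Longrightarrow> cdiff2 (\<lambda>z. inverse (f z)) z"
  by (rule cdiff2_compose) (auto simp: field_differentiable_def intro: DERIV_inverse)

lemma cdiff2_divide: "cdiff2 f z \<Longrightarrow> cdiff2 g z \<Longrightarrow> g z \<noteq> 0 \<Longrightarrow> cdiff2 (\<lambda>z. f z / g z) z"
  unfolding divide_inverse by (intro cdiff2_mult cdiff2_inverse)

lemma cdiff2_power: "cdiff2 f z \<Longrightarrow> cdiff2 (\<lambda>z. f z ^ n) z"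
  by (induction n) (auto intro: cdiff2_const cdiff2_mult)

lemma cdiff2_transform:
  assumes "cdiff2 f z" "open S" "z \<in> S" "\<And>x. x \<in> S \<Longrightarrow> f x = g x"
  shows "cdiff2 g z"
proof -
  obtain a b where "(f has_derivative (\<lambda>h. a * fst h + b * snd h)) (at z)"
    using assms(1) by (auto simp: cdiff2_def)
  then have "(g has_derivative (\<lambda>h. a * fst h + b * snd h)) (at z)"
    by (rule has_derivative_transform_within_open) (use assms in auto)
  then show ?thesis by (auto simp: cdiff2_def)
qed

lemma cdiff2_imp_continuous: "cdiff2 f z \<Longrightarrow> isCont f z"
  by (auto simp: cdiff2_def dest: has_derivative_continuous)

lemma holomorphic2_on_imp_continuous_on: "holomorphic2_on f \<Omega> \<Longrightarrow> continuous_on \<Omega> f"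
  by (auto simp: holomorphic2_on_iff intro: continuous_at_imp_continuous_on cdiff2_imp_continuous)

lemma holomorphic2_curve_deriv:
  assumes f: "(f has_derivative (\<lambda>h. A * fst h + B * snd h)) (at (a l, b l))"
    and a: "(a has_field_derivative a') (at l)" and b: "(b has_field_derivative b') (at l)"
  shows "((\<lambda>l. f (a l, b l)) has_field_derivative (A * a' + B * b')) (at l)"
proof -
  have "((\<lambda>l. (a l, b l)) has_derivative (\<lambda>h. (a' * h, b' * h))) (at l)"
    using a b by (intro has_derivative_Pair) (auto simp: has_field_derivative_def)
  from has_derivative_compose[OF this f] show ?thesis
    unfolding has_field_derivative_def by (rule has_derivative_eq_rhs) (auto simp: algebra_simps)
qed

text \<open>Restriction to complex curves is the passage to one-variable theory: to the Cauchy
  estimate below, and later to the slices of the domain.\<close>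

lemma holomorphic2_curve:
  assumes f: "holomorphic2_on f \<Omega>" and a: "a holomorphic_on S" and b: "b holomorphic_on S" and S: "open S"
    and im: "\<And>l. l \<in> S \<Longrightarrow> (a l, b l) \<in> \<Omega>"
  shows "(\<lambda>l. f (a l, b l)) holomorphic_on S"
proof -
  have "(\<lambda>l. f (a l, b l)) field_differentiable (at l)" if l: "l \<in> S" for l
  proof -
    obtain A B where 1: "(f has_derivative (\<lambda>h. A * fst h + B * snd h)) (at (a l, b l))"
      using f im[OF l] by (auto simp: holomorphic2_on_def)
    show ?thesis unfolding field_differentiable_def
      using holomorphic2_curve_deriv[OF 1 holomorphic_derivI[OF a S l] holomorphic_derivI[OF b S l]] by blast
  qed
  then show ?thesis
    by (auto simp: holomorphic_on_def intro: field_differentiable_at_within)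
qed

text \<open>Cauchy's estimate on a complex line bounds the Taylor remainder by the supremum alone; this
  uniformity is what allows differentiation under the integral sign.\<close>

lemma holomorphic2_remainder:
  assumes hol: "holomorphic2_on \<phi> (ball z0 r)" and r: "r > 0" and M: "\<And>z. z \<in> ball z0 r \<Longrightarrow> norm (\<phi> z) \<le> M"
    and D: "(\<phi> has_derivative (\<lambda>h. a * fst h + b * snd h)) (at z0)" and h: "norm h < r / 2"
  shows "norm (\<phi> (z0 + h) - \<phi> z0 - (a * fst h + b * snd h)) \<le> 32 * M / r\<^sup>2 * (norm h)\<^sup>2"
proof (cases "h = 0")
  case False
  \<comment> \<open>The direction of \<open>h\<close> rescaled to length r, so that the unit disc
    parametrises the part of the complex line through \<open>z0\<close> that lies in the
    ball.\<close>
  define v where "v = (r / norm h) *\<^sub>R h"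
  have v: "norm v = r" using False r by (simp add: v_def)
  define \<psi> where "\<psi> l = \<phi> (fst z0 + l * fst v, snd z0 + l * snd v)" for l
  have nl: "norm (l * fst v, l * snd v) = norm l * r" for l
  proof -
    have "norm (l * fst v, l * snd v) = sqrt ((norm l)\<^sup>2 * ((norm (fst v))\<^sup>2 + (norm (snd v))\<^sup>2))"
      by (simp add: norm_Pair norm_mult power_mult_distrib algebra_simps)
    also have "\<dots> = norm l * norm v" unfolding real_sqrt_mult by (simp add: norm_prod_def)
    finally show ?thesis by (simp add: v)
  qed
  have inb: "(fst z0 + l * fst v, snd z0 + l * snd v) \<in> ball z0 r" if "norm l < 1" for l
  proof -
    have "z0 - (fst z0 + l * fst v, snd z0 + l * snd v) = - (l * fst v, l * snd v)"
      by (simp add: prod_eq_iff)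
    then have "dist z0 (fst z0 + l * fst v, snd z0 + l * snd v) = norm l * r"
      by (metis dist_norm nl norm_minus_cancel)
    then show ?thesis using that r by simp
  qed
  have hol\<psi>: "\<psi> holomorphic_on ball 0 1"
    unfolding \<psi>_def by (rule holomorphic2_curve[OF hol]) (use inb in \<open>auto intro!: holomorphic_intros\<close>)
  have d\<psi>: "deriv \<psi> 0 = a * fst v + b * snd v"
    unfolding \<psi>_def
  proof (rule DERIV_imp_deriv, rule holomorphic2_curve_deriv)
    show "(\<phi> has_derivative (\<lambda>h. a * fst h + b * snd h)) (at (fst z0 + 0 * fst v, snd z0 + 0 * snd v))"
      using D by simp
  qed (auto intro!: derivative_eq_intros)
  \<comment> \<open>Circles of radius 1/4 around points of the closed half disc stay in the unit
    disc; the constant is 2! M / (1/4)^2 = 32 M.\<close>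
  have B: "norm ((deriv ^^ 2) \<psi> x) \<le> 32 * M" if x: "x \<in> cball 0 (1/2)" for x
  proof -
    have sub: "cball x (1/4) \<subseteq> ball 0 1"
    proof
      fix y assume "y \<in> cball x (1/4)"
      then show "y \<in> ball 0 1" using x norm_triangle_ineq2[of y x] by (auto simp: dist_norm norm_minus_commute)
    qed
    have "norm ((deriv ^^ 2) \<psi> x) \<le> fact 2 * M / (1/4)^2"
    proof (rule Cauchy_inequality)
      show "\<psi> holomorphic_on ball x (1/4)" by (rule holomorphic_on_subset[OF hol\<psi>]) (use sub ball_subset_cball in blast)
      show "continuous_on (cball x (1/4)) \<psi>"
        by (rule holomorphic_on_imp_continuous_on[OF holomorphic_on_subset[OF hol\<psi> sub]])
      show "norm (\<psi> y) \<le> M" if "norm (x - y) = 1/4" for y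
      proof -
        have "y \<in> cball x (1/4)" using that by (simp add: dist_norm)
        then have "y \<in> ball 0 1" using sub by blast
        then show ?thesis unfolding \<psi>_def by (intro M inb) simp
      qed
    qed simp
    then show ?thesis by (simp add: fact_2 power2_eq_square)
  qed
  define l where "l = complex_of_real (norm h / r)"
  have nl': "norm l = norm h / r" using r unfolding l_def by (simp only: norm_of_real) simp
  have l: "norm l < 1/2" unfolding nl' using h r by (simp add: field_simps)
  have "norm ((deriv ^^ 0) \<psi> l - (\<Sum>i\<le>1. (deriv ^^ i) \<psi> 0 * (l - 0) ^ i / fact i)) \<le> 32 * M * norm (l - 0) ^ Suc 1 / fact 1"
  proof (rule complex_Taylor[of "cball 0 (1/2)"])
    show "((deriv ^^ i) \<psi> has_field_derivative (deriv ^^ Suc i) \<psi> x) (at x within cball 0 (1 / 2))"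
      if "x \<in> cball 0 (1/2)" for i x
    proof -
      have "x \<in> ball 0 1" using that by simp
      moreover have "(deriv ^^ i) \<psi> holomorphic_on ball 0 1" by (intro holomorphic_higher_deriv hol\<psi>) auto
      ultimately show ?thesis
        by (auto intro!: DERIV_subset[OF holomorphic_derivI[of _ "ball 0 1"]])
    qed
    show "norm ((deriv ^^ Suc 1) \<psi> x) \<le> 32 * M" if "x \<in> cball 0 (1/2)" for x
      using B[OF that] by (simp add: numeral_2_eq_2)
  qed (use l in auto)
  then have "norm (\<psi> l - (\<psi> 0 + (a * fst v + b * snd v) * l)) \<le> 32 * M * (norm l)\<^sup>2"
    by (simp add: d\<psi> power2_eq_square)
  moreover have "\<psi> 0 = \<phi> z0" by (simp add: \<psi>_def)
  moreover have lv: "l * fst v = fst h" "l * snd v = snd h"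
    using False r by (simp_all add: l_def v_def scaleR_conv_of_real)
  then have "\<psi> l = \<phi> (z0 + h)" by (simp add: \<psi>_def plus_prod_def)
  moreover have "(a * fst v + b * snd v) * l = a * fst h + b * snd h"
    unfolding lv[symmetric] by (simp add: algebra_simps)
  moreover have "32 * M * (norm l)\<^sup>2 = 32 * M / r\<^sup>2 * (norm h)\<^sup>2"
    using r by (simp add: nl' power_divide)
  ultimately show ?thesis by (simp add: algebra_simps)
qed simp

lemma has_derivative_quadratic:
  fixes F :: "'a::real_normed_vector \<Rightarrow> 'b::real_normed_vector"
  assumes L: "bounded_linear L" and r: "r > 0"
    and q: "\<And>h. norm h < r \<Longrightarrow> norm (F (z0 + h) - F z0 - L h) \<le> K * (norm h)\<^sup>2"
  shows "(F has_derivative L) (at z0)"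
proof (rule has_derivativeI_sandwich[OF r L])
  show "norm (F y - F z0 - L (y - z0)) / norm (y - z0) \<le> K * norm (y - z0)" if "y \<noteq> z0" "dist y z0 < r" for y
    using q[of "y - z0"] that by (simp add: dist_norm field_simps power2_eq_square)
  have "((\<lambda>y. K * norm (y - z0)) \<longlongrightarrow> K * norm (z0 - z0)) (at z0)" by (intro tendsto_intros)
  then show "((\<lambda>y. K * norm (y - z0)) \<longlongrightarrow> 0) (at z0)" by simp
qed

text \<open>The quadratic remainder is uniform in \<open>w\<close>, so it can be integrated against
  \<open>f\<close>; the integrated coefficients then form the derivative.\<close>

lemma cdiff2_integral:
  fixes \<Gamma> :: "complex \<times> complex \<Rightarrow> 'a \<Rightarrow> complex"
  assumes hol: "\<And>w. holomorphic2_on (\<lambda>z. \<Gamma> z w) (ball z0 r)" and r: "r > 0"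
    and M: "\<And>z w. z \<in> ball z0 r \<Longrightarrow> norm (\<Gamma> z w) \<le> M"
    and [measurable]: "\<And>z. \<Gamma> z \<in> borel_measurable N" and f: "integrable N f"
  shows "cdiff2 (\<lambda>z. \<integral>w. f w * \<Gamma> z w \<partial>N) z0"
proof -
  have [measurable]: "f \<in> borel_measurable N" using f by auto
  have "\<forall>w. \<exists>a b. ((\<lambda>z. \<Gamma> z w) has_derivative (\<lambda>h. a * fst h + b * snd h)) (at z0)"
    using hol r by (auto simp: holomorphic2_on_def)
  then obtain a b where ab: "\<And>w. ((\<lambda>z. \<Gamma> z w) has_derivative (\<lambda>h. a w * fst h + b w * snd h)) (at z0)"
    by metis
  have M0: "M \<ge> 0" using M[of z0 undefined] r norm_ge_zero order.trans by (metis centre_in_ball)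
  define K where "K = 32 * M / r\<^sup>2"
  have K: "K \<ge> 0" using M0 by (simp add: K_def)
  have q: "norm (\<Gamma> (z0 + h) w - \<Gamma> z0 w - (a w * fst h + b w * snd h)) \<le> K * (norm h)\<^sup>2" if "norm h < r / 2" for h w
    unfolding K_def by (rule holomorphic2_remainder[OF hol r M ab that])
  \<comment> \<open>A null sequence of step sizes below r/2. Difference quotients along it are
    measurable in w, and so are their limits, the coefficients \<open>a\<close> and
    \<open>b\<close>.\<close>
  define c where "c n = r / (4 * (real n + 1))" for n :: nat
  have c: "c n > 0" "c n < r / 2" for n
  proof -
    show "c n > 0" using r by (simp add: c_def)
    have "r * 2 < r * (4 * (real n + 1))" using r by (intro mult_strict_left_mono) auto
    then show "c n < r / 2" using r by (simp add: c_def field_simps)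
  qed
  have c0: "(\<lambda>n. K * c n) \<longlonglongrightarrow> 0"
    unfolding c_def by (rule tendsto_mult_right_zero) real_asymp
  have lim: "(\<lambda>n. (\<Gamma> (z0 + c n *\<^sub>R e) w - \<Gamma> z0 w) / c n) \<longlonglongrightarrow> a w * fst e + b w * snd e" if e: "norm e = 1" for e w
  proof (rule LIM_zero_cancel, rule Lim_null_comparison[OF _ c0], rule always_eventually, rule allI)
    fix n
    have "norm (c n *\<^sub>R e) < r / 2" using c[of n] e by simp
    from q[OF this, of w] have "norm (\<Gamma> (z0 + c n *\<^sub>R e) w - \<Gamma> z0 w - c n * (a w * fst e + b w * snd e)) \<le> K * (c n)\<^sup>2"
      using e c[of n] by (simp add: scaleR_conv_of_real algebra_simps)
    moreover have "(\<Gamma> (z0 + c n *\<^sub>R e) w - \<Gamma> z0 w) / c n - (a w * fst e + b w * snd e) =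
      (\<Gamma> (z0 + c n *\<^sub>R e) w - \<Gamma> z0 w - c n * (a w * fst e + b w * snd e)) / c n"
      using c[of n] by (simp add: field_simps)
    ultimately show "norm ((\<Gamma> (z0 + c n *\<^sub>R e) w - \<Gamma> z0 w) / c n - (a w * fst e + b w * snd e)) \<le> K * c n"
      using c[of n] by (simp add: norm_divide field_simps power2_eq_square)
  qed
  have la: "(\<lambda>n. (\<Gamma> (z0 + c n *\<^sub>R (1,0)) w - \<Gamma> z0 w) / c n) \<longlonglongrightarrow> a w" for w
    using lim[of "(1,0)" w] by (simp add: norm_Pair)
  have lb: "(\<lambda>n. (\<Gamma> (z0 + c n *\<^sub>R (0,1)) w - \<Gamma> z0 w) / c n) \<longlonglongrightarrow> b w" for w
    using lim[of "(0,1)" w] by (simp add: norm_Pair)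
  have [measurable]: "a \<in> borel_measurable N" by (rule borel_measurable_LIMSEQ_metric[OF _ la]) measurable
  have [measurable]: "b \<in> borel_measurable N" by (rule borel_measurable_LIMSEQ_metric[OF _ lb]) measurable
  \<comment> \<open>The remainder estimate for the single step \<open>c 0\<close> bounds both
    coefficients uniformly, so their products with \<open>f\<close> are integrable.\<close>
  define B where "B = (2 * M + K * (c 0)\<^sup>2) / c 0"
  have bd: "norm (a w * fst e + b w * snd e) \<le> B" if e: "norm e = 1" for e w
  proof -
    have n: "norm (c 0 *\<^sub>R e) < r / 2" using c[of 0] e by simp
    from q[OF this, of w] have 1: "norm (\<Gamma> (z0 + c 0 *\<^sub>R e) w - \<Gamma> z0 w - c 0 * (a w * fst e + b w * snd e)) \<le> K * (c 0)\<^sup>2"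
      using e c[of 0] by (simp add: scaleR_conv_of_real algebra_simps)
    have 2: "norm (\<Gamma> (z0 + c 0 *\<^sub>R e) w) \<le> M" "norm (\<Gamma> z0 w) \<le> M"
      by (rule M, use n r in \<open>simp add: dist_norm\<close>)+
    have "norm (c 0 * (a w * fst e + b w * snd e)) \<le> 2 * M + K * (c 0)\<^sup>2"
      using 1 2 norm_triangle_ineq4[of "\<Gamma> (z0 + c 0 *\<^sub>R e) w" "\<Gamma> z0 w"]
        norm_triangle_ineq2[of "c 0 * (a w * fst e + b w * snd e)" "\<Gamma> (z0 + c 0 *\<^sub>R e) w - \<Gamma> z0 w"]
      by (simp add: norm_minus_commute)
    moreover have "norm (c 0 * (a w * fst e + b w * snd e)) = c 0 * norm (a w * fst e + b w * snd e)"
      using c[of 0] by (simp add: norm_mult)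
    ultimately show ?thesis using c[of 0] by (simp add: B_def field_simps)
  qed
  have ba: "norm (a w) \<le> B" and bb: "norm (b w) \<le> B" for w
    using bd[of "(1,0)" w] bd[of "(0,1)" w] by (simp_all add: norm_Pair)
  have bint: "integrable N (\<lambda>w. f w * g w)" if [measurable]: "g \<in> borel_measurable N" and "\<And>w. norm (g w) \<le> C" for g C
  proof (rule Bochner_Integration.integrable_bound)
    show "integrable N (\<lambda>w. C * norm (f w))" using f by simp
    show "AE w in N. norm (f w * g w) \<le> norm (C * norm (f w))"
    proof (rule AE_I2)
      fix w
      have "norm (f w * g w) = norm (g w) * norm (f w)" by (simp add: norm_mult)
      also have "\<dots> \<le> \<bar>C\<bar> * norm (f w)" by (intro mult_right_mono order.trans[OF that(2)]) auto
      finally show "norm (f w * g w) \<le> norm (C * norm (f w))" by (simp add: abs_mult)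
    qed
  qed measurable
  have i1: "integrable N (\<lambda>w. f w * \<Gamma> z w)" if "z \<in> ball z0 r" for z by (rule bint[OF _ M[OF that]]) measurable
  have i2: "integrable N (\<lambda>w. f w * a w)" "integrable N (\<lambda>w. f w * b w)" by (rule bint[OF _ ba] bint[OF _ bb], measurable)+
  define A where "A = (\<integral>w. f w * a w \<partial>N)"
  define B' where "B' = (\<integral>w. f w * b w \<partial>N)"
  have "((\<lambda>z. \<integral>w. f w * \<Gamma> z w \<partial>N) has_derivative (\<lambda>h. A * fst h + B' * snd h)) (at z0)"
  proof (rule has_derivative_quadratic)
    show "bounded_linear (\<lambda>h. A * fst h + B' * snd h)"
      by (intro bounded_linear_add bounded_linear_compose[OF bounded_linear_mult_right] bounded_linear_fst bounded_linear_snd)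
    show "r / 2 > 0" using r by simp
    fix h :: "complex \<times> complex" assume h: "norm h < r / 2"
    have "(\<integral>w. f w * \<Gamma> (z0 + h) w \<partial>N) - (\<integral>w. f w * \<Gamma> z0 w \<partial>N) - (A * fst h + B' * snd h) =
       (\<integral>w. f w * \<Gamma> (z0 + h) w - f w * \<Gamma> z0 w - (f w * a w * fst h + f w * b w * snd h) \<partial>N)"
      using i1[of "z0 + h"] i1[of z0] i2 h r by (simp add: A_def B'_def dist_norm)
    also have "norm \<dots> \<le> (\<integral>w. K * (norm h)\<^sup>2 * norm (f w) \<partial>N)"
    proof (rule order.trans[OF integral_norm_bound integral_mono])
      show "integrable N (\<lambda>w. norm (f w * \<Gamma> (z0 + h) w - f w * \<Gamma> z0 w - (f w * a w * fst h + f w * b w * snd h)))"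
        using i1[of "z0 + h"] i1[of z0] i2 h r by (simp add: dist_norm)
      show "integrable N (\<lambda>w. K * (norm h)\<^sup>2 * norm (f w))" using f by simp
      fix w
      have "norm (f w * \<Gamma> (z0 + h) w - f w * \<Gamma> z0 w - (f w * a w * fst h + f w * b w * snd h)) =
         norm (f w) * norm (\<Gamma> (z0 + h) w - \<Gamma> z0 w - (a w * fst h + b w * snd h))"
        unfolding norm_mult[symmetric] by (simp add: algebra_simps)
      also have "\<dots> \<le> norm (f w) * (K * (norm h)\<^sup>2)" by (intro mult_left_mono q h) auto
      finally show "norm (f w * \<Gamma> (z0 + h) w - f w * \<Gamma> z0 w - (f w * a w * fst h + f w * b w * snd h)) \<le> K * (norm h)\<^sup>2 * norm (f w)"
        by (simp add: mult_ac)
    qed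
    also have "\<dots> = K * (\<integral>w. norm (f w) \<partial>N) * (norm h)\<^sup>2" by simp
    finally show "norm ((\<integral>w. f w * \<Gamma> (z0 + h) w \<partial>N) - (\<integral>w. f w * \<Gamma> z0 w \<partial>N) - (A * fst h + B' * snd h)) \<le> K * (\<integral>w. norm (f w) \<partial>N) * (norm h)\<^sup>2" .
  qed
  then show ?thesis by (auto simp: cdiff2_def)
qed

section \<open>Bergman spaces with a Schur-bounded kernel\<close>

locale finite_domain =
  fixes \<Omega> :: "(complex \<times> complex) set"
  assumes op: "open \<Omega>" and fin: "emeasure lborel \<Omega> < \<infinity>"
begin

text \<open>Borel functions vanishing off the domain: for them, integrals over
  \<open>lebesgue_on \<Omega>\<close> become integrals against \<open>lborel\<close> on the whole
  space, where product measures and Fubini are at hand.\<close>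

definition H :: "(complex \<times> complex \<Rightarrow> complex) set" where
  "H = {f. sqint lborel f \<and> (\<forall>z. z \<notin> \<Omega> \<longrightarrow> f z = 0)}"

abbreviation nrm :: "(complex \<times> complex \<Rightarrow> complex) \<Rightarrow> real" where "nrm \<equiv> l2norm lborel"

lemma \<Omega>_meas [measurable]: "\<Omega> \<in> sets borel"
  using op by (rule borel_open)

lemma H_D: "f \<in> H \<Longrightarrow> sqint lborel f" "f \<in> H \<Longrightarrow> z \<notin> \<Omega> \<Longrightarrow> f z = 0"
  by (simp_all add: H_def del: split_paired_All)

lemma H_I: "sqint lborel f \<Longrightarrow> (\<And>z. z \<notin> \<Omega> \<Longrightarrow> f z = 0) \<Longrightarrow> f \<in> H"
  by (auto simp: H_def)

lemma H_meas: "f \<in> H \<Longrightarrow> f \<in> borel_measurable borel"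
  using H_D(1)[of f] by (simp add: sqint_def)

lemma sqint_indicator: "sqint lborel (indicator \<Omega> :: _ \<Rightarrow> complex)"
proof -
  have "integrable lborel (\<lambda>x. indicator \<Omega> x :: real)"
    using fin by simp
  moreover have "(\<lambda>x. (norm (indicator \<Omega> x :: complex))\<^sup>2) = (\<lambda>x. indicator \<Omega> x :: real)"
    by (auto simp: indicator_def)
  ultimately show ?thesis unfolding sqint_def by (simp add: borel_measurable_indicator)
qed

text \<open>Finite volume: pairing with the indicator of the domain puts square integrable functions
  into L1.\<close>

lemma H_integrable: "f \<in> H \<Longrightarrow> integrable lborel f"
proof -
  assume f: "f \<in> H"
  have "(\<lambda>x. f x * indicator \<Omega> x) = f"
    using H_D(2)[OF f] by (force simp: indicator_def)
  then show ?thesis using sqint_mult(1)[OF H_D(1)[OF f] sqint_indicator] by simp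
qed

lemma bounded_H:
  assumes [measurable]: "f \<in> borel_measurable borel" and "\<And>z. z \<notin> \<Omega> \<Longrightarrow> f z = 0" "\<And>z. norm (f z) \<le> M"
  shows "f \<in> H"
proof -
  have "(\<lambda>x. f x * indicator \<Omega> x) = f"
    using assms(2) by (force simp: indicator_def)
  then show ?thesis using sqint_bounded_mult(1)[OF sqint_indicator, of f M] assms by (auto intro: H_I)
qed

lemma H_bounded_mult:
  assumes "f \<in> H" "u \<in> borel_measurable borel" "\<And>x. norm (u x) \<le> c"
  shows "(\<lambda>x. u x * f x) \<in> H" "nrm (\<lambda>x. u x * f x) \<le> c * nrm f"
  using sqint_bounded_mult[OF H_D(1)[OF assms(1)], of u c] assms(2,3) H_D(2)[OF assms(1)] by (auto intro: H_I)

lemma lebesgue_on_integral: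
  fixes f :: "complex \<times> complex \<Rightarrow> 'b::{banach, second_countable_topology}"
  assumes [measurable]: "f \<in> borel_measurable borel" and 0: "\<And>z. z \<notin> \<Omega> \<Longrightarrow> f z = 0"
  shows "integral\<^sup>L (lebesgue_on \<Omega>) f = integral\<^sup>L lborel f"
    "integrable (lebesgue_on \<Omega>) f \<longleftrightarrow> integrable lborel f"
proof -
  have eq: "(\<lambda>x. indicator \<Omega> x *\<^sub>R f x) = f" using 0 by (force simp: indicator_def)
  have s: "\<Omega> \<inter> space lebesgue \<in> sets lebesgue" by simp
  show "integral\<^sup>L (lebesgue_on \<Omega>) f = integral\<^sup>L lborel f"
    using integral_restrict_space[OF s, of f] eq by (simp add: integral_completion)
  show "integrable (lebesgue_on \<Omega>) f \<longleftrightarrow> integrable lborel f"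
    using integrable_restrict_space[OF s, of f] eq by (simp add: integrable_completion)
qed

lemma L2_norm_on_eq:
  assumes [measurable]: "f \<in> borel_measurable borel" and 0: "\<And>z. z \<notin> \<Omega> \<Longrightarrow> f z = 0"
  shows "L2_norm_on \<Omega> f = nrm f"
  unfolding L2_norm_on_def l2norm_def by (subst lebesgue_on_integral) (use 0 in auto)

lemma L2_inner_eq:
  assumes [measurable]: "f \<in> borel_measurable borel" "g \<in> borel_measurable borel" and 0: "\<And>z. z \<notin> \<Omega> \<Longrightarrow> g z = 0"
  shows "L2_inner \<Omega> f g = (\<integral>z. f z * cnj (g z) \<partial>lborel)"
  unfolding L2_inner_def by (subst lebesgue_on_integral) (use 0 in auto)

lemma holomorphic2_meas:
  assumes "holomorphic2_on f \<Omega>" "\<And>z. z \<notin> \<Omega> \<Longrightarrow> f z = 0"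
  shows "f \<in> borel_measurable borel"
proof -
  have "(\<lambda>x. indicator \<Omega> x *\<^sub>R f x) \<in> borel_measurable borel"
    by (intro borel_measurable_continuous_on_indicator \<Omega>_meas holomorphic2_on_imp_continuous_on assms)
  moreover have "(\<lambda>x. indicator \<Omega> x *\<^sub>R f x) = f" using assms(2) by (force simp: indicator_def)
  ultimately show ?thesis by simp
qed

text \<open>Holomorphic functions are continuous on the open domain, hence Borel once extended by 0;
  so the completed measure of the definition and \<open>lborel\<close> single out the same
  functions.\<close>

lemma bergman_iff: "f \<in> bergman_space \<Omega> \<longleftrightarrow> f \<in> H \<and> holomorphic2_on f \<Omega>"
proof (cases "holomorphic2_on f \<Omega> \<and> (\<forall>z. z \<notin> \<Omega> \<longrightarrow> f z = 0)")
  case True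
  then have [measurable]: "f \<in> borel_measurable borel" using holomorphic2_meas by blast
  have "f \<in> borel_measurable (lebesgue_on \<Omega>)"
    by (intro measurable_restrict_space1 measurable_completion) simp
  moreover have "integrable (lebesgue_on \<Omega>) (\<lambda>z. (norm (f z))\<^sup>2) \<longleftrightarrow> integrable lborel (\<lambda>z. (norm (f z))\<^sup>2)"
    by (rule lebesgue_on_integral(2)) (use True in auto)
  ultimately show ?thesis using True by (auto simp: bergman_space_def L2_space_def H_def sqint_def)
qed (auto simp: bergman_space_def H_def)

lemma bergman_H: "f \<in> bergman_space \<Omega> \<Longrightarrow> f \<in> H"
  by (simp add: bergman_iff)

lemma bergman_add: "f \<in> bergman_space \<Omega> \<Longrightarrow> g \<in> bergman_space \<Omega> \<Longrightarrow> (\<lambda>z. f z + g z) \<in> bergman_space \<Omega>"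
  unfolding bergman_iff holomorphic2_on_iff using sqint_add(1)[of lborel f g] by (auto intro: cdiff2_add simp: H_def)

lemma bergman_cmult: "f \<in> bergman_space \<Omega> \<Longrightarrow> (\<lambda>z. c * f z) \<in> bergman_space \<Omega>"
  unfolding bergman_iff holomorphic2_on_iff using sqint_cmult(1)[of lborel f c]
  by (auto intro!: cdiff2_mult cdiff2_const simp: H_def)

lemma bergman_diff: "f \<in> bergman_space \<Omega> \<Longrightarrow> g \<in> bergman_space \<Omega> \<Longrightarrow> (\<lambda>z. f z - g z) \<in> bergman_space \<Omega>"
  using bergman_add[OF _ bergman_cmult[of g "-1"], of f] by simp

end

text \<open>Collects what the operator theory uses of the kernel: local bounds uniform in the second
  variable for differentiating under the integral, symmetry for self-adjointness, the reproducing
  formula, and a Schur weight for boundedness on L2.\<close>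

locale schur_kernel = finite_domain \<Omega> for \<Omega> :: "(complex \<times> complex) set" +
  fixes G :: "complex \<times> complex \<Rightarrow> complex \<times> complex \<Rightarrow> complex"
    and h :: "complex \<times> complex \<Rightarrow> real" and C :: real
  assumes G_meas [measurable]: "(\<lambda>(z, w). G z w) \<in> borel_measurable (borel \<Otimes>\<^sub>M borel)"
    and G_zero: "z \<notin> \<Omega> \<or> w \<notin> \<Omega> \<Longrightarrow> G z w = 0"
    and G_herm: "cnj (G z w) = G w z"
    and G_cont: "continuous_on (\<Omega> \<times> \<Omega>) (\<lambda>(z, w). G z w)"
    and G_locbd: "z \<in> \<Omega> \<Longrightarrow> \<exists>r>0. \<exists>M. ball z r \<subseteq> \<Omega> \<and> (\<forall>x\<in>ball z r. \<forall>w. norm (G x w) \<le> M)"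
    and G_hol: "w \<in> \<Omega> \<Longrightarrow> holomorphic2_on (\<lambda>z. G z w) \<Omega>"
    and G_repr: "f \<in> bergman_space \<Omega> \<Longrightarrow> z \<in> \<Omega> \<Longrightarrow> (\<integral>w. f w * G z w \<partial>lborel) = f z"
    and G_pos: "z \<in> \<Omega> \<Longrightarrow> Re (G z z) > 0"
    and h_meas [measurable]: "h \<in> borel_measurable borel"
    and h_pos: "z \<in> \<Omega> \<Longrightarrow> h z > 0" and h_nonneg: "h z \<ge> 0"
    and C0: "C \<ge> 0" and schur: "(\<integral>\<^sup>+w. ennreal (norm (G z w) * h w) \<partial>lborel) \<le> ennreal (C * h z)"
begin

definition P :: "(complex \<times> complex \<Rightarrow> complex) \<Rightarrow> complex \<times> complex \<Rightarrow> complex" where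
  "P f z = (\<integral>w. f w * G z w \<partial>lborel)"

definition K :: "complex \<times> complex \<Rightarrow> complex \<times> complex \<Rightarrow> complex" where
  "K z = (\<lambda>w. G w z)"

lemma G_bounded: "\<exists>M. \<forall>w. norm (G z w) \<le> M"
proof (cases "z \<in> \<Omega>")
  case True
  then obtain r M where "r > 0" "\<forall>x\<in>ball z r. \<forall>w. norm (G x w) \<le> M" using G_locbd by blast
  then show ?thesis using centre_in_ball by blast
next
  case False
  then have "norm (G z w) \<le> 0" for w using G_zero by simp
  then show ?thesis by blast
qed

lemma G_H: "G z \<in> H"
proof -
  obtain M where "\<And>w. norm (G z w) \<le> M" using G_bounded by blast
  then show ?thesis by (intro bounded_H[of _ M]) (auto simp: G_zero)
qed

lemma K_cnj: "K z w = cnj (G z w)"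
  by (simp add: K_def G_herm)

lemma K_H: "K z \<in> H"
  unfolding K_cnj[abs_def] by (intro H_I sqint_cnj H_D(1)[OF G_H]) (simp add: G_zero)

lemma nrm_G: "nrm (G z) = nrm (K z)"
  by (simp add: K_cnj[abs_def])

lemma K_bergman: "z \<in> \<Omega> \<Longrightarrow> K z \<in> bergman_space \<Omega>"
  unfolding bergman_iff using K_H[of z] G_hol[of z] by (simp add: K_def)

lemma P_integrable: "f \<in> H \<Longrightarrow> integrable lborel (\<lambda>w. f w * G z w)"
  by (rule sqint_mult(1)[OF H_D(1) H_D(1)[OF G_H]])

lemma P_outside: "z \<notin> \<Omega> \<Longrightarrow> P f z = 0"
  by (simp add: P_def G_zero)

lemma P_bound: "f \<in> H \<Longrightarrow> norm (P f z) \<le> nrm f * nrm (K z)"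
  unfolding P_def nrm_G[symmetric] by (rule sqint_mult(2)[OF H_D(1) H_D(1)[OF G_H]])

lemma P_holomorphic:
  assumes f: "f \<in> H" shows "holomorphic2_on (P f) \<Omega>"
  unfolding holomorphic2_on_iff
proof
  fix z0 assume z0: "z0 \<in> \<Omega>"
  obtain r M where r: "r > 0" "ball z0 r \<subseteq> \<Omega>" and M: "\<And>x w. x \<in> ball z0 r \<Longrightarrow> norm (G x w) \<le> M"
    using G_locbd[OF z0] by blast
  show "cdiff2 (P f) z0" unfolding P_def
  proof (rule cdiff2_integral[OF _ r(1) M _ H_integrable[OF f]])
    fix w show "holomorphic2_on (\<lambda>z. G z w) (ball z0 r)"
    proof (cases "w \<in> \<Omega>")
      case True
      then show ?thesis using G_hol[OF True] r(2) by (auto simp: holomorphic2_on_iff)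
    next
      case False
      then have "(\<lambda>z. G z w) = (\<lambda>z. 0)" using G_zero by auto
      then show ?thesis by (auto simp: holomorphic2_on_iff cdiff2_const)
    qed
  qed auto
qed

lemma P_meas: "f \<in> H \<Longrightarrow> P f \<in> borel_measurable borel"
  by (rule holomorphic2_meas[OF P_holomorphic P_outside])

text \<open>Taken with absolute values inside: it bounds \<open>P\<close> and also supplies the
  absolute convergence for exchanging integrals in \<open>P_adjoint\<close>. By Hermitian symmetry
  the row bound serves as column bound too.\<close>

lemma S_nn:
  assumes f: "f \<in> H"
  shows "(\<integral>\<^sup>+z. (\<integral>\<^sup>+w. ennreal (norm (G z w) * norm (f w)) \<partial>lborel)\<^sup>2 \<partial>lborel) \<le> ennreal ((C * nrm f)\<^sup>2)"
proof -
  note [measurable] = H_meas[OF f]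
  have herm: "norm (G z w) = norm (G w z)" for z w using G_herm[of z w] by (metis complex_mod_cnj)
  have "(\<integral>\<^sup>+z. (\<integral>\<^sup>+w. ennreal (norm (G z w) * norm (f w)) \<partial>lborel)\<^sup>2 \<partial>lborel) \<le>
      ennreal (C * C) * (\<integral>\<^sup>+w. ennreal ((norm (f w))\<^sup>2) \<partial>lborel)"
  proof (rule schur_test[where \<Omega> = \<Omega> and h = h and h' = h])
    show "(\<integral>\<^sup>+z. ennreal (norm (G z w) * h z) \<partial>lborel) \<le> ennreal (C * h w)" for w
      using schur[of w] by (simp add: herm[of _ w])
    show "(\<lambda>(z, w). norm (G z w)) \<in> borel_measurable (lborel \<Otimes>\<^sub>M lborel)" by measurable
    show "norm (f w) = 0" if "w \<notin> \<Omega>" for w using H_D(2)[OF f that] by simp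
  qed (simp_all add: h_pos h_nonneg C0 schur lborel.sigma_finite_measure_axioms)
  then show ?thesis
    using nn_integral_sqint[OF H_D(1)[OF f]] C0 by (simp add: ennreal_mult'[symmetric] power2_eq_square mult_ac)
qed

lemma P_le_S: "f \<in> H \<Longrightarrow> ennreal (norm (P f z)) \<le> (\<integral>\<^sup>+w. ennreal (norm (G z w) * norm (f w)) \<partial>lborel)"
  unfolding P_def using integral_norm_bound_ennreal[OF P_integrable[of f z]] by (simp add: norm_mult mult.commute)

lemma P_bergman:
  assumes f: "f \<in> H" shows "P f \<in> bergman_space \<Omega>" "nrm (P f) \<le> C * nrm f"
proof -
  have le: "(\<integral>\<^sup>+z. ennreal ((norm (P f z))\<^sup>2) \<partial>lborel) \<le> ennreal ((C * nrm f)\<^sup>2)"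
  proof (rule order.trans[OF _ S_nn[OF f]], rule nn_integral_mono)
    fix z show "ennreal ((norm (P f z))\<^sup>2) \<le> (\<integral>\<^sup>+w. ennreal (norm (G z w) * norm (f w)) \<partial>lborel)\<^sup>2"
      using power_mono[OF P_le_S[OF f, of z], of 2] by (simp add: ennreal_power)
  qed
  from sqintI_bounded[OF _ this] P_meas[OF f] have s: "sqint lborel (P f)" and n: "(nrm (P f))\<^sup>2 \<le> (C * nrm f)\<^sup>2" by auto
  show "P f \<in> bergman_space \<Omega>" unfolding bergman_iff using s P_holomorphic[OF f] P_outside by (auto intro: H_I)
  show "nrm (P f) \<le> C * nrm f" by (rule power2_le_imp_le[OF n]) (use C0 in simp)
qed

lemma P_id: "f \<in> bergman_space \<Omega> \<Longrightarrow> P f = f"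
proof (rule ext)
  fix z assume f: "f \<in> bergman_space \<Omega>"
  show "P f z = f z"
    using G_repr[OF f] P_outside[of z f] H_D(2)[OF bergman_H[OF f]] by (cases "z \<in> \<Omega>") (auto simp: P_def)
qed

lemma bergman_bound: "f \<in> bergman_space \<Omega> \<Longrightarrow> norm (f z) \<le> nrm f * nrm (K z)"
  using P_bound[OF bergman_H] P_id by metis

lemma P_adjoint:
  assumes f: "f \<in> H" and g: "g \<in> H"
  shows "(\<integral>z. P f z * cnj (g z) \<partial>lborel) = (\<integral>w. f w * cnj (P g w) \<partial>lborel)"
proof -
  note [measurable] = H_meas[OF f] H_meas[OF g]
  define S where "S z = (\<integral>\<^sup>+w. ennreal (norm (G z w) * norm (f w)) \<partial>lborel)" for z
  have [measurable]: "S \<in> borel_measurable borel" unfolding S_def by measurable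
  have "(\<integral>\<^sup>+z. S z * ennreal (norm (g z)) \<partial>lborel)\<^sup>2 \<le> (\<integral>\<^sup>+z. (S z)\<^sup>2 \<partial>lborel) * (\<integral>\<^sup>+z. (ennreal (norm (g z)))\<^sup>2 \<partial>lborel)"
    by (rule Cauchy_Schwarz_nn_integral) measurable
  also have "(\<integral>\<^sup>+z. (ennreal (norm (g z)))\<^sup>2 \<partial>lborel) = ennreal ((nrm g)\<^sup>2)"
    using nn_integral_sqint[OF H_D(1)[OF g]] by (simp add: ennreal_power)
  also have "(\<integral>\<^sup>+z. (S z)\<^sup>2 \<partial>lborel) * ennreal ((nrm g)\<^sup>2) \<le> ennreal ((C * nrm f)\<^sup>2) * ennreal ((nrm g)\<^sup>2)"
    by (intro mult_right_mono) (use S_nn[OF f] in \<open>auto simp: S_def\<close>)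
  also have "\<dots> < top" by (simp add: ennreal_mult[symmetric])
  finally have "(\<integral>\<^sup>+z. S z * ennreal (norm (g z)) \<partial>lborel)\<^sup>2 < top" .
  then have fin: "(\<integral>\<^sup>+z. S z * ennreal (norm (g z)) \<partial>lborel) < top"
    by (cases "\<integral>\<^sup>+z. S z * ennreal (norm (g z)) \<partial>lborel") (auto simp: power2_eq_square ennreal_top_mult)
  have int: "integrable (lborel \<Otimes>\<^sub>M lborel) (\<lambda>(z, w). f w * G z w * cnj (g z))"
  proof (rule integrableI_bounded)
    show "(\<lambda>(z, w). f w * G z w * cnj (g z)) \<in> borel_measurable (lborel \<Otimes>\<^sub>M lborel)" by measurable
    have "(\<integral>\<^sup>+x. ennreal (norm (case x of (z, w) \<Rightarrow> f w * G z w * cnj (g z))) \<partial>(lborel \<Otimes>\<^sub>M lborel)) =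
       (\<integral>\<^sup>+z. (\<integral>\<^sup>+w. ennreal (norm (f w * G z w * cnj (g z))) \<partial>lborel) \<partial>lborel)"
      by (subst lborel.nn_integral_fst[symmetric]) auto
    also have "\<dots> = (\<integral>\<^sup>+z. (\<integral>\<^sup>+w. ennreal (norm (G z w) * norm (f w)) * ennreal (norm (g z)) \<partial>lborel) \<partial>lborel)"
      by (intro nn_integral_cong) (simp add: norm_mult ennreal_mult[symmetric] mult_ac)
    also have "\<dots> = (\<integral>\<^sup>+z. S z * ennreal (norm (g z)) \<partial>lborel)"
      unfolding S_def by (intro nn_integral_cong nn_integral_multc) measurable
    finally show "(\<integral>\<^sup>+x. ennreal (norm (case x of (z, w) \<Rightarrow> f w * G z w * cnj (g z))) \<partial>(lborel \<Otimes>\<^sub>M lborel)) < \<infinity>"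
      using fin by simp
  qed
  have "(\<integral>z. P f z * cnj (g z) \<partial>lborel) = (\<integral>z. (\<integral>w. f w * G z w * cnj (g z) \<partial>lborel) \<partial>lborel)"
    unfolding P_def by simp
  also have "\<dots> = (\<integral>w. (\<integral>z. f w * G z w * cnj (g z) \<partial>lborel) \<partial>lborel)"
    by (rule lborel_pair.Fubini_integral[symmetric]) (use int in simp)
  also have "\<dots> = (\<integral>w. f w * cnj (P g w) \<partial>lborel)"
  proof (rule Bochner_Integration.integral_cong[OF refl])
    fix w
    have "(\<integral>z. f w * G z w * cnj (g z) \<partial>lborel) = (\<integral>z. f w * cnj (g z * G w z) \<partial>lborel)"
      by (intro Bochner_Integration.integral_cong[OF refl]) (simp add: G_herm mult_ac)
    also have "\<dots> = f w * (\<integral>z. cnj (g z * G w z) \<partial>lborel)" by (rule integral_mult_right_zero)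
    also have "(\<integral>z. cnj (g z * G w z) \<partial>lborel) = cnj (P g w)" unfolding P_def by (rule Bochner_Integration.integral_cnj)
    finally show "(\<integral>z. f w * G z w * cnj (g z) \<partial>lborel) = f w * cnj (P g w)" .
  qed
  finally show ?thesis .
qed

section \<open>The orthogonal projection and the reproducing kernel identified\<close>

lemma nrm_square: "complex_of_real ((nrm f)\<^sup>2) = (\<integral>z. f z * cnj (f z) \<partial>lborel)"
  unfolding l2norm_square by (simp add: complex_norm_square[symmetric] flip: integral_complex_of_real)

text \<open>Evaluation is bounded by the norm, so vanishing norm forces vanishing at every point;
  this is the uniqueness behind both definite descriptions.\<close>

lemma bergman_zero:
  assumes "f \<in> bergman_space \<Omega>" "(\<integral>z. f z * cnj (f z) \<partial>lborel) = 0"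
  shows "f = (\<lambda>_. 0)"
proof
  fix z
  have "nrm f = 0" using nrm_square[of f] assms(2) by simp
  then show "f z = 0" using bergman_bound[OF assms(1), of z] by simp
qed

lemma inner_integrable: "f \<in> H \<Longrightarrow> g \<in> H \<Longrightarrow> integrable lborel (\<lambda>z. f z * cnj (g z))"
  by (rule sqint_mult(1)[OF H_D(1) sqint_cnj[OF H_D(1)]])

text \<open>\<open>P\<close> is self-adjoint and fixes the Bergman space, so \<open>f - P f\<close>
  is orthogonal to that space; any other candidate differs from \<open>P f\<close> by an element
  orthogonal to itself.\<close>

lemma bergman_proj_eq:
  assumes f: "f \<in> H" shows "bergman_proj \<Omega> f = P f"
  unfolding bergman_proj_def
proof (rule the_equality)
  have L2: "L2_inner \<Omega> (\<lambda>z. f z - k z) g = (\<integral>z. f z * cnj (g z) \<partial>lborel) - (\<integral>z. k z * cnj (g z) \<partial>lborel)"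
    if "k \<in> bergman_space \<Omega>" "g \<in> bergman_space \<Omega>" for k g
  proof -
    note H = that[THEN bergman_H]
    note [measurable] = H[THEN H_meas] H_meas[OF f]
    have "L2_inner \<Omega> (\<lambda>z. f z - k z) g = (\<integral>z. (f z - k z) * cnj (g z) \<partial>lborel)"
      by (rule L2_inner_eq) (use H_D(2)[OF H(2)] in auto)
    also have "\<dots> = (\<integral>z. f z * cnj (g z) - k z * cnj (g z) \<partial>lborel)" by (simp add: algebra_simps)
    finally show ?thesis
      by (simp add: Bochner_Integration.integral_diff inner_integrable f H)
  qed
  have orth: "(\<integral>z. P f z * cnj (g z) \<partial>lborel) = (\<integral>z. f z * cnj (g z) \<partial>lborel)" if "g \<in> bergman_space \<Omega>" for g
    using P_adjoint[OF f bergman_H[OF that]] by (simp add: P_id[OF that])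
  show "P f \<in> bergman_space \<Omega> \<and> (\<forall>g\<in>bergman_space \<Omega>. L2_inner \<Omega> (\<lambda>z. f z - P f z) g = 0)"
    using P_bergman[OF f] L2[OF P_bergman(1)[OF f]] orth by simp
  fix k assume k: "k \<in> bergman_space \<Omega> \<and> (\<forall>g\<in>bergman_space \<Omega>. L2_inner \<Omega> (\<lambda>z. f z - k z) g = 0)"
  define d where "d = (\<lambda>z. k z - P f z)"
  have d: "d \<in> bergman_space \<Omega>" unfolding d_def by (intro bergman_diff P_bergman f) (use k in auto)
  have "(\<integral>z. d z * cnj (d z) \<partial>lborel) = (\<integral>z. k z * cnj (d z) - P f z * cnj (d z) \<partial>lborel)"
    unfolding d_def by (simp add: algebra_simps)
  also have "\<dots> = (\<integral>z. k z * cnj (d z) \<partial>lborel) - (\<integral>z. P f z * cnj (d z) \<partial>lborel)"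
    by (intro Bochner_Integration.integral_diff inner_integrable bergman_H d P_bergman f) (use k in auto)
  also have "\<dots> = 0" using k L2[of k d] d orth[OF d] by simp
  finally have "d = (\<lambda>_. 0)" by (rule bergman_zero[OF d])
  then show "k = P f" by (auto simp: d_def fun_eq_iff)
qed

lemma inner_K: "f \<in> bergman_space \<Omega> \<Longrightarrow> z \<in> \<Omega> \<Longrightarrow> (\<integral>w. f w * cnj (K z w) \<partial>lborel) = f z"
  using G_repr[of f z] by (simp add: K_cnj)

lemma bergman_kernel_eq:
  assumes z: "z \<in> \<Omega>" shows "bergman_kernel \<Omega> z = K z"
  unfolding bergman_kernel_def
proof (rule the_equality)
  have L2: "L2_inner \<Omega> f k = (\<integral>w. f w * cnj (k w) \<partial>lborel)" if "f \<in> bergman_space \<Omega>" "k \<in> bergman_space \<Omega>" for f k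
    by (rule L2_inner_eq) (use that in \<open>auto intro: H_meas bergman_H H_D\<close>)
  show "K z \<in> bergman_space \<Omega> \<and> (\<forall>f\<in>bergman_space \<Omega>. L2_inner \<Omega> f (K z) = f z)"
    using K_bergman[OF z] L2 inner_K z by simp
  fix k assume k: "k \<in> bergman_space \<Omega> \<and> (\<forall>f\<in>bergman_space \<Omega>. L2_inner \<Omega> f k = f z)"
  define d where "d = (\<lambda>w. k w - K z w)"
  have d: "d \<in> bergman_space \<Omega>" unfolding d_def by (intro bergman_diff K_bergman z) (use k in auto)
  have "(\<integral>w. d w * cnj (d w) \<partial>lborel) = (\<integral>w. d w * cnj (k w) - d w * cnj (K z w) \<partial>lborel)"
    unfolding d_def by (simp add: algebra_simps)
  also have "\<dots> = (\<integral>w. d w * cnj (k w) \<partial>lborel) - (\<integral>w. d w * cnj (K z w) \<partial>lborel)"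
    by (intro Bochner_Integration.integral_diff inner_integrable bergman_H d K_bergman z) (use k in auto)
  also have "\<dots> = 0" using k L2[of d k] d inner_K[OF d z] by simp
  finally have "d = (\<lambda>_. 0)" by (rule bergman_zero[OF d])
  then show "k = K z" by (auto simp: d_def fun_eq_iff)
qed

lemma K_norm: assumes "z \<in> \<Omega>" shows "complex_of_real ((nrm (K z))\<^sup>2) = G z z" "nrm (K z) > 0"
proof -
  have "complex_of_real ((nrm (K z))\<^sup>2) = K z z" unfolding nrm_square by (rule inner_K[OF K_bergman[OF assms] assms])
  then show 1: "complex_of_real ((nrm (K z))\<^sup>2) = G z z" by (simp add: K_def)
  have "(nrm (K z))\<^sup>2 > 0" using G_pos[OF assms] by (simp flip: 1)
  then show "nrm (K z) > 0" by (metis l2norm_nonneg less_eq_real_def zero_power2 less_irrefl)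
qed

lemma normalized_kernel_eq:
  "z \<in> \<Omega> \<Longrightarrow> normalized_kernel \<Omega> z = (\<lambda>w. K z w / complex_of_real (nrm (K z)))"
  unfolding normalized_kernel_def bergman_kernel_eq
  by (subst L2_norm_on_eq[OF H_meas[OF K_H] H_D(2)[OF K_H]]) auto

lemma weak_limit:
  assumes f: "\<And>n::nat. f n \<in> H" "\<And>n. nrm (f n) \<le> B" and f0: "f0 \<in> H" and lim: "\<And>z. (\<lambda>n. f n z) \<longlonglongrightarrow> f0 z"
    and g: "g \<in> H"
  shows "(\<lambda>n. \<integral>z. f n z * g z \<partial>lborel) \<longlonglongrightarrow> (\<integral>z. f0 z * g z \<partial>lborel)"
proof -
  have "(\<lambda>n. \<integral>z. (f n z - f0 z) * g z \<partial>lborel) \<longlonglongrightarrow> 0"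
  proof (rule weakly_null)
    show "sqint lborel (\<lambda>z. f n z - f0 z)" for n by (rule sqint_diff(1)[OF H_D(1)[OF f(1)] H_D(1)[OF f0]])
    show "nrm (\<lambda>z. f n z - f0 z) \<le> B + nrm f0" for n
      using sqint_diff(2)[OF H_D(1)[OF f(1)[of n]] H_D(1)[OF f0]] f(2)[of n] by simp
    show "(\<lambda>n. f n z - f0 z) \<longlonglongrightarrow> 0" for z using lim[of z] by (simp add: LIM_zero)
  qed (use g H_D H_integrable in auto)
  moreover have "(\<integral>z. (f n z - f0 z) * g z \<partial>lborel) = (\<integral>z. f n z * g z \<partial>lborel) - (\<integral>z. f0 z * g z \<partial>lborel)" for n
    unfolding left_diff_distrib
    by (intro Bochner_Integration.integral_diff sqint_mult(1) H_D(1) f f0 g)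
  ultimately show ?thesis by (simp add: LIM_zero_iff)
qed

section \<open>Equicontinuity and normal families\<close>

lemma K_diff_norm:
  assumes "z \<in> \<Omega>" "w \<in> \<Omega>"
  shows "(nrm (\<lambda>x. K z x - K w x))\<^sup>2 = Re (G z z - G w z - G z w + G w w)"
proof -
  let ?d = "\<lambda>x. K z x - K w x"
  have d: "?d \<in> bergman_space \<Omega>" by (intro bergman_diff K_bergman assms)
  have "complex_of_real ((nrm ?d)\<^sup>2) = (\<integral>x. ?d x * cnj (K z x) - ?d x * cnj (K w x) \<partial>lborel)"
    unfolding nrm_square by (simp add: algebra_simps)
  also have "\<dots> = (\<integral>x. ?d x * cnj (K z x) \<partial>lborel) - (\<integral>x. ?d x * cnj (K w x) \<partial>lborel)"
    by (intro Bochner_Integration.integral_diff inner_integrable bergman_H d K_bergman assms)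
  also have "\<dots> = G z z - G w z - G z w + G w w"
    using inner_K[OF d assms(1)] inner_K[OF d assms(2)] assms by (simp add: K_def)
  finally show ?thesis by (metis Re_complex_of_real)
qed

text \<open>Makes norm-bounded families equicontinuous: the distance of the two kernels is a common
  modulus, and \<open>K_diff_tendsto\<close> derives its decay from the continuity of
  \<open>G\<close> at the diagonal.\<close>

lemma bergman_diff_bound:
  assumes f: "f \<in> bergman_space \<Omega>" and "z \<in> \<Omega>" "w \<in> \<Omega>"
  shows "norm (f z - f w) \<le> nrm f * nrm (\<lambda>x. K z x - K w x)"
proof -
  have "f z - f w = (\<integral>x. f x * cnj (K z x) \<partial>lborel) - (\<integral>x. f x * cnj (K w x) \<partial>lborel)"
    by (simp add: inner_K assms)
  also have "\<dots> = (\<integral>x. f x * cnj (K z x) - f x * cnj (K w x) \<partial>lborel)"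
    by (intro Bochner_Integration.integral_diff[symmetric] inner_integrable bergman_H f K_bergman assms)
  also have "\<dots> = (\<integral>x. f x * cnj (K z x - K w x) \<partial>lborel)" by (simp add: algebra_simps)
  also have "norm \<dots> \<le> nrm f * nrm (\<lambda>x. cnj (K z x - K w x))"
    by (rule sqint_mult(2)) (intro sqint_cnj sqint_diff H_D(1) bergman_H f K_bergman assms)+
  also have "nrm (\<lambda>x. cnj (K z x - K w x)) = nrm (\<lambda>x. K z x - K w x)" by (rule l2norm_cnj)
  finally show ?thesis .
qed

lemma K_diff_tendsto:
  assumes z: "z \<in> \<Omega>"
  shows "((\<lambda>w. nrm (\<lambda>x. K z x - K w x)) \<longlongrightarrow> 0) (at z)"
proof -
  have c: "isCont (\<lambda>(z, w). G z w) (z, z)"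
    using G_cont z op by (auto simp: continuous_on_eq_continuous_at open_Times)
  have t: "((\<lambda>w. G (a w) (b w)) \<longlongrightarrow> G z z) (at z)" if "(a \<longlongrightarrow> z) (at z)" "(b \<longlongrightarrow> z) (at z)" for a b
    using isCont_tendsto_compose[OF c tendsto_Pair[OF that]] by simp
  have "((\<lambda>w. Re (G z z - G w z - G z w + G w w)) \<longlongrightarrow> Re (G z z - G z z - G z z + G z z)) (at z)"
    by (intro tendsto_intros t)
  then have "((\<lambda>w. sqrt (Re (G z z - G w z - G z w + G w w))) \<longlongrightarrow> sqrt 0) (at z)"
    by (intro tendsto_real_sqrt) simp
  then have "((\<lambda>w. sqrt (Re (G z z - G w z - G z w + G w w))) \<longlongrightarrow> 0) (at z)" by simp
  moreover have "\<forall>\<^sub>F w in at z. sqrt (Re (G z z - G w z - G z w + G w w)) = nrm (\<lambda>x. K z x - K w x)"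
    using eventually_at_in_open'[OF op z]
  proof eventually_elim
    case (elim w)
    then show ?case using K_diff_norm[OF z, of w] by (metis l2norm_nonneg real_sqrt_unique)
  qed
  ultimately show ?thesis by (rule Lim_transform_eventually)
qed

text \<open>A diagonal argument gives convergence on a countable dense set, equicontinuity extends
  it to all points, and Fatou's lemma keeps the limit in L2 with the same bound.\<close>

lemma bergman_subsequence:
  assumes f: "\<And>n::nat. f n \<in> bergman_space \<Omega>" and B: "\<And>n. nrm (f n) \<le> B"
  obtains r f0 where "strict_mono r" "f0 \<in> bergman_space \<Omega>" "nrm f0 \<le> B" "\<And>z. (\<lambda>n. f (r n) z) \<longlonglongrightarrow> f0 z"
proof -
  have B0: "B \<ge> 0" using B[of 0] order.trans l2norm_nonneg by blast
  obtain D0 :: "(complex \<times> complex) set" where D0: "countable D0" "\<And>X. open X \<Longrightarrow> X \<noteq> {} \<Longrightarrow> \<exists>d \<in> D0. d \<in> X"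
    using countable_dense_exists by metis
  define S where "S = D0 \<inter> \<Omega>"
  have "countable S" using D0 by (simp add: S_def)
  \<comment> \<open>Division by the kernel norm makes the bound the same at all points of the
    countable set, as the diagonal argument requires.\<close>
  moreover have "norm (f n x / complex_of_real (nrm (K x))) \<le> B" if "x \<in> S" for n x
  proof -
    have k: "nrm (K x) > 0" using K_norm that by (simp add: S_def)
    have "norm (f n x) \<le> B * nrm (K x)"
      by (rule order.trans[OF bergman_bound[OF f]]) (intro mult_right_mono B, simp)
    then show ?thesis using k by (simp add: norm_divide field_simps)
  qed
  ultimately obtain r where r: "strict_mono (r :: nat \<Rightarrow> nat)"
    and l: "\<And>x. x \<in> S \<Longrightarrow> \<exists>l. (\<lambda>n. f (r n) x / complex_of_real (nrm (K x))) \<longlonglongrightarrow> l"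
    using function_convergent_subsequence[of S "\<lambda>n x. f n x / complex_of_real (nrm (K x))" B] by blast
  have conv: "convergent (\<lambda>n. f (r n) z)" for z
  proof (cases "z \<in> \<Omega>")
    case False
    then have "(\<lambda>n. f (r n) z) = (\<lambda>n. 0)" using H_D(2)[OF bergman_H[OF f]] by auto
    then show ?thesis by (simp add: convergent_const)
  next
    case True
    have "Cauchy (\<lambda>n. f (r n) z)"
    proof (rule metric_CauchyI)
      fix e :: real assume e: "e > 0"
      have "\<forall>\<^sub>F w in at z. B * nrm (\<lambda>x. K z x - K w x) < e / 3 \<and> w \<in> \<Omega>"
      proof (rule eventually_conj)
        have "((\<lambda>w. B * nrm (\<lambda>x. K z x - K w x)) \<longlongrightarrow> 0) (at z)"
          by (rule tendsto_mult_right_zero[OF K_diff_tendsto[OF True]])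
        then show "\<forall>\<^sub>F w in at z. B * nrm (\<lambda>x. K z x - K w x) < e / 3"
          by (rule order_tendstoD) (use e in simp)
      qed (use True op in \<open>auto intro: eventually_at_in_open'\<close>)
      then obtain X where X: "open X" "z \<in> X" "\<And>w. w \<in> X \<Longrightarrow> w \<noteq> z \<Longrightarrow> B * nrm (\<lambda>x. K z x - K w x) < e / 3 \<and> w \<in> \<Omega>"
        by (auto simp: eventually_at_topological)
      obtain w where w: "w \<in> D0" "w \<in> X \<inter> \<Omega>" using D0(2)[of "X \<inter> \<Omega>"] X True op by blast
      have bw: "B * nrm (\<lambda>x. K z x - K w x) < e / 3"
      proof (cases "w = z")
        case True
        have "nrm (\<lambda>x. K z x - K z x) = 0" by (simp add: l2norm_def)
        then show ?thesis using True e by simp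
      next
        case False then show ?thesis using X(3)[of w] w by simp
      qed
      have wS: "w \<in> S" using w by (simp add: S_def)
      then obtain c where "(\<lambda>n. f (r n) w / complex_of_real (nrm (K w))) \<longlonglongrightarrow> c" using l by blast
      then have "(\<lambda>n. f (r n) w / complex_of_real (nrm (K w)) * complex_of_real (nrm (K w))) \<longlonglongrightarrow> c * complex_of_real (nrm (K w))"
        by (intro tendsto_intros)
      moreover have "nrm (K w) > 0" using K_norm w by simp
      ultimately have "Cauchy (\<lambda>n. f (r n) w)" using LIMSEQ_imp_Cauchy by fastforce
      then obtain N where N: "\<And>m n. m \<ge> N \<Longrightarrow> n \<ge> N \<Longrightarrow> dist (f (r m) w) (f (r n) w) < e / 3"
        using metric_CauchyD[of _ "e/3"] e by (metis divide_pos_pos zero_less_numeral)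
      have d: "dist (f (r n) z) (f (r n) w) < e / 3" for n
      proof -
        have "dist (f (r n) z) (f (r n) w) \<le> nrm (f (r n)) * nrm (\<lambda>x. K z x - K w x)"
          unfolding dist_norm by (rule bergman_diff_bound[OF f True]) (use w in simp)
        also have "\<dots> \<le> B * nrm (\<lambda>x. K z x - K w x)" by (intro mult_right_mono B) simp
        finally show ?thesis using bw by simp
      qed
      show "\<exists>M. \<forall>m\<ge>M. \<forall>n\<ge>M. dist (f (r m) z) (f (r n) z) < e"
      proof (intro exI[of _ N] allI impI)
        fix m n assume "m \<ge> N" "n \<ge> N"
        then have "dist (f (r m) w) (f (r n) w) < e / 3" by (rule N)
        then show "dist (f (r m) z) (f (r n) z) < e"
          using d[of m] d[of n] dist_triangle[of "f (r m) z" "f (r n) z" "f (r m) w"]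
            dist_triangle[of "f (r m) w" "f (r n) z" "f (r n) w"] by (simp add: dist_commute)
      qed
    qed
    then show ?thesis by (rule Cauchy_convergent)
  qed
  define f0 where "f0 z = lim (\<lambda>n. f (r n) z)" for z
  have lim: "(\<lambda>n. f (r n) z) \<longlonglongrightarrow> f0 z" for z
    unfolding f0_def using conv[of z] by (simp add: convergent_LIMSEQ_iff)
  note [measurable] = H_meas[OF bergman_H[OF f]]
  have [measurable]: "f0 \<in> borel_measurable borel" by (rule borel_measurable_LIMSEQ_metric[OF _ lim]) simp
  have out: "f0 z = 0" if "z \<notin> \<Omega>" for z
    using LIMSEQ_unique[OF lim[of z], of 0] H_D(2)[OF bergman_H[OF f] that] by simp
  have "(\<integral>\<^sup>+z. ennreal ((norm (f0 z))\<^sup>2) \<partial>lborel) = (\<integral>\<^sup>+z. liminf (\<lambda>n. ennreal ((norm (f (r n) z))\<^sup>2)) \<partial>lborel)"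
  proof (rule nn_integral_cong)
    fix z
    have "(\<lambda>n. ennreal ((norm (f (r n) z))\<^sup>2)) \<longlonglongrightarrow> ennreal ((norm (f0 z))\<^sup>2)"
      by (intro tendsto_intros lim)
    then show "ennreal ((norm (f0 z))\<^sup>2) = liminf (\<lambda>n. ennreal ((norm (f (r n) z))\<^sup>2))"
      by (rule lim_imp_Liminf[OF trivial_limit_sequentially, symmetric])
  qed
  also have "\<dots> \<le> liminf (\<lambda>n. \<integral>\<^sup>+z. ennreal ((norm (f (r n) z))\<^sup>2) \<partial>lborel)"
    by (rule nn_integral_liminf) simp
  also have "\<dots> \<le> liminf (\<lambda>n::nat. ennreal (B\<^sup>2))"
  proof (rule Liminf_mono, rule always_eventually, rule allI)
    fix n
    show "(\<integral>\<^sup>+z. ennreal ((norm (f (r n) z))\<^sup>2) \<partial>lborel) \<le> ennreal (B\<^sup>2)"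
      using B[of "r n"] by (simp add: nn_integral_sqint[OF H_D(1)[OF bergman_H[OF f]]] power_mono ennreal_leI)
  qed
  also have "\<dots> = ennreal (B\<^sup>2)" by (simp add: Liminf_const)
  finally have le: "(\<integral>\<^sup>+z. ennreal ((norm (f0 z))\<^sup>2) \<partial>lborel) \<le> ennreal (B\<^sup>2)" .
  have s: "sqint lborel f0" and n2: "(nrm f0)\<^sup>2 \<le> B\<^sup>2"
    using sqintI_bounded[OF _ le] by auto
  have f0H: "f0 \<in> H" by (rule H_I[OF s out])
  have n: "nrm f0 \<le> B" by (rule power2_le_imp_le[OF n2 B0])
  \<comment> \<open>Bounded pointwise convergence is weak convergence, so the limit inherits the
    reproducing formula; its holomorphy is then that of the range of \<open>P\<close>.\<close>
  have "f0 = P f0"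
  proof
    fix z
    have "(\<lambda>n. P (f (r n)) z) \<longlonglongrightarrow> P f0 z"
      unfolding P_def by (rule weak_limit[OF bergman_H[OF f] B f0H lim G_H])
    then have "(\<lambda>n. f (r n) z) \<longlonglongrightarrow> P f0 z" by (simp add: P_id[OF f])
    with lim[of z] show "f0 z = P f0 z" by (rule LIMSEQ_unique)
  qed
  then have "f0 \<in> bergman_space \<Omega>" using P_bergman(1)[OF f0H] by simp
  from that[OF r this n lim] show thesis .
qed

section \<open>Metric structure and sequential compactness\<close>

lemma normalized_kernel_bergman: "z \<in> \<Omega> \<Longrightarrow> normalized_kernel \<Omega> z \<in> bergman_space \<Omega>"
  using bergman_cmult[OF K_bergman[of z], of "1 / complex_of_real (nrm (K z))"] by (simp add: normalized_kernel_eq)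

lemma bergman_dist_eq:
  "f \<in> bergman_space \<Omega> \<Longrightarrow> g \<in> bergman_space \<Omega> \<Longrightarrow> bergman_dist \<Omega> f g = nrm (\<lambda>z. f z - g z)"
  unfolding bergman_dist_def using bergman_H[OF bergman_diff, of f g] by (intro L2_norm_on_eq H_meas) (auto dest: H_D(2))

lemma bergman_dist_outside:
  "bergman_dist \<Omega> f g = bergman_dist \<Omega> g f" "bergman_dist \<Omega> f g \<ge> 0"
  by (simp_all add: bergman_dist_def L2_norm_on_def norm_minus_commute)

sublocale bergman: Metric_space "bergman_space \<Omega>" "bergman_dist \<Omega>"
proof
  show "0 \<le> bergman_dist \<Omega> x y" "bergman_dist \<Omega> x y = bergman_dist \<Omega> y x" for x y
    using bergman_dist_outside by auto
  show "bergman_dist \<Omega> x y = 0 \<longleftrightarrow> x = y" if xy: "x \<in> bergman_space \<Omega>" "y \<in> bergman_space \<Omega>" for x y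
  proof
    assume "bergman_dist \<Omega> x y = 0"
    then have "nrm (\<lambda>z. x z - y z) = 0" using bergman_dist_eq xy by simp
    then have "norm (x z - y z) \<le> 0" for z using bergman_bound[OF bergman_diff[OF xy], of z] by simp
    then show "x = y" by (auto simp: fun_eq_iff)
  qed (simp add: bergman_dist_eq xy l2norm_def)
  show "bergman_dist \<Omega> x z \<le> bergman_dist \<Omega> x y + bergman_dist \<Omega> y z"
    if xyz: "x \<in> bergman_space \<Omega>" "y \<in> bergman_space \<Omega>" "z \<in> bergman_space \<Omega>" for x y z
  proof -
    have "nrm (\<lambda>p. (x p - y p) + (y p - z p)) \<le> nrm (\<lambda>p. x p - y p) + nrm (\<lambda>p. y p - z p)"
      by (intro sqint_add(2) H_D(1) bergman_H bergman_diff xyz)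
    then show ?thesis by (simp add: bergman_dist_eq xyz)
  qed
qed

text \<open>Bolzano-Weierstrass for closures: every infinite subset of \<open>S\<close> must have an
  accumulation point, and an injective sequence in the subset provides one.\<close>

lemma compact_closure_sequential:
  assumes S: "S \<subseteq> bergman_space \<Omega>"
    and seq: "\<And>\<sigma>. range \<sigma> \<subseteq> S \<Longrightarrow> \<exists>l r. l \<in> bergman_space \<Omega> \<and> strict_mono (r :: nat \<Rightarrow> nat) \<and>
       (\<lambda>n. nrm (\<lambda>z. \<sigma> (r n) z - l z)) \<longlonglongrightarrow> 0"
  shows "compactin bergman.mtopology (bergman.mtopology closure_of S)"
  unfolding bergman.compact_closure_of_eq_Bolzano_Weierstrass
proof (intro allI impI)
  fix T assume T: "infinite T \<and> T \<subseteq> S \<and> T \<subseteq> bergman_space \<Omega>"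
  then obtain \<sigma> :: "nat \<Rightarrow> _" where \<sigma>: "inj \<sigma>" "range \<sigma> \<subseteq> T" using infinite_countable_subset by blast
  then obtain l r where l: "l \<in> bergman_space \<Omega>" and r: "strict_mono r"
    and lim: "(\<lambda>n. nrm (\<lambda>z. \<sigma> (r n) z - l z)) \<longlonglongrightarrow> 0"
    using seq[of \<sigma>] T by blast
  have "l \<in> bergman.mtopology derived_set_of T"
    unfolding bergman.metric_derived_set_of
  proof (intro CollectI conjI l allI impI)
    fix e :: real assume e: "e > 0"
    have "\<forall>\<^sub>F n in sequentially. nrm (\<lambda>z. \<sigma> (r n) z - l z) < e" using order_tendstoD(2)[OF lim e] .
    then obtain N where N: "\<And>n. n \<ge> N \<Longrightarrow> nrm (\<lambda>z. \<sigma> (r n) z - l z) < e" by (auto simp: eventually_sequentially)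
    \<comment> \<open>Two consecutive terms of an injective sequence cannot both equal the limit, so
      some term within e of \<open>l\<close> is different from \<open>l\<close>.\<close>
    have "\<sigma> (r N) \<noteq> \<sigma> (r (Suc N))" using \<sigma>(1) r by (simp add: inj_eq strict_mono_eq)
    then obtain n where n: "n \<ge> N" "\<sigma> (r n) \<noteq> l" by (metis le_SucI order_refl)
    have m: "\<sigma> (r n) \<in> bergman_space \<Omega>" "\<sigma> (r n) \<in> T" using \<sigma>(2) T by auto
    show "\<exists>y\<in>T. y \<noteq> l \<and> y \<in> bergman.mball l e"
      using N[OF n(1)] n(2) m l by (intro bexI[of _ "\<sigma> (r n)"]) (auto simp: bergman.in_mball bergman_dist_eq l2norm_minus_commute)
  qed
  then show "bergman.mtopology derived_set_of T \<noteq> {}" by blast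
qed

lemma compact_closure_sequentialD:
  assumes comp: "compactin bergman.mtopology (bergman.mtopology closure_of S)" and S: "S \<subseteq> bergman_space \<Omega>"
    and \<sigma>: "range \<sigma> \<subseteq> S"
  shows "\<exists>l r. l \<in> bergman_space \<Omega> \<and> strict_mono (r :: nat \<Rightarrow> nat) \<and> (\<lambda>n. nrm (\<lambda>z. \<sigma> (r n) z - l z)) \<longlonglongrightarrow> 0"
proof -
  have "S \<subseteq> bergman.mtopology closure_of S" using S by (intro closure_of_subset) simp
  then have "range \<sigma> \<subseteq> bergman.mtopology closure_of S" using \<sigma> by blast
  then obtain l r where l: "l \<in> bergman.mtopology closure_of S" and r: "strict_mono (r :: nat \<Rightarrow> nat)"
    and lim: "limitin bergman.mtopology (\<sigma> \<circ> r) l sequentially"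
    using comp unfolding bergman.compactin_sequentially by metis
  have lb: "l \<in> bergman_space \<Omega>" using lim by (simp add: bergman.limit_metric_sequentially)
  have "(\<lambda>n. nrm (\<lambda>z. \<sigma> (r n) z - l z)) \<longlonglongrightarrow> 0"
  proof (rule LIMSEQ_I)
    fix e :: real assume "e > 0"
    then obtain N where "\<And>n. n \<ge> N \<Longrightarrow> bergman_dist \<Omega> (\<sigma> (r n)) l < e"
      using lim unfolding bergman.limit_metric_sequentially comp_def by metis
    moreover have "\<sigma> (r n) \<in> bergman_space \<Omega>" for n using \<sigma> S by blast
    ultimately show "\<exists>no. \<forall>n\<ge>no. norm (nrm (\<lambda>z. \<sigma> (r n) z - l z) - 0) < e"
      using lb by (intro exI[of _ N]) (simp add: bergman_dist_eq)
  qed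
  with lb r show ?thesis by blast
qed

end

section \<open>Toeplitz operators and localisation\<close>

text \<open>Outside the near region \<open>E\<close> the Schur integrals are small. The set \<open>F\<close> absorbs \<open>E \<circ> E\<close>, and its last
  property is what Cauchy--Schwarz against \<open>T k\<^sub>z\<close> requires.\<close>

definition near_far ::
    "(complex \<times> complex) set \<Rightarrow> (complex \<times> complex \<Rightarrow> complex \<times> complex \<Rightarrow> complex) \<Rightarrow> (complex \<times> complex \<Rightarrow> real) \<Rightarrow>
     real \<Rightarrow> ((complex \<times> complex) \<times> complex \<times> complex) set \<Rightarrow> ((complex \<times> complex) \<times> complex \<times> complex) set \<Rightarrow> real \<Rightarrow> bool" where
  "near_far \<Omega> G h \<epsilon> E F C' \<longleftrightarrow>
     E \<in> sets (borel \<Otimes>\<^sub>M borel) \<and> F \<in> sets (borel \<Otimes>\<^sub>M borel) \<and> C' \<ge> 0 \<and>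
     (\<forall>z\<in>\<Omega>. (\<integral>\<^sup>+w. ennreal (norm (G z w) * h w) * indicator (- E) (z, w) \<partial>lborel) \<le> ennreal (\<epsilon> * h z)) \<and>
     (\<forall>z\<in>\<Omega>. \<forall>x\<in>\<Omega>. \<forall>w\<in>\<Omega>. (z, x) \<in> E \<longrightarrow> (x, w) \<in> E \<longrightarrow> (z, w) \<in> F) \<and>
     (\<forall>z\<in>\<Omega>. (\<integral>\<^sup>+w. ennreal ((h w)\<^sup>2) * indicator F (z, w) * indicator \<Omega> w \<partial>lborel) \<le> ennreal (C' * (h z)\<^sup>2 / Re (G z z)))"

locale localized_kernel = schur_kernel +
  assumes near: "\<epsilon> > 0 \<Longrightarrow> \<exists>E F C'. near_far \<Omega> G h \<epsilon> E F C'"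
begin

lemma G_norm_commute: "norm (G z w) = norm (G w z)"
  by (metis G_herm complex_mod_cnj)

lemma K_norm_Re: "z \<in> \<Omega> \<Longrightarrow> (nrm (K z))\<^sup>2 = Re (G z z)"
  by (metis K_norm(1) Re_complex_of_real)

end

text \<open>Here the symbol is Borel and bounded at every point;
  \<open>Linf_borel_representative\<close> reduces essentially bounded symbols to this case.\<close>

locale localized_toeplitz = localized_kernel +
  fixes u :: "complex \<times> complex \<Rightarrow> complex" and Cu :: real
  assumes u_meas [measurable]: "u \<in> borel_measurable borel" and u_bound: "norm (u x) \<le> Cu"
begin

lemma Cu0: "Cu \<ge> 0" using u_bound[of undefined] norm_ge_zero order.trans by blast

definition T :: "(complex \<times> complex \<Rightarrow> complex) \<Rightarrow> complex \<times> complex \<Rightarrow> complex" where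
  "T f = P (\<lambda>w. u w * f w)"

text \<open>The adjoint of \<open>T\<close> on the Bergman space, obtained as the Toeplitz operator
  with the conjugate symbol; see \<open>T_adjoint\<close>.\<close>

definition Ta :: "(complex \<times> complex \<Rightarrow> complex) \<Rightarrow> complex \<times> complex \<Rightarrow> complex" where
  "Ta f = P (\<lambda>w. cnj (u w) * f w)"

lemma cnj_u: "(\<lambda>w. cnj (u w)) \<in> borel_measurable borel" "norm (cnj (u x)) \<le> Cu"
  using u_bound by auto

lemma uH: "f \<in> H \<Longrightarrow> (\<lambda>w. u w * f w) \<in> H" "f \<in> H \<Longrightarrow> (\<lambda>w. cnj (u w) * f w) \<in> H"
  by (rule H_bounded_mult[OF _ u_meas u_bound] H_bounded_mult[OF _ cnj_u]; assumption)+

lemma T_bergman: "f \<in> H \<Longrightarrow> T f \<in> bergman_space \<Omega>" "f \<in> H \<Longrightarrow> Ta f \<in> bergman_space \<Omega>"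
  unfolding T_def Ta_def by (intro P_bergman uH; assumption)+

lemma T_bound: "f \<in> H \<Longrightarrow> nrm (T f) \<le> C * Cu * nrm f" "f \<in> H \<Longrightarrow> nrm (Ta f) \<le> C * Cu * nrm f"
proof -
  assume f: "f \<in> H"
  have "nrm (T f) \<le> C * nrm (\<lambda>w. u w * f w)" unfolding T_def by (intro P_bergman uH f)
  also have "\<dots> \<le> C * (Cu * nrm f)" by (intro mult_left_mono H_bounded_mult(2)[OF f u_meas u_bound] C0)
  finally show "nrm (T f) \<le> C * Cu * nrm f" by (simp add: mult_ac)
  have "nrm (Ta f) \<le> C * nrm (\<lambda>w. cnj (u w) * f w)" unfolding Ta_def by (intro P_bergman uH f)
  also have "\<dots> \<le> C * (Cu * nrm f)" by (intro mult_left_mono H_bounded_mult(2)[OF f cnj_u] C0)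
  finally show "nrm (Ta f) \<le> C * Cu * nrm f" by (simp add: mult_ac)
qed

lemma T_adjoint:
  assumes f: "f \<in> bergman_space \<Omega>" and g: "g \<in> bergman_space \<Omega>"
  shows "(\<integral>z. T f z * cnj (g z) \<partial>lborel) = (\<integral>z. f z * cnj (Ta g z) \<partial>lborel)"
proof -
  note H = bergman_H[OF f] bergman_H[OF g]
  have "(\<integral>z. T f z * cnj (g z) \<partial>lborel) = (\<integral>z. u z * f z * cnj (g z) \<partial>lborel)"
    unfolding T_def by (subst P_adjoint[OF uH(1)[OF H(1)] H(2)]) (simp add: P_id[OF g])
  also have "\<dots> = (\<integral>z. f z * cnj (cnj (u z) * g z) \<partial>lborel)" by (simp add: mult_ac)
  also have "\<dots> = (\<integral>z. P f z * cnj (cnj (u z) * g z) \<partial>lborel)" by (simp add: P_id[OF f])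
  also have "\<dots> = (\<integral>z. f z * cnj (Ta g z) \<partial>lborel)"
    unfolding Ta_def by (rule P_adjoint[OF H(1) uH(2)[OF H(2)]])
  finally show ?thesis .
qed

lemma T_diff:
  assumes "f \<in> H" "g \<in> H"
  shows "T (\<lambda>z. f z - g z) = (\<lambda>z. T f z - T g z)"
proof
  fix z
  have "T (\<lambda>z. f z - g z) z = (\<integral>w. u w * f w * G z w - u w * g w * G z w \<partial>lborel)"
    unfolding T_def P_def by (simp add: algebra_simps)
  also have "\<dots> = T f z - T g z"
    unfolding T_def P_def by (rule Bochner_Integration.integral_diff[OF P_integrable[OF uH(1)[OF assms(1)]] P_integrable[OF uH(1)[OF assms(2)]]])
  finally show "T (\<lambda>z. f z - g z) z = T f z - T g z" .
qed

lemma T_cmult: "T (\<lambda>z. c * f z) = (\<lambda>z. c * T f z)"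
proof
  fix z
  have "T (\<lambda>z. c * f z) z = (\<integral>w. c * (u w * f w * G z w) \<partial>lborel)"
    unfolding T_def P_def by (simp add: mult_ac)
  also have "\<dots> = c * T f z" unfolding T_def P_def by (rule integral_mult_right_zero)
  finally show "T (\<lambda>z. c * f z) z = c * T f z" .
qed

lemma zero_H: "(\<lambda>_. 0) \<in> H"
  by (rule bounded_H[of _ 0]) auto

lemma weak_null:
  assumes f: "\<And>n::nat. f n \<in> H" "\<And>n. nrm (f n) \<le> B" and lim: "\<And>z. (\<lambda>n. f n z) \<longlonglongrightarrow> 0" and g: "g \<in> H"
  shows "(\<lambda>n. \<integral>z. f n z * g z \<partial>lborel) \<longlonglongrightarrow> 0"
  using weak_limit[OF f zero_H lim g] by simp

text \<open>Each value of \<open>T f\<close> and of \<open>Ta f\<close> is a pairing of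
  \<open>f\<close> with a fixed element of \<open>H\<close>, so weak convergence gives pointwise
  convergence of the images.\<close>

lemma T_weakly_null:
  assumes f: "\<And>n::nat. f n \<in> H" "\<And>n. nrm (f n) \<le> B" and lim: "\<And>z. (\<lambda>n. f n z) \<longlonglongrightarrow> 0"
  shows "(\<lambda>n. T (f n) z) \<longlonglongrightarrow> 0" "(\<lambda>n. Ta (f n) z) \<longlonglongrightarrow> 0"
proof -
  have "T (f n) z = (\<integral>w. f n w * (u w * G z w) \<partial>lborel)" for n
    unfolding T_def P_def by (simp add: mult_ac)
  then show "(\<lambda>n. T (f n) z) \<longlonglongrightarrow> 0" using weak_null[OF f lim uH(1)[OF G_H[of z]]] by simp
  have "Ta (f n) z = (\<integral>w. f n w * (cnj (u w) * G z w) \<partial>lborel)" for n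
    unfolding Ta_def P_def by (simp add: mult_ac)
  then show "(\<lambda>n. Ta (f n) z) \<longlonglongrightarrow> 0" using weak_null[OF f lim uH(2)[OF G_H[of z]]] by simp
qed

text \<open>By \<open>Ta_repr\<close>, the conjugate of \<open>t\<close> is an integral kernel of
  \<open>Ta\<close>. Its row at \<open>z\<close> is \<open>T (K z)\<close>, the very function that
  the hypothesis controls; this is why the adjoint is estimated first.\<close>

definition t :: "complex \<times> complex \<Rightarrow> complex \<times> complex \<Rightarrow> complex" where
  "t z w = T (K z) w"

lemma t_meas [measurable]: "(\<lambda>(z, w). t z w) \<in> borel_measurable (borel \<Otimes>\<^sub>M borel)"
  unfolding t_def T_def P_def K_def by measurable

lemma t_H: "t z \<in> H"
  unfolding t_def by (intro bergman_H T_bergman K_H)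

text \<open>\<open>T (K z)\<close> is a composition of two copies of the kernel with the symbol in
  between, so two successive Schur estimates will control it.\<close>

lemma t_bound: "ennreal (norm (t z w)) \<le> (\<integral>\<^sup>+x. ennreal (Cu * (norm (G z x) * norm (G x w))) \<partial>lborel)"
proof -
  have "ennreal (norm (t z w)) \<le> (\<integral>\<^sup>+x. ennreal (norm (u x * K z x * G w x)) \<partial>lborel)"
    unfolding t_def T_def P_def by (rule integral_norm_bound_ennreal[OF P_integrable[OF uH(1)[OF K_H]]])
  also have "\<dots> \<le> (\<integral>\<^sup>+x. ennreal (Cu * (norm (G z x) * norm (G x w))) \<partial>lborel)"
  proof (rule nn_integral_mono, rule ennreal_leI)
    fix x
    have "norm (u x * K z x * G w x) = norm (u x) * (norm (G z x) * norm (G x w))"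
      by (simp add: norm_mult K_cnj G_norm_commute[of w x])
    also have "\<dots> \<le> Cu * (norm (G z x) * norm (G x w))" by (intro mult_right_mono u_bound) simp
    finally show "norm (u x * K z x * G w x) \<le> Cu * (norm (G z x) * norm (G x w))" .
  qed
  finally show ?thesis .
qed

lemma Ta_repr:
  assumes y: "y \<in> bergman_space \<Omega>" and z: "z \<in> \<Omega>"
  shows "Ta y z = (\<integral>w. y w * cnj (t z w) \<partial>lborel)"
proof -
  have "Ta y z = (\<integral>w. Ta y w * cnj (K z w) \<partial>lborel)"
    by (rule inner_K[symmetric, OF T_bergman(2)[OF bergman_H[OF y]] z])
  also have "\<dots> = (\<integral>w. cnj (K z w * cnj (Ta y w)) \<partial>lborel)" by (simp add: mult_ac)
  also have "\<dots> = cnj (\<integral>w. K z w * cnj (Ta y w) \<partial>lborel)" by (rule Bochner_Integration.integral_cnj)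
  also have "(\<integral>w. K z w * cnj (Ta y w) \<partial>lborel) = (\<integral>w. t z w * cnj (y w) \<partial>lborel)"
    unfolding t_def by (rule T_adjoint[symmetric, OF K_bergman[OF z] y])
  also have "cnj \<dots> = (\<integral>w. cnj (t z w * cnj (y w)) \<partial>lborel)" by (rule Bochner_Integration.integral_cnj[symmetric])
  also have "\<dots> = (\<integral>w. y w * cnj (t z w) \<partial>lborel)" by (simp add: mult_ac)
  finally show ?thesis .
qed

lemma Ta_le:
  assumes y: "y \<in> bergman_space \<Omega>" and z: "z \<in> \<Omega>"
  shows "ennreal (norm (Ta y z)) \<le> (\<integral>\<^sup>+w. ennreal (norm (t z w) * norm (y w)) \<partial>lborel)"
proof -
  have "integrable lborel (\<lambda>w. y w * cnj (t z w))" by (rule inner_integrable[OF bergman_H[OF y] t_H])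
  from integral_norm_bound_ennreal[OF this] show ?thesis
    unfolding Ta_repr[OF y z] by (simp add: norm_mult mult.commute)
qed

text \<open>Two Schur estimates in succession after exchanging integrals. A finite bound is enough
  here, since the rows will carry the smallness.\<close>

lemma t_column:
  "(\<integral>\<^sup>+z. ennreal (norm (t z w) * h z) \<partial>lborel) \<le> ennreal (Cu * C * C * h w)"
proof -
  have "(\<integral>\<^sup>+z. ennreal (norm (t z w) * h z) \<partial>lborel) \<le>
    (\<integral>\<^sup>+z. (\<integral>\<^sup>+x. ennreal (Cu * norm (G w x)) * ennreal (norm (G x z) * h z) \<partial>lborel) \<partial>lborel)"
  proof (rule nn_integral_mono)
    fix z
    have "ennreal (norm (t z w) * h z) = ennreal (norm (t z w)) * ennreal (h z)"
      using h_nonneg by (simp add: ennreal_mult')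
    also have "\<dots> \<le> (\<integral>\<^sup>+x. ennreal (Cu * (norm (G z x) * norm (G x w))) \<partial>lborel) * ennreal (h z)"
      by (intro mult_right_mono t_bound) simp
    also have "\<dots> = (\<integral>\<^sup>+x. ennreal (Cu * (norm (G z x) * norm (G x w))) * ennreal (h z) \<partial>lborel)"
      by (rule nn_integral_multc[symmetric]) measurable
    also have "\<dots> = (\<integral>\<^sup>+x. ennreal (Cu * norm (G w x)) * ennreal (norm (G x z) * h z) \<partial>lborel)"
      by (intro nn_integral_cong) (simp add: ennreal_mult'[symmetric] h_nonneg Cu0 mult_ac G_norm_commute[of z] G_norm_commute[of w])
    finally show "ennreal (norm (t z w) * h z) \<le> (\<integral>\<^sup>+x. ennreal (Cu * norm (G w x)) * ennreal (norm (G x z) * h z) \<partial>lborel)" .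
  qed
  also have "\<dots> = (\<integral>\<^sup>+x. (\<integral>\<^sup>+z. ennreal (Cu * norm (G w x)) * ennreal (norm (G x z) * h z) \<partial>lborel) \<partial>lborel)"
    by (rule lborel_pair.Fubini'[symmetric]) measurable
  also have "\<dots> = (\<integral>\<^sup>+x. ennreal (Cu * norm (G w x)) * (\<integral>\<^sup>+z. ennreal (norm (G x z) * h z) \<partial>lborel) \<partial>lborel)"
    by (intro nn_integral_cong nn_integral_cmult) measurable
  also have "\<dots> \<le> (\<integral>\<^sup>+x. ennreal (Cu * norm (G w x)) * ennreal (C * h x) \<partial>lborel)"
    by (intro nn_integral_mono mult_left_mono schur) simp
  also have "\<dots> = (\<integral>\<^sup>+x. ennreal (Cu * C) * ennreal (norm (G w x) * h x) \<partial>lborel)"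
    by (intro nn_integral_cong) (simp add: ennreal_mult'[symmetric] h_nonneg Cu0 C0 mult_ac)
  also have "\<dots> = ennreal (Cu * C) * (\<integral>\<^sup>+x. ennreal (norm (G w x) * h x) \<partial>lborel)"
    by (rule nn_integral_cmult) measurable
  also have "\<dots> \<le> ennreal (Cu * C) * ennreal (C * h w)" by (intro mult_left_mono schur) simp
  also have "\<dots> = ennreal (Cu * C * C * h w)"
    using Cu0 C0 h_nonneg by (simp add: ennreal_mult'[symmetric] mult_ac)
  finally show ?thesis .
qed

text \<open>On the near region the hypothesis on \<open>T k\<^sub>z\<close> enters through Cauchy-Schwarz; the far region is
  negligible uniformly in \<open>z\<close>, whatever the symbol.\<close>

lemma t_row:
  assumes e: "\<epsilon> > 0"
  obtains C' where "C' \<ge> 0"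
    "\<And>z. z \<in> \<Omega> \<Longrightarrow> (\<integral>\<^sup>+w. ennreal (norm (t z w) * h w) \<partial>lborel) \<le> ennreal ((nrm (t z) / nrm (K z) * C' + 2 * Cu * C * \<epsilon>) * h z)"
proof -
  obtain E F C1 where nf: "near_far \<Omega> G h \<epsilon> E F C1" using near[OF e] by blast
  have [measurable]: "E \<in> sets (borel \<Otimes>\<^sub>M borel)" "F \<in> sets (borel \<Otimes>\<^sub>M borel)" and C1: "C1 \<ge> 0"
    using nf by (simp_all add: near_far_def)
  have far: "(\<integral>\<^sup>+w. ennreal (norm (G z w) * h w) * indicator (- E) (z, w) \<partial>lborel) \<le> ennreal (\<epsilon> * h z)" if "z \<in> \<Omega>" for z
    using nf that by (simp add: near_far_def)
  have EF': "\<forall>z\<in>\<Omega>. \<forall>x\<in>\<Omega>. \<forall>w\<in>\<Omega>. (z, x) \<in> E \<longrightarrow> (x, w) \<in> E \<longrightarrow> (z, w) \<in> F"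
    using nf by (simp add: near_far_def)
  have EF: "(z, w) \<in> F" if "z \<in> \<Omega>" "x \<in> \<Omega>" "w \<in> \<Omega>" "(z, x) \<in> E" "(x, w) \<in> E" for z x w
    by (rule EF'[rule_format, OF that])
  have nearF: "(\<integral>\<^sup>+w. ennreal ((h w)\<^sup>2) * indicator F (z, w) * indicator \<Omega> w \<partial>lborel) \<le> ennreal (C1 * (h z)\<^sup>2 / Re (G z z))" if "z \<in> \<Omega>" for z
    using nf that by (simp add: near_far_def)
  have bound: "(\<integral>\<^sup>+w. ennreal (norm (t z w) * h w) \<partial>lborel) \<le> ennreal ((nrm (t z) / nrm (K z) * sqrt C1 + 2 * Cu * C * \<epsilon>) * h z)"
    if z: "z \<in> \<Omega>" for z
  proof -
    note [measurable] = H_meas[OF t_H[of z]]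
    \<comment> \<open>The weight cut down to the near region of \<open>z\<close>; its L2 norm is
      what the last clause of \<open>near_far\<close> bounds.\<close>
    define g where "g w = complex_of_real (h w * indicator F (z, w) * indicator \<Omega> w)" for w
    have [measurable]: "g \<in> borel_measurable borel" unfolding g_def by measurable
    have kz: "nrm (K z) > 0" using K_norm(2)[OF z] .
    have g2: "(norm (g w))\<^sup>2 = (h w)\<^sup>2 * indicator F (z, w) * indicator \<Omega> w" for w
      by (simp add: g_def power_mult_distrib indicator_def)
    have "(\<integral>\<^sup>+w. ennreal ((norm (g w))\<^sup>2) \<partial>lborel) = (\<integral>\<^sup>+w. ennreal ((h w)\<^sup>2) * indicator F (z, w) * indicator \<Omega> w \<partial>lborel)"
      unfolding g2 by (intro nn_integral_cong) (simp add: indicator_def)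
    also have "\<dots> \<le> ennreal (C1 * (h z)\<^sup>2 / Re (G z z))" by (rule nearF[OF z])
    finally have gle: "(\<integral>\<^sup>+w. ennreal ((norm (g w))\<^sup>2) \<partial>lborel) \<le> ennreal (C1 * (h z)\<^sup>2 / Re (G z z))" .
    have "C1 * (h z)\<^sup>2 / Re (G z z) \<ge> 0" using C1 G_pos[OF z] by simp
    from sqintI_bounded[OF _ gle this] have sg: "sqint lborel g" and "(nrm g)\<^sup>2 \<le> C1 * (h z)\<^sup>2 / Re (G z z)" by auto
    then have "(nrm g)\<^sup>2 \<le> (sqrt C1 * h z / nrm (K z))\<^sup>2"
      using C1 by (simp add: power_divide power_mult_distrib K_norm_Re[OF z])
    then have ng: "nrm g \<le> sqrt C1 * h z / nrm (K z)"
      by (rule power2_le_imp_le) (use C1 h_nonneg in simp)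
    have near': "(\<integral>\<^sup>+w. ennreal (norm (t z w)) * ennreal (norm (g w)) \<partial>lborel) \<le> ennreal (nrm (t z) / nrm (K z) * sqrt C1 * h z)"
    proof (rule order.trans[OF sqint_mult_nn[OF H_D(1)[OF t_H] sg]], rule ennreal_leI)
      have "nrm (t z) * nrm g \<le> nrm (t z) * (sqrt C1 * h z / nrm (K z))" by (intro mult_left_mono ng) simp
      then show "nrm (t z) * nrm g \<le> nrm (t z) / nrm (K z) * sqrt C1 * h z" by simp
    qed
    \<comment> \<open>If \<open>(z, w)\<close> lies outside \<open>F\<close>, then for every
      intermediate \<open>x\<close> the step from z to x or the step from x to w lies outside
      \<open>E\<close>.\<close>
    have far1: "ennreal (norm (t z w) * h w) * indicator (- F) (z, w) \<le>
        (\<integral>\<^sup>+x. ennreal (Cu * norm (G z x)) * (ennreal (norm (G x w) * h w) * (indicator (- E) (z, x) + indicator (- E) (x, w))) \<partial>lborel)" for w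
    proof -
      have "ennreal (norm (t z w) * h w) * indicator (- F) (z, w) = ennreal (norm (t z w)) * (ennreal (h w) * indicator (- F) (z, w))"
        using h_nonneg by (simp add: ennreal_mult' mult.assoc)
      also have "\<dots> \<le> (\<integral>\<^sup>+x. ennreal (Cu * (norm (G z x) * norm (G x w))) \<partial>lborel) * (ennreal (h w) * indicator (- F) (z, w))"
        by (intro mult_right_mono t_bound) simp
      also have "\<dots> = (\<integral>\<^sup>+x. ennreal (Cu * (norm (G z x) * norm (G x w))) * (ennreal (h w) * indicator (- F) (z, w)) \<partial>lborel)"
        by (rule nn_integral_multc[symmetric]) measurable
      also have "\<dots> \<le> (\<integral>\<^sup>+x. ennreal (Cu * norm (G z x)) * (ennreal (norm (G x w) * h w) * (indicator (- E) (z, x) + indicator (- E) (x, w))) \<partial>lborel)"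
      proof (rule nn_integral_mono)
        fix x
        show "ennreal (Cu * (norm (G z x) * norm (G x w))) * (ennreal (h w) * indicator (- F) (z, w)) \<le>
          ennreal (Cu * norm (G z x)) * (ennreal (norm (G x w) * h w) * (indicator (- E) (z, x) + indicator (- E) (x, w)))"
        proof (cases "x \<in> \<Omega> \<and> w \<in> \<Omega>")
          case False
          then have "G x w = 0" using G_zero by blast
          then show ?thesis by simp
        next
          case True
          have "indicator (- F) (z, w) \<le> (indicator (- E) (z, x) + indicator (- E) (x, w) :: ennreal)"
            using EF[of z x w] z True by (auto simp: indicator_def)
          then have "ennreal (Cu * norm (G z x)) * (ennreal (norm (G x w) * h w) * indicator (- F) (z, w)) \<le>
            ennreal (Cu * norm (G z x)) * (ennreal (norm (G x w) * h w) * (indicator (- E) (z, x) + indicator (- E) (x, w)))"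
            by (intro mult_left_mono) auto
          also have "ennreal (Cu * norm (G z x)) * (ennreal (norm (G x w) * h w) * indicator (- F) (z, w)) =
            ennreal (Cu * (norm (G z x) * norm (G x w))) * (ennreal (h w) * indicator (- F) (z, w))"
            using Cu0 h_nonneg by (simp add: ennreal_mult' mult_ac)
          finally show ?thesis .
        qed
      qed
      finally show ?thesis .
    qed
    have sp: "(\<integral>\<^sup>+w. ennreal (norm (G x w) * h w) * (indicator (- E) (z, x) + indicator (- E) (x, w)) \<partial>lborel) \<le>
       ennreal (C * h x) * indicator (- E) (z, x) + ennreal (\<epsilon> * h x)" if x: "x \<in> \<Omega>" for x
    proof -
      have "(\<integral>\<^sup>+w. ennreal (norm (G x w) * h w) * (indicator (- E) (z, x) + indicator (- E) (x, w)) \<partial>lborel) =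
        (\<integral>\<^sup>+w. ennreal (norm (G x w) * h w) * indicator (- E) (z, x) + ennreal (norm (G x w) * h w) * indicator (- E) (x, w) \<partial>lborel)"
        by (simp add: distrib_left)
      also have "\<dots> = (\<integral>\<^sup>+w. ennreal (norm (G x w) * h w) * indicator (- E) (z, x) \<partial>lborel) +
        (\<integral>\<^sup>+w. ennreal (norm (G x w) * h w) * indicator (- E) (x, w) \<partial>lborel)"
        by (rule nn_integral_add) measurable
      also have "(\<integral>\<^sup>+w. ennreal (norm (G x w) * h w) * indicator (- E) (z, x) \<partial>lborel) = 
          (\<integral>\<^sup>+w. ennreal (norm (G x w) * h w) \<partial>lborel) * indicator (- E) (z, x)"
        by (rule nn_integral_multc) measurable
      finally show ?thesis using add_mono[OF mult_right_mono[OF schur[of x], of "indicator (- E) (z, x)"] far[OF x]] by simp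
    qed
    have "(\<integral>\<^sup>+w. ennreal (norm (t z w) * h w) * indicator (- F) (z, w) \<partial>lborel) \<le>
       (\<integral>\<^sup>+w. (\<integral>\<^sup>+x. ennreal (Cu * norm (G z x)) * (ennreal (norm (G x w) * h w) * (indicator (- E) (z, x) + indicator (- E) (x, w))) \<partial>lborel) \<partial>lborel)"
      by (intro nn_integral_mono far1)
    also have "\<dots> = (\<integral>\<^sup>+x. (\<integral>\<^sup>+w. ennreal (Cu * norm (G z x)) * (ennreal (norm (G x w) * h w) * (indicator (- E) (z, x) + indicator (- E) (x, w))) \<partial>lborel) \<partial>lborel)"
      by (rule lborel_pair.Fubini'[symmetric]) measurable
    also have "\<dots> = (\<integral>\<^sup>+x. ennreal (Cu * norm (G z x)) * (\<integral>\<^sup>+w. ennreal (norm (G x w) * h w) * (indicator (- E) (z, x) + indicator (- E) (x, w)) \<partial>lborel) \<partial>lborel)"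
      by (intro nn_integral_cong nn_integral_cmult) measurable
    also have "\<dots> \<le> (\<integral>\<^sup>+x. ennreal (Cu * norm (G z x)) * (ennreal (C * h x) * indicator (- E) (z, x) + ennreal (\<epsilon> * h x)) \<partial>lborel)"
    proof (rule nn_integral_mono)
      fix x show "ennreal (Cu * norm (G z x)) * (\<integral>\<^sup>+w. ennreal (norm (G x w) * h w) * (indicator (- E) (z, x) + indicator (- E) (x, w)) \<partial>lborel)
        \<le> ennreal (Cu * norm (G z x)) * (ennreal (C * h x) * indicator (- E) (z, x) + ennreal (\<epsilon> * h x))"
        by (cases "x \<in> \<Omega>") (simp_all add: mult_left_mono[OF sp] G_zero)
    qed
    also have "\<dots> = (\<integral>\<^sup>+x. ennreal (Cu * C) * (ennreal (norm (G z x) * h x) * indicator (- E) (z, x)) + ennreal (Cu * \<epsilon>) * ennreal (norm (G z x) * h x) \<partial>lborel)"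
      using Cu0 C0 h_nonneg e by (intro nn_integral_cong) (simp add: ennreal_mult' distrib_left mult_ac)
    also have "\<dots> = (\<integral>\<^sup>+x. ennreal (Cu * C) * (ennreal (norm (G z x) * h x) * indicator (- E) (z, x)) \<partial>lborel) + (\<integral>\<^sup>+x. ennreal (Cu * \<epsilon>) * ennreal (norm (G z x) * h x) \<partial>lborel)"
      by (rule nn_integral_add) measurable
    also have "\<dots> = ennreal (Cu * C) * (\<integral>\<^sup>+x. ennreal (norm (G z x) * h x) * indicator (- E) (z, x) \<partial>lborel) + ennreal (Cu * \<epsilon>) * (\<integral>\<^sup>+x. ennreal (norm (G z x) * h x) \<partial>lborel)"
      by (intro arg_cong2[where f = "(+)"] nn_integral_cmult) measurable
    \<comment> \<open>One \<epsilon> comes from a far first step with the full Schur bound for the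
      second, the other from a far second step with the full bound for the first; hence the factor
      2.\<close>
    also have "\<dots> \<le> ennreal (Cu * C) * ennreal (\<epsilon> * h z) + ennreal (Cu * \<epsilon>) * ennreal (C * h z)"
      by (intro add_mono mult_left_mono far z schur) auto
    also have "\<dots> = ennreal (2 * Cu * C * \<epsilon> * h z)"
      using Cu0 C0 h_nonneg e by (simp add: ennreal_mult'[symmetric] ennreal_plus[symmetric] mult_ac del: ennreal_plus)
    finally have far': "(\<integral>\<^sup>+w. ennreal (norm (t z w) * h w) * indicator (- F) (z, w) \<partial>lborel) \<le> ennreal (2 * Cu * C * \<epsilon> * h z)" .
    have "(\<integral>\<^sup>+w. ennreal (norm (t z w) * h w) \<partial>lborel) =
      (\<integral>\<^sup>+w. ennreal (norm (t z w)) * ennreal (norm (g w)) + ennreal (norm (t z w) * h w) * indicator (- F) (z, w) \<partial>lborel)"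
    proof (rule nn_integral_cong)
      fix w show "ennreal (norm (t z w) * h w) = ennreal (norm (t z w)) * ennreal (norm (g w)) + ennreal (norm (t z w) * h w) * indicator (- F) (z, w)"
        using h_nonneg[of w] H_D(2)[OF t_H, of w z]
        by (cases "w \<in> \<Omega>"; cases "(z, w) \<in> F") (simp_all add: g_def ennreal_mult' norm_mult)
    qed
    also have "\<dots> = (\<integral>\<^sup>+w. ennreal (norm (t z w)) * ennreal (norm (g w)) \<partial>lborel) + (\<integral>\<^sup>+w. ennreal (norm (t z w) * h w) * indicator (- F) (z, w) \<partial>lborel)"
      by (rule nn_integral_add) measurable
    also have "\<dots> \<le> ennreal (nrm (t z) / nrm (K z) * sqrt C1 * h z) + ennreal (2 * Cu * C * \<epsilon> * h z)"
      by (intro add_mono near' far')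
    also have "\<dots> = ennreal ((nrm (t z) / nrm (K z) * sqrt C1 + 2 * Cu * C * \<epsilon>) * h z)"
      using Cu0 C0 h_nonneg e C1 kz by (subst ennreal_plus[symmetric]) (simp_all add: distrib_right)
    finally show ?thesis .
  qed
  show thesis by (rule that[OF _ bound]) (use C1 in auto)
qed

lemma t_norm: "nrm (t z) = nrm (T (K z))"
  by (simp add: t_def[abs_def])

text \<open>Where the kernel norm is large, the rows of \<open>t\<close> are small and its columns
  bounded, so Schur's test makes that part small in L2. Where the kernel norm is at most m, the
  images are uniformly bounded and pointwise null, and dominated convergence applies because the
  domain has finite measure.\<close>

lemma Ta_strongly_null:
  assumes dec: "\<And>\<epsilon>. \<epsilon> > 0 \<Longrightarrow> \<exists>m. \<forall>z\<in>\<Omega>. nrm (K z) > m \<longrightarrow> nrm (T (K z)) \<le> \<epsilon> * nrm (K z)"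
    and y: "\<And>n::nat. y n \<in> bergman_space \<Omega>" "\<And>n. nrm (y n) \<le> B" and lim: "\<And>z. (\<lambda>n. y n z) \<longlonglongrightarrow> 0"
  shows "(\<lambda>n. nrm (Ta (y n))) \<longlonglongrightarrow> 0"
proof -
  note yH = bergman_H[OF y(1)]
  note [measurable] = H_meas[OF yH] H_meas[OF bergman_H[OF T_bergman(2)[OF yH]]]
  have B0: "B \<ge> 0" using y(2)[of 0] order.trans l2norm_nonneg by blast
  define D where "D = Cu * C * C"
  have D0: "D \<ge> 0" using Cu0 C0 by (simp add: D_def)
  have main: "\<exists>N. \<forall>n\<ge>N. (nrm (Ta (y n)))\<^sup>2 \<le> e" if e: "e > 0" for e
  proof -
    \<comment> \<open>Tolerances are chosen backwards: Schur's test will give the bound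
      \<open>\<eta> * D * B\<^sup>2\<close>, which has to be at most e/2. The added 1 here and in
      the next constants keeps the denominators positive.\<close>
    define \<eta> where "\<eta> = e / (2 * (D * B\<^sup>2 + 1))"
    have DB: "D * B\<^sup>2 \<ge> 0" using D0 by simp
    have \<eta>: "\<eta> > 0" "\<eta> * D * B\<^sup>2 \<le> e / 2"
    proof -
      show "\<eta> > 0" using e DB by (simp add: \<eta>_def)
      have "e * (D * B\<^sup>2) \<le> e * (D * B\<^sup>2 + 1)" using e by simp
      then show "\<eta> * D * B\<^sup>2 \<le> e / 2" using DB by (simp add: \<eta>_def field_simps)
    qed
    define \<epsilon> where "\<epsilon> = \<eta> / (4 * (Cu * C + 1))"
    have CC: "Cu * C \<ge> 0" using Cu0 C0 by simp
    have \<epsilon>: "\<epsilon> > 0" "2 * Cu * C * \<epsilon> \<le> \<eta> / 2"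
    proof -
      show "\<epsilon> > 0" using \<eta>(1) CC by (simp add: \<epsilon>_def)
      have "\<eta> * (Cu * C) \<le> \<eta> * (Cu * C + 1)" using \<eta>(1) by simp
      then show "2 * Cu * C * \<epsilon> \<le> \<eta> / 2" using CC by (simp add: \<epsilon>_def field_simps)
    qed
    obtain C' where C': "C' \<ge> 0"
      and row: "\<And>z. z \<in> \<Omega> \<Longrightarrow> (\<integral>\<^sup>+w. ennreal (norm (t z w) * h w) \<partial>lborel) \<le> ennreal ((nrm (t z) / nrm (K z) * C' + 2 * Cu * C * \<epsilon>) * h z)"
      using t_row[OF \<epsilon>(1)] by blast
    define \<delta> where "\<delta> = \<eta> / (2 * (C' + 1))"
    have \<delta>: "\<delta> > 0" "\<delta> * C' \<le> \<eta> / 2"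
    proof -
      show "\<delta> > 0" using \<eta>(1) C' by (simp add: \<delta>_def)
      have "\<eta> * C' \<le> \<eta> * (C' + 1)" using \<eta>(1) by simp
      then show "\<delta> * C' \<le> \<eta> / 2" using C' by (simp add: \<delta>_def field_simps)
    qed
    obtain m0 where m0: "\<And>z. z \<in> \<Omega> \<Longrightarrow> nrm (K z) > m0 \<Longrightarrow> nrm (T (K z)) \<le> \<delta> * nrm (K z)"
      using dec[OF \<delta>(1)] by blast
    define m where "m = max m0 0"
    \<comment> \<open>Described through \<open>Re (G z z)\<close>, the squared kernel norm, so that
      measurability follows from that of \<open>G\<close>.\<close>
    define A where "A = {z \<in> \<Omega>. Re (G z z) > m\<^sup>2}"
    have [measurable]: "(\<lambda>z. G z z) \<in> borel_measurable borel"
    proof -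
      have "(\<lambda>w. (\<lambda>(z, w). G z w) (w, w)) \<in> borel_measurable borel" by measurable
      then show ?thesis by simp
    qed
    have [measurable]: "A \<in> sets borel" unfolding A_def by measurable
    have A: "z \<in> \<Omega>" "nrm (T (K z)) \<le> \<delta> * nrm (K z)" if "z \<in> A" for z
    proof -
      show z: "z \<in> \<Omega>" using that by (simp add: A_def)
      have "m\<^sup>2 < (nrm (K z))\<^sup>2" using that K_norm_Re[OF z] by (simp add: A_def)
      then have "m < nrm (K z)" by (rule power2_less_imp_less) simp
      then show "nrm (T (K z)) \<le> \<delta> * nrm (K z)" using m0[OF z] by (simp add: m_def)
    qed
    have nA: "nrm (K z) \<le> m" if "z \<in> \<Omega>" "z \<notin> A" for z
    proof -
      have "(nrm (K z))\<^sup>2 \<le> m\<^sup>2" using that K_norm_Re by (simp add: A_def)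
      then show ?thesis by (rule power2_le_imp_le) (simp add: m_def)
    qed
    have inA: "(\<integral>\<^sup>+z. ennreal (indicator A z * (norm (Ta (y n) z))\<^sup>2) \<partial>lborel) \<le> ennreal (e / 2)" for n
    proof -
      have "(\<integral>\<^sup>+z. ennreal (indicator A z * (norm (Ta (y n) z))\<^sup>2) \<partial>lborel) \<le>
        (\<integral>\<^sup>+z. (\<integral>\<^sup>+w. ennreal (indicator A z * norm (t z w) * norm (y n w)) \<partial>lborel)\<^sup>2 \<partial>lborel)"
      proof (rule nn_integral_mono)
        fix z show "ennreal (indicator A z * (norm (Ta (y n) z))\<^sup>2) \<le> (\<integral>\<^sup>+w. ennreal (indicator A z * norm (t z w) * norm (y n w)) \<partial>lborel)\<^sup>2"
        proof (cases "z \<in> A")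
          case True
          then show ?thesis using power_mono[OF Ta_le[OF y(1)[of n] A(1)[OF True]], of 2] by (simp add: ennreal_power)
        qed simp
      qed
      \<comment> \<open>Rows are cut to \<open>A\<close>, where they are at most \<eta> times the
        weight; columns keep the crude constant \<open>D\<close>.\<close>
      also have "\<dots> \<le> ennreal (\<eta> * D) * (\<integral>\<^sup>+w. ennreal ((norm (y n w))\<^sup>2) \<partial>lborel)"
      proof (rule schur_test[where \<Omega> = \<Omega> and h = h and h' = h])
        show "(\<lambda>(z, w). indicator A z * norm (t z w)) \<in> borel_measurable (lborel \<Otimes>\<^sub>M lborel)" by measurable
        show "norm (y n w) = 0" if "w \<notin> \<Omega>" for w using H_D(2)[OF yH that] by simp
        show "(\<integral>\<^sup>+w. ennreal (indicator A z * norm (t z w) * h w) \<partial>lborel) \<le> ennreal (\<eta> * h z)" for z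
        proof (cases "z \<in> A")
          case True
          have k: "nrm (K z) > 0" using K_norm(2) A(1)[OF True] .
          have "nrm (t z) / nrm (K z) \<le> \<delta>" using A(2)[OF True] k by (simp add: t_norm field_simps)
          then have "nrm (t z) / nrm (K z) * C' \<le> \<delta> * C'" by (rule mult_right_mono[OF _ C'])
          then have "nrm (t z) / nrm (K z) * C' + 2 * Cu * C * \<epsilon> \<le> \<eta>" using \<delta>(2) \<epsilon>(2) by simp
          then have "ennreal ((nrm (t z) / nrm (K z) * C' + 2 * Cu * C * \<epsilon>) * h z) \<le> ennreal (\<eta> * h z)"
            by (intro ennreal_leI mult_right_mono h_nonneg)
          then show ?thesis using order.trans[OF row[OF A(1)[OF True]]] True by simp
        qed simp
        show "(\<integral>\<^sup>+z. ennreal (indicator A z * norm (t z w) * h z) \<partial>lborel) \<le> ennreal (D * h w)" for w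
        proof (rule order.trans[OF _ t_column[of w, folded D_def]], rule nn_integral_mono, rule ennreal_leI)
          fix z show "indicator A z * norm (t z w) * h z \<le> norm (t z w) * h z"
            using h_nonneg by (simp add: indicator_def)
        qed
      qed (use \<eta>(1) D0 in \<open>simp_all add: h_pos h_nonneg lborel.sigma_finite_measure_axioms\<close>)
      also have "\<dots> = ennreal (\<eta> * D * (nrm (y n))\<^sup>2)"
        using \<eta>(1) D0 by (simp add: nn_integral_sqint[OF H_D(1)[OF yH]] ennreal_mult')
      also have "\<dots> \<le> ennreal (\<eta> * D * B\<^sup>2)"
        using \<eta>(1) D0 y(2)[of n] by (intro ennreal_leI mult_left_mono power_mono) auto
      also have "\<dots> \<le> ennreal (e / 2)" by (rule ennreal_leI[OF \<eta>(2)])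
      finally show ?thesis .
    qed
    define M where "M = (C * Cu * B * m)\<^sup>2"
    have bd: "indicator (\<Omega> - A) z * (norm (Ta (y n) z))\<^sup>2 \<le> M * indicator \<Omega> z" for z n
    proof (cases "z \<in> \<Omega> - A")
      case True
      have "norm (Ta (y n) z) \<le> nrm (Ta (y n)) * nrm (K z)" by (rule bergman_bound[OF T_bergman(2)[OF yH]])
      also have "\<dots> \<le> (C * Cu * B) * m"
      proof (intro mult_mono)
        have "nrm (Ta (y n)) \<le> C * Cu * nrm (y n)" by (rule T_bound(2)[OF yH])
        also have "\<dots> \<le> C * Cu * B" using C0 Cu0 by (intro mult_left_mono y(2)) simp
        finally show "nrm (Ta (y n)) \<le> C * Cu * B" .
      qed (use True nA C0 Cu0 B0 in auto)
      finally have "(norm (Ta (y n) z))\<^sup>2 \<le> M" unfolding M_def by (intro power_mono) auto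
      then show ?thesis using True by simp
    qed (simp add: M_def)
    have bi: "integrable lborel (\<lambda>z. M * indicator \<Omega> z)" using fin by simp
    have outlim: "(\<lambda>n. \<integral>z. indicator (\<Omega> - A) z * (norm (Ta (y n) z))\<^sup>2 \<partial>lborel) \<longlonglongrightarrow> (\<integral>z. 0 \<partial>(lborel :: (complex \<times> complex) measure))"
    proof (rule integral_dominated_convergence[OF _ _ bi])
      show "AE z in lborel. (\<lambda>n. indicator (\<Omega> - A) z * (norm (Ta (y n) z))\<^sup>2) \<longlonglongrightarrow> 0"
      proof (rule AE_I2)
        fix z
        have "(\<lambda>n. indicator (\<Omega> - A) z * (norm (Ta (y n) z))\<^sup>2) \<longlonglongrightarrow> indicator (\<Omega> - A) z * (norm (0::complex))\<^sup>2"
          by (intro tendsto_intros T_weakly_null(2)[OF yH y(2) lim])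
        then show "(\<lambda>n. indicator (\<Omega> - A) z * (norm (Ta (y n) z))\<^sup>2) \<longlonglongrightarrow> 0" by simp
      qed
      show "AE z in lborel. norm (indicator (\<Omega> - A) z * (norm (Ta (y n) z))\<^sup>2) \<le> M * indicator \<Omega> z" for n
        using bd[of _ n] by (intro AE_I2) (simp add: abs_mult)
    qed measurable
    then obtain N where N: "\<And>n. n \<ge> N \<Longrightarrow> (\<integral>z. indicator (\<Omega> - A) z * (norm (Ta (y n) z))\<^sup>2 \<partial>lborel) < e / 2"
      using order_tendstoD(2)[of _ "0::real" sequentially "e / 2"] e by (auto simp: eventually_sequentially)
    have "(nrm (Ta (y n)))\<^sup>2 \<le> e" if n: "n \<ge> N" for n
    proof -
      have "ennreal ((nrm (Ta (y n)))\<^sup>2) = (\<integral>\<^sup>+z. ennreal ((norm (Ta (y n) z))\<^sup>2) \<partial>lborel)"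
        by (rule nn_integral_sqint[symmetric, OF H_D(1)[OF bergman_H[OF T_bergman(2)[OF yH]]]])
      also have "\<dots> = (\<integral>\<^sup>+z. ennreal (indicator A z * (norm (Ta (y n) z))\<^sup>2) + ennreal (indicator (\<Omega> - A) z * (norm (Ta (y n) z))\<^sup>2) \<partial>lborel)"
      proof (rule nn_integral_cong)
        fix z show "ennreal ((norm (Ta (y n) z))\<^sup>2) = ennreal (indicator A z * (norm (Ta (y n) z))\<^sup>2) + ennreal (indicator (\<Omega> - A) z * (norm (Ta (y n) z))\<^sup>2)"
          using A(1)[of z] P_outside[of z] by (cases "z \<in> A"; cases "z \<in> \<Omega>") (auto simp: Ta_def)
      qed
      also have "\<dots> = (\<integral>\<^sup>+z. ennreal (indicator A z * (norm (Ta (y n) z))\<^sup>2) \<partial>lborel) + (\<integral>\<^sup>+z. ennreal (indicator (\<Omega> - A) z * (norm (Ta (y n) z))\<^sup>2) \<partial>lborel)"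
        by (rule nn_integral_add) measurable
      also have "(\<integral>\<^sup>+z. ennreal (indicator (\<Omega> - A) z * (norm (Ta (y n) z))\<^sup>2) \<partial>lborel) = ennreal (\<integral>z. indicator (\<Omega> - A) z * (norm (Ta (y n) z))\<^sup>2 \<partial>lborel)"
      proof (rule nn_integral_eq_integral)
        show "integrable lborel (\<lambda>z. indicator (\<Omega> - A) z * (norm (Ta (y n) z))\<^sup>2)"
          by (rule Bochner_Integration.integrable_bound[OF bi]) (use bd[of _ n] in \<open>auto simp: abs_mult M_def intro!: AE_I2\<close>)
      qed auto
      also have "(\<integral>\<^sup>+z. ennreal (indicator A z * (norm (Ta (y n) z))\<^sup>2) \<partial>lborel) + ennreal (\<integral>z. indicator (\<Omega> - A) z * (norm (Ta (y n) z))\<^sup>2 \<partial>lborel)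
          \<le> ennreal (e / 2) + ennreal (e / 2)"
        using N[OF n] by (intro add_mono inA ennreal_leI) simp
      also have "\<dots> = ennreal e" using e by (simp add: ennreal_plus[symmetric] del: ennreal_plus)
      finally show ?thesis using e by simp
    qed
    then show ?thesis by blast
  qed
  show ?thesis
  proof (rule LIMSEQ_I)
    fix r :: real assume r: "r > 0"
    obtain N where N: "\<And>n. n \<ge> N \<Longrightarrow> (nrm (Ta (y n)))\<^sup>2 \<le> (r/2)\<^sup>2" using main[of "(r/2)\<^sup>2"] r by auto
    have "norm (nrm (Ta (y n)) - 0) < r" if "n \<ge> N" for n
      using power2_le_imp_le[OF N[OF that]] r by simp
    then show "\<exists>no. \<forall>n\<ge>no. norm (nrm (Ta (y n)) - 0) < r" by blast
  qed
qed

text \<open>The squared norm of \<open>T g\<close> is the pairing of \<open>g\<close> with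
  \<open>Ta (T g)\<close>. Since \<open>T g\<close> is again bounded and pointwise null,
  \<open>Ta_strongly_null\<close> applies to it.\<close>

lemma T_strongly_null:
  assumes dec: "\<And>\<epsilon>. \<epsilon> > 0 \<Longrightarrow> \<exists>m. \<forall>z\<in>\<Omega>. nrm (K z) > m \<longrightarrow> nrm (T (K z)) \<le> \<epsilon> * nrm (K z)"
    and g: "\<And>n::nat. g n \<in> bergman_space \<Omega>" "\<And>n. nrm (g n) \<le> B" and lim: "\<And>z. (\<lambda>n. g n z) \<longlonglongrightarrow> 0"
  shows "(\<lambda>n. nrm (T (g n))) \<longlonglongrightarrow> 0"
proof -
  note gH = bergman_H[OF g(1)]
  have "(\<lambda>n. nrm (Ta (T (g n)))) \<longlonglongrightarrow> 0"
  proof (rule Ta_strongly_null[OF dec])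
    show "nrm (T (g n)) \<le> C * Cu * B" for n
      by (rule order.trans[OF T_bound(1)[OF gH]]) (use C0 Cu0 g(2) in \<open>auto intro!: mult_left_mono\<close>)
  qed (use T_bergman(1)[OF gH] T_weakly_null(1)[OF gH g(2) lim] in auto)
  then have "(\<lambda>n. B * nrm (Ta (T (g n)))) \<longlonglongrightarrow> 0" by (rule tendsto_mult_right_zero)
  moreover have "(nrm (T (g n)))\<^sup>2 \<le> B * nrm (Ta (T (g n)))" for n
  proof -
    have "complex_of_real ((nrm (T (g n)))\<^sup>2) = (\<integral>z. g n z * cnj (Ta (T (g n)) z) \<partial>lborel)"
      unfolding nrm_square by (rule T_adjoint[OF g(1) T_bergman(1)[OF gH]])
    then have "(nrm (T (g n)))\<^sup>2 = norm (\<integral>z. g n z * cnj (Ta (T (g n)) z) \<partial>lborel)"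
      by (metis norm_of_real abs_of_nonneg zero_le_power2)
    also have "\<dots> \<le> nrm (g n) * nrm (\<lambda>z. cnj (Ta (T (g n)) z))"
      by (rule sqint_mult(2)) (intro sqint_cnj H_D(1) gH bergman_H T_bergman)+
    also have "\<dots> \<le> B * nrm (Ta (T (g n)))" by (simp add: mult_right_mono g)
    finally show ?thesis .
  qed
  ultimately have "(\<lambda>n. (nrm (T (g n)))\<^sup>2) \<longlonglongrightarrow> 0"
    by (rule_tac Lim_null_comparison[rotated]) auto
  from tendsto_real_sqrt[OF this] show ?thesis by simp
qed

text \<open>From kernels to compactness: subtract the pointwise limit of a subsequence and apply
  \<open>T_strongly_null\<close>. Conversely, normalised kernels of growing norm are pointwise null,
  so every norm limit of their images must vanish.\<close>

lemma compact_iff_kernels: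
  "(\<forall>S. bergman.mbounded S \<longrightarrow> T ` S \<subseteq> bergman_space \<Omega> \<and> compactin bergman.mtopology (bergman.mtopology closure_of (T ` S))) \<longleftrightarrow>
   (\<forall>\<epsilon>>0. \<exists>m. \<forall>z\<in>\<Omega>. nrm (K z) > m \<longrightarrow> nrm (T (K z)) \<le> \<epsilon> * nrm (K z))" (is "?lhs \<longleftrightarrow> ?rhs")
proof
  assume R: ?rhs
  show ?lhs
  proof (intro allI impI conjI)
    fix S assume S: "bergman.mbounded S"
    then have Sb: "S \<subseteq> bergman_space \<Omega>" by (rule bergman.mbounded_subset_mspace)
    then show TS: "T ` S \<subseteq> bergman_space \<Omega>" using T_bergman bergman_H by blast
    obtain p B where pB: "S = {} \<or> (p \<in> bergman_space \<Omega> \<and> (\<forall>x\<in>S. bergman_dist \<Omega> p x \<le> B))"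
      using S unfolding bergman.mbounded by blast
    show "compactin bergman.mtopology (bergman.mtopology closure_of (T ` S))"
    proof (rule compact_closure_sequential[OF TS])
      fix \<sigma> :: "nat \<Rightarrow> _" assume \<sigma>: "range \<sigma> \<subseteq> T ` S"
      then have "\<forall>n. \<exists>f. f \<in> S \<and> \<sigma> n = T f" by blast
      then obtain f where f: "\<And>n. f n \<in> S" "\<And>n. \<sigma> n = T (f n)" by metis
      have fb: "f n \<in> bergman_space \<Omega>" for n using f Sb by blast
      have p: "p \<in> bergman_space \<Omega>" using pB f by blast
      have fB: "nrm (f n) \<le> nrm p + B" for n
      proof -
        have "nrm (\<lambda>z. p z - (p z - f n z)) \<le> nrm p + nrm (\<lambda>z. p z - f n z)"
          by (intro sqint_diff(2) H_D(1) bergman_H bergman_diff p fb)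
        moreover have "nrm (\<lambda>z. p z - f n z) \<le> B"
          using pB f(1)[of n] bergman_dist_eq[OF p fb[of n]] by (metis empty_iff)
        ultimately show ?thesis by simp
      qed
      obtain r f0 where r: "strict_mono r" and f0: "f0 \<in> bergman_space \<Omega>" "nrm f0 \<le> nrm p + B"
        and lim: "\<And>z. (\<lambda>n. f (r n) z) \<longlonglongrightarrow> f0 z"
        using bergman_subsequence[of f, OF fb fB] by blast
      have "(\<lambda>n. nrm (T (\<lambda>z. f (r n) z - f0 z))) \<longlonglongrightarrow> 0"
      proof (rule T_strongly_null)
        show "nrm (\<lambda>z. f (r n) z - f0 z) \<le> 2 * (nrm p + B)" for n
          using sqint_diff(2)[OF H_D(1)[OF bergman_H[OF fb[of "r n"]]] H_D(1)[OF bergman_H[OF f0(1)]]] fB[of "r n"] f0(2) by simp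
        show "(\<lambda>n. f (r n) z - f0 z) \<longlonglongrightarrow> 0" for z using lim[of z] by (simp add: LIM_zero)
      qed (use R fb f0 in \<open>auto intro: bergman_diff\<close>)
      then have "(\<lambda>n. nrm (\<lambda>z. \<sigma> (r n) z - T f0 z)) \<longlonglongrightarrow> 0"
        by (simp add: T_diff[OF bergman_H[OF fb] bergman_H[OF f0(1)]] f(2))
      then show "\<exists>l r. l \<in> bergman_space \<Omega> \<and> strict_mono r \<and> (\<lambda>n. nrm (\<lambda>z. \<sigma> (r n) z - l z)) \<longlonglongrightarrow> 0"
        using r T_bergman(1)[OF bergman_H[OF f0(1)]] by blast
    qed
  qed
next
  assume L: ?lhs
  show ?rhs
  proof (rule ccontr)
    assume "\<not> ?rhs"
    then obtain \<epsilon> where e: "\<epsilon> > 0" and "\<forall>m. \<exists>z\<in>\<Omega>. nrm (K z) > m \<and> \<epsilon> * nrm (K z) < nrm (T (K z))"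
      by (auto simp: not_le)
    then have "\<forall>n::nat. \<exists>z. z \<in> \<Omega> \<and> nrm (K z) > real n \<and> \<epsilon> * nrm (K z) < nrm (T (K z))" by blast
    then obtain z where z: "\<And>n. z n \<in> \<Omega>" "\<And>n. nrm (K (z n)) > real n" "\<And>n. \<epsilon> * nrm (K (z n)) < nrm (T (K (z n)))"
      by metis
    define k where "k n = (\<lambda>w. (1 / complex_of_real (nrm (K (z n)))) * K (z n) w)" for n
    have kp: "nrm (K (z n)) > 0" for n using K_norm(2) z(1) .
    have kb: "k n \<in> bergman_space \<Omega>" for n unfolding k_def by (intro bergman_cmult K_bergman z)
    have k1: "nrm (k n) = 1" for n
      unfolding k_def sqint_cmult(2)[OF H_D(1)[OF K_H]] using kp[of n] by (simp add: norm_divide)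
    have Tk: "nrm (T (k n)) > \<epsilon>" for n
    proof -
      have "nrm (T (k n)) = nrm (T (K (z n))) / nrm (K (z n))"
        unfolding k_def T_cmult sqint_cmult(2)[OF H_D(1)[OF bergman_H[OF T_bergman(1)[OF K_H]]]]
        using kp[of n] by (simp add: norm_divide)
      then have "nrm (T (K (z n))) = nrm (T (k n)) * nrm (K (z n))" using kp[of n] by simp
      with z(3)[of n] have "\<epsilon> * nrm (K (z n)) < nrm (T (k n)) * nrm (K (z n))" by simp
      then show ?thesis using kp[of n] by (simp only: mult_less_cancel_right_pos)
    qed
    \<comment> \<open>For fixed w the kernel is bounded in the other variable, while the normalising
      norm tends to infinity.\<close>
    have k0: "(\<lambda>n. k n w) \<longlonglongrightarrow> 0" for w
    proof -
      obtain M where M: "\<And>x. norm (G w x) \<le> M" using G_bounded by blast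
      have inf: "filterlim (\<lambda>n. nrm (K (z n))) at_top sequentially"
        by (rule filterlim_at_top_mono[OF filterlim_real_sequentially]) (use z(2) in \<open>auto intro!: always_eventually less_imp_le\<close>)
      have "(\<lambda>n. M / nrm (K (z n))) \<longlonglongrightarrow> 0" by (rule real_tendsto_divide_at_top[OF tendsto_const inf])
      then show ?thesis
      proof (rule Lim_null_comparison[rotated], intro always_eventually allI)
        fix n show "norm (k n w) \<le> M / nrm (K (z n))"
          using M[of "z n"] kp[of n] by (simp add: k_def K_def norm_mult norm_divide divide_right_mono)
      qed
    qed
    have mb: "bergman.mbounded (range k)"
      unfolding bergman.mbounded_alt
    proof (intro conjI exI[of _ 2] ballI)
      show "range k \<subseteq> bergman_space \<Omega>" using kb by blast
      show "bergman_dist \<Omega> x y \<le> 2" if "x \<in> range k" "y \<in> range k" for x y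
      proof -
        obtain a b where "x = k a" "y = k b" using \<open>x \<in> range k\<close> \<open>y \<in> range k\<close> by blast
        then show ?thesis using sqint_diff(2)[OF H_D(1)[OF bergman_H[OF kb[of a]]] H_D(1)[OF bergman_H[OF kb[of b]]]]
          by (simp add: bergman_dist_eq kb k1)
      qed
    qed
    have "T ` range k \<subseteq> bergman_space \<Omega> \<and> compactin bergman.mtopology (bergman.mtopology closure_of (T ` range k))"
      by (rule mp[OF spec[OF L] mb])
    then have comp: "T ` range k \<subseteq> bergman_space \<Omega>" "compactin bergman.mtopology (bergman.mtopology closure_of (T ` range k))"
      by (rule conjunct1, rule conjunct2)
    have "range (\<lambda>n. T (k n)) \<subseteq> T ` range k" by blast
    from compact_closure_sequentialD[OF comp(2,1) this] obtain l r where l: "l \<in> bergman_space \<Omega>"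
      and r: "strict_mono (r :: nat \<Rightarrow> nat)" and lim: "(\<lambda>n. nrm (\<lambda>w. T (k (r n)) w - l w)) \<longlonglongrightarrow> 0" by blast
    have kH: "k n \<in> H" "nrm (k n) \<le> 1" for n using kb bergman_H k1 by auto
    have "l w = 0" for w
    proof -
      have "(\<lambda>n. nrm (\<lambda>w. T (k (r n)) w - l w) * nrm (K w)) \<longlonglongrightarrow> 0" by (rule tendsto_mult_left_zero[OF lim])
      then have "(\<lambda>n. T (k (r n)) w - l w) \<longlonglongrightarrow> 0"
      proof (rule Lim_null_comparison[rotated], intro always_eventually allI)
        fix n show "norm (T (k (r n)) w - l w) \<le> nrm (\<lambda>w. T (k (r n)) w - l w) * nrm (K w)"
          by (rule bergman_bound[OF bergman_diff[OF T_bergman(1)[OF kH(1)] l]])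
      qed
      then have "(\<lambda>n. T (k (r n)) w) \<longlonglongrightarrow> l w" by (simp add: LIM_zero_iff)
      moreover have "(\<lambda>n. T (k (r n)) w) \<longlonglongrightarrow> 0"
        using LIMSEQ_subseq_LIMSEQ[OF T_weakly_null(1)[OF kH k0, of w] r] by (simp add: comp_def)
      ultimately show ?thesis by (rule LIMSEQ_unique)
    qed
    then have "(\<lambda>n. nrm (T (k (r n)))) \<longlonglongrightarrow> 0" using lim by simp
    then obtain n where "nrm (T (k (r n))) < \<epsilon>"
      using order_tendstoD(2)[of _ 0 sequentially \<epsilon>] e by (auto simp: eventually_sequentially)
    then show False using Tk[of "r n"] by simp
  qed
qed

end

section \<open>Essentially bounded symbols and the Skwarczynski distance\<close>

context localized_kernel
begin

text \<open>Real and imaginary parts of a Lebesgue measurable function agree almost everywhere with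
  Borel functions; truncation at the essential bound then makes the bound hold everywhere.\<close>

lemma Linf_borel_representative:
  assumes u: "u \<in> Linf_space \<Omega>"
  obtains u' Cu where "u' \<in> borel_measurable borel" "\<And>x. norm (u' x) \<le> Cu" "AE x in lebesgue_on \<Omega>. u x = u' x"
proof -
  obtain c where um: "u \<in> borel_measurable (lebesgue_on \<Omega>)" and c: "AE z in lebesgue_on \<Omega>. norm (u z) \<le> c"
    using u by (auto simp: Linf_space_def)
  have s: "\<Omega> \<inter> space lebesgue \<in> sets lebesgue" by simp
  have m: "(\<lambda>z. indicator \<Omega> z *\<^sub>R u z) \<in> borel_measurable lebesgue"
    using um borel_measurable_restrict_space_iff[OF s, of u] by simp
  have "(\<lambda>z. Re (indicator \<Omega> z *\<^sub>R u z)) \<in> borel_measurable (completion lborel)"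
    "(\<lambda>z. Im (indicator \<Omega> z *\<^sub>R u z)) \<in> borel_measurable (completion lborel)"
    using m by measurable
  from this[THEN completion_ex_borel_measurable_real]
  obtain a b where [measurable]: "a \<in> borel_measurable lborel" "b \<in> borel_measurable lborel"
    and ab: "AE z in lborel. Re (indicator \<Omega> z *\<^sub>R u z) = a z" "AE z in lborel. Im (indicator \<Omega> z *\<^sub>R u z) = b z" by blast
  define u0 where "u0 z = complex_of_real (a z) + \<i> * complex_of_real (b z)" for z
  have [measurable]: "u0 \<in> borel_measurable borel" unfolding u0_def by measurable
  have "AE z in lborel. indicator \<Omega> z *\<^sub>R u z = u0 z"
    using ab by eventually_elim (simp add: u0_def complex_eq_iff)
  then have "AE z in lebesgue. indicator \<Omega> z *\<^sub>R u z = u0 z" by (rule AE_completion)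
  then have "AE z in lebesgue_on \<Omega>. u z = u0 z"
    unfolding AE_restrict_space_iff[OF s] by eventually_elim auto
  define u' where "u' z = (if norm (u0 z) \<le> max c 0 then u0 z else 0)" for z
  have [measurable]: "u' \<in> borel_measurable borel" unfolding u'_def by measurable
  have "norm (u' z) \<le> max c 0" for z by (simp add: u'_def)
  moreover have "AE z in lebesgue_on \<Omega>. u z = u' z"
    using \<open>AE z in lebesgue_on \<Omega>. u z = u0 z\<close> c by eventually_elim (auto simp: u'_def)
  ultimately show thesis by (intro that[of u' "max c 0"]) auto
qed

text \<open>The conditions that define the two projections are conditions on integrals, so symbols
  equal almost everywhere give the same definite description.\<close>

lemma toeplitz_cong_AE:
  assumes u: "u \<in> borel_measurable (lebesgue_on \<Omega>)" and u': "u' \<in> borel_measurable borel"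
    and eq: "AE x in lebesgue_on \<Omega>. u x = u' x" and f: "f \<in> H"
  shows "toeplitz \<Omega> u f = toeplitz \<Omega> u' f"
proof -
  have L2: "L2_inner \<Omega> (\<lambda>z. u z * f z - k z) g = L2_inner \<Omega> (\<lambda>z. u' z * f z - k z) g"
    if k: "k \<in> bergman_space \<Omega>" and g: "g \<in> bergman_space \<Omega>" for k g
  proof -
    have lm: "p \<in> borel_measurable (lebesgue_on \<Omega>)" if "p \<in> borel_measurable borel" for p :: "complex \<times> complex \<Rightarrow> complex"
      using that by (intro measurable_restrict_space1 measurable_completion) simp
    note [measurable] = u lm[OF u'] lm[OF H_meas[OF f]] lm[OF H_meas[OF bergman_H[OF k]]] lm[OF H_meas[OF bergman_H[OF g]]]
    show ?thesis unfolding L2_inner_def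
    proof (rule integral_cong_AE)
      show "AE x in lebesgue_on \<Omega>. (u x * f x - k x) * cnj (g x) = (u' x * f x - k x) * cnj (g x)"
        using eq by eventually_elim simp
    qed measurable
  qed
  have "(k \<in> bergman_space \<Omega> \<and> (\<forall>g\<in>bergman_space \<Omega>. L2_inner \<Omega> (\<lambda>z. u z * f z - k z) g = 0)) \<longleftrightarrow>
    (k \<in> bergman_space \<Omega> \<and> (\<forall>g\<in>bergman_space \<Omega>. L2_inner \<Omega> (\<lambda>z. u' z * f z - k z) g = 0))" for k
    using L2 by auto
  then show ?thesis unfolding toeplitz_def bergman_proj_def by simp
qed

text \<open>Constancy of \<open>G z 0\<close> turns the inner product of the normalised kernels into
  a quotient of norms, so the distance to 0 depends on the kernel norm alone.\<close>

lemma skwarczynski_dist_eq: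
  assumes z: "z \<in> \<Omega>" and o: "0 \<in> \<Omega>" and G0: "G z 0 = G 0 0"
  shows "skwarczynski_dist \<Omega> z 0 = sqrt (1 - nrm (K 0) / nrm (K z))" "nrm (K 0) / nrm (K z) \<le> 1"
proof -
  have k: "nrm (K z) > 0" "nrm (K 0) > 0" by (intro K_norm(2) z o)+
  note nb = normalized_kernel_bergman[OF z] normalized_kernel_bergman[OF o]
  have "L2_inner \<Omega> (normalized_kernel \<Omega> z) (normalized_kernel \<Omega> 0) =
     (\<integral>w. normalized_kernel \<Omega> z w * cnj (normalized_kernel \<Omega> 0 w) \<partial>lborel)"
    by (rule L2_inner_eq) (use nb in \<open>auto intro: H_meas bergman_H H_D\<close>)
  also have "\<dots> = (\<integral>w. (1 / complex_of_real (nrm (K z) * nrm (K 0))) * (K z w * cnj (K 0 w)) \<partial>lborel)"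
    by (simp add: normalized_kernel_eq z o)
  also have "\<dots> = (1 / complex_of_real (nrm (K z) * nrm (K 0))) * (\<integral>w. K z w * cnj (K 0 w) \<partial>lborel)"
    by (rule integral_mult_right_zero)
  also have "(\<integral>w. K z w * cnj (K 0 w) \<partial>lborel) = K z 0" by (rule inner_K[OF K_bergman[OF z] o])
  also have "K z 0 = cnj (G z 0)" by (simp add: K_cnj)
  also have "\<dots> = complex_of_real ((nrm (K 0))\<^sup>2)" unfolding G0 K_norm(1)[OF o, symmetric] by simp
  also have "(1 / complex_of_real (nrm (K z) * nrm (K 0))) * complex_of_real ((nrm (K 0))\<^sup>2) = complex_of_real (nrm (K 0) / nrm (K z))"
    using k by (simp add: power2_eq_square)
  finally have eq: "L2_inner \<Omega> (normalized_kernel \<Omega> z) (normalized_kernel \<Omega> 0) = complex_of_real (nrm (K 0) / nrm (K z))" .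
  have n: "norm (complex_of_real (nrm (K 0) / nrm (K z))) = nrm (K 0) / nrm (K z)"
    unfolding norm_of_real using k by simp
  show "skwarczynski_dist \<Omega> z 0 = sqrt (1 - nrm (K 0) / nrm (K z))"
    unfolding skwarczynski_dist_def eq n ..
  have "(nrm (K 0))\<^sup>2 = norm (K z 0)"
    using \<open>K z 0 = cnj (G z 0)\<close> \<open>cnj (G z 0) = complex_of_real ((nrm (K 0))\<^sup>2)\<close> by (simp add: norm_power)
  also have "\<dots> \<le> nrm (K z) * nrm (K 0)" by (rule bergman_bound[OF K_bergman[OF z]])
  finally have "nrm (K 0) \<le> nrm (K z)" using k by (simp add: power2_eq_square)
  then show "nrm (K 0) / nrm (K z) \<le> 1" using k by simp
qed

text \<open>The squared distance is 1 minus a constant over the kernel norm, so approach to 1 means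
  that the kernel norm tends to infinity. The distance stays strictly below 1, which matches the
  punctured neighbourhood \<open>at 1\<close>.\<close>

lemma tendsto_going_to_boundary:
  fixes Q :: "complex \<times> complex \<Rightarrow> real"
  assumes o: "0 \<in> \<Omega>" and G0: "\<And>z. z \<in> \<Omega> \<Longrightarrow> G z 0 = G 0 0"
  shows "(Q \<longlongrightarrow> 0) ((\<lambda>z. skwarczynski_dist \<Omega> z 0) going_to (at 1) within \<Omega>) \<longleftrightarrow>
    (\<forall>\<epsilon>>0. \<exists>m. \<forall>z\<in>\<Omega>. nrm (K z) > m \<longrightarrow> \<bar>Q z\<bar> < \<epsilon>)"
proof -
  define c where "c = nrm (K 0)"
  define d where "d = (\<lambda>z. skwarczynski_dist \<Omega> z 0)"
  have c: "c > 0" using K_norm(2)[OF o] by (simp add: c_def)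
  have k: "nrm (K z) > 0" if "z \<in> \<Omega>" for z using K_norm(2)[OF that] .
  have d2: "(d z)\<^sup>2 = 1 - c / nrm (K z)" "d z \<ge> 0" "d z < 1" "c / nrm (K z) > 0" if z: "z \<in> \<Omega>" for z
  proof -
    have e: "d z = sqrt (1 - c / nrm (K z))" and le: "c / nrm (K z) \<le> 1"
      using skwarczynski_dist_eq[OF z o G0[OF z]] by (simp_all add: d_def c_def)
    show p: "c / nrm (K z) > 0" using c k[OF z] by simp
    show "(d z)\<^sup>2 = 1 - c / nrm (K z)" "d z \<ge> 0" unfolding e using le by simp_all
    show "d z < 1" unfolding e using p by simp
  qed
  have "(\<forall>\<^sub>F z in (d going_to (at 1) within \<Omega>). p z) \<longleftrightarrow> (\<exists>m. \<forall>z\<in>\<Omega>. nrm (K z) > m \<longrightarrow> p z)" for p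
  proof
    assume "\<forall>\<^sub>F z in (d going_to (at 1) within \<Omega>). p z"
    then obtain R where R: "eventually R (at 1)" "\<And>z. z \<in> \<Omega> \<Longrightarrow> R (d z) \<Longrightarrow> p z"
      unfolding going_to_within_def eventually_inf_principal eventually_filtercomap by blast
    then obtain \<delta> where \<delta>: "\<delta> > 0" "\<And>x. x \<noteq> 1 \<Longrightarrow> dist x 1 < \<delta> \<Longrightarrow> R x"
      unfolding eventually_at by blast
    show "\<exists>m. \<forall>z\<in>\<Omega>. nrm (K z) > m \<longrightarrow> p z"
    proof (intro exI[of _ "c / \<delta>"] ballI impI)
      fix z assume z: "z \<in> \<Omega>" and m: "nrm (K z) > c / \<delta>"
      have "c / nrm (K z) < \<delta>" using m \<delta>(1) k[OF z] by (simp add: field_simps)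
      moreover have "1 - d z \<le> 1 - (d z)\<^sup>2"
        using d2(2,3)[OF z] by (simp add: power2_eq_square mult_left_le)
      ultimately have "dist (d z) 1 < \<delta>" using d2[OF z] by (simp add: dist_real_def)
      then show "p z" using R(2)[OF z] \<delta>(2) d2(3)[OF z] by simp
    qed
  next
    assume "\<exists>m. \<forall>z\<in>\<Omega>. nrm (K z) > m \<longrightarrow> p z"
    then obtain m0 where m0: "\<And>z. z \<in> \<Omega> \<Longrightarrow> nrm (K z) > m0 \<Longrightarrow> p z" by blast
    define m where "m = max m0 1"
    define R where "R x \<longleftrightarrow> dist x 1 < c / (2 * m)" for x :: real
    have m: "m > 0" by (simp add: m_def)
    have "eventually R (at 1)" unfolding eventually_at R_def using c m by (intro exI[of _ "c / (2 * m)"]) auto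
    moreover have "p z" if z: "z \<in> \<Omega>" and "R (d z)" for z
    proof (rule m0[OF z])
      have "1 - d z < c / (2 * m)" using \<open>R (d z)\<close> d2(3)[OF z] by (simp add: R_def dist_real_def)
      \<comment> \<open>Passing from d to its square costs at most a factor 2, which is why
        \<open>R\<close> is defined with \<open>c / (2 * m)\<close>.\<close>
      moreover have "1 - (d z)\<^sup>2 \<le> 2 * (1 - d z)"
      proof -
        have "2 * (1 - d z) - (1 - (d z)\<^sup>2) = (1 - d z)\<^sup>2" by (simp add: power2_eq_square algebra_simps)
        then show ?thesis by (metis diff_ge_0_iff_ge zero_le_power2)
      qed
      ultimately have "c / nrm (K z) < c / m" using d2(1)[OF z] by simp
      then have "m < nrm (K z)" using c m k[OF z] by (simp add: frac_less_eq field_simps)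
      then show "m0 < nrm (K z)" by (simp add: m_def)
    qed
    ultimately show "\<forall>\<^sub>F z in (d going_to (at 1) within \<Omega>). p z"
      unfolding going_to_within_def eventually_inf_principal eventually_filtercomap by blast
  qed
  then show ?thesis unfolding d_def tendsto_iff by simp
qed

theorem toeplitz_compact_iff:
  assumes u: "u \<in> Linf_space \<Omega>" and o: "0 \<in> \<Omega>" and G0: "\<And>z. z \<in> \<Omega> \<Longrightarrow> G z 0 = G 0 0"
  shows "compact_on_bergman \<Omega> (toeplitz \<Omega> u) \<longleftrightarrow>
    ((\<lambda>z. L2_norm_on \<Omega> (toeplitz \<Omega> u (normalized_kernel \<Omega> z))) \<longlongrightarrow> 0)
      ((\<lambda>z. skwarczynski_dist \<Omega> z 0) going_to (at 1) within \<Omega>)"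
proof -
  obtain u' Cu where u': "u' \<in> borel_measurable borel" "\<And>x. norm (u' x) \<le> Cu" "AE x in lebesgue_on \<Omega>. u x = u' x"
    using Linf_borel_representative[OF u] by blast
  interpret localized_toeplitz \<Omega> G h C u' Cu
    by unfold_locales (rule u')+
  have um: "u \<in> borel_measurable (lebesgue_on \<Omega>)" using u by (simp add: Linf_space_def)
  have toe: "toeplitz \<Omega> u f = T f" if "f \<in> H" for f
  proof -
    have "toeplitz \<Omega> u f = toeplitz \<Omega> u' f" by (rule toeplitz_cong_AE[OF um u'(1,3) that])
    then show ?thesis unfolding toeplitz_def T_def using bergman_proj_eq[OF uH(1)[OF that]] by simp
  qed
  have im: "toeplitz \<Omega> u ` S = T ` S" if "bergman.mbounded S" for S
    using bergman.mbounded_subset_mspace[OF that] by (intro image_cong refl toe bergman_H) blast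
  have 1: "compact_on_bergman \<Omega> (toeplitz \<Omega> u) \<longleftrightarrow>
     (\<forall>S. bergman.mbounded S \<longrightarrow> T ` S \<subseteq> bergman_space \<Omega> \<and> compactin bergman.mtopology (bergman.mtopology closure_of (T ` S)))"
    unfolding compact_on_bergman_def Let_def using im by simp
  have nT: "L2_norm_on \<Omega> (toeplitz \<Omega> u (normalized_kernel \<Omega> z)) = nrm (T (K z)) / nrm (K z)" if z: "z \<in> \<Omega>" for z
  proof -
    have nH: "normalized_kernel \<Omega> z \<in> H" by (rule bergman_H[OF normalized_kernel_bergman[OF z]])
    have kn: "normalized_kernel \<Omega> z = (\<lambda>w. (1 / complex_of_real (nrm (K z))) * K z w)"
      by (simp add: normalized_kernel_eq[OF z])
    have "L2_norm_on \<Omega> (toeplitz \<Omega> u (normalized_kernel \<Omega> z)) = nrm (T (normalized_kernel \<Omega> z))"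
      unfolding toe[OF nH] using bergman_H[OF T_bergman(1)[OF nH]] by (intro L2_norm_on_eq H_meas) (auto dest: H_D(2))
    also have "\<dots> = nrm (T (K z)) / nrm (K z)"
      unfolding kn T_cmult sqint_cmult(2)[OF H_D(1)[OF bergman_H[OF T_bergman(1)[OF K_H]]]] by (simp add: norm_divide)
    finally show ?thesis .
  qed
  have k: "nrm (K z) > 0" if "z \<in> \<Omega>" for z using K_norm(2)[OF that] .
  note E1 = trans[OF 1 compact_iff_kernels]
  have E2: "((\<lambda>z. L2_norm_on \<Omega> (toeplitz \<Omega> u (normalized_kernel \<Omega> z))) \<longlongrightarrow> 0)
      ((\<lambda>z. skwarczynski_dist \<Omega> z 0) going_to (at 1) within \<Omega>) \<longleftrightarrow>
    (\<forall>\<epsilon>>0. \<exists>m. \<forall>z\<in>\<Omega>. nrm (K z) > m \<longrightarrow> \<bar>L2_norm_on \<Omega> (toeplitz \<Omega> u (normalized_kernel \<Omega> z))\<bar> < \<epsilon>)"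
    by (rule tendsto_going_to_boundary[OF o G0])
  have "(\<forall>\<epsilon>>0. \<exists>m. \<forall>z\<in>\<Omega>. nrm (K z) > m \<longrightarrow> nrm (T (K z)) \<le> \<epsilon> * nrm (K z)) \<longleftrightarrow>
    (\<forall>\<epsilon>>0. \<exists>m. \<forall>z\<in>\<Omega>. nrm (K z) > m \<longrightarrow> \<bar>L2_norm_on \<Omega> (toeplitz \<Omega> u (normalized_kernel \<Omega> z))\<bar> < \<epsilon>)"
  proof (intro iffI allI impI)
    fix \<epsilon> :: real assume A: "\<forall>\<epsilon>>0. \<exists>m. \<forall>z\<in>\<Omega>. nrm (K z) > m \<longrightarrow> nrm (T (K z)) \<le> \<epsilon> * nrm (K z)" and e: "\<epsilon> > 0"
    \<comment> \<open>Halving turns the weak inequality of one formulation into the strict one of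
      the limit.\<close>
    have "\<epsilon> / 2 > 0" using e by simp
    then have "\<exists>m. \<forall>z\<in>\<Omega>. nrm (K z) > m \<longrightarrow> nrm (T (K z)) \<le> \<epsilon> / 2 * nrm (K z)" by (rule A[rule_format])
    then obtain m where m: "\<And>z. z \<in> \<Omega> \<Longrightarrow> nrm (K z) > m \<Longrightarrow> nrm (T (K z)) \<le> \<epsilon> / 2 * nrm (K z)" by blast
    have "\<bar>L2_norm_on \<Omega> (toeplitz \<Omega> u (normalized_kernel \<Omega> z))\<bar> < \<epsilon>" if z: "z \<in> \<Omega>" and "nrm (K z) > m" for z
    proof -
      have "nrm (T (K z)) / nrm (K z) \<le> \<epsilon> / 2" using m[OF that] k[OF z] by (simp add: pos_divide_le_eq)
      then have "nrm (T (K z)) / nrm (K z) < \<epsilon>" using e by linarith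
      then show ?thesis unfolding nT[OF z] using k[OF z] by simp
    qed
    then show "\<exists>m. \<forall>z\<in>\<Omega>. nrm (K z) > m \<longrightarrow> \<bar>L2_norm_on \<Omega> (toeplitz \<Omega> u (normalized_kernel \<Omega> z))\<bar> < \<epsilon>" by blast
  next
    fix \<epsilon> :: real assume "\<forall>\<epsilon>>0. \<exists>m. \<forall>z\<in>\<Omega>. nrm (K z) > m \<longrightarrow> \<bar>L2_norm_on \<Omega> (toeplitz \<Omega> u (normalized_kernel \<Omega> z))\<bar> < \<epsilon>" and e: "\<epsilon> > 0"
    then obtain m where m: "\<And>z. z \<in> \<Omega> \<Longrightarrow> nrm (K z) > m \<Longrightarrow> \<bar>L2_norm_on \<Omega> (toeplitz \<Omega> u (normalized_kernel \<Omega> z))\<bar> < \<epsilon>" by blast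
    have "nrm (T (K z)) \<le> \<epsilon> * nrm (K z)" if z: "z \<in> \<Omega>" and "nrm (K z) > m" for z
      using m[OF that] k[OF z] unfolding nT[OF z] by (simp add: field_simps)
    then show "\<exists>m. \<forall>z\<in>\<Omega>. nrm (K z) > m \<longrightarrow> nrm (T (K z)) \<le> \<epsilon> * nrm (K z)" by blast
  qed
  then show ?thesis unfolding E1 E2 .
qed

end

section \<open>Integrals over the unit disc\<close>

lemma nn_integral_powr_01:
  assumes "b > (-1::real)"
  shows "(\<integral>\<^sup>+y. indicator {0<..<1} y * ennreal (y powr b) \<partial>lborel) = ennreal (1 / (b + 1))"
proof -
  have "((\<lambda>y. y powr b) has_integral (1 powr (b + 1) / (b + 1))) {0..1}"
    by (rule has_integral_powr_from_0) (use assms in auto)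
  then have "(\<integral>\<^sup>+y. indicator {0..1} y * ennreal (y powr b) \<partial>lborel) = ennreal (1 / (b + 1))"
    using nn_integral_has_integral_lebesgue[of "{0..1}" "\<lambda>y. y powr b"] by (simp add: ennreal_indicator[symmetric] ennreal_mult'[symmetric] del: ennreal_indicator)
  moreover have "(\<integral>\<^sup>+y. indicator {0<..<1} y * ennreal (y powr b) \<partial>lborel) = (\<integral>\<^sup>+y. indicator {0..1} y * ennreal (y powr b) \<partial>lborel)"
    by (intro nn_integral_cong_AE, rule AE_mp[OF AE_lborel_singleton[of 0] AE_mp[OF AE_lborel_singleton[of 1]]]) (auto simp: indicator_def)
  ultimately show ?thesis by simp
qed

text \<open>With t = a (1 - y), the inequality \<open>ln y \<le> y - 1\<close> bounds
  \<open>y powr a\<close> by exp (-t), which is at most 1 / (1 + t). This replaces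
  \<open>1 - y powr a\<close> by a linear function in the integral below.\<close>

lemma one_minus_powr_ge:
  assumes a: "a > (0::real)" and y: "0 < y" "y \<le> 1"
  shows "1 - y powr a \<ge> a / (1 + a) * (1 - y)"
proof -
  define t where "t = a * (1 - y)"
  have t: "t \<ge> 0" "t \<le> a" using a y by (auto simp: t_def mult_left_le)
  have "a * ln y \<le> a * (y - 1)" using ln_le_minus_one[of y] a y by (intro mult_left_mono) auto
  then have "a * ln y \<le> - t" by (simp add: t_def algebra_simps)
  then have "y powr a \<le> exp (- t)" using y by (simp add: powr_def)
  also have "\<dots> \<le> 1 / (1 + t)"
    using exp_ge_add_one_self[of t] t by (simp add: exp_minus field_simps)
  finally have "1 - y powr a \<ge> t / (1 + t)" using t by (simp add: field_simps)
  moreover have "t / (1 + t) \<ge> t / (1 + a)" using t a by (intro divide_left_mono) auto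
  ultimately show ?thesis by (simp add: t_def)
qed

lemma nn_integral_linear_powr:
  assumes c: "c > 0" and s: "s > 0" and g: "g > (1::real)"
  shows "(\<integral>\<^sup>+y. indicator {0<..<1} y * ennreal ((s + c * (1 - y)) powr (-g)) \<partial>lborel) \<le> ennreal (s powr (1 - g) / (c * (g - 1)))"
proof -
  define \<Phi> where "\<Phi> y = (s + c * (1 - y)) powr (1 - g) / (c * (g - 1))" for y
  have pos: "s + c * (1 - y) > 0" if "0 \<le> y" "y \<le> 1" for y using that c s by (intro add_pos_nonneg) auto
  have "(\<integral>\<^sup>+y. ennreal ((s + c * (1 - y)) powr (-g)) * indicator {0..1} y \<partial>lborel) = ennreal (\<Phi> 1 - \<Phi> 0)"
  proof (rule nn_integral_FTC_Icc)
    show "(\<Phi> has_real_derivative (s + c * (1 - y)) powr (-g)) (at y)" if "y \<in> {0..1}" for y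
    proof -
      have "(\<Phi> has_real_derivative (1 - g) * (s + c * (1 - y)) powr (1 - g - 1) * (- c) / (c * (g - 1))) (at y)"
        unfolding \<Phi>_def using pos[of y] that c g by (auto intro!: derivative_eq_intros)
      moreover have "(1 - g) * (s + c * (1 - y)) powr (1 - g - 1) * (- c) / (c * (g - 1)) = (s + c * (1 - y)) powr (-g)"
      proof -
        have "(1 - g) * q * (- c) = q * (c * (g - 1))" for q by (simp add: algebra_simps)
        then have "(1 - g) * q * (- c) / (c * (g - 1)) = q" for q using c g by simp
        then show ?thesis by simp
      qed
      ultimately show ?thesis by simp
    qed
  qed auto
  also have "\<dots> \<le> ennreal (\<Phi> 1)"
    unfolding \<Phi>_def using c g by (intro ennreal_leI) simp
  also have "\<Phi> 1 = s powr (1 - g) / (c * (g - 1))" by (simp add: \<Phi>_def)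
  finally have le: "(\<integral>\<^sup>+y. ennreal ((s + c * (1 - y)) powr (-g)) * indicator {0..1} y \<partial>lborel) \<le> ennreal (s powr (1 - g) / (c * (g - 1)))" .
  show ?thesis
    by (rule order.trans[OF nn_integral_mono le]) (auto simp: indicator_def)
qed

text \<open>Below 1/2 the second factor is bounded, and \<open>e > -1\<close> makes the first
  integrable. Above 1/2 the base \<open>1 - \<tau> * y powr a\<close> is at least half the sum of
  \<open>1 - \<tau>\<close> and a multiple of \<open>1 - y\<close>, and integrating that power
  produces the exponent \<open>1 - g\<close>.\<close>

lemma nn_integral_transverse:
  assumes a: "a > 0" and e: "e > -1" and g: "g > (1::real)"
  obtains D where "D \<ge> 0" "\<And>\<tau>. 0 \<le> \<tau> \<Longrightarrow> \<tau> < 1 \<Longrightarrow>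
    (\<integral>\<^sup>+y. indicator {0<..<1} y * ennreal (y powr e * (1 - \<tau> * y powr a) powr (-g)) \<partial>lborel) \<le> ennreal (D * (1 - \<tau>) powr (1 - g))"
proof -
  define c where "c = a / (1 + a)"
  define C1 where "C1 = (1 - (1/2) powr a) powr (-g)"
  define C2 where "C2 = (1 + (1/2) powr e) * (1/2) powr (-g)"
  define D where "D = C1 / (e + 1) + C2 / (c * (g - 1))"
  have c: "c > 0" using a by (simp add: c_def)
  have C: "C1 \<ge> 0" "C2 \<ge> 0" by (simp_all add: C1_def C2_def)
  have half: "(1/2::real) powr a < 1" using powr_less_mono2[of a "1/2" 1] a by simp
  have pt: "y powr e * (1 - \<tau> * y powr a) powr (-g) \<le> C1 * y powr e + C2 * ((1 - \<tau>) + c * (1 - y)) powr (-g)"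
    if \<tau>: "0 \<le> \<tau>" "\<tau> < 1" and y: "0 < y" "y < 1" for \<tau> y
  proof (cases "y < 1/2")
    case True
    have "y powr a \<le> (1/2) powr a" using True y a by (intro powr_mono2) auto
    moreover have "\<tau> * y powr a \<le> y powr a" using \<tau> by (simp add: mult_left_le_one_le)
    ultimately have "1 - \<tau> * y powr a \<ge> 1 - (1/2) powr a" by linarith
    then have "(1 - \<tau> * y powr a) powr (-g) \<le> C1" unfolding C1_def using half g by (intro powr_mono2') auto
    then have "y powr e * (1 - \<tau> * y powr a) powr (-g) \<le> y powr e * C1" by (intro mult_left_mono) auto
    then show ?thesis using C by (simp add: mult.commute add_increasing2)
  next
    case False
    have ya: "y powr a \<le> 1" using powr_mono2[of a y 1] a y by simp
    have "1 - \<tau> * y powr a \<ge> 1 - \<tau>" using \<tau> ya by (simp add: mult_left_le)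
    moreover have "1 - \<tau> * y powr a \<ge> 1 - y powr a" using \<tau> by (simp add: mult_left_le_one_le)
    moreover have "1 - y powr a \<ge> c * (1 - y)" unfolding c_def using one_minus_powr_ge[OF a] y by simp
    moreover have "k \<ge> 1/2 * (p + d)" if "k \<ge> p" "k \<ge> q" "q \<ge> d" for k p q d :: real
      using that by simp
    ultimately have "1 - \<tau> * y powr a \<ge> 1/2 * ((1 - \<tau>) + c * (1 - y))" by blast
    moreover have p: "(1 - \<tau>) + c * (1 - y) > 0" using \<tau> c y by (intro add_pos_pos) auto
    ultimately have "(1 - \<tau> * y powr a) powr (-g) \<le> (1/2 * ((1 - \<tau>) + c * (1 - y))) powr (-g)"
      using g by (intro powr_mono2') auto
    also have "\<dots> = (1/2) powr (-g) * ((1 - \<tau>) + c * (1 - y)) powr (-g)" using p by (subst powr_mult) auto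
    finally have 1: "(1 - \<tau> * y powr a) powr (-g) \<le> (1/2) powr (-g) * ((1 - \<tau>) + c * (1 - y)) powr (-g)" .
    have 2: "y powr e \<le> 1 + (1/2) powr e"
    proof (cases "e \<ge> 0")
      case True
      then have "y powr e \<le> 1" using powr_mono2[of e y 1] y by simp
      then show ?thesis by (simp add: add_increasing2)
    next
      case neg: False
      then have "y powr e \<le> (1/2) powr e" using False by (intro powr_mono2') auto
      then show ?thesis by simp
    qed
    have "y powr e * (1 - \<tau> * y powr a) powr (-g) \<le> (1 + (1/2) powr e) * ((1/2) powr (-g) * ((1 - \<tau>) + c * (1 - y)) powr (-g))"
      by (intro mult_mono 1 2) auto
    then show ?thesis using C by (simp add: C2_def mult.assoc add_increasing)
  qed
  have "(\<integral>\<^sup>+y. indicator {0<..<1} y * ennreal (y powr e * (1 - \<tau> * y powr a) powr (-g)) \<partial>lborel) \<le> ennreal (D * (1 - \<tau>) powr (1 - g))"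
    if \<tau>: "0 \<le> \<tau>" "\<tau> < 1" for \<tau>
  proof -
    have "(\<integral>\<^sup>+y. indicator {0<..<1} y * ennreal (y powr e * (1 - \<tau> * y powr a) powr (-g)) \<partial>lborel) \<le>
      (\<integral>\<^sup>+y. ennreal C1 * (indicator {0<..<1} y * ennreal (y powr e)) + ennreal C2 * (indicator {0<..<1} y * ennreal (((1 - \<tau>) + c * (1 - y)) powr (-g))) \<partial>lborel)"
    proof (rule nn_integral_mono)
      fix y :: real
      show "indicator {0<..<1} y * ennreal (y powr e * (1 - \<tau> * y powr a) powr (-g)) \<le>
        ennreal C1 * (indicator {0<..<1} y * ennreal (y powr e)) + ennreal C2 * (indicator {0<..<1} y * ennreal (((1 - \<tau>) + c * (1 - y)) powr (-g)))"
      proof (cases "y \<in> {0<..<1}")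
        case True
        then have "ennreal (y powr e * (1 - \<tau> * y powr a) powr (-g)) \<le> ennreal (C1 * y powr e + C2 * ((1 - \<tau>) + c * (1 - y)) powr (-g))"
          by (intro ennreal_leI pt \<tau>) auto
        also have "\<dots> = ennreal C1 * ennreal (y powr e) + ennreal C2 * ennreal (((1 - \<tau>) + c * (1 - y)) powr (-g))"
          using C by (simp add: ennreal_mult)
        finally show ?thesis using True by simp
      qed simp
    qed
    also have "\<dots> = ennreal C1 * (\<integral>\<^sup>+y. indicator {0<..<1} y * ennreal (y powr e) \<partial>lborel) +
      ennreal C2 * (\<integral>\<^sup>+y. indicator {0<..<1} y * ennreal (((1 - \<tau>) + c * (1 - y)) powr (-g)) \<partial>lborel)"
      by (subst nn_integral_add) (simp_all add: nn_integral_cmult)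
    also have "\<dots> \<le> ennreal C1 * ennreal (1 / (e + 1)) + ennreal C2 * ennreal ((1 - \<tau>) powr (1 - g) / (c * (g - 1)))"
      using nn_integral_linear_powr[OF c _ g, of "1 - \<tau>"] \<tau> by (intro add_mono mult_left_mono) (simp_all add: nn_integral_powr_01 e)
    also have "\<dots> = ennreal (C1 / (e + 1) + C2 / (c * (g - 1)) * (1 - \<tau>) powr (1 - g))"
      using C e c g by (simp add: ennreal_mult'[symmetric] ennreal_plus[symmetric] del: ennreal_plus)
    also have "\<dots> \<le> ennreal (D * (1 - \<tau>) powr (1 - g))"
    proof (rule ennreal_leI)
      have "(1 - \<tau>) powr (1 - g) \<ge> 1" using powr_mono2'[of "1 - g" "1 - \<tau>" 1] g \<tau> by simp
      then have "C1 / (e + 1) * 1 \<le> C1 / (e + 1) * (1 - \<tau>) powr (1 - g)" using C e by (intro mult_left_mono) auto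
      then show "C1 / (e + 1) + C2 / (c * (g - 1)) * (1 - \<tau>) powr (1 - g) \<le> D * (1 - \<tau>) powr (1 - g)"
        by (simp add: D_def distrib_right)
    qed
    finally show ?thesis .
  qed
  moreover have "D \<ge> 0" using C e c g by (simp add: D_def)
  ultimately show thesis using that by blast
qed

text \<open>The kernel exponent is tied to the weight exponent so that, up to a constant factor, the
  integrand is a power of \<open>hdelta\<close> times the invariant density. Moving to the origin
  therefore gives an equality and not only an estimate.\<close>

lemma disc_kernel_nn:
  assumes b: "b > (-1::real)" and \<sigma>: "norm (\<sigma>::complex) < 1"
  shows "(\<integral>\<^sup>+\<zeta>. indicator (ball 0 1) \<zeta> * ennreal (norm (1 - \<zeta> * \<sigma>) powr (-2 * (b + 2)) * (1 - (norm \<zeta>)\<^sup>2) powr b) \<partial>lborel) =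
    ennreal (pi / (b + 1) * (1 - (norm \<sigma>)\<^sup>2) powr (- (b + 2)))"
proof -
  have [measurable]: "ball (0::complex) s \<in> sets borel" for s by auto
  have s1: "1 - (norm \<sigma>)\<^sup>2 > 0" using \<sigma> by (simp add: abs_square_less_1)
  have [measurable]: "hdelta (cnj \<sigma>) \<in> borel_measurable borel" unfolding hdelta_def by measurable
  have pt: "norm (1 - \<zeta> * \<sigma>) powr (-2 * (b + 2)) * (1 - (norm \<zeta>)\<^sup>2) powr b =
     (1 - (norm \<sigma>)\<^sup>2) powr (- (b + 2)) * (1 / (1 - (norm \<zeta>)\<^sup>2)\<^sup>2 * hdelta (cnj \<sigma>) \<zeta> powr (b + 2))" if \<zeta>: "norm \<zeta> < 1" for \<zeta>
  proof -
    define X where "X = 1 - (norm \<zeta>)\<^sup>2"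
    define Y where "Y = 1 - (norm \<sigma>)\<^sup>2"
    define m where "m = norm (1 - \<zeta> * \<sigma>)"
    have X: "X > 0" using \<zeta> by (simp add: X_def abs_square_less_1)
    have Y: "Y > 0" using s1 by (simp add: Y_def)
    have "1 + cnj (- cnj \<sigma>) * \<zeta> \<noteq> 0" by (rule moeb_den) (use \<sigma> \<zeta> in auto)
    then have m: "m > 0" by (simp add: m_def mult.commute)
    define B where "B = b + 2"
    have h: "hdelta (cnj \<sigma>) \<zeta> = Y * X / m\<^sup>2"
      by (simp add: hdelta_def X_def Y_def m_def mult.commute)
    have P: "(m\<^sup>2) powr B = m powr (2 * B)" using powr_powr[of m 2 B] m by simp
    have 1: "(Y * X / m\<^sup>2) powr B = Y powr B * X powr B / m powr (2 * B)"
      using X Y m by (simp add: powr_divide powr_mult P)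
    have 2: "X powr B = X powr b * X\<^sup>2" using X by (simp add: B_def powr_add)
    have 3: "Y powr (- B) = 1 / Y powr B" "m powr (-2 * B) = 1 / m powr (2 * B)"
      using powr_minus_divide[of Y B] powr_minus_divide[of m "2 * B"] by simp_all
    have "Y powr (- B) * (1 / X\<^sup>2 * (Y * X / m\<^sup>2) powr B) = m powr (-2 * B) * X powr b"
      unfolding 1 2 3 using X Y m by simp
    then show ?thesis unfolding h B_def by (simp only: X_def Y_def m_def)
  qed
  have "(\<integral>\<^sup>+\<zeta>. indicator (ball 0 1) \<zeta> * ennreal (norm (1 - \<zeta> * \<sigma>) powr (-2 * (b + 2)) * (1 - (norm \<zeta>)\<^sup>2) powr b) \<partial>lborel) =
    (\<integral>\<^sup>+\<zeta>. ennreal ((1 - (norm \<sigma>)\<^sup>2) powr (- (b + 2))) * (indicator (ball 0 1) \<zeta> * (ennreal (1 / (1 - (norm \<zeta>)\<^sup>2)\<^sup>2) * ennreal (hdelta (cnj \<sigma>) \<zeta> powr (b + 2)))) \<partial>lborel)"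
  proof (rule nn_integral_cong)
    fix \<zeta> :: complex
    show "indicator (ball 0 1) \<zeta> * ennreal (norm (1 - \<zeta> * \<sigma>) powr (-2 * (b + 2)) * (1 - (norm \<zeta>)\<^sup>2) powr b) =
      ennreal ((1 - (norm \<sigma>)\<^sup>2) powr (- (b + 2))) * (indicator (ball 0 1) \<zeta> * (ennreal (1 / (1 - (norm \<zeta>)\<^sup>2)\<^sup>2) * ennreal (hdelta (cnj \<sigma>) \<zeta> powr (b + 2))))"
    proof (cases "norm \<zeta> < 1")
      case True
      show ?thesis unfolding pt[OF True] using True by (simp add: ennreal_mult'[symmetric])
    qed simp
  qed
  also have "\<dots> = ennreal ((1 - (norm \<sigma>)\<^sup>2) powr (- (b + 2))) * (\<integral>\<^sup>+\<zeta>. indicator (ball 0 1) \<zeta> * (ennreal (1 / (1 - (norm \<zeta>)\<^sup>2)\<^sup>2) * ennreal (hdelta (cnj \<sigma>) \<zeta> powr (b + 2))) \<partial>lborel)"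
    by (rule nn_integral_cmult) measurable
  also have "(\<integral>\<^sup>+\<zeta>. indicator (ball 0 1) \<zeta> * (ennreal (1 / (1 - (norm \<zeta>)\<^sup>2)\<^sup>2) * ennreal (hdelta (cnj \<sigma>) \<zeta> powr (b + 2))) \<partial>lborel) =
    ennreal pi * (\<integral>\<^sup>+y. indicator {0<..<1} y * (ennreal (1 / y\<^sup>2) * ennreal (y powr (b + 2))) \<partial>lborel)"
    by (rule invariant_radial_nn) (use \<sigma> in auto)
  also have "(\<integral>\<^sup>+y. indicator {0<..<1} y * (ennreal (1 / y\<^sup>2) * ennreal (y powr (b + 2))) \<partial>lborel) = (\<integral>\<^sup>+y. indicator {0<..<1} y * ennreal (y powr b) \<partial>lborel)"
  proof (rule nn_integral_cong)
    fix y :: real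
    show "indicator {0<..<1} y * (ennreal (1 / y\<^sup>2) * ennreal (y powr (b + 2))) = indicator {0<..<1} y * ennreal (y powr b)"
    proof (cases "y \<in> {0<..<1}")
      case True
      then have "1 / y\<^sup>2 * y powr (b + 2) = y powr b" by (simp add: powr_add powr_realpow[of _ 2, simplified])
      then show ?thesis by (simp add: ennreal_mult'[symmetric])
    qed simp
  qed
  also have "\<dots> = ennreal (1 / (b + 1))" by (rule nn_integral_powr_01[OF b])
  also have "ennreal ((1 - (norm \<sigma>)\<^sup>2) powr (- (b + 2))) * (ennreal pi * ennreal (1 / (b + 1))) = ennreal (pi / (b + 1) * (1 - (norm \<sigma>)\<^sup>2) powr (- (b + 2)))"
    using b by (simp add: ennreal_mult'[symmetric] mult_ac)
  finally show ?thesis .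
qed

section \<open>The kernel and its Schur estimates\<close>

locale hartogs =
  fixes \<alpha> :: real
  assumes \<alpha>: "\<alpha> > 0"
begin

abbreviation U :: "(complex \<times> complex) set" where "U \<equiv> U_dom \<alpha>"

definition xx :: "complex \<times> complex \<Rightarrow> real" where "xx z = 1 - (norm (snd z))\<^sup>2"

definition A :: "complex \<times> complex \<Rightarrow> complex \<times> complex \<Rightarrow> complex" where "A z w = 1 - snd z * cnj (snd w)"

text \<open>Below, \<open>G\<close> is the Bergman kernel of the domain. The functions \<open>s\<close> and \<open>tau\<close> are invariant
  under the automorphisms \<open>Phi\<close> over the Moebius maps of the second coordinate.\<close>

definition s :: "complex \<times> complex \<Rightarrow> complex \<times> complex \<Rightarrow> complex" where
  "s z w = fst z * cnj (fst w) / A z w powr complex_of_real \<alpha>"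

definition tau :: "complex \<times> complex \<Rightarrow> real" where "tau z = (norm (fst z))\<^sup>2 / xx z powr \<alpha>"

definition G :: "complex \<times> complex \<Rightarrow> complex \<times> complex \<Rightarrow> complex" where
  "G z w = (if z \<in> U \<and> w \<in> U then (complex_of_real (\<alpha> + 1) + complex_of_real (\<alpha> - 1) * s z w) /
      (complex_of_real (pi\<^sup>2) * A z w powr complex_of_real (2 + \<alpha>) * (1 - s z w) ^ 3) else 0)"

text \<open>The modulus of the kernel without its numerator. The numerator is bounded above and away
  from 0, so size estimates can be made for this simpler positive function.\<close>

definition N :: "complex \<times> complex \<Rightarrow> complex \<times> complex \<Rightarrow> real" where
  "N z w = norm (A z w) powr (- (2 + \<alpha>)) * norm (1 - s z w) powr (-3)"

text \<open>On a fibre, -1/2 is the exponent b with 2 (b + 2) = 3, for which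
  \<open>disc_kernel_nn\<close> applies exactly. The exponent \<open>1 + \<alpha> / 2\<close> is
  half of the kernel exponent \<open>2 + \<alpha>\<close>, and makes the remaining integral over the
  second coordinate Moebius invariant.\<close>

definition h :: "complex \<times> complex \<Rightarrow> real" where
  "h z = (if z \<in> U then xx z powr (- (1 + \<alpha> / 2)) * (1 - tau z) powr (- (1 / 2)) else 0)"

text \<open>Taking powers turns the defining inequality into a fibration by discs: the fibre over
  \<open>snd z\<close> has squared radius \<open>xx z powr \<alpha>\<close>, and \<open>tau\<close>
  is the squared modulus relative to it.\<close>

lemma mem_U: "z \<in> U \<longleftrightarrow> norm (snd z) < 1 \<and> tau z < 1"
proof (cases "norm (snd z) < 1")
  case True
  then have x: "xx z > 0" by (simp add: xx_def abs_square_less_1)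
  have "norm (fst z) powr (2 / \<alpha>) < xx z \<longleftrightarrow> (norm (fst z))\<^sup>2 < xx z powr \<alpha>"
  proof
    assume "norm (fst z) powr (2 / \<alpha>) < xx z"
    then have "(norm (fst z) powr (2 / \<alpha>)) powr \<alpha> < xx z powr \<alpha>" using \<alpha> by (intro powr_less_mono2) auto
    then show "(norm (fst z))\<^sup>2 < xx z powr \<alpha>" using \<alpha> by (simp add: powr_powr)
  next
    assume "(norm (fst z))\<^sup>2 < xx z powr \<alpha>"
    then have "((norm (fst z))\<^sup>2) powr (1 / \<alpha>) < (xx z powr \<alpha>) powr (1 / \<alpha>)" using \<alpha> by (intro powr_less_mono2) auto
    moreover have "((norm (fst z))\<^sup>2) powr (1 / \<alpha>) = norm (fst z) powr (2 / \<alpha>)"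
      using powr_powr[of "norm (fst z)" 2 "1 / \<alpha>"] by simp
    ultimately show "norm (fst z) powr (2 / \<alpha>) < xx z" using \<alpha> x by (simp add: powr_powr)
  qed
  moreover have "z \<in> U \<longleftrightarrow> norm (fst z) powr (2 / \<alpha>) < xx z" by (auto simp: U_dom_def xx_def)
  moreover have "tau z < 1 \<longleftrightarrow> (norm (fst z))\<^sup>2 < xx z powr \<alpha>" using x by (simp add: tau_def)
  ultimately show ?thesis using True by simp
next
  case False
  then have "(norm (snd z))\<^sup>2 \<ge> 1" by simp
  moreover have "norm (fst z) powr (2 / \<alpha>) \<ge> 0" by simp
  ultimately have "norm (fst z) powr (2 / \<alpha>) + (norm (snd z))\<^sup>2 \<ge> 1" by linarith
  then show ?thesis using False unfolding U_dom_def by simp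
qed

lemma U_bounds: assumes "z \<in> U" shows "norm (snd z) < 1" "xx z > 0" "xx z \<le> 1" "tau z \<ge> 0" "tau z < 1" "1 - tau z > 0"
  using assms by (auto simp: mem_U xx_def tau_def abs_square_less_1)

lemma U_ball: "z \<in> U \<Longrightarrow> fst z \<in> ball 0 1 \<and> snd z \<in> ball 0 1"
proof -
  assume z: "z \<in> U"
  have "(norm (fst z))\<^sup>2 < xx z powr \<alpha>" using U_bounds[OF z] by (simp add: tau_def)
  also have "\<dots> \<le> 1" using powr_mono2[of \<alpha> "xx z" 1] U_bounds[OF z] \<alpha> by simp
  finally show ?thesis using U_bounds(1)[OF z] by (simp add: abs_square_less_1)
qed

lemma U_open: "open U"
  unfolding U_dom_def
  by (intro open_Collect_less continuous_on_add continuous_on_powr' continuous_intros) (use \<alpha> in auto)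

lemma U_meas [measurable]: "U \<in> sets borel"
  by (rule borel_open[OF U_open])

lemma U_fin: "emeasure lborel U < \<infinity>"
proof -
  have "U \<subseteq> ball 0 1 \<times> ball 0 1" using U_ball by (auto simp: mem_Times_iff)
  then have "bounded U" by (rule bounded_subset[rotated]) (intro bounded_Times bounded_ball)
  then show ?thesis by (rule emeasure_bounded_finite)
qed

lemma zero_U: "0 \<in> U" by (simp add: mem_U tau_def)

section \<open>Identities and bounds for the factors of the kernel\<close>

lemma A_square: "(norm (A z w))\<^sup>2 = xx z * xx w + (norm (snd z - snd w))\<^sup>2"
  unfolding A_def xx_def cmod_power2 by (simp add: algebra_simps power2_eq_square)

lemma A_ge: "(norm (A z w))\<^sup>2 \<ge> xx z * xx w"
  by (simp add: A_square)

text \<open>A positive real part keeps the base off the branch cut, so its complex powers are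
  holomorphic and compatible with conjugation.\<close>

lemma A_Re: assumes "z \<in> U" "w \<in> U" shows "Re (A z w) > 0" "A z w \<noteq> 0" "A z w \<notin> \<real>\<^sub>\<le>\<^sub>0"
proof -
  have "norm (snd z * cnj (snd w)) < 1"
    using mult_strict_mono[of "norm (snd z)" 1 "norm (snd w)" 1] U_bounds(1)[OF assms(1)] U_bounds(1)[OF assms(2)] by (simp add: norm_mult)
  then show r: "Re (A z w) > 0" unfolding A_def by (rule norm_lt_1_re)
  then show "A z w \<noteq> 0" by auto
  show "A z w \<notin> \<real>\<^sub>\<le>\<^sub>0" using r by (auto simp: complex_nonpos_Reals_iff)
qed

lemma A_diag: "A z z = complex_of_real (xx z)"
  using complex_norm_square[of "snd z"] by (simp add: A_def xx_def)

lemma cnj_A: "cnj (A z w) = A w z"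
  by (simp add: A_def mult.commute)

lemma cnj_A_powr: "z \<in> U \<Longrightarrow> w \<in> U \<Longrightarrow> cnj (A z w powr complex_of_real r) = A w z powr complex_of_real r"
  using A_Re(1)[of z w] by (subst cnj_powr) (auto simp: cnj_A)

lemma cnj_s: "z \<in> U \<Longrightarrow> w \<in> U \<Longrightarrow> cnj (s z w) = s w z"
  by (simp add: s_def cnj_A_powr mult.commute)

lemma norm_A_powr: "norm (A z w powr complex_of_real r) = norm (A z w) powr r"
  by (simp add: norm_powr_real_powr')

text \<open>The last factor is a power of \<open>hdelta\<close> of the second coordinates, hence at
  most 1; it measures how far s stays below its Cauchy-Schwarz bound.\<close>

lemma s_square:
  assumes z: "z \<in> U" and w: "w \<in> U"
  shows "(norm (s z w))\<^sup>2 = tau z * tau w * (xx z * xx w / (norm (A z w))\<^sup>2) powr \<alpha>"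
proof -
  have a: "norm (A z w) > 0" using A_Re(2)[OF z w] by simp
  have "((norm (A z w))\<^sup>2) powr \<alpha> = (norm (A z w) powr \<alpha>)\<^sup>2"
    using a by (simp add: power2_eq_square powr_mult)
  then show ?thesis using U_bounds(2)[OF z] U_bounds(2)[OF w] a
    by (simp add: s_def tau_def norm_divide norm_mult norm_A_powr power_divide power_mult_distrib powr_divide powr_mult)
qed

lemma s_le: assumes z: "z \<in> U" and w: "w \<in> U" shows "(norm (s z w))\<^sup>2 \<le> tau z * tau w" "norm (s z w) < 1"
proof -
  have a: "norm (A z w) > 0" using A_Re(2)[OF z w] by simp
  have "xx z * xx w / (norm (A z w))\<^sup>2 \<le> 1" using A_ge[of z w] a by simp
  then have "(xx z * xx w / (norm (A z w))\<^sup>2) powr \<alpha> \<le> 1"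
    using powr_mono2[of \<alpha> "xx z * xx w / (norm (A z w))\<^sup>2" 1] \<alpha> U_bounds(2)[OF z] U_bounds(2)[OF w] by simp
  then show 1: "(norm (s z w))\<^sup>2 \<le> tau z * tau w"
    unfolding s_square[OF z w] using U_bounds(4)[OF z] U_bounds(4)[OF w] by (simp add: mult_left_le)
  also have "\<dots> < 1" using mult_strict_mono[of "tau z" 1 "tau w" 1] U_bounds[OF z] U_bounds[OF w] by simp
  finally show "norm (s z w) < 1" by (simp add: abs_square_less_1)
qed

lemma s_diag: "z \<in> U \<Longrightarrow> s z z = complex_of_real (tau z)"
  using complex_norm_square[of "fst z"] U_bounds(2)[of z] by (simp add: s_def tau_def A_diag powr_of_real)

text \<open>The last bound is
  \<open>(1 - a * b)\<^sup>2 \<ge> (1 - a\<^sup>2) * (1 - b\<^sup>2)\<close> for the square roots of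
  \<open>tau\<close>. Together with \<open>A_ge\<close> it shows that both quotients defining the
  near region are at least 1.\<close>

lemma one_minus_s: assumes z: "z \<in> U" and w: "w \<in> U"
  shows "norm (1 - s z w) \<ge> 1 - sqrt (tau z) * sqrt (tau w)" "norm (1 - s z w) > 0" "(norm (1 - s z w))\<^sup>2 \<ge> (1 - tau z) * (1 - tau w)"
proof -
  have "norm (s z w) \<le> sqrt (tau z * tau w)" using real_le_rsqrt[OF s_le(1)[OF z w]] .
  then have le: "norm (s z w) \<le> sqrt (tau z) * sqrt (tau w)" by (simp add: real_sqrt_mult)
  have "norm (1 - s z w) \<ge> 1 - norm (s z w)" using norm_triangle_ineq2[of 1 "s z w"] by simp
  then show 1: "norm (1 - s z w) \<ge> 1 - sqrt (tau z) * sqrt (tau w)" using le by linarith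
  show "norm (1 - s z w) > 0" using s_le(2)[OF z w] by auto
  have r: "sqrt (tau z) \<le> 1" "sqrt (tau w) \<le> 1" using U_bounds[OF z] U_bounds[OF w] by auto
  then have nn: "1 - sqrt (tau z) * sqrt (tau w) \<ge> 0" using mult_le_one[of "sqrt (tau z)" "sqrt (tau w)"] U_bounds[OF w] by simp
  have "(1 - (sqrt (tau z))\<^sup>2) * (1 - (sqrt (tau w))\<^sup>2) \<le> (1 - sqrt (tau z) * sqrt (tau w))\<^sup>2"
  proof -
    have "(1 - a * b)\<^sup>2 - (1 - a\<^sup>2) * (1 - b\<^sup>2) = (a - b)\<^sup>2" for a b :: real by (simp add: power2_eq_square algebra_simps)
    then show ?thesis by (metis diff_ge_0_iff_ge zero_le_power2)
  qed
  also have "\<dots> \<le> (norm (1 - s z w))\<^sup>2" by (rule power_mono[OF 1 nn])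
  finally show "(norm (1 - s z w))\<^sup>2 \<ge> (1 - tau z) * (1 - tau w)" using U_bounds[OF z] U_bounds[OF w] by simp
qed

lemma N_diag: "z \<in> U \<Longrightarrow> N z z = xx z powr (- (2 + \<alpha>)) * (1 - tau z) powr (-3)"
proof -
  assume z: "z \<in> U"
  have "norm (1 - complex_of_real (tau z)) = 1 - tau z"
    using U_bounds[OF z] by (metis abs_of_pos norm_of_real of_real_1 of_real_diff)
  then show ?thesis using U_bounds[OF z] by (simp add: N_def A_diag s_diag[OF z])
qed

lemma N_commute: "z \<in> U \<Longrightarrow> w \<in> U \<Longrightarrow> N z w = N w z"
proof -
  assume z: "z \<in> U" and w: "w \<in> U"
  have "norm (A z w) = norm (A w z)" by (metis cnj_A complex_mod_cnj)
  moreover have "norm (1 - s z w) = norm (1 - s w z)" by (metis cnj_s[OF z w] complex_cnj_diff complex_cnj_one complex_mod_cnj)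
  ultimately show ?thesis by (simp add: N_def)
qed

lemma N_nonneg: "N z w \<ge> 0" by (simp add: N_def)

lemma N_pos: "z \<in> U \<Longrightarrow> w \<in> U \<Longrightarrow> N z w > 0"
  using A_Re(2)[of z w] one_minus_s(2)[of z w] by (simp add: N_def)

text \<open>Since the modulus of s is below 1, the numerator of the kernel lies between
  \<open>\<alpha> + 1 - \<bar>\<alpha> - 1\<bar>\<close>, which is
  \<open>2 * min 1 \<alpha>\<close>, and \<open>2 * \<alpha> + 2\<close>.\<close>

definition c1 :: real where "c1 = 2 * min 1 \<alpha> / pi\<^sup>2"
definition c2 :: real where "c2 = (2 * \<alpha> + 2) / pi\<^sup>2"

lemma c1_c2_pos: "c1 > 0" "c2 > 0" using \<alpha> by (simp_all add: c1_def c2_def)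

lemma norm_G: assumes z: "z \<in> U" and w: "w \<in> U"
  shows "norm (G z w) \<ge> c1 * N z w" "norm (G z w) \<le> c2 * N z w"
proof -
  define num where "num = norm (complex_of_real (\<alpha> + 1) + complex_of_real (\<alpha> - 1) * s z w)"
  have p: "norm (1 - s z w) > 0" by (rule one_minus_s(2)[OF z w])
  have a: "norm (A z w) > 0" using A_Re(2)[OF z w] by simp
  have "norm (G z w) = num / (pi\<^sup>2 * norm (A z w) powr (2 + \<alpha>) * norm (1 - s z w) ^ 3)"
    using z w unfolding G_def num_def by (simp add: norm_divide norm_mult norm_A_powr norm_power del: of_real_add of_real_diff)
  also have "norm (1 - s z w) ^ 3 = norm (1 - s z w) powr 3" using p by simp
  also have "num / (pi\<^sup>2 * norm (A z w) powr (2 + \<alpha>) * norm (1 - s z w) powr 3) = num / pi\<^sup>2 * N z w"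
    using p a by (simp add: N_def powr_minus_divide[of _ 3] powr_minus_divide[of _ "2 + \<alpha>"] del: powr_numeral minus_add_distrib)
  finally have eq: "norm (G z w) = num / pi\<^sup>2 * N z w" .
  have le: "norm (complex_of_real (\<alpha> - 1) * s z w) \<le> \<bar>\<alpha> - 1\<bar>"
    unfolding norm_mult norm_of_real using s_le(2)[OF z w] by (simp add: mult_left_le)
  have "num \<ge> norm (complex_of_real (\<alpha> + 1)) - norm (complex_of_real (\<alpha> - 1) * s z w)"
    unfolding num_def by (metis norm_diff_ineq)
  then have "num \<ge> \<alpha> + 1 - \<bar>\<alpha> - 1\<bar>" using le \<alpha> unfolding norm_of_real by linarith
  then have 1: "num \<ge> 2 * min 1 \<alpha>" by linarith
  have "num \<le> norm (complex_of_real (\<alpha> + 1)) + norm (complex_of_real (\<alpha> - 1) * s z w)"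
    unfolding num_def by (rule norm_triangle_ineq)
  then have 2: "num \<le> 2 * \<alpha> + 2" using le \<alpha> unfolding norm_of_real by linarith
  show "norm (G z w) \<ge> c1 * N z w" "norm (G z w) \<le> c2 * N z w" unfolding eq c1_def c2_def using 1 2
    by (intro mult_right_mono divide_right_mono N_nonneg; simp)+
qed

lemma h_nonneg: "h z \<ge> 0" by (simp add: h_def)
lemma h_pos: "z \<in> U \<Longrightarrow> h z > 0" using U_bounds[of z] by (simp add: h_def)

section \<open>Regularity of the kernel\<close>

lemma cont_A: "continuous_on S (\<lambda>p. A (fst p) (snd p))"
  unfolding A_def by (intro continuous_intros)

lemma cont_s: "continuous_on (U \<times> U) (\<lambda>p. s (fst p) (snd p))"
  unfolding s_def
  by (intro continuous_intros continuous_on_powr_complex cont_A)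
     (auto simp: A_Re A_Re(1)[THEN less_imp_le])

lemma cont_G: "continuous_on (U \<times> U) (\<lambda>(z, w). G z w)"
proof -
  have "continuous_on (U \<times> U) (\<lambda>p. (complex_of_real (\<alpha> + 1) + complex_of_real (\<alpha> - 1) * s (fst p) (snd p)) /
      (complex_of_real (pi\<^sup>2) * A (fst p) (snd p) powr complex_of_real (2 + \<alpha>) * (1 - s (fst p) (snd p)) ^ 3))"
    using one_minus_s(2)
    by (intro continuous_intros continuous_on_powr_complex cont_A cont_s)
       (auto simp: A_Re A_Re(1)[THEN less_imp_le])
  then show ?thesis by (rule continuous_on_eq) (auto simp: G_def)
qed

lemma G_meas: "(\<lambda>(z, w). G z w) \<in> borel_measurable (borel \<Otimes>\<^sub>M borel)"
proof -
  have "(\<lambda>p. indicator (U \<times> U) p *\<^sub>R (case p of (z, w) \<Rightarrow> G z w)) \<in> borel_measurable borel"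
    by (intro borel_measurable_continuous_on_indicator cont_G borel_open open_Times U_open)
  moreover have "(\<lambda>p. indicator (U \<times> U) p *\<^sub>R (case p of (z, w) \<Rightarrow> G z w)) = (\<lambda>(z, w). G z w)"
    by (auto simp: G_def fun_eq_iff indicator_def)
  ultimately show ?thesis by (simp add: borel_prod)
qed

lemma G_herm: "cnj (G z w) = G w z"
  by (auto simp: G_def cnj_s cnj_A_powr simp flip: of_real_add of_real_diff)

lemma G_diag: assumes z: "z \<in> U" shows "Re (G z z) > 0" "Re (G z z) \<le> c2 * N z z"
proof -
  have "G z z = complex_of_real ((\<alpha> + 1 + (\<alpha> - 1) * tau z) / (pi\<^sup>2 * xx z powr (2 + \<alpha>) * (1 - tau z) ^ 3))"
    using z U_bounds(2)[OF z] powr_of_real[of "xx z" "2 + \<alpha>"] unfolding G_def A_diag s_diag[OF z] by simp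
  then have eq: "Re (G z z) = (\<alpha> + 1 + (\<alpha> - 1) * tau z) / (pi\<^sup>2 * xx z powr (2 + \<alpha>) * (1 - tau z) ^ 3)" by simp
  have "\<alpha> + 1 + (\<alpha> - 1) * tau z = \<alpha> * (1 + tau z) + (1 - tau z)" by (simp add: algebra_simps)
  also have "\<dots> > 0" using \<alpha> U_bounds[OF z] by (intro add_nonneg_pos) auto
  finally show "Re (G z z) > 0" unfolding eq using U_bounds[OF z] by simp
  show "Re (G z z) \<le> c2 * N z z" using norm_G(2)[OF z z] complex_Re_le_cmod[of "G z z"] by linarith
qed

lemma G_zero_const: "z \<in> U \<Longrightarrow> G z 0 = G 0 0"
  using zero_U by (simp add: G_def s_def A_def)

lemma fst_snd_meas [measurable]:
  "(fst :: complex \<times> complex \<Rightarrow> complex) \<in> borel_measurable borel" "(snd :: complex \<times> complex \<Rightarrow> complex) \<in> borel_measurable borel"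
  by (intro borel_measurable_continuous_onI continuous_intros)+

lemma xx_meas [measurable]: "xx \<in> borel_measurable borel"
  unfolding xx_def by measurable

lemma tau_meas [measurable]: "tau \<in> borel_measurable borel"
  unfolding tau_def by measurable

lemma h_meas: "h \<in> borel_measurable borel"
proof -
  show ?thesis unfolding h_def by measurable
qed

lemma G_hol: assumes w: "w \<in> U" shows "holomorphic2_on (\<lambda>z. G z w) U"
  unfolding holomorphic2_on_iff
proof
  fix z assume z: "z \<in> U"
  have cA: "cdiff2 (\<lambda>z. A z w) z" unfolding A_def by (intro cdiff2_diff cdiff2_mult cdiff2_const cdiff2_snd)
  have cAp: "cdiff2 (\<lambda>z. A z w powr c) z" for c
    by (rule cdiff2_compose[OF cA]) (use has_field_derivative_powr[OF A_Re(3)[OF z w]] in \<open>auto simp: field_differentiable_def\<close>)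
  have cs: "cdiff2 (\<lambda>z. s z w) z" unfolding s_def
    using A_Re(2)[OF z w] by (intro cdiff2_divide cdiff2_mult cdiff2_const cdiff2_fst cAp) simp
  have "cdiff2 (\<lambda>z. (complex_of_real (\<alpha> + 1) + complex_of_real (\<alpha> - 1) * s z w) /
      (complex_of_real (pi\<^sup>2) * A z w powr complex_of_real (2 + \<alpha>) * (1 - s z w) ^ 3)) z"
    using A_Re(2)[OF z w] one_minus_s(2)[OF z w]
    by (intro cdiff2_divide cdiff2_add cdiff2_mult cdiff2_power cdiff2_diff cdiff2_const cs cAp) simp
  then show "cdiff2 (\<lambda>z. G z w) z"
    by (rule cdiff2_transform[OF _ U_open z]) (use w in \<open>simp add: G_def\<close>)
qed

lemma N_le: assumes z: "z \<in> U" and w: "w \<in> U"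
  shows "N z w \<le> (1 - norm (snd z)) powr (- (2 + \<alpha>)) * (1 - sqrt (tau z)) powr (-3)"
proof -
  have 1: "norm (A z w) \<ge> 1 - norm (snd z)"
  proof -
    have "norm (snd z * cnj (snd w)) \<le> norm (snd z)" using U_bounds(1)[OF w] by (simp add: norm_mult mult_left_le)
    then show ?thesis unfolding A_def using norm_triangle_ineq2[of 1 "snd z * cnj (snd w)"] by simp
  qed
  have "sqrt (tau z) * sqrt (tau w) \<le> sqrt (tau z)" using U_bounds[OF z] U_bounds[OF w] by (simp add: mult_left_le)
  then have 2: "norm (1 - s z w) \<ge> 1 - sqrt (tau z)" using one_minus_s(1)[OF z w] by linarith
  have 3: "1 - norm (snd z) > 0" "1 - sqrt (tau z) > 0" using U_bounds[OF z] by auto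
  show ?thesis unfolding N_def
    using 1 2 3 \<alpha> by (intro mult_mono powr_mono2') auto
qed

text \<open>\<open>N_le\<close> bounds the kernel by a continuous function of the first variable
  alone, so a neighbourhood on which that function stays bounded works for all \<open>w\<close> at
  once.\<close>

lemma G_locbd: assumes z: "z \<in> U" shows "\<exists>r>0. \<exists>M. ball z r \<subseteq> U \<and> (\<forall>x\<in>ball z r. \<forall>w. norm (G x w) \<le> M)"
proof -
  define f where "f z = c2 * ((1 - norm (snd z)) powr (- (2 + \<alpha>)) * (1 - sqrt (tau z)) powr (-3))" for z :: "complex \<times> complex"
  have "isCont f z"
    unfolding f_def tau_def xx_def using U_bounds[OF z] unfolding tau_def xx_def
    by (intro continuous_intros) auto
  then have "\<forall>\<^sub>F x in nhds z. f x < f z + 1"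
    unfolding isCont_def tendsto_at_iff_tendsto_nhds by (rule order_tendstoD) simp
  moreover have "\<forall>\<^sub>F x in nhds z. x \<in> U" using U_open z by (rule eventually_nhds_in_open)
  ultimately have "\<forall>\<^sub>F x in nhds z. f x < f z + 1 \<and> x \<in> U" by (rule eventually_conj)
  then obtain r where r: "r > 0" "\<And>x. dist x z < r \<Longrightarrow> f x < f z + 1 \<and> x \<in> U" by (auto simp: eventually_nhds_metric)
  have "norm (G x w) \<le> f z + 1" if "x \<in> ball z r" for x w
  proof -
    have x: "f x < f z + 1" "x \<in> U" using r(2)[of x] that by (auto simp: dist_commute)
    have fx: "f x \<ge> 0" using c1_c2_pos by (simp add: f_def)
    show ?thesis
    proof (cases "w \<in> U")
      case True
      have "norm (G x w) \<le> f x"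
        using order.trans[OF norm_G(2)[OF x(2) True] mult_left_mono[OF N_le[OF x(2) True], of c2]] c1_c2_pos by (simp add: f_def)
      then show ?thesis using x by linarith
    qed (use x fx in \<open>simp add: G_def\<close>)
  qed
  then show ?thesis using r by (intro exI[of _ r] conjI exI[of _ "f z + 1"]) (auto simp: dist_commute)
qed

text \<open>The parameter k is the share of the kernel given up for the gain in the far region; k =
  0 is the plain Schur bound. The condition \<open>k < 1 / 3\<close> keeps the fibre exponent b
  above -1, the last condition keeps the transverse exponent e above -1. Fibres are integrated first
  and exactly, then the second coordinate through the variable \<open>hdelta\<close>.\<close>

lemma schur_estimate:
  assumes k: "0 \<le> k" "k < 1 / 3" "(1 + \<alpha> / 2) * (1 - k) > 1"
  obtains D where "D \<ge> 0" "\<And>z. z \<in> U \<Longrightarrow>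
    (\<integral>\<^sup>+w. indicator U w * ennreal (N w z powr (1 - k) * (N w w powr (k / 2) * h w)) \<partial>lborel) \<le> ennreal (D * (N z z powr (- k / 2) * h z))"
proof -
  define q where "q = 1 - k"
  define b where "b = - (1 + 3 * k) / 2"
  define e where "e = (1 + \<alpha> / 2) * q - 2"
  define E where "E = (1 + \<alpha> / 2) * q"
  define e1 where "e1 = - ((1 + \<alpha> / 2) * (1 + k))"
  \<comment> \<open>The middle identity ties the kernel exponent to the weight exponent, as
    \<open>disc_kernel_nn\<close> demands.\<close>
  have b: "b > -1" "-2 * (b + 2) = - 3 * q" "b + 2 > 1" using k by (auto simp: b_def q_def field_simps)
  have e: "e > -1" "E = e + 2" using k by (auto simp: e_def E_def q_def)
  obtain D0 where D0: "D0 \<ge> 0" and tr: "\<And>\<tau>. 0 \<le> \<tau> \<Longrightarrow> \<tau> < 1 \<Longrightarrow>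
    (\<integral>\<^sup>+y. indicator {0<..<1} y * ennreal (y powr e * (1 - \<tau> * y powr \<alpha>) powr (- (b + 2))) \<partial>lborel) \<le> ennreal (D0 * (1 - \<tau>) powr (1 - (b + 2)))"
    using nn_integral_transverse[OF \<alpha> e(1) b(3)] by blast
  have [measurable]: "ball (0::complex) r \<in> sets borel" for r by auto
  have main: "(\<integral>\<^sup>+w. indicator U w * ennreal (N w z powr (1 - k) * (N w w powr (k / 2) * h w)) \<partial>lborel) \<le> ennreal (pi / (b + 1) * pi * D0 * (N z z powr (- k / 2) * h z))"
    if z: "z \<in> U" for z
  proof -
    note zD = U_bounds[OF z]
    define \<Phi> where "\<Phi> w = indicator U w * ennreal (norm (A w z) powr (- (2 + \<alpha>) * q) * norm (1 - s w z) powr (- 3 * q) * (xx w powr e1 * (1 - tau w) powr b))" for w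
    have N_powr: "N w z powr q = norm (A w z) powr (- (2 + \<alpha>) * q) * norm (1 - s w z) powr (- 3 * q)" for w
      unfolding N_def by (simp add: powr_mult powr_powr)
    have W: "N w w powr (k / 2) * h w = xx w powr e1 * (1 - tau w) powr b" if w: "w \<in> U" for w
    proof -
      have x: "xx w powr (- (2 + \<alpha>) * (k / 2)) * xx w powr (- (1 + \<alpha> / 2)) = xx w powr e1"
        unfolding powr_add[symmetric] e1_def by (rule arg_cong[where f = "\<lambda>e. xx w powr e"]) (simp add: field_simps)
      have t: "(1 - tau w) powr (- 3 * (k / 2)) * (1 - tau w) powr (- (1 / 2)) = (1 - tau w) powr b"
        unfolding powr_add[symmetric] b_def by (rule arg_cong[where f = "\<lambda>e. (1 - tau w) powr e"]) (simp add: field_simps)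
      have "N w w powr (k / 2) * h w = (xx w powr (- (2 + \<alpha>) * (k / 2)) * xx w powr (- (1 + \<alpha> / 2))) * ((1 - tau w) powr (- 3 * (k / 2)) * (1 - tau w) powr (- (1 / 2)))"
        unfolding N_diag[OF w] using w by (simp add: h_def powr_mult powr_powr)
      then show ?thesis unfolding x t .
    qed
    have I\<Phi>: "(\<integral>\<^sup>+w. indicator U w * ennreal (N w z powr (1 - k) * (N w w powr (k / 2) * h w)) \<partial>lborel) = integral\<^sup>N lborel \<Phi>"
    proof (rule nn_integral_cong)
      fix w show "indicator U w * ennreal (N w z powr (1 - k) * (N w w powr (k / 2) * h w)) = \<Phi> w"
        unfolding \<Phi>_def N_powr[unfolded q_def, folded q_def] by (cases "w \<in> U") (simp_all add: W N_powr q_def[symmetric] mult.assoc)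
    qed
    have mA: "(\<lambda>w. norm (A w z)) \<in> borel_measurable borel"
      by (intro borel_measurable_continuous_onI continuous_intros) (simp add: A_def continuous_intros)
    have ms: "(\<lambda>w. indicator U w *\<^sub>R norm (1 - s w z)) \<in> borel_measurable borel"
    proof (intro borel_measurable_continuous_on_indicator U_meas continuous_intros)
      have "continuous_on U (\<lambda>w. s (fst (w, z)) (snd (w, z)))"
        by (rule continuous_on_compose2[OF cont_s]) (use z in \<open>auto intro!: continuous_intros\<close>)
      then show "continuous_on U (\<lambda>w. s w z)" by simp
    qed
    \<comment> \<open>A second indicator inside the product replaces the factor with
      \<open>s\<close>, shown continuous only on the domain, by a globally Borel function.\<close>
    have \<Phi>_eq: "\<Phi> = (\<lambda>w. indicator U w * ennreal (norm (A w z) powr (- (2 + \<alpha>) * q) * (indicator U w *\<^sub>R norm (1 - s w z)) powr (- 3 * q) * (xx w powr e1 * (1 - tau w) powr b)))"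
      by (auto simp: \<Phi>_def indicator_def fun_eq_iff)
    note [measurable] = mA ms
    have \<Phi>_m: "(\<lambda>w. indicator U w * ennreal (norm (A w z) powr (- (2 + \<alpha>) * q) * (indicator U w *\<^sub>R norm (1 - s w z)) powr (- 3 * q) * (xx w powr e1 * (1 - tau w) powr b))) \<in> borel_measurable borel"
      by measurable
    have [measurable]: "\<Phi> \<in> borel_measurable borel" unfolding \<Phi>_eq by (rule \<Phi>_m)
    have "integral\<^sup>N lborel \<Phi> = (\<integral>\<^sup>+w2. (\<integral>\<^sup>+w1. \<Phi> (w1, w2) \<partial>lborel) \<partial>lborel)"
      by (subst lborel_pair.nn_integral_snd) (simp_all add: lborel_prod)
    also have "\<dots> = (\<integral>\<^sup>+w2. ennreal (pi / (b + 1) * xx z powr (- E)) * (indicator (ball 0 1) w2 * (ennreal (1 / (1 - (norm w2)\<^sup>2)\<^sup>2) *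
         ennreal (hdelta (snd z) w2 powr E * (1 - tau z * hdelta (snd z) w2 powr \<alpha>) powr (- (b + 2))))) \<partial>lborel)"
    proof (rule nn_integral_cong)
      fix w2 :: complex
      show "(\<integral>\<^sup>+w1. \<Phi> (w1, w2) \<partial>lborel) = ennreal (pi / (b + 1) * xx z powr (- E)) * (indicator (ball 0 1) w2 * (ennreal (1 / (1 - (norm w2)\<^sup>2)\<^sup>2) *
         ennreal (hdelta (snd z) w2 powr E * (1 - tau z * hdelta (snd z) w2 powr \<alpha>) powr (- (b + 2)))))"
      proof (cases "norm w2 < 1")
        case False
        then have "(w1, w2) \<notin> U" for w1 by (simp add: mem_U)
        then show ?thesis using False by (simp add: \<Phi>_def)
      next
        case True
        define x where "x = 1 - (norm w2)\<^sup>2"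
        define \<rho> where "\<rho> = x powr (\<alpha> / 2)"
        define a where "a = 1 - w2 * cnj (snd z)"
        define \<sigma> where "\<sigma> = complex_of_real \<rho> * (cnj (fst z) / a powr complex_of_real \<alpha>)"
        define \<delta> where "\<delta> = hdelta (snd z) w2"
        have x: "x > 0" using True by (simp add: x_def abs_square_less_1)
        have \<rho>: "\<rho> > 0" "\<rho>\<^sup>2 = x powr \<alpha>" using x by (simp_all add: \<rho>_def power2_eq_square powr_add[symmetric])
        have w0: "(0, w2) \<in> U" using True by (simp add: mem_U tau_def)
        have a: "norm a > 0" using A_Re(2)[OF w0 z] by (simp add: a_def A_def)
        have Aa: "A (w1, w2) z = a" for w1 by (simp add: A_def a_def)
        have \<delta>: "\<delta> = xx z * x / (norm a)\<^sup>2" by (simp add: \<delta>_def hdelta_def xx_def x_def a_def mult.commute)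
        have \<delta>0: "\<delta> > 0" using x zD a by (simp add: \<delta>)
        have \<delta>1: "\<delta> \<le> 1" using A_ge[of "(0, w2)" z] a by (simp add: \<delta> Aa xx_def x_def mult.commute)
        \<comment> \<open>Rescaling the fibre to the unit disc sends the kernel parameter to
          \<sigma>; for fixed \<open>z\<close> its modulus depends on \<open>w2\<close> only through
          \<open>hdelta\<close>.\<close>
        have n\<sigma>: "(norm \<sigma>)\<^sup>2 = tau z * \<delta> powr \<alpha>"
        proof -
          have "((norm a)\<^sup>2) powr \<alpha> = (norm a powr \<alpha>)\<^sup>2" using a by (simp add: power2_eq_square powr_mult)
          then have "\<delta> powr \<alpha> = xx z powr \<alpha> * x powr \<alpha> / (norm a powr \<alpha>)\<^sup>2"
            unfolding \<delta> using x zD a by (simp add: powr_divide powr_mult)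
          moreover have "(norm \<sigma>)\<^sup>2 = x powr \<alpha> * (norm (fst z))\<^sup>2 / (norm a powr \<alpha>)\<^sup>2"
            unfolding \<sigma>_def using \<rho> by (simp add: norm_mult norm_divide norm_powr_real_powr' power_mult_distrib power_divide)
          ultimately show ?thesis using zD by (simp add: tau_def)
        qed
        have "(norm \<sigma>)\<^sup>2 \<le> tau z"
          unfolding n\<sigma> using powr_mono2[of \<alpha> \<delta> 1] \<delta>0 \<delta>1 \<alpha> zD by (simp add: mult_left_le)
        then have "(norm \<sigma>)\<^sup>2 < 1" using zD(5) by linarith
        then have \<sigma>: "norm \<sigma> < 1" by (simp add: abs_square_less_1)
        define g where "g w1 = ennreal (norm a powr (- (2 + \<alpha>) * q) * norm (1 - w1 * (cnj (fst z) / a powr complex_of_real \<alpha>)) powr (- 3 * q) * (x powr e1 * (1 - (norm w1)\<^sup>2 / x powr \<alpha>) powr b))" for w1 :: complex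
        have [measurable]: "g \<in> borel_measurable borel" unfolding g_def by measurable
        have ti: "tau (w1, w2) = (norm w1)\<^sup>2 / x powr \<alpha>" for w1 by (simp add: tau_def xx_def x_def)
        have mU: "(w1, w2) \<in> U \<longleftrightarrow> w1 \<in> ball 0 \<rho>" for w1
        proof -
          have "(w1, w2) \<in> U \<longleftrightarrow> (norm w1)\<^sup>2 < \<rho>\<^sup>2" using True x by (simp add: mem_U ti \<rho>)
          also have "\<dots> \<longleftrightarrow> norm w1 < \<rho>" using \<rho>(1) by (metis less_eq_real_def norm_ge_zero power2_less_imp_less power_strict_mono zero_less_numeral)
          finally show ?thesis by simp
        qed
        have "(\<integral>\<^sup>+w1. \<Phi> (w1, w2) \<partial>lborel) = (\<integral>\<^sup>+w1. indicator (ball 0 (norm (complex_of_real \<rho>) * 1)) w1 * g w1 \<partial>lborel)"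
        proof (rule nn_integral_cong)
          fix w1
          have r: "norm (complex_of_real \<rho>) * 1 = \<rho>" using \<rho> by simp
          have "s (w1, w2) z = w1 * (cnj (fst z) / a powr complex_of_real \<alpha>)" by (simp add: s_def Aa)
          then show "\<Phi> (w1, w2) = indicator (ball 0 (norm (complex_of_real \<rho>) * 1)) w1 * g w1"
            unfolding \<Phi>_def g_def r Aa ti using mU[of w1] by (simp add: indicator_def xx_def x_def)
        qed
        also have "\<dots> = (\<integral>\<^sup>+\<zeta>. indicator (ball 0 1) \<zeta> * (ennreal ((norm (complex_of_real \<rho>))\<^sup>2) * g (complex_of_real \<rho> * \<zeta>)) \<partial>lborel)"
          by (rule area_disc_nn) (use \<rho> in auto)
        also have "\<dots> = (\<integral>\<^sup>+\<zeta>. ennreal (x powr \<alpha> * (norm a powr (- (2 + \<alpha>) * q) * x powr e1)) *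
            (indicator (ball 0 1) \<zeta> * ennreal (norm (1 - \<zeta> * \<sigma>) powr (-2 * (b + 2)) * (1 - (norm \<zeta>)\<^sup>2) powr b)) \<partial>lborel)"
        proof (rule nn_integral_cong)
          fix \<zeta> :: complex
          have n: "(norm (complex_of_real \<rho>))\<^sup>2 = x powr \<alpha>" using \<rho> by simp
          have "complex_of_real \<rho> * \<zeta> * (cnj (fst z) / a powr complex_of_real \<alpha>) = \<zeta> * \<sigma>" by (simp add: \<sigma>_def)
          moreover have "(norm (complex_of_real \<rho> * \<zeta>))\<^sup>2 / x powr \<alpha> = (norm \<zeta>)\<^sup>2"
            using x unfolding norm_mult power_mult_distrib n by simp
          ultimately have "g (complex_of_real \<rho> * \<zeta>) = ennreal (norm a powr (- (2 + \<alpha>) * q) * x powr e1 * (norm (1 - \<zeta> * \<sigma>) powr (-2 * (b + 2)) * (1 - (norm \<zeta>)\<^sup>2) powr b))"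
            unfolding g_def b(2) by (simp add: mult_ac)
          then show "indicator (ball 0 1) \<zeta> * (ennreal ((norm (complex_of_real \<rho>))\<^sup>2) * g (complex_of_real \<rho> * \<zeta>)) =
             ennreal (x powr \<alpha> * (norm a powr (- (2 + \<alpha>) * q) * x powr e1)) *
            (indicator (ball 0 1) \<zeta> * ennreal (norm (1 - \<zeta> * \<sigma>) powr (-2 * (b + 2)) * (1 - (norm \<zeta>)\<^sup>2) powr b))"
            unfolding n by (simp add: ennreal_mult'[symmetric] mult_ac)
        qed
        also have "\<dots> = ennreal (x powr \<alpha> * (norm a powr (- (2 + \<alpha>) * q) * x powr e1)) * ennreal (pi / (b + 1) * (1 - (norm \<sigma>)\<^sup>2) powr (- (b + 2)))"
          by (subst nn_integral_cmult) (simp_all only: disc_kernel_nn[OF b(1) \<sigma>], measurable)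
        also have "\<dots> = ennreal (x powr \<alpha> * (norm a powr (- (2 + \<alpha>) * q) * x powr e1) * (pi / (b + 1) * (1 - tau z * \<delta> powr \<alpha>) powr (- (b + 2))))"
          unfolding n\<sigma> using b by (simp add: ennreal_mult'[symmetric])
        \<comment> \<open>All powers of x and of the modulus of a collect into the invariant density
          \<open>1 / x\<^sup>2\<close> and a power of \<open>hdelta\<close>. The exponents match
          because of the value \<open>1 + \<alpha> / 2\<close> in \<open>h\<close>.\<close>
        also have "x powr \<alpha> * (norm a powr (- (2 + \<alpha>) * q) * x powr e1) = xx z powr (- E) * (1 / x\<^sup>2 * \<delta> powr E)"
        proof -
          have "\<delta> powr E = xx z powr E * x powr E / ((norm a)\<^sup>2) powr E" unfolding \<delta> using x zD a by (simp add: powr_divide powr_mult)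
          also have "((norm a)\<^sup>2) powr E = norm a powr (2 * E)" using powr_powr[of "norm a" 2 E] a by simp
          also have "xx z powr E * x powr E / norm a powr (2 * E) = xx z powr E * x powr E * norm a powr (- (2 * E))" by (simp add: powr_minus_divide)
          finally have d: "\<delta> powr E = xx z powr E * x powr E * norm a powr (- (2 * E))" .
          have xz: "xx z powr (- E) * xx z powr E = 1" using zD by (simp add: powr_add[symmetric])
          have "x powr \<alpha> * x powr e1 = x powr (E - 2)" unfolding powr_add[symmetric] E_def e1_def q_def
            by (rule arg_cong[where f = "\<lambda>e. x powr e"]) (simp add: field_simps)
          also have "\<dots> = x powr E / x\<^sup>2" using x by (simp add: powr_diff)
          finally have xe: "x powr \<alpha> * x powr e1 = x powr E / x\<^sup>2" .
          have ne: "- (2 + \<alpha>) * q = - (2 * E)" by (simp add: E_def field_simps)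
          have "xx z powr (- E) * (1 / x\<^sup>2 * \<delta> powr E) = (xx z powr (- E) * xx z powr E) * (x powr E / x\<^sup>2) * norm a powr (- (2 * E))"
            unfolding d by simp
          also have "\<dots> = x powr \<alpha> * (norm a powr (- (2 + \<alpha>) * q) * x powr e1)" unfolding xz xe[symmetric] ne by simp
          finally show ?thesis by simp
        qed
        finally have "(\<integral>\<^sup>+w1. \<Phi> (w1, w2) \<partial>lborel) = ennreal (xx z powr (- E) * (1 / x\<^sup>2 * \<delta> powr E) * (pi / (b + 1) * (1 - tau z * \<delta> powr \<alpha>) powr (- (b + 2))))" .
        also have "\<dots> = ennreal ((pi / (b + 1) * xx z powr (- E)) * (1 / x\<^sup>2 * (\<delta> powr E * (1 - tau z * \<delta> powr \<alpha>) powr (- (b + 2)))))"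
          by (simp add: mult_ac)
        also have "\<dots> = ennreal (pi / (b + 1) * xx z powr (- E)) * (ennreal (1 / x\<^sup>2) * ennreal (\<delta> powr E * (1 - tau z * \<delta> powr \<alpha>) powr (- (b + 2))))"
          using b by (subst ennreal_mult, simp, simp, subst ennreal_mult, simp_all)
        finally show ?thesis using True by (simp add: x_def \<delta>_def)
      qed
    qed
    also have "\<dots> = ennreal (pi / (b + 1) * xx z powr (- E)) * (\<integral>\<^sup>+w2. indicator (ball 0 1) w2 * (ennreal (1 / (1 - (norm w2)\<^sup>2)\<^sup>2) *
         ennreal (hdelta (snd z) w2 powr E * (1 - tau z * hdelta (snd z) w2 powr \<alpha>) powr (- (b + 2)))) \<partial>lborel)"
    proof (rule nn_integral_cmult)
      have [measurable]: "hdelta (snd z) \<in> borel_measurable borel" unfolding hdelta_def by measurable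
      show "(\<lambda>w2. indicator (ball 0 1) w2 * (ennreal (1 / (1 - (norm w2)\<^sup>2)\<^sup>2) *
         ennreal (hdelta (snd z) w2 powr E * (1 - tau z * hdelta (snd z) w2 powr \<alpha>) powr (- (b + 2))))) \<in> borel_measurable lborel"
        by measurable
    qed
    also have "(\<integral>\<^sup>+w2. indicator (ball 0 1) w2 * (ennreal (1 / (1 - (norm w2)\<^sup>2)\<^sup>2) *
         ennreal (hdelta (snd z) w2 powr E * (1 - tau z * hdelta (snd z) w2 powr \<alpha>) powr (- (b + 2)))) \<partial>lborel) =
       ennreal pi * (\<integral>\<^sup>+y. indicator {0<..<1} y * (ennreal (1 / y\<^sup>2) * ennreal (y powr E * (1 - tau z * y powr \<alpha>) powr (- (b + 2)))) \<partial>lborel)"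
      by (rule invariant_radial_nn[where g = "\<lambda>y. ennreal (y powr E * (1 - tau z * y powr \<alpha>) powr (- (b + 2)))"]) (use zD in auto)
    also have "(\<integral>\<^sup>+y. indicator {0<..<1} y * (ennreal (1 / y\<^sup>2) * ennreal (y powr E * (1 - tau z * y powr \<alpha>) powr (- (b + 2)))) \<partial>lborel) =
       (\<integral>\<^sup>+y. indicator {0<..<1} y * ennreal (y powr e * (1 - tau z * y powr \<alpha>) powr (- (b + 2))) \<partial>lborel)"
    proof (rule nn_integral_cong)
      fix y :: real
      show "indicator {0<..<1} y * (ennreal (1 / y\<^sup>2) * ennreal (y powr E * (1 - tau z * y powr \<alpha>) powr (- (b + 2)))) =
        indicator {0<..<1} y * ennreal (y powr e * (1 - tau z * y powr \<alpha>) powr (- (b + 2)))"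
      proof (cases "y \<in> {0<..<1}")
        case True
        then have "1 / y\<^sup>2 * (y powr E * (1 - tau z * y powr \<alpha>) powr (- (b + 2))) = y powr e * (1 - tau z * y powr \<alpha>) powr (- (b + 2))"
          by (simp add: e(2) powr_add)
        then show ?thesis by (simp add: ennreal_mult'[symmetric])
      qed simp
    qed
    also have "ennreal (pi / (b + 1) * xx z powr (- E)) * (ennreal pi * (\<integral>\<^sup>+y. indicator {0<..<1} y * ennreal (y powr e * (1 - tau z * y powr \<alpha>) powr (- (b + 2))) \<partial>lborel))
      \<le> ennreal (pi / (b + 1) * xx z powr (- E)) * (ennreal pi * ennreal (D0 * (1 - tau z) powr (1 - (b + 2))))"
      by (intro mult_left_mono tr zD) auto
    also have "\<dots> = ennreal (pi / (b + 1) * pi * D0 * (xx z powr (- E) * (1 - tau z) powr (1 - (b + 2))))"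
      using b D0 by (simp add: ennreal_mult'[symmetric] mult_ac)
    also have "xx z powr (- E) * (1 - tau z) powr (1 - (b + 2)) = N z z powr (- k / 2) * h z"
    proof -
      have x: "xx z powr (- (2 + \<alpha>) * (- k / 2)) * xx z powr (- (1 + \<alpha> / 2)) = xx z powr (- E)"
        unfolding powr_add[symmetric] E_def q_def by (rule arg_cong[where f = "\<lambda>e. xx z powr e"]) (simp add: field_simps)
      have t: "(1 - tau z) powr (- 3 * (- k / 2)) * (1 - tau z) powr (- (1 / 2)) = (1 - tau z) powr (1 - (b + 2))"
        unfolding powr_add[symmetric] b_def by (rule arg_cong[where f = "\<lambda>e. (1 - tau z) powr e"]) (simp add: field_simps)
      have "N z z powr (- k / 2) * h z = (xx z powr (- (2 + \<alpha>) * (- k / 2)) * xx z powr (- (1 + \<alpha> / 2))) * ((1 - tau z) powr (- 3 * (- k / 2)) * (1 - tau z) powr (- (1 / 2)))"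
        unfolding N_diag[OF z] using z by (simp add: h_def powr_mult powr_powr)
      then show ?thesis unfolding x t by simp
    qed
    finally show ?thesis unfolding I\<Phi> .
  qed
  show thesis by (rule that[OF _ main]) (use b D0 in auto)
qed

end

section \<open>Separating near and far points\<close>

text \<open>The size at the middle point is comparable with both ends,
  \<open>q \<le> 4 * R * p\<close> and \<open>q \<le> 4 * R * r\<close>, so it can be traded for an
  end in each bound. The triangle inequality then gives the constant 32 (4 + 4) = 256.\<close>

lemma quasi_triangle_square:
  fixes p q r ab bc ac R :: real
  assumes pos: "p > 0" "q > 0" "r > 0" "ab \<ge> 0" "bc \<ge> 0" "ac \<ge> 0" "R \<ge> 0"
    and ab: "ab\<^sup>2 \<le> R * (p * q)" and bc: "bc\<^sup>2 \<le> R * (q * r)"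
    and le: "p \<le> 2 * ab" "q \<le> 2 * ab" "q \<le> 2 * bc" "r \<le> 2 * bc" and tri: "ac \<le> 4 * (ab + bc)"
  shows "ac\<^sup>2 \<le> 256 * R\<^sup>2 * (p * r)"
proof -
  have q1: "q \<le> 4 * R * p"
  proof -
    have "q\<^sup>2 \<le> (2 * ab)\<^sup>2" using le(2) pos by (intro power_mono) auto
    also have "\<dots> \<le> 4 * (R * (p * q))" using ab by (simp add: power_mult_distrib)
    finally have "q * q \<le> (4 * R * p) * q" by (simp add: power2_eq_square mult_ac)
    then show ?thesis using pos by (simp only: mult_le_cancel_right_pos)
  qed
  have q2: "q \<le> 4 * R * r"
  proof -
    have "q\<^sup>2 \<le> (2 * bc)\<^sup>2" using le(3) pos by (intro power_mono) auto
    also have "\<dots> \<le> 4 * (R * (q * r))" using bc by (simp add: power_mult_distrib)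
    finally have "q * q \<le> (4 * R * r) * q" by (simp add: power2_eq_square mult_ac)
    then show ?thesis using pos by (simp only: mult_le_cancel_right_pos)
  qed
  have "R * (p * q) \<le> R * (p * (4 * R * r))" using pos q2 by (intro mult_left_mono) auto
  with ab have 1: "ab\<^sup>2 \<le> 4 * R\<^sup>2 * (p * r)" by (simp add: power2_eq_square mult_ac)
  have "R * (q * r) \<le> R * ((4 * R * p) * r)" using pos q1 by (intro mult_left_mono mult_right_mono) auto
  with bc have 2: "bc\<^sup>2 \<le> 4 * R\<^sup>2 * (p * r)" by (simp add: power2_eq_square mult_ac)
  have "ac\<^sup>2 \<le> (4 * (ab + bc))\<^sup>2" using tri pos by (intro power_mono) auto
  also have "\<dots> \<le> 32 * (ab\<^sup>2 + bc\<^sup>2)" 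
  proof -
    have "32 * (ab\<^sup>2 + bc\<^sup>2) - (4 * (ab + bc))\<^sup>2 = 16 * (ab - bc)\<^sup>2" by (simp add: power2_eq_square algebra_simps)
    then show ?thesis by (metis diff_ge_0_iff_ge mult_nonneg_nonneg zero_le_numeral zero_le_power2)
  qed
  finally show ?thesis using 1 2 by simp
qed

lemma Cauchy_Schwarz_complex_sum:
  fixes x y :: "nat \<Rightarrow> complex"
  shows "(norm (\<Sum>n<m. x n * cnj (y n)))\<^sup>2 \<le> Re (\<Sum>n<m. x n * cnj (x n)) * Re (\<Sum>n<m. y n * cnj (y n))"
proof -
  have sq: "Re (\<Sum>n<m. x n * cnj (x n)) = (\<Sum>n<m. (norm (x n))\<^sup>2)" for x :: "nat \<Rightarrow> complex"
    by (simp add: complex_norm_square[symmetric] del: of_real_power)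
  have "norm (\<Sum>n<m. x n * cnj (y n)) \<le> (\<Sum>n<m. norm (x n) * norm (y n))"
    by (rule order.trans[OF norm_sum]) (simp add: norm_mult)
  then have "(norm (\<Sum>n<m. x n * cnj (y n)))\<^sup>2 \<le> (\<Sum>n<m. norm (x n) * norm (y n))\<^sup>2" by (intro power_mono) auto
  also have "\<dots> \<le> (\<Sum>n<m. (norm (x n))\<^sup>2) * (\<Sum>n<m. (norm (y n))\<^sup>2)" by (rule Cauchy_Schwarz_ineq_sum)
  finally show ?thesis by (simp only: sq)
qed

context hartogs
begin

text \<open>Under the root stand the coefficients of the binomial series of 1 - x to the power
  -\<alpha>, which are nonnegative because \<open>\<alpha> > 0\<close>.\<close>

definition gram_coord :: "nat \<Rightarrow> complex \<times> complex \<Rightarrow> complex" where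
  "gram_coord n z = fst z * complex_of_real (sqrt (pochhammer \<alpha> n / fact n)) * snd z ^ n"

text \<open>Expanding the binomial series exhibits \<open>s\<close> as a Gram kernel of vectors in the unit ball of
  \<open>\<ell>\<^sup>2\<close>; this gives the quasi-triangle inequality for \<open>\<bar>1 - s\<bar>\<close>.\<close>

lemma s_sums:
  assumes z: "z \<in> U" and w: "w \<in> U"
  shows "(\<lambda>n. gram_coord n z * cnj (gram_coord n w)) sums s z w"
proof -
  define q where "q = snd z * cnj (snd w)"
  have q: "norm (- q) < 1"
    using mult_strict_mono[of "norm (snd z)" 1 "norm (snd w)" 1] U_bounds(1)[OF z] U_bounds(1)[OF w] by (simp add: q_def norm_mult)
  have c0: "pochhammer \<alpha> n / fact n \<ge> 0" for n using \<alpha> by (simp add: pochhammer_nonneg)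
  have "(\<lambda>n. ((- complex_of_real \<alpha>) gchoose n) * (- q) ^ n) sums (1 + - q) powr (- complex_of_real \<alpha>)"
    by (rule gen_binomial_complex[OF q])
  moreover have "((- complex_of_real \<alpha>) gchoose n) * (- q) ^ n = complex_of_real (pochhammer \<alpha> n / fact n) * q ^ n" for n
  proof -
    have "(- 1) ^ n * (- q) ^ n = q ^ n" by (simp flip: power_mult_distrib)
    then show ?thesis by (simp add: gbinomial_pochhammer pochhammer_of_real)
  qed
  ultimately have "(\<lambda>n. complex_of_real (pochhammer \<alpha> n / fact n) * q ^ n) sums A z w powr (- complex_of_real \<alpha>)"
    by (simp add: A_def q_def)
  then have "(\<lambda>n. (fst z * cnj (fst w)) * (complex_of_real (pochhammer \<alpha> n / fact n) * q ^ n)) sums ((fst z * cnj (fst w)) * A z w powr (- complex_of_real \<alpha>))"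
    by (rule sums_mult)
  moreover have "(fst z * cnj (fst w)) * (complex_of_real (pochhammer \<alpha> n / fact n) * q ^ n) = gram_coord n z * cnj (gram_coord n w)" for n
  proof -
    have "complex_of_real (pochhammer \<alpha> n / fact n) = complex_of_real (sqrt (pochhammer \<alpha> n / fact n)) * complex_of_real (sqrt (pochhammer \<alpha> n / fact n))"
      unfolding of_real_mult[symmetric] by (simp only: real_sqrt_mult_self abs_of_nonneg[OF c0[of n]])
    then show ?thesis by (simp only: gram_coord_def q_def complex_cnj_mult complex_cnj_power complex_cnj_complex_of_real power_mult_distrib) (simp add: mult_ac)
  qed
  moreover have "(fst z * cnj (fst w)) * A z w powr (- complex_of_real \<alpha>) = s z w"
    by (simp add: s_def powr_minus divide_inverse)
  ultimately show ?thesis by simp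
qed

text \<open>Cauchy-Schwarz for the differences a - b and b - c of the Gram vectors, taken on partial
  sums and passed to the limit.\<close>

lemma s_gram:
  assumes a: "a \<in> U" and b: "b \<in> U" and c: "c \<in> U"
  shows "(norm (s a b - s a c - s b b + s b c))\<^sup>2 \<le>
    Re (s a a - s a b - s b a + s b b) * Re (s b b - s b c - s c b + s c c)"
proof -
  define S where "S m x y = (\<Sum>n<m. gram_coord n x * cnj (gram_coord n y))" for m x y
  have lim: "(\<lambda>m. S m x y) \<longlonglongrightarrow> s x y" if "x \<in> U" "y \<in> U" for x y
    using s_sums[OF that] by (simp add: sums_def S_def)
  have e: "(\<Sum>n<m. (gram_coord n x - gram_coord n y) * cnj (gram_coord n u - gram_coord n v)) = S m x u - S m x v - S m y u + S m y v" for m x y u v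
    by (simp add: S_def algebra_simps sum.distrib sum_subtractf)
  have "(norm (S m a b - S m a c - S m b b + S m b c))\<^sup>2 \<le>
    Re (S m a a - S m a b - S m b a + S m b b) * Re (S m b b - S m b c - S m c b + S m c c)" for m
    using Cauchy_Schwarz_complex_sum[where m = m and x = "\<lambda>n. gram_coord n a - gram_coord n b" and y = "\<lambda>n. gram_coord n b - gram_coord n c"] unfolding e .
  moreover have "(\<lambda>m. (norm (S m a b - S m a c - S m b b + S m b c))\<^sup>2) \<longlonglongrightarrow> (norm (s a b - s a c - s b b + s b c))\<^sup>2"
    by (intro tendsto_intros lim a b c)
  moreover have "(\<lambda>m. Re (S m a a - S m a b - S m b a + S m b b) * Re (S m b b - S m b c - S m c b + S m c c)) \<longlonglongrightarrow>
      Re (s a a - s a b - s b a + s b b) * Re (s b b - s b c - s c b + s c c)"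
    by (intro tendsto_intros lim a b c)
  ultimately show ?thesis using LIMSEQ_le by blast
qed

lemma one_minus_tau_le: assumes z: "z \<in> U" and w: "w \<in> U"
  shows "1 - tau z \<le> 2 * norm (1 - s z w)" "1 - tau w \<le> 2 * norm (1 - s z w)"
proof -
  have r: "sqrt (tau z) \<le> 1" "sqrt (tau w) \<le> 1" "sqrt (tau z) \<ge> 0" "sqrt (tau w) \<ge> 0" using U_bounds[OF z] U_bounds[OF w] by auto
  have *: "1 - t \<le> 2 * (1 - sqrt t)" if "0 \<le> t" for t
  proof -
    have "2 * (1 - x) - (1 - x\<^sup>2) = (1 - x)\<^sup>2" for x :: real by (simp add: power2_eq_square algebra_simps)
    from this[of "sqrt t"] have "2 * (1 - sqrt t) - (1 - t) \<ge> 0" using that by (metis real_sqrt_pow2 zero_le_power2)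
    then show ?thesis by simp
  qed
  have "sqrt (tau z) * sqrt (tau w) \<le> sqrt (tau z)" "sqrt (tau z) * sqrt (tau w) \<le> sqrt (tau w)"
    using r by (simp_all add: mult_left_le mult_left_le_one_le)
  then have "norm (1 - s z w) \<ge> 1 - sqrt (tau z)" "norm (1 - s z w) \<ge> 1 - sqrt (tau w)"
    using one_minus_s(1)[OF z w] by simp_all
  then show "1 - tau z \<le> 2 * norm (1 - s z w)" "1 - tau w \<le> 2 * norm (1 - s z w)"
    using *[OF U_bounds(4)[OF z]] *[OF U_bounds(4)[OF w]] by simp_all
qed

text \<open>In terms of Gram vectors, the squared length of a - b is at most twice the modulus of
  \<open>1 - s a b\<close>, so Cauchy-Schwarz bounds the cross term \<open>T\<close> by x +
  y.\<close>

lemma s_triangle: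
  assumes a: "a \<in> U" and b: "b \<in> U" and c: "c \<in> U"
  shows "norm (1 - s a c) \<le> 4 * (norm (1 - s a b) + norm (1 - s b c))"
proof -
  define T where "T = s a b - s a c - s b b + s b c"
  define x where "x = norm (1 - s a b)"
  define y where "y = norm (1 - s b c)"
  have half: "Re (s u u - s u v - s v u + s v v) \<le> 2 * norm (1 - s u v)"
    "Re (s u u - s u v - s v u + s v v) \<ge> 0" if u: "u \<in> U" and v: "v \<in> U" for u v
  proof -
    have "Re (s v u) = Re (s u v)" using cnj_s[OF u v] by (metis cnj.simps(1))
    then have e: "Re (s u u - s u v - s v u + s v v) = 2 * Re (1 - s u v) - (1 - tau u) - (1 - tau v)"
      by (simp add: s_diag u v)
    then show "Re (s u u - s u v - s v u + s v v) \<le> 2 * norm (1 - s u v)"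
      using complex_Re_le_cmod[of "1 - s u v"] U_bounds[OF u] U_bounds[OF v] by linarith
    have "Re (s u v) \<le> sqrt (tau u) * sqrt (tau v)"
      using complex_Re_le_cmod[of "s u v"] real_le_rsqrt[OF s_le(1)[OF u v]] by (simp add: real_sqrt_mult)
    moreover have "(sqrt (tau u))\<^sup>2 + (sqrt (tau v))\<^sup>2 - 2 * (sqrt (tau u) * sqrt (tau v)) = (sqrt (tau u) - sqrt (tau v))\<^sup>2"
      by (simp add: power2_eq_square algebra_simps)
    then have "tau u + tau v - 2 * (sqrt (tau u) * sqrt (tau v)) \<ge> 0" using U_bounds[OF u] U_bounds[OF v] by (metis real_sqrt_pow2 zero_le_power2)
    ultimately show "Re (s u u - s u v - s v u + s v v) \<ge> 0" unfolding e by simp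
  qed
  have "(norm T)\<^sup>2 \<le> (2 * x) * (2 * y)"
    unfolding T_def x_def y_def
    by (rule order.trans[OF s_gram[OF a b c]]) (intro mult_mono half a b c, auto)
  also have "\<dots> \<le> (x + y)\<^sup>2"
  proof -
    have "(x + y)\<^sup>2 - (2 * x) * (2 * y) = (x - y)\<^sup>2" by (simp add: power2_eq_square algebra_simps)
    then show ?thesis by (metis diff_ge_0_iff_ge zero_le_power2)
  qed
  finally have T: "norm T \<le> x + y" by (rule power2_le_imp_le) (simp add: x_def y_def)
  \<comment> \<open>Inserting b leaves the cross term, the two distances and the diagonal defect
    \<open>1 - tau b\<close>, which \<open>one_minus_tau_le\<close> absorbs into y.\<close>
  have "1 - s a c = T + (1 - s a b) + ((1 - s b c) - complex_of_real (1 - tau b))"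
    by (simp add: T_def s_diag[OF b])
  then have "norm (1 - s a c) \<le> norm (T + (1 - s a b)) + norm ((1 - s b c) - complex_of_real (1 - tau b))"
    by (metis norm_triangle_ineq)
  also have "norm (T + (1 - s a b)) \<le> norm T + x" unfolding x_def by (rule norm_triangle_ineq)
  also have "norm ((1 - s b c) - complex_of_real (1 - tau b)) \<le> y + norm (complex_of_real (1 - tau b))"
    unfolding y_def by (rule norm_triangle_ineq4)
  also have "norm (complex_of_real (1 - tau b)) \<le> 2 * y"
    unfolding norm_of_real y_def using one_minus_tau_le(1)[OF b c] U_bounds[OF b] by simp
  finally have F: "norm (1 - s a c) \<le> norm T + x + (y + 2 * y)" by simp
  have "x \<ge> 0" "y \<ge> 0" by (simp_all add: x_def y_def)
  with F T have "norm (1 - s a c) \<le> 4 * (x + y)" by argo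
  then show ?thesis by (simp only: x_def y_def)
qed

lemma A_triangle:
  assumes a: "a \<in> U" and b: "b \<in> U" and c: "c \<in> U"
  shows "norm (A a c) \<le> norm (A a b) + norm (A b c)"
proof -
  have "(norm (snd b - snd c))\<^sup>2 \<le> (norm (A b c))\<^sup>2" using A_square[of b c] U_bounds[OF b] U_bounds[OF c] by simp
  then have bc: "norm (snd b - snd c) \<le> norm (A b c)" by (rule power2_le_imp_le) simp
  have "A a c = A a b + snd a * cnj (snd b - snd c)" by (simp add: A_def algebra_simps)
  then have "norm (A a c) \<le> norm (A a b) + norm (snd a * cnj (snd b - snd c))" by (metis norm_triangle_ineq)
  also have "norm (snd a * cnj (snd b - snd c)) \<le> norm (snd b - snd c)"
    unfolding norm_mult complex_mod_cnj using U_bounds(1)[OF a] by (simp add: mult_left_le_one_le)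
  finally show ?thesis using bc by simp
qed

lemma xx_le: assumes z: "z \<in> U" and w: "w \<in> U" shows "xx z \<le> 2 * norm (A z w)" "xx w \<le> 2 * norm (A z w)"
proof -
  have *: "1 - x\<^sup>2 \<le> 2 * (1 - x)" for x :: real
  proof -
    have "2 * (1 - x) - (1 - x\<^sup>2) = (1 - x)\<^sup>2" by (simp add: power2_eq_square algebra_simps)
    then show ?thesis by (metis diff_ge_0_iff_ge zero_le_power2)
  qed
  have "norm (snd z * cnj (snd w)) \<le> norm (snd z)" "norm (snd z * cnj (snd w)) \<le> norm (snd w)"
    using U_bounds(1)[OF w] U_bounds(1)[OF z] by (simp_all add: norm_mult mult_left_le mult_left_le_one_le)
  moreover have "norm (A z w) \<ge> 1 - norm (snd z * cnj (snd w))"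
    unfolding A_def using norm_triangle_ineq2[of 1 "snd z * cnj (snd w)"] by simp
  ultimately show "xx z \<le> 2 * norm (A z w)" "xx w \<le> 2 * norm (A z w)"
    using *[of "norm (snd z)"] *[of "norm (snd w)"] unfolding xx_def by simp_all
qed

text \<open>Both quotients compared with R are at least 1 by \<open>A_ge\<close> and
  \<open>one_minus_s\<close>; near means that neither exceeds R. Since they obey a triangle
  inequality only up to constants, composing two near steps enlarges R.\<close>

definition near_set :: "real \<Rightarrow> ((complex \<times> complex) \<times> complex \<times> complex) set" where
  "near_set R = {(z, w). z \<in> U \<and> w \<in> U \<and> (norm (A z w))\<^sup>2 \<le> R * (xx z * xx w) \<and> (norm (1 - s z w))\<^sup>2 \<le> R * ((1 - tau z) * (1 - tau w))}"

lemma near_set_meas: "near_set R \<in> sets (borel \<Otimes>\<^sub>M borel)"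
proof -
  define f where "f p = (case p of (z, w) \<Rightarrow> max ((norm (A z w))\<^sup>2 - R * (xx z * xx w)) ((norm (1 - s z w))\<^sup>2 - R * ((1 - tau z) * (1 - tau w))))" for p
  have UU: "U \<times> U \<in> sets borel" by (intro borel_open open_Times U_open)
  have ct: "continuous_on U tau" unfolding tau_def xx_def
    using U_bounds(2) unfolding xx_def by (intro continuous_intros) force+
  have "continuous_on (U \<times> U) (\<lambda>p. max ((norm (A (fst p) (snd p)))\<^sup>2 - R * (xx (fst p) * xx (snd p))) ((norm (1 - s (fst p) (snd p)))\<^sup>2 - R * ((1 - tau (fst p)) * (1 - tau (snd p)))))"
    unfolding xx_def
    by (intro continuous_intros cont_A cont_s continuous_on_compose2[OF ct]) auto
  then have "continuous_on (U \<times> U) f" by (rule continuous_on_eq) (auto simp: f_def)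
  then have "(\<lambda>p. indicator (U \<times> U) p *\<^sub>R f p) \<in> borel_measurable borel"
    by (rule borel_measurable_continuous_on_indicator[OF UU])
  then have "{p \<in> space borel. indicator (U \<times> U) p *\<^sub>R f p \<le> 0} \<in> sets borel" by measurable
  then have "{p \<in> space borel. indicator (U \<times> U) p *\<^sub>R f p \<le> 0} \<inter> U \<times> U \<in> sets borel" using UU by blast
  also have "{p \<in> space borel. indicator (U \<times> U) p *\<^sub>R f p \<le> 0} \<inter> U \<times> U = near_set R"
    by (auto simp: near_set_def f_def indicator_def)
  finally show ?thesis unfolding borel_prod .
qed

lemma near_set_compose:
  assumes R: "R \<ge> 0" and zx: "(z, x) \<in> near_set R" and xw: "(x, w) \<in> near_set R"
  shows "(z, w) \<in> near_set (256 * R\<^sup>2)"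
proof -
  have U: "z \<in> U" "x \<in> U" "w \<in> U" using zx xw by (auto simp: near_set_def)
  have "(norm (A z w))\<^sup>2 \<le> 256 * R\<^sup>2 * (xx z * xx w)"
    by (rule quasi_triangle_square[of "xx z" "xx x" "xx w" "norm (A z x)" "norm (A x w)" "norm (A z w)" R])
       (use U_bounds(2) U R zx xw xx_le A_triangle[OF U] in \<open>auto simp: near_set_def intro: order.trans[OF A_triangle[OF U]]\<close>)
  moreover have "(norm (1 - s z w))\<^sup>2 \<le> 256 * R\<^sup>2 * ((1 - tau z) * (1 - tau w))"
    by (rule quasi_triangle_square[of "1 - tau z" "1 - tau x" "1 - tau w" "norm (1 - s z x)" "norm (1 - s x w)" "norm (1 - s z w)" R])
       (use U_bounds(6) U R zx xw one_minus_tau_le s_triangle[OF U] in \<open>auto simp: near_set_def\<close>)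
  ultimately show ?thesis using U by (simp add: near_set_def)
qed

text \<open>Near points have comparable \<open>xx\<close> and comparable \<open>1 - tau\<close>, and
  the mixed factors exceed those at \<open>z\<close> only by a constant. The exponents are
  \<open>2 + \<alpha>\<close> plus 1 for the squared weight and \<open>2 + \<alpha>\<close> plus 3
  for the kernel.\<close>

lemma near_set_bounds:
  assumes R: "R \<ge> 1" and zw: "(z, w) \<in> near_set R"
  shows "(h w)\<^sup>2 \<le> (4 * R) powr (3 + \<alpha>) * (h z)\<^sup>2" "N z z \<le> (2 * R) powr (5 + \<alpha>) * N w z"
proof -
  have U: "z \<in> U" "w \<in> U" and a: "(norm (A z w))\<^sup>2 \<le> R * (xx z * xx w)" and d: "(norm (1 - s z w))\<^sup>2 \<le> R * ((1 - tau z) * (1 - tau w))"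
    using zw by (auto simp: near_set_def)
  note zD = U_bounds[OF U(1)] and wD = U_bounds[OF U(2)]
  \<comment> \<open>Shared by both factors, with m the mutual quantity and p, q the sizes at the two
    points.\<close>
  have cmp: "p \<le> 4 * R * q" "q \<le> 4 * R * p" "m \<le> 2 * R * p" if "p > 0" "q > 0" "m \<ge> 0" "m\<^sup>2 \<le> R * (p * q)" "p \<le> 2 * m" "q \<le> 2 * m" for p q m :: real
  proof -
    have "p\<^sup>2 \<le> (2 * m)\<^sup>2" using that by (intro power_mono) auto
    then have "p * p \<le> (4 * R * q) * p" using that(4) by (simp add: power2_eq_square mult_ac)
    then show "p \<le> 4 * R * q" using that by (simp only: mult_le_cancel_right_pos)
    have "q\<^sup>2 \<le> (2 * m)\<^sup>2" using that by (intro power_mono) auto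
    then have "q * q \<le> (4 * R * p) * q" using that(4) by (simp add: power2_eq_square mult_ac)
    then show q: "q \<le> 4 * R * p" using that by (simp only: mult_le_cancel_right_pos)
    have "m\<^sup>2 \<le> R * (p * (4 * R * p))" using that q R by (intro order.trans[OF that(4)] mult_left_mono) auto
    also have "\<dots> = (2 * R * p)\<^sup>2" by (simp add: power2_eq_square)
    finally show "m \<le> 2 * R * p" by (rule power2_le_imp_le) (use that R in auto)
  qed
  have x: "xx z \<le> 4 * R * xx w" "norm (A z w) \<le> 2 * R * xx z"
    by (rule cmp[of "xx z" "xx w" "norm (A z w)"]; use zD wD a xx_le[OF U] in simp)+
  have t: "1 - tau z \<le> 4 * R * (1 - tau w)" "norm (1 - s z w) \<le> 2 * R * (1 - tau z)"
    by (rule cmp[of "1 - tau z" "1 - tau w" "norm (1 - s z w)"]; use zD wD d one_minus_tau_le[OF U] in simp)+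
  have h2: "(h v)\<^sup>2 = xx v powr (- (2 + \<alpha>)) * (1 - tau v) powr (-1)" if "v \<in> U" for v
  proof -
    have 1: "(xx v powr (- (1 + \<alpha> / 2)))\<^sup>2 = xx v powr (- (2 + \<alpha>))"
      unfolding power2_eq_square powr_add[symmetric] by (rule arg_cong[where f = "\<lambda>e. xx v powr e"]) simp
    have 2: "((1 - tau v) powr (- (1 / 2)))\<^sup>2 = (1 - tau v) powr (-1)"
      unfolding power2_eq_square powr_add[symmetric] by (rule arg_cong[where f = "\<lambda>e. (1 - tau v) powr e"]) simp
    have "h v = xx v powr (- (1 + \<alpha> / 2)) * (1 - tau v) powr (- (1 / 2))" using that by (simp add: h_def)
    then show ?thesis by (simp only: power_mult_distrib 1 2)
  qed
  have xw: "xx w powr (- (2 + \<alpha>)) \<le> (4 * R) powr (2 + \<alpha>) * xx z powr (- (2 + \<alpha>))"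
  proof -
    have "xx w powr (- (2 + \<alpha>)) \<le> (xx z / (4 * R)) powr (- (2 + \<alpha>))"
      using x(1) zD R \<alpha> by (intro powr_mono2') (auto simp: field_simps)
    also have "\<dots> = (4 * R) powr (2 + \<alpha>) * xx z powr (- (2 + \<alpha>))"
    proof -
      have "(xx z / (4 * R)) powr (- (2 + \<alpha>)) = xx z powr (- (2 + \<alpha>)) / (4 * R) powr (- (2 + \<alpha>))"
        by (rule powr_divide)
      also have "(4 * R) powr (- (2 + \<alpha>)) = 1 / (4 * R) powr (2 + \<alpha>)" by (rule powr_minus_divide)
      finally show ?thesis by simp
    qed
    finally show ?thesis .
  qed
  have tw: "(1 - tau w) powr (-1) \<le> (4 * R) powr 1 * (1 - tau z) powr (-1)"
  proof -
    have "(1 - tau w) powr (-1) \<le> ((1 - tau z) / (4 * R)) powr (-1)"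
      using t(1) zD R by (intro powr_mono2') (auto simp: field_simps)
    also have "\<dots> = (4 * R) powr 1 * (1 - tau z) powr (-1)"
      using zD R powr_minus_divide[of "4 * R" "- 1"] by (subst powr_divide) auto
    finally show ?thesis .
  qed
  have "(h w)\<^sup>2 \<le> ((4 * R) powr (2 + \<alpha>) * xx z powr (- (2 + \<alpha>))) * ((4 * R) powr 1 * (1 - tau z) powr (-1))"
    unfolding h2[OF U(2)] by (intro mult_mono xw tw) auto
  also have "\<dots> = ((4 * R) powr (2 + \<alpha>) * (4 * R) powr 1) * (h z)\<^sup>2" unfolding h2[OF U(1)] by (simp only: mult_ac)
  also have "(4 * R) powr (2 + \<alpha>) * (4 * R) powr 1 = (4 * R) powr (3 + \<alpha>)" unfolding powr_add[symmetric] by (rule arg_cong[where f = "\<lambda>e. (4 * R) powr e"]) simp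
  finally show "(h w)\<^sup>2 \<le> (4 * R) powr (3 + \<alpha>) * (h z)\<^sup>2" .
  have A0: "norm (A z w) > 0" using A_Re(2)[OF U] by simp
  have "(2 * R * xx z) powr (- (2 + \<alpha>)) \<le> norm (A z w) powr (- (2 + \<alpha>))" using x(2) A0 \<alpha> by (intro powr_mono2') auto
  moreover have "(2 * R * (1 - tau z)) powr (-3) \<le> norm (1 - s z w) powr (-3)"
    using t(2) one_minus_s(2)[OF U] by (intro powr_mono2') auto
  ultimately have "(2 * R * xx z) powr (- (2 + \<alpha>)) * (2 * R * (1 - tau z)) powr (-3) \<le> N z w"
    unfolding N_def by (intro mult_mono) auto
  moreover have "(2 * R) powr (5 + \<alpha>) * ((2 * R * xx z) powr (- (2 + \<alpha>)) * (2 * R * (1 - tau z)) powr (-3)) = N z z"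
  proof -
    have "(2 * R) powr (5 + \<alpha>) * ((2 * R * xx z) powr (- (2 + \<alpha>)) * (2 * R * (1 - tau z)) powr (-3)) =
      ((2 * R) powr (5 + \<alpha>) * (2 * R) powr (- (2 + \<alpha>)) * (2 * R) powr (-3)) * (xx z powr (- (2 + \<alpha>)) * (1 - tau z) powr (-3))"
      using R zD by (simp only: powr_mult mult_ac)
    also have "(2 * R) powr (5 + \<alpha>) * (2 * R) powr (- (2 + \<alpha>)) * (2 * R) powr (-3) = 1"
      unfolding powr_add[symmetric] using R by simp
    finally show ?thesis by (simp add: N_diag[OF U(1)])
  qed
  ultimately have "N z z \<le> (2 * R) powr (5 + \<alpha>) * N z w" by (metis mult_left_mono powr_ge_zero)
  then show "N z z \<le> (2 * R) powr (5 + \<alpha>) * N w z" by (simp add: N_commute[OF U])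
qed

text \<open>One of the two quotients exceeds R while the other is at least 1. They enter with
  exponents \<open>1 + \<alpha> / 2\<close> and 3/2, both at least 1, hence the gain
  \<open>R powr (-1)\<close>.\<close>

lemma far_bound:
  assumes R: "R \<ge> 1" and U: "z \<in> U" "w \<in> U" and far: "(z, w) \<notin> near_set R"
  shows "N z w \<le> R powr (-1) * (N z z powr (1/2) * N w w powr (1/2))"
proof -
  note zD = U_bounds[OF U(1)] and wD = U_bounds[OF U(2)]
  define X where "X = xx z * xx w"
  define T where "T = (1 - tau z) * (1 - tau w)"
  have X: "X > 0" and T: "T > 0" using zD wD by (simp_all add: X_def T_def)
  have A0: "norm (A z w) > 0" and s0: "norm (1 - s z w) > 0" using A_Re(2)[OF U] one_minus_s(2)[OF U] by simp_all
  have NA: "N z w = ((norm (A z w))\<^sup>2) powr (- (1 + \<alpha> / 2)) * ((norm (1 - s z w))\<^sup>2) powr (- (3/2))"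
    using powr_powr[of "norm (A z w)" 2 "- (1 + \<alpha> / 2)"] powr_powr[of "norm (1 - s z w)" 2 "- (3/2)"] A0 s0
    by (simp add: N_def)
  have half: "N z z powr (1/2) * N w w powr (1/2) = X powr (- (1 + \<alpha> / 2)) * T powr (- (3/2))"
  proof -
    have h: "N v v powr (1/2) = xx v powr (- (1 + \<alpha> / 2)) * (1 - tau v) powr (- (3/2))" if "v \<in> U" for v
    proof -
      have e: "- (2 + \<alpha>) * (1/2) = - (1 + \<alpha> / 2)" "- 3 * (1/2) = - (3/2 :: real)" by simp_all
      show ?thesis unfolding N_diag[OF that] powr_mult powr_powr e ..
    qed
    show ?thesis unfolding h[OF U(1)] h[OF U(2)] X_def T_def using zD wD by (simp only: powr_mult mult_ac)
  qed
  have gA: "(norm (A z w))\<^sup>2 \<ge> X" using A_ge by (simp add: X_def)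
  have gs: "(norm (1 - s z w))\<^sup>2 \<ge> T" using one_minus_s(3)[OF U] by (simp add: T_def)
  have r: "R powr (- p) \<le> R powr (-1)" if "p \<ge> 1" for p using R that by (intro powr_mono) auto
  consider "(norm (A z w))\<^sup>2 > R * X" | "(norm (1 - s z w))\<^sup>2 > R * T"
    using far U by (auto simp: near_set_def X_def T_def not_le)
  then have "N z w \<le> R powr (-1) * (X powr (- (1 + \<alpha> / 2)) * T powr (- (3/2)))"
  proof cases
    case 1
    have "((norm (A z w))\<^sup>2) powr (- (1 + \<alpha> / 2)) \<le> (R * X) powr (- (1 + \<alpha> / 2))"
      using 1 X R \<alpha> by (intro powr_mono2') auto
    also have "\<dots> = R powr (- (1 + \<alpha> / 2)) * X powr (- (1 + \<alpha> / 2))" by (rule powr_mult)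
    also have "\<dots> \<le> R powr (-1) * X powr (- (1 + \<alpha> / 2))" using \<alpha> by (intro mult_right_mono r) auto
    finally have a: "((norm (A z w))\<^sup>2) powr (- (1 + \<alpha> / 2)) \<le> R powr (-1) * X powr (- (1 + \<alpha> / 2))" .
    have b: "((norm (1 - s z w))\<^sup>2) powr (- (3/2)) \<le> T powr (- (3/2))" using gs T by (intro powr_mono2') auto
    have "N z w \<le> (R powr (-1) * X powr (- (1 + \<alpha> / 2))) * T powr (- (3/2))"
      unfolding NA by (intro mult_mono a b) auto
    then show ?thesis by (simp only: mult.assoc)
  next
    case 2
    have "((norm (1 - s z w))\<^sup>2) powr (- (3/2)) \<le> (R * T) powr (- (3/2))"
      using 2 T R by (intro powr_mono2') auto
    also have "\<dots> = R powr (- (3/2)) * T powr (- (3/2))" by (rule powr_mult)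
    also have "\<dots> \<le> R powr (-1) * T powr (- (3/2))" by (intro mult_right_mono r) auto
    finally have a: "((norm (1 - s z w))\<^sup>2) powr (- (3/2)) \<le> R powr (-1) * T powr (- (3/2))" .
    have b: "((norm (A z w))\<^sup>2) powr (- (1 + \<alpha> / 2)) \<le> X powr (- (1 + \<alpha> / 2))" using gA X \<alpha> by (intro powr_mono2') auto
    have "N z w \<le> X powr (- (1 + \<alpha> / 2)) * (R powr (-1) * T powr (- (3/2)))"
      unfolding NA by (intro mult_mono a b) auto
    then show ?thesis by (simp only: mult_ac)
  qed
  then show ?thesis unfolding half .
qed

lemma N_indicator_meas:
  assumes z: "z \<in> U"
  shows "(\<lambda>w. indicator U w * ennreal (N w z powr p * (N w w powr q * h w))) \<in> borel_measurable borel"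
proof -
  have c: "continuous_on U (\<lambda>w. N w (f w))" if f: "continuous_on U f" "\<And>w. w \<in> U \<Longrightarrow> f w \<in> U" for f
  proof -
    have "continuous_on U (\<lambda>w. norm (A (fst (w, f w)) (snd (w, f w))) powr (- (2 + \<alpha>)) * norm (1 - s (fst (w, f w)) (snd (w, f w))) powr (-3))"
      using A_Re(2) one_minus_s(2) f
      by (intro continuous_intros continuous_on_compose2[OF cont_s] continuous_on_compose2[OF cont_A[of UNIV]]) auto
    then show ?thesis by (simp add: N_def)
  qed
  have m: "(\<lambda>w. indicator U w *\<^sub>R N w z) \<in> borel_measurable borel" "(\<lambda>w. indicator U w *\<^sub>R N w w) \<in> borel_measurable borel"
    using z by (intro borel_measurable_continuous_on_indicator U_meas c; simp)+
  have eq: "(\<lambda>w. indicator U w * ennreal (N w z powr p * (N w w powr q * h w))) =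
    (\<lambda>w. indicator U w * ennreal ((indicator U w *\<^sub>R N w z) powr p * ((indicator U w *\<^sub>R N w w) powr q * h w)))"
    by (auto simp: fun_eq_iff indicator_def)
  note [measurable] = m h_meas
  show ?thesis unfolding eq by measurable
qed

lemma G_schur:
  obtains C where "C \<ge> 0" "\<And>z. (\<integral>\<^sup>+w. ennreal (norm (G z w) * h w) \<partial>lborel) \<le> ennreal (C * h z)"
proof -
  obtain D where D: "D \<ge> 0" and bd: "\<And>z. z \<in> U \<Longrightarrow>
    (\<integral>\<^sup>+w. indicator U w * ennreal (N w z powr (1 - 0) * (N w w powr (0 / 2) * h w)) \<partial>lborel) \<le> ennreal (D * (N z z powr (- 0 / 2) * h z))"
    using schur_estimate[of 0] \<alpha> by auto
  have "(\<integral>\<^sup>+w. ennreal (norm (G z w) * h w) \<partial>lborel) \<le> ennreal (c2 * D * h z)" for z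
  proof (cases "z \<in> U")
    case True
    have m: "(\<lambda>w. indicator U w * ennreal (N w z powr (1 - 0) * (N w w powr (0 / 2) * h w))) \<in> borel_measurable lborel"
      by (subst measurable_cong_sets[OF sets_lborel refl]) (rule N_indicator_meas[OF True])
    have "(\<integral>\<^sup>+w. ennreal (norm (G z w) * h w) \<partial>lborel) \<le> (\<integral>\<^sup>+w. ennreal c2 * (indicator U w * ennreal (N w z powr (1 - 0) * (N w w powr (0 / 2) * h w))) \<partial>lborel)"
    proof (rule nn_integral_mono)
      fix w show "ennreal (norm (G z w) * h w) \<le> ennreal c2 * (indicator U w * ennreal (N w z powr (1 - 0) * (N w w powr (0 / 2) * h w)))"
      proof (cases "w \<in> U")
        case w: True
        have "norm (G z w) * h w \<le> c2 * (N w z * h w)"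
          using mult_right_mono[OF norm_G(2)[OF True w] h_nonneg[of w]] by (simp add: N_commute[OF True w] mult.assoc)
        then show ?thesis using w c1_c2_pos N_pos[OF w w] N_nonneg[of w z] h_nonneg[of w]
          by (simp add: ennreal_mult'[symmetric] ennreal_leI)
      qed (simp add: G_def)
    qed
    also have "\<dots> = ennreal c2 * (\<integral>\<^sup>+w. indicator U w * ennreal (N w z powr (1 - 0) * (N w w powr (0 / 2) * h w)) \<partial>lborel)"
      by (rule nn_integral_cmult[OF m])
    also have "\<dots> \<le> ennreal c2 * ennreal (D * (N z z powr (- 0 / 2) * h z))" by (intro mult_left_mono bd True) simp
    also have "\<dots> = ennreal (c2 * D * h z)"
      using c1_c2_pos D h_nonneg[of z] N_pos[OF True True] by (simp add: ennreal_mult'[symmetric] mult.assoc)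
    finally show ?thesis .
  qed (simp add: G_def)
  then show thesis using that[of "c2 * D"] D c1_c2_pos by simp
qed

text \<open>In the far region \<open>far_bound\<close> makes the factor \<open>N powr k\<close>
  small and \<open>schur_estimate\<close> handles \<open>N powr (1 - k)\<close>. In the near region
  the modulus of \<open>G w z\<close> is at least a constant times \<open>N z z\<close>, so the
  integral of its square, which equals \<open>G z z\<close>, bounds the integral of the squared
  weight.\<close>

lemma kernel_near_far:
  assumes e: "\<epsilon> > 0"
    and norm2: "\<And>z. z \<in> U \<Longrightarrow> (\<integral>\<^sup>+w. ennreal ((norm (G w z))\<^sup>2) \<partial>lborel) = ennreal (Re (G z z))"
  shows "\<exists>E F C'. near_far U G h \<epsilon> E F C'"
proof -
  \<comment> \<open>Small enough for \<open>schur_estimate\<close>: 1/4 is below 1/3, and the second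
    bound makes \<open>(1 + \<alpha> / 2) * k\<close> at most \<open>\<alpha> / 4\<close>.\<close>
  define k where "k = min (1/4) (\<alpha> / (2 * (\<alpha> + 2)))"
  have k: "0 < k" "k < 1 / 3" using \<alpha> by (auto simp: k_def)
  have k3: "(1 + \<alpha> / 2) * (1 - k) > 1"
  proof -
    have "(1 + \<alpha> / 2) * k \<le> (1 + \<alpha> / 2) * (\<alpha> / (2 * (\<alpha> + 2)))" using \<alpha> by (intro mult_left_mono) (auto simp: k_def)
    also have "\<dots> = \<alpha> / 4" using \<alpha> by (simp add: field_simps)
    finally show ?thesis using \<alpha> by (simp add: algebra_simps)
  qed
  obtain D where D: "D \<ge> 0" and bd: "\<And>z. z \<in> U \<Longrightarrow>
    (\<integral>\<^sup>+w. indicator U w * ennreal (N w z powr (1 - k) * (N w w powr (k / 2) * h w)) \<partial>lborel) \<le> ennreal (D * (N z z powr (- k / 2) * h z))"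
    using schur_estimate[of k] k k3 by auto
  \<comment> \<open>Chosen so that \<open>c2 * D * R powr (- k)\<close> is at most \<epsilon>; the
    maximum with 1 is what \<open>far_bound\<close> asks for.\<close>
  define R where "R = max 1 ((c2 * D / \<epsilon> + 1) powr (1 / k))"
  have R: "R \<ge> 1" by (simp add: R_def)
  have Rk: "c2 * D * R powr (- k) \<le> \<epsilon>"
  proof -
    have p: "c2 * D / \<epsilon> + 1 > 0" using c1_c2_pos D e by (intro add_nonneg_pos) auto
    have "((c2 * D / \<epsilon> + 1) powr (1 / k)) powr k \<le> R powr k" unfolding R_def using k by (intro powr_mono2) auto
    then have "c2 * D / \<epsilon> + 1 \<le> R powr k" using k p by (simp add: powr_powr)
    then have "c2 * D / \<epsilon> \<le> R powr k" by simp
    then have "c2 * D \<le> \<epsilon> * R powr k" using e by (simp add: field_simps)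
    then show ?thesis using R by (simp add: powr_minus_divide field_simps)
  qed
  define R' where "R' = 256 * R\<^sup>2"
  have R': "R' \<ge> 1"
  proof -
    have "R\<^sup>2 \<ge> 1" using R by simp
    then show ?thesis by (simp add: R'_def)
  qed
  define B where "B = (2 * R') powr (5 + \<alpha>)"
  define H where "H = (4 * R') powr (3 + \<alpha>)"
  define C' where "C' = H * B\<^sup>2 * c2\<^sup>2 / c1\<^sup>2"
  have HB: "H \<ge> 0" "B > 0" using R' by (simp_all add: H_def B_def)
  have far: "(\<integral>\<^sup>+w. ennreal (norm (G z w) * h w) * indicator (- near_set R) (z, w) \<partial>lborel) \<le> ennreal (\<epsilon> * h z)" if z: "z \<in> U" for z
  proof -
    have "(\<integral>\<^sup>+w. ennreal (norm (G z w) * h w) * indicator (- near_set R) (z, w) \<partial>lborel) \<le>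
      (\<integral>\<^sup>+w. ennreal (c2 * R powr (- k) * N z z powr (k / 2)) * (indicator U w * ennreal (N w z powr (1 - k) * (N w w powr (k / 2) * h w))) \<partial>lborel)"
    proof (rule nn_integral_mono)
      fix w show "ennreal (norm (G z w) * h w) * indicator (- near_set R) (z, w) \<le>
        ennreal (c2 * R powr (- k) * N z z powr (k / 2)) * (indicator U w * ennreal (N w z powr (1 - k) * (N w w powr (k / 2) * h w)))"
      proof (cases "w \<in> U \<and> (z, w) \<notin> near_set R")
        case True
        then have w: "w \<in> U" and f: "(z, w) \<notin> near_set R" by auto
        have Np: "N z w > 0" by (rule N_pos[OF z w])
        have "N z w powr k \<le> (R powr (-1) * (N z z powr (1/2) * N w w powr (1/2))) powr k"
          using k N_nonneg by (intro powr_mono2 far_bound[OF R z w f]) auto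
        also have "\<dots> = R powr (- k) * (N z z powr (k / 2) * N w w powr (k / 2))"
          by (simp only: powr_mult powr_powr) simp
        finally have 1: "N z w powr k \<le> R powr (- k) * (N z z powr (k / 2) * N w w powr (k / 2))" .
        have "N z w = N z w powr (1 - k) * N z w powr k" unfolding powr_add[symmetric] using Np by simp
        also have "\<dots> \<le> N z w powr (1 - k) * (R powr (- k) * (N z z powr (k / 2) * N w w powr (k / 2)))"
          by (intro mult_left_mono 1) auto
        finally have "c2 * N z w \<le> c2 * (N z w powr (1 - k) * (R powr (- k) * (N z z powr (k / 2) * N w w powr (k / 2))))"
          using c1_c2_pos by (intro mult_left_mono) auto
        with norm_G(2)[OF z w] have "norm (G z w) \<le> c2 * (N z w powr (1 - k) * (R powr (- k) * (N z z powr (k / 2) * N w w powr (k / 2))))" by linarith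
        then have "norm (G z w) * h w \<le> c2 * (N z w powr (1 - k) * (R powr (- k) * (N z z powr (k / 2) * N w w powr (k / 2)))) * h w"
          by (intro mult_right_mono h_nonneg)
        also have "\<dots> = c2 * R powr (- k) * N z z powr (k / 2) * (N w z powr (1 - k) * (N w w powr (k / 2) * h w))"
          by (simp add: N_commute[OF z w] mult_ac)
        finally have "ennreal (norm (G z w) * h w) \<le> ennreal (c2 * R powr (- k) * N z z powr (k / 2) * (N w z powr (1 - k) * (N w w powr (k / 2) * h w)))"
          by (rule ennreal_leI)
        then show ?thesis using w f c1_c2_pos by (simp add: ennreal_mult'[symmetric])
      qed (auto simp: G_def)
    qed
    also have "\<dots> = ennreal (c2 * R powr (- k) * N z z powr (k / 2)) * (\<integral>\<^sup>+w. indicator U w * ennreal (N w z powr (1 - k) * (N w w powr (k / 2) * h w)) \<partial>lborel)"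
      by (rule nn_integral_cmult) (use N_indicator_meas[OF z] in simp)
    also have "\<dots> \<le> ennreal (c2 * R powr (- k) * N z z powr (k / 2)) * ennreal (D * (N z z powr (- k / 2) * h z))"
      by (intro mult_left_mono bd z) simp
    also have "\<dots> = ennreal (c2 * D * R powr (- k) * (N z z powr (k / 2) * N z z powr (- k / 2)) * h z)"
      using c1_c2_pos D h_nonneg by (simp add: ennreal_mult'[symmetric] mult_ac)
    also have "N z z powr (k / 2) * N z z powr (- k / 2) = 1" unfolding powr_add[symmetric] using N_pos[OF z z] by simp
    also have "ennreal (c2 * D * R powr (- k) * 1 * h z) \<le> ennreal (\<epsilon> * h z)"
      using Rk h_nonneg by (intro ennreal_leI mult_right_mono) auto
    finally show ?thesis .
  qed
  have near: "(\<integral>\<^sup>+w. ennreal ((h w)\<^sup>2) * indicator (near_set R') (z, w) * indicator U w \<partial>lborel) \<le> ennreal (C' * (h z)\<^sup>2 / Re (G z z))" if z: "z \<in> U" for z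
  proof -
    have Np: "N z z > 0" by (rule N_pos[OF z z])
    have [measurable]: "(\<lambda>w. G w z) \<in> borel_measurable borel"
    proof -
      note [measurable] = G_meas
      have "(\<lambda>w. (\<lambda>(z, w). G z w) (w, z)) \<in> borel_measurable borel" by measurable
      then show ?thesis by simp
    qed
    \<comment> \<open>On the near set 1 is at most \<open>B / (N z z * c1) * norm (G w z)\<close>,
      so the weight there is dominated by a multiple of the squared kernel.\<close>
    define Q where "Q = H * (h z)\<^sup>2 * (B / (N z z * c1))\<^sup>2"
    have Q: "Q \<ge> 0" using HB by (simp add: Q_def)
    have "(\<integral>\<^sup>+w. ennreal ((h w)\<^sup>2) * indicator (near_set R') (z, w) * indicator U w \<partial>lborel) \<le> (\<integral>\<^sup>+w. ennreal Q * ennreal ((norm (G w z))\<^sup>2) \<partial>lborel)"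
    proof (rule nn_integral_mono)
      fix w show "ennreal ((h w)\<^sup>2) * indicator (near_set R') (z, w) * indicator U w \<le> ennreal Q * ennreal ((norm (G w z))\<^sup>2)"
      proof (cases "(z, w) \<in> near_set R'")
        case True
        then have w: "w \<in> U" by (simp add: near_set_def)
        have h: "(h w)\<^sup>2 \<le> H * (h z)\<^sup>2" and "N z z \<le> B * N w z"
          using near_set_bounds[OF R' True] by (simp_all add: H_def B_def)
        moreover have "B * (c1 * N w z) \<le> B * norm (G w z)" using norm_G(1)[OF w z] HB by (intro mult_left_mono) auto
        moreover have "N z z * c1 \<le> (B * N w z) * c1" using \<open>N z z \<le> B * N w z\<close> c1_c2_pos by (intro mult_right_mono) auto
        moreover have "(B * N w z) * c1 = B * (c1 * N w z)" by simp
        ultimately have "N z z * c1 \<le> B * norm (G w z)" by linarith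
        then have "1 \<le> B / (N z z * c1) * norm (G w z)" using Np c1_c2_pos by (simp add: field_simps)
        then have "1 \<le> (B / (N z z * c1) * norm (G w z))\<^sup>2" by simp
        then have "H * (h z)\<^sup>2 * 1 \<le> H * (h z)\<^sup>2 * (B / (N z z * c1) * norm (G w z))\<^sup>2" using HB by (intro mult_left_mono) auto
        then have "H * (h z)\<^sup>2 \<le> Q * (norm (G w z))\<^sup>2"
          unfolding Q_def power_mult_distrib[of "B / (N z z * c1)"] by (simp only: mult.assoc mult_1_right)
        with h have "(h w)\<^sup>2 \<le> Q * (norm (G w z))\<^sup>2" by linarith
        then show ?thesis using True w Q by (simp add: ennreal_mult'[symmetric] ennreal_leI)
      qed simp
    qed
    also have "\<dots> = ennreal Q * ennreal (Re (G z z))" by (subst nn_integral_cmult) (simp_all add: norm2[OF z])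
    also have "\<dots> = ennreal (Q * Re (G z z))" using Q G_diag(1)[OF z] by (simp add: ennreal_mult'[symmetric])
    also have "\<dots> \<le> ennreal (C' * (h z)\<^sup>2 / Re (G z z))"
    proof (rule ennreal_leI)
      have g: "Re (G z z) > 0" "Re (G z z) \<le> c2 * N z z" using G_diag[OF z] by auto
      have "(Re (G z z))\<^sup>2 \<le> (c2 * N z z)\<^sup>2" using g by (intro power_mono) auto
      then have "Q * (Re (G z z))\<^sup>2 \<le> Q * (c2 * N z z)\<^sup>2" using Q by (intro mult_left_mono) auto
      also have "\<dots> = C' * (h z)\<^sup>2" using Np c1_c2_pos by (simp add: Q_def C'_def power_mult_distrib power_divide)
      finally show "Q * Re (G z z) \<le> C' * (h z)\<^sup>2 / Re (G z z)" using g by (simp add: pos_le_divide_eq power2_eq_square mult.assoc)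
    qed
    finally show ?thesis .
  qed
  have "near_far U G h \<epsilon> (near_set R) (near_set R') C'"
    unfolding near_far_def
  proof (intro conjI ballI impI near_set_meas far near)
    show "C' \<ge> 0" using HB by (simp add: C'_def)
    show "(z, w) \<in> near_set R'" if "(z, x) \<in> near_set R" "(x, w) \<in> near_set R" for z x w
      unfolding R'_def by (rule near_set_compose[OF _ that]) (use R in simp)
  qed
  then show ?thesis by blast
qed

end

section \<open>The reproducing formula\<close>

text \<open>Rotation by the angle pi / (m - n) preserves area and weight and changes the sign of the
  integrand.\<close>

lemma integral_disc_monomials:
  fixes W :: "real \<Rightarrow> real"
  assumes r: "r \<ge> 0" and [measurable]: "W \<in> borel_measurable borel" and mn: "m \<noteq> n"
  shows "(\<integral>w. indicator (ball 0 r) w *\<^sub>R (W (norm w) *\<^sub>R (c * w ^ m * cnj w ^ n)) \<partial>lborel) = (0 :: complex)" (is "?I = 0")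
proof -
  define \<theta> where "\<theta> = pi / (real m - real n)"
  define e where "e = cis \<theta>"
  have ne: "e \<noteq> 0" "norm e = 1" by (simp_all add: e_def)
  have em: "e ^ m * cnj e ^ n = -1"
  proof -
    have "e ^ m * cnj e ^ n = cis (real m * \<theta>) * cis (- (real n * \<theta>))"
      unfolding e_def cis_cnj Complex.DeMoivre by simp
    also have "\<dots> = cis ((real m - real n) * \<theta>)" by (simp add: cis_mult algebra_simps)
    also have "(real m - real n) * \<theta> = pi" using mn by (simp add: \<theta>_def)
    finally show ?thesis by simp
  qed
  have "?I = (\<integral>w. indicator (ball 0 (norm e * r)) w *\<^sub>R (W (norm w) *\<^sub>R (c * w ^ m * cnj w ^ n)) \<partial>lborel)"
    by (simp add: ne)
  also have "\<dots> = (\<integral>w. indicator (ball 0 r) w *\<^sub>R ((norm e)\<^sup>2 *\<^sub>R (W (norm (e * w)) *\<^sub>R (c * (e * w) ^ m * cnj (e * w) ^ n))) \<partial>lborel)"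
    by (rule area_disc[OF r ne(1)]) measurable
  also have "\<dots> = (\<integral>w. - (indicator (ball 0 r) w *\<^sub>R (W (norm w) *\<^sub>R (c * w ^ m * cnj w ^ n))) \<partial>lborel)"
  proof (rule Bochner_Integration.integral_cong[OF refl])
    fix w
    have "c * (e * w) ^ m * cnj (e * w) ^ n = (e ^ m * cnj e ^ n) * (c * w ^ m * cnj w ^ n)"
      by (simp add: power_mult_distrib mult_ac)
    then show "indicator (ball 0 r) w *\<^sub>R ((norm e)\<^sup>2 *\<^sub>R (W (norm (e * w)) *\<^sub>R (c * (e * w) ^ m * cnj (e * w) ^ n))) =
      - (indicator (ball 0 r) w *\<^sub>R (W (norm w) *\<^sub>R (c * w ^ m * cnj w ^ n)))"
      by (simp add: em ne norm_mult)
  qed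
  also have "\<dots> = - ?I" by (rule Bochner_Integration.integral_minus)
  finally show ?thesis by simp
qed

lemma integrable_indicator_ball: "integrable lborel (indicator (ball (c::complex) r) :: _ \<Rightarrow> real)"
  by (rule integrable_real_indicator) (use emeasure_bounded_finite[OF bounded_ball] in auto)

lemma integrable_ball_bounded:
  fixes g :: "complex \<Rightarrow> 'b::{banach, second_countable_topology}"
  assumes [measurable]: "g \<in> borel_measurable borel" and "\<And>w. norm w < r \<Longrightarrow> norm (g w) \<le> M"
  shows "integrable lborel (\<lambda>w. indicator (ball 0 r) w *\<^sub>R g w)"
proof (rule Bochner_Integration.integrable_bound)
  have [measurable]: "ball (0::complex) r \<in> sets borel" by auto
  show "integrable lborel (\<lambda>w. M * indicator (ball (0::complex) r) w)"
    by (rule integrable_mult_right[OF integrable_indicator_ball])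
  show "(\<lambda>w. indicator (ball 0 r) w *\<^sub>R g w) \<in> borel_measurable lborel" by measurable
  show "AE w in lborel. norm (indicator (ball 0 r) w *\<^sub>R g w) \<le> norm (M * indicator (ball (0::complex) r) w)"
  proof (rule AE_I2)
    fix w
    show "norm (indicator (ball 0 r) w *\<^sub>R g w) \<le> norm (M * indicator (ball (0::complex) r) w)"
      using assms(2)[of w] by (cases "w \<in> ball 0 r") (auto intro: order.trans[OF _ abs_ge_self])
  qed
qed

text \<open>On a smaller concentric disc the Taylor series converges absolutely and uniformly, so it
  can be integrated term by term, and only the n-th term survives.\<close>

lemma integral_disc_coefficient_aux:
  fixes W :: "real \<Rightarrow> real"
  assumes r: "0 < \<rho>" "\<rho> < r" and f: "f holomorphic_on ball 0 r" and [measurable]: "W \<in> borel_measurable borel"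
    and W: "\<And>t. 0 \<le> W t" "\<And>t. W t \<le> 1"
  shows "(\<integral>w. indicator (ball 0 \<rho>) w *\<^sub>R (W (norm w) *\<^sub>R (f w * cnj w ^ n)) \<partial>lborel) =
    (deriv ^^ n) f 0 / fact n * complex_of_real (\<integral>w. indicator (ball (0::complex) \<rho>) w * (W (norm w) * norm w ^ (2 * n)) \<partial>lborel)"
proof -
  define a where "a m = (deriv ^^ m) f 0 / fact m" for m
  define F where "F m w = indicator (ball 0 \<rho>) w *\<^sub>R (W (norm w) *\<^sub>R (a m * w ^ m * cnj w ^ n))" for m w
  have [measurable]: "ball (0::complex) \<rho> \<in> sets borel" by auto
  have ps: "(\<lambda>m. a m * w ^ m) sums f w" if "norm w < r" for w
    using holomorphic_power_series[OF f, of w] that by (simp add: a_def)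
  define x where "x = complex_of_real ((\<rho> + r) / 2)"
  have x: "norm x = (\<rho> + r) / 2" using r unfolding x_def norm_of_real by simp
  have abs: "summable (\<lambda>m. norm (a m) * \<rho> ^ m)"
  proof -
    have "summable (\<lambda>m. a m * x ^ m)" using ps[of x] r x by (auto simp: sums_iff)
    then have "summable (\<lambda>m. norm (a m * complex_of_real \<rho> ^ m))" by (rule powser_insidea) (use r x in simp)
    then show ?thesis using r by (simp add: norm_mult norm_power)
  qed
  have nF: "norm (F m w) \<le> (norm (a m) * \<rho> ^ m * \<rho> ^ n) * indicator (ball 0 \<rho>) w" for m w
  proof (cases "norm w < \<rho>")
    case True
    have "norm (F m w) = W (norm w) * (norm (a m) * norm w ^ m * norm w ^ n)"
      using True W by (simp add: F_def norm_mult norm_power)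
    also have "\<dots> \<le> 1 * (norm (a m) * \<rho> ^ m * \<rho> ^ n)" using True W r
      by (intro mult_mono power_mono) auto
    finally show ?thesis using True by simp
  qed (simp add: F_def)
  have iF: "integrable lborel (F m)" for m
    unfolding F_def
  proof (rule integrable_ball_bounded)
    fix w :: complex assume w: "norm w < \<rho>"
    have "norm (W (norm w) *\<^sub>R (a m * w ^ m * cnj w ^ n)) = W (norm w) * (norm (a m) * norm w ^ m * norm w ^ n)"
      using W by (simp add: norm_mult norm_power)
    also have "\<dots> \<le> 1 * (norm (a m) * \<rho> ^ m * \<rho> ^ n)" using w W r by (intro mult_mono power_mono) auto
    finally show "norm (W (norm w) *\<^sub>R (a m * w ^ m * cnj w ^ n)) \<le> 1 * (norm (a m) * \<rho> ^ m * \<rho> ^ n)" .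
  qed measurable
  define V where "V = (\<integral>w. indicator (ball (0::complex) \<rho>) w \<partial>lborel :: real)"
  have iB: "integrable lborel (indicator (ball (0::complex) \<rho>) :: _ \<Rightarrow> real)"
    by (rule integrable_indicator_ball)
  have sumF: "(\<lambda>m. F m w) sums (indicator (ball 0 \<rho>) w *\<^sub>R (W (norm w) *\<^sub>R (f w * cnj w ^ n)))" for w
  proof (cases "norm w < \<rho>")
    case True
    then have "(\<lambda>m. (a m * w ^ m) * (complex_of_real (W (norm w)) * cnj w ^ n)) sums (f w * (complex_of_real (W (norm w)) * cnj w ^ n))"
      using r by (intro sums_mult2 ps) auto
    then show ?thesis using True by (simp add: F_def scaleR_conv_of_real mult_ac)
  qed (simp add: F_def)
  have "(\<lambda>m. integral\<^sup>L lborel (F m)) sums (\<integral>w. (\<Sum>m. F m w) \<partial>lborel)"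
  proof (rule sums_integral[OF iF])
    show "AE w in lborel. summable (\<lambda>m. norm (F m w))"
    proof (rule AE_I2, rule summable_comparison_test)
      fix w :: complex
      show "summable (\<lambda>m. (norm (a m) * \<rho> ^ m * \<rho> ^ n) * indicator (ball 0 \<rho>) w)"
        by (intro summable_mult2 abs)
      show "\<exists>N. \<forall>m\<ge>N. norm (norm (F m w)) \<le> (norm (a m) * \<rho> ^ m * \<rho> ^ n) * indicator (ball 0 \<rho>) w"
        using nF by simp
    qed
    show "summable (\<lambda>m. \<integral>w. norm (F m w) \<partial>lborel)"
    proof (rule summable_comparison_test)
      show "summable (\<lambda>m. (norm (a m) * \<rho> ^ m * \<rho> ^ n) * V)" by (intro summable_mult2 abs)
      have "(\<integral>w. norm (F m w) \<partial>lborel) \<le> (\<integral>w. (norm (a m) * \<rho> ^ m * \<rho> ^ n) * indicator (ball (0::complex) \<rho>) w \<partial>lborel)" for m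
        by (rule integral_mono[OF integrable_norm[OF iF] integrable_mult_right[OF iB] nF])
      then have "(\<integral>w. norm (F m w) \<partial>lborel) \<le> (norm (a m) * \<rho> ^ m * \<rho> ^ n) * V" for m
        by (simp only: V_def integral_mult_right_zero)
      then show "\<exists>N. \<forall>m\<ge>N. norm (\<integral>w. norm (F m w) \<partial>lborel) \<le> (norm (a m) * \<rho> ^ m * \<rho> ^ n) * V"
        by (simp add: integral_nonneg_AE)
    qed
  qed
  also have "(\<lambda>w. \<Sum>m. F m w) = (\<lambda>w. indicator (ball 0 \<rho>) w *\<^sub>R (W (norm w) *\<^sub>R (f w * cnj w ^ n)))"
    using sumF by (simp add: sums_iff)
  finally have S: "(\<lambda>m. integral\<^sup>L lborel (F m)) sums (\<integral>w. indicator (ball 0 \<rho>) w *\<^sub>R (W (norm w) *\<^sub>R (f w * cnj w ^ n)) \<partial>lborel)" .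
  have "integral\<^sup>L lborel (F m) = 0" if "m \<noteq> n" for m
    unfolding F_def by (rule integral_disc_monomials) (use r that in auto)
  then have "(\<lambda>m. integral\<^sup>L lborel (F m)) sums integral\<^sup>L lborel (F n)" 
    using sums_finite[of "{n}" "\<lambda>m. integral\<^sup>L lborel (F m)"] by simp
  with S have "(\<integral>w. indicator (ball 0 \<rho>) w *\<^sub>R (W (norm w) *\<^sub>R (f w * cnj w ^ n)) \<partial>lborel) = integral\<^sup>L lborel (F n)"
    by (rule sums_unique2)
  also have "\<dots> = (\<integral>w. a n * complex_of_real (indicator (ball (0::complex) \<rho>) w * (W (norm w) * norm w ^ (2 * n))) \<partial>lborel)"
  proof (rule Bochner_Integration.integral_cong[OF refl])
    fix w :: complex
    have "w ^ n * cnj w ^ n = complex_of_real (norm w ^ (2 * n))"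
      by (simp add: power_mult_distrib[symmetric] complex_norm_square[symmetric] power_mult)
    then have "F n w = indicator (ball 0 \<rho>) w *\<^sub>R (W (norm w) *\<^sub>R (a n * complex_of_real (norm w ^ (2 * n))))"
      by (simp only: F_def mult.assoc)
    then show "F n w = a n * complex_of_real (indicator (ball (0::complex) \<rho>) w * (W (norm w) * norm w ^ (2 * n)))"
      by (simp only: scaleR_conv_of_real of_real_mult mult_ac)
  qed
  also have "\<dots> = a n * complex_of_real (\<integral>w. indicator (ball (0::complex) \<rho>) w * (W (norm w) * norm w ^ (2 * n)) \<partial>lborel)"
    by (simp only: integral_mult_right_zero integral_complex_of_real)
  finally show ?thesis by (simp add: a_def)
qed

lemma tendsto_ball_exhaust:
  fixes f :: "complex \<Rightarrow> 'b::{banach, second_countable_topology}"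
  assumes r: "r > 0" and i: "integrable lborel (\<lambda>w. indicator (ball 0 r) w *\<^sub>R f w)"
  shows "(\<lambda>k. \<integral>w. indicator (ball 0 (r * (1 - 1 / (real k + 2)))) w *\<^sub>R f w \<partial>lborel) \<longlonglongrightarrow> (\<integral>w. indicator (ball 0 r) w *\<^sub>R f w \<partial>lborel)"
proof -
  define \<rho> where "\<rho> k = r * (1 - 1 / (real k + 2))" for k
  have \<rho>: "\<rho> k < r" for k using r by (simp add: \<rho>_def)
  have [measurable]: "ball (0::complex) s \<in> sets borel" for s by auto
  have eq: "indicator (ball 0 (\<rho> k)) w *\<^sub>R f w = indicator (ball 0 (\<rho> k)) w *\<^sub>R (indicator (ball 0 r) w *\<^sub>R f w)" for k w
    using \<rho>[of k] by (auto simp: indicator_def)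
  have lim\<rho>: "\<rho> \<longlonglongrightarrow> r" unfolding \<rho>_def by real_asymp
  have m: "(\<lambda>w. indicator (ball 0 r) w *\<^sub>R f w) \<in> borel_measurable lborel" using i by auto
  have "(\<lambda>k. \<integral>w. indicator (ball 0 (\<rho> k)) w *\<^sub>R (indicator (ball 0 r) w *\<^sub>R f w) \<partial>lborel) \<longlonglongrightarrow> (\<integral>w. indicator (ball 0 r) w *\<^sub>R f w \<partial>lborel)"
  proof (rule integral_dominated_convergence[OF m _ integrable_norm[OF i]])
    show "(\<lambda>w. indicator (ball 0 (\<rho> k)) w *\<^sub>R (indicator (ball 0 r) w *\<^sub>R f w)) \<in> borel_measurable lborel" for k
      using m by measurable
    show "AE w in lborel. (\<lambda>k. indicator (ball 0 (\<rho> k)) w *\<^sub>R (indicator (ball 0 r) w *\<^sub>R f w)) \<longlonglongrightarrow> indicator (ball 0 r) w *\<^sub>R f w"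
    proof (rule AE_I2, rule tendsto_eventually)
      fix w :: complex
      show "\<forall>\<^sub>F k in sequentially. indicator (ball 0 (\<rho> k)) w *\<^sub>R (indicator (ball 0 r) w *\<^sub>R f w) = indicator (ball 0 r) w *\<^sub>R f w"
      proof (cases "norm w < r")
        case True
        have "\<forall>\<^sub>F k in sequentially. norm w < \<rho> k" using order_tendstoD(1)[OF lim\<rho> True] .
        then show ?thesis by eventually_elim simp
      qed simp
    qed
    show "AE w in lborel. norm (indicator (ball 0 (\<rho> k)) w *\<^sub>R (indicator (ball 0 r) w *\<^sub>R f w)) \<le> norm (indicator (ball 0 r) w *\<^sub>R f w)" for k
      by (rule AE_I2) (simp add: indicator_def)
  qed
  then have "(\<lambda>k. \<integral>w. indicator (ball 0 (\<rho> k)) w *\<^sub>R f w \<partial>lborel) \<longlonglongrightarrow> (\<integral>w. indicator (ball 0 r) w *\<^sub>R f w \<partial>lborel)"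
    by (simp only: eq[symmetric])
  then show ?thesis unfolding \<rho>_def .
qed

lemma integral_disc_coefficient:
  fixes W :: "real \<Rightarrow> real"
  assumes r: "0 < r" and f: "f holomorphic_on ball 0 r" and [measurable]: "W \<in> borel_measurable borel"
    and W: "\<And>t. 0 \<le> W t" "\<And>t. W t \<le> 1"
    and i: "integrable lborel (\<lambda>w. indicator (ball 0 r) w *\<^sub>R (W (norm w) *\<^sub>R f w))"
  shows "(\<integral>w. indicator (ball 0 r) w *\<^sub>R (W (norm w) *\<^sub>R (f w * cnj w ^ n)) \<partial>lborel) =
    (deriv ^^ n) f 0 / fact n * complex_of_real (\<integral>w. indicator (ball (0::complex) r) w * (W (norm w) * norm w ^ (2 * n)) \<partial>lborel)"
proof -
  have [measurable]: "ball (0::complex) s \<in> sets borel" for s by auto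
  have i1: "integrable lborel (\<lambda>w. indicator (ball 0 r) w *\<^sub>R (W (norm w) *\<^sub>R (f w * cnj w ^ n)))"
  proof (rule Bochner_Integration.integrable_bound)
    show "integrable lborel (\<lambda>w. r ^ n * norm (indicator (ball 0 r) w *\<^sub>R (W (norm w) *\<^sub>R f w)))"
      by (rule integrable_mult_right[OF integrable_norm[OF i]])
    have "(\<lambda>w. indicator (ball 0 r) w *\<^sub>R (W (norm w) *\<^sub>R f w)) \<in> borel_measurable lborel" using i by auto
    then have "(\<lambda>w. (indicator (ball 0 r) w *\<^sub>R (W (norm w) *\<^sub>R f w)) * cnj w ^ n) \<in> borel_measurable lborel" by measurable
    then show "(\<lambda>w. indicator (ball 0 r) w *\<^sub>R (W (norm w) *\<^sub>R (f w * cnj w ^ n))) \<in> borel_measurable lborel" by simp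
    show "AE w in lborel. norm (indicator (ball 0 r) w *\<^sub>R (W (norm w) *\<^sub>R (f w * cnj w ^ n))) \<le> norm (r ^ n * norm (indicator (ball 0 r) w *\<^sub>R (W (norm w) *\<^sub>R f w)))"
    proof (rule AE_I2)
      fix w :: complex
      show "norm (indicator (ball 0 r) w *\<^sub>R (W (norm w) *\<^sub>R (f w * cnj w ^ n))) \<le> norm (r ^ n * norm (indicator (ball 0 r) w *\<^sub>R (W (norm w) *\<^sub>R f w)))"
      proof (cases "norm w < r")
        case True
        have "(W (norm w) * norm (f w)) * norm w ^ n \<le> (W (norm w) * norm (f w)) * r ^ n"
          using True W by (intro mult_left_mono power_mono) auto
        then show ?thesis using True W r by (simp add: norm_mult norm_power mult_ac)
      qed simp
    qed
  qed
  have i2: "integrable lborel (\<lambda>w. indicator (ball (0::complex) r) w *\<^sub>R (W (norm w) * norm w ^ (2 * n)))"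
  proof (rule integrable_ball_bounded)
    fix w :: complex assume "norm w < r"
    then have "W (norm w) * norm w ^ (2 * n) \<le> 1 * r ^ (2 * n)" using W by (intro mult_mono power_mono) auto
    then show "norm (W (norm w) * norm w ^ (2 * n)) \<le> 1 * r ^ (2 * n)" using W by simp
  qed measurable
  define \<rho> where "\<rho> k = r * (1 - 1 / (real k + 2))" for k
  have \<rho>: "0 < \<rho> k" "\<rho> k < r" for k using r by (auto simp: \<rho>_def)
  have eq: "(\<integral>w. indicator (ball 0 (\<rho> k)) w *\<^sub>R (W (norm w) *\<^sub>R (f w * cnj w ^ n)) \<partial>lborel) =
    (deriv ^^ n) f 0 / fact n * complex_of_real (\<integral>w. indicator (ball (0::complex) (\<rho> k)) w *\<^sub>R (W (norm w) * norm w ^ (2 * n)) \<partial>lborel)" for k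
    unfolding real_scaleR_def by (rule integral_disc_coefficient_aux[OF \<rho> f _ W]) measurable
  have "(\<lambda>k. (deriv ^^ n) f 0 / fact n * complex_of_real (\<integral>w. indicator (ball (0::complex) (\<rho> k)) w *\<^sub>R (W (norm w) * norm w ^ (2 * n)) \<partial>lborel)) \<longlonglongrightarrow>
    (deriv ^^ n) f 0 / fact n * complex_of_real (\<integral>w. indicator (ball (0::complex) r) w *\<^sub>R (W (norm w) * norm w ^ (2 * n)) \<partial>lborel)"
    unfolding \<rho>_def by (intro tendsto_intros tendsto_ball_exhaust[OF r i2])
  moreover have "(\<lambda>k. \<integral>w. indicator (ball 0 (\<rho> k)) w *\<^sub>R (W (norm w) *\<^sub>R (f w * cnj w ^ n)) \<partial>lborel) \<longlonglongrightarrow>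
    (\<integral>w. indicator (ball 0 r) w *\<^sub>R (W (norm w) *\<^sub>R (f w * cnj w ^ n)) \<partial>lborel)"
    unfolding \<rho>_def by (rule tendsto_ball_exhaust[OF r i1])
  ultimately show ?thesis unfolding eq real_scaleR_def by (rule LIMSEQ_unique[rotated])
qed

lemma holomorphic_disc_mean:
  assumes r: "0 < r" and f: "f holomorphic_on ball 0 r" and i: "integrable lborel (\<lambda>w. indicator (ball 0 r) w *\<^sub>R f w)"
  shows "(\<integral>w. indicator (ball 0 r) w *\<^sub>R f w \<partial>lborel) = complex_of_real (pi * r\<^sup>2) * f 0"
proof -
  have m: "(\<integral>w. indicator (ball (0::complex) r) w \<partial>lborel) = pi * r\<^sup>2"
    using content_ball[of r "0::complex"] r by (simp add: unit_ball_vol_2)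
  show ?thesis
    using integral_disc_coefficient[OF r f, of "\<lambda>_. 1" 0] i m by simp
qed

text \<open>The weight is the area of the slice of the domain over the first coordinate w, divided
  by pi. The moment is a difference of two power integrals, found by adding the subtracted one back
  so as to stay with nonnegative integrals.\<close>

lemma disc_moment:
  assumes a: "a > (0::real)"
  shows "(\<integral>w. indicator (ball (0::complex) 1) w * (max 0 (1 - norm w powr (2 / a)) * norm w ^ (2 * n)) \<partial>lborel) =
    pi / ((real n + 1) * (a * (real n + 1) + 1))" (is "?I = _")
proof -
  have [measurable]: "ball (0::complex) s \<in> sets borel" for s by auto
  define g where "g y = ennreal (max 0 (1 - y powr (1 / a)) * y ^ n)" for y :: real
  have [measurable]: "g \<in> borel_measurable borel" unfolding g_def by measurable
  define X where "X = (\<integral>\<^sup>+y. indicator {0<..<1} y * g y \<partial>lborel)"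
  have "(\<integral>\<^sup>+y. indicator {0<..<1} y * ennreal (y powr real n) \<partial>lborel) =
    (\<integral>\<^sup>+y. indicator {0<..<1} y * g y + indicator {0<..<1} y * ennreal (y powr (real n + 1 / a)) \<partial>lborel)"
  proof (rule nn_integral_cong)
    fix y :: real
    show "indicator {0<..<1} y * ennreal (y powr real n) = indicator {0<..<1} y * g y + indicator {0<..<1} y * ennreal (y powr (real n + 1 / a))"
    proof (cases "y \<in> {0<..<1}")
      case True
      have le: "y powr (1 / a) \<le> 1" using powr_mono2[of "1 / a" y 1] True a by simp
      have "y powr real n = max 0 (1 - y powr (1 / a)) * y ^ n + y powr (real n + 1 / a)"
        using True le by (simp add: powr_add powr_realpow algebra_simps)
      then show ?thesis using True by (simp add: g_def ennreal_plus[symmetric] del: ennreal_plus)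
    qed simp
  qed
  also have "\<dots> = X + (\<integral>\<^sup>+y. indicator {0<..<1} y * ennreal (y powr (real n + 1 / a)) \<partial>lborel)"
    unfolding X_def by (rule nn_integral_add) measurable
  finally have "ennreal (1 / (real n + 1)) = X + ennreal (1 / (real n + 1 / a + 1))"
    using a by (simp add: nn_integral_powr_01 add_pos_nonneg less_le_trans[of _ 0])
  then have X: "X = ennreal (1 / (real n + 1) - 1 / (real n + 1 / a + 1))"
    using a by (metis ennreal_add_diff_cancel_right ennreal_minus ennreal_neq_top zero_le_divide_1_iff add_nonneg_nonneg of_nat_0_le_iff zero_le_one less_imp_le)
  have v: "1 / (real n + 1) - 1 / (real n + 1 / a + 1) = 1 / ((real n + 1) * (a * (real n + 1) + 1))"
  proof -
    have p: "real n + 1 > 0" "a * (real n + 1) + 1 > 0" using a by (auto intro: add_nonneg_pos)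
    have "real n + 1 / a + 1 = (a * (real n + 1) + 1) / a" using a by (simp add: field_simps)
    then have "1 / (real n + 1 / a + 1) = a / (a * (real n + 1) + 1)" by simp
    moreover have "1 / (real n + 1) - a / (a * (real n + 1) + 1) = 1 / ((real n + 1) * (a * (real n + 1) + 1))"
      using p by (simp add: divide_simps)
    ultimately show ?thesis by simp
  qed
  have "?I = enn2real (\<integral>\<^sup>+w. ennreal (indicator (ball (0::complex) 1) w * (max 0 (1 - norm w powr (2 / a)) * norm w ^ (2 * n))) \<partial>lborel)"
    by (rule integral_eq_nn_integral) auto
  also have "(\<integral>\<^sup>+w. ennreal (indicator (ball (0::complex) 1) w * (max 0 (1 - norm w powr (2 / a)) * norm w ^ (2 * n))) \<partial>lborel) =
    (\<integral>\<^sup>+w. indicator (ball (0::complex) 1) w * g ((norm w)\<^sup>2) \<partial>lborel)"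
  proof (rule nn_integral_cong)
    fix w :: complex
    have "((norm w)\<^sup>2) powr (1 / a) = norm w powr (2 / a)" using powr_powr[of "norm w" 2 "1 / a"] by simp
    then show "ennreal (indicator (ball (0::complex) 1) w * (max 0 (1 - norm w powr (2 / a)) * norm w ^ (2 * n))) = indicator (ball (0::complex) 1) w * g ((norm w)\<^sup>2)"
      by (simp add: g_def power_mult indicator_def)
  qed
  also have "\<dots> = ennreal pi * X" unfolding X_def by (rule radial_nn) measurable
  also have "\<dots> = ennreal (pi / ((real n + 1) * (a * (real n + 1) + 1)))"
    unfolding X v using a by (simp add: ennreal_mult'[symmetric])
  finally show ?thesis using a by (simp add: add_nonneg_nonneg)
qed

section \<open>The kernel at points with second coordinate 0\<close>

context hartogs
begin

text \<open>Reciprocal of the squared L2 norm over the domain of the n-th power of the first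
  coordinate, that is, of pi times \<open>disc_moment\<close>.\<close>

definition kernel_coeff :: "nat \<Rightarrow> real" where "kernel_coeff n = (real n + 1) * (\<alpha> * (real n + 1) + 1) / pi\<^sup>2"

text \<open>The kernel \<open>G z w\<close> for \<open>snd z = 0\<close>, as a function of
  \<open>fst z * cnj (fst w)\<close>.\<close>

definition kernel_fun :: "complex \<Rightarrow> complex" where
  "kernel_fun x = (complex_of_real (\<alpha> + 1) + complex_of_real (\<alpha> - 1) * x) / (complex_of_real (pi\<^sup>2) * (1 - x) ^ 3)"

text \<open>The coefficient splits as
  \<open>\<alpha> * (n + 1) * (n + 2) + (1 - \<alpha>) * (n + 1)\<close> over pi squared; the
  generating functions of the two terms are multiples of the cube and the square of 1 / (1 -
  x).\<close>

lemma kernel_fun_sums: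
  assumes x: "norm x < 1"
  shows "(\<lambda>n. complex_of_real (kernel_coeff n) * x ^ n) sums kernel_fun x"
proof -
  have s1: "1 - x \<noteq> 0" using x by auto
  have g1: "(\<lambda>n. of_nat (Suc n) * x ^ n) sums (1 / (1 - x)\<^sup>2)" by (rule geometric_deriv_sums[OF x])
  have g0: "(\<lambda>n. x ^ n) sums (1 / (1 - x))" by (rule geometric_sums[OF x])
  have "summable (\<lambda>n. norm (of_nat (Suc n) * x ^ n))"
  proof -
    have "summable (\<lambda>n. of_nat (Suc n) * (norm x) ^ n)" using geometric_deriv_sums[of "norm x"] x by (simp add: sums_iff)
    then show ?thesis by (simp add: norm_mult norm_power del: of_nat_Suc)
  qed
  moreover have "summable (\<lambda>n. norm (x ^ n))" using x by (simp add: norm_power summable_geometric)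
  ultimately have "(\<lambda>n. \<Sum>i\<le>n. (of_nat (Suc i) * x ^ i) * x ^ (n - i)) sums ((\<Sum>n. of_nat (Suc n) * x ^ n) * (\<Sum>n. x ^ n))"
    by (rule Cauchy_product_sums)
  moreover have bin: "(\<Sum>i\<le>n. (of_nat (Suc i) * x ^ i) * x ^ (n - i)) = complex_of_real ((real n + 1) * (real n + 2) / 2) * x ^ n" for n
  proof -
    have "(\<Sum>i\<le>n. (of_nat (Suc i) * x ^ i) * x ^ (n - i)) = (\<Sum>i\<le>n. of_nat (Suc i) * x ^ n)"
      by (intro sum.cong refl) (simp add: mult.assoc power_add[symmetric])
    also have "\<dots> = (\<Sum>i\<le>n. of_nat (Suc i)) * x ^ n" by (simp add: sum_distrib_right)
    also have "(\<Sum>i\<le>n. of_nat (Suc i)) = complex_of_real ((real n + 1) * (real n + 2) / 2)"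
      by (induction n) (auto simp: field_simps)
    finally show ?thesis .
  qed
  ultimately have g2: "(\<lambda>n. complex_of_real ((real n + 1) * (real n + 2) / 2) * x ^ n) sums (1 / (1 - x)\<^sup>2 * (1 / (1 - x)))"
    by (simp only: bin sums_unique[OF g1, symmetric] sums_unique[OF g0, symmetric])
  have "(\<lambda>n. complex_of_real (2 * \<alpha> / pi\<^sup>2) * (complex_of_real ((real n + 1) * (real n + 2) / 2) * x ^ n) + complex_of_real ((1 - \<alpha>) / pi\<^sup>2) * (of_nat (Suc n) * x ^ n))
    sums (complex_of_real (2 * \<alpha> / pi\<^sup>2) * (1 / (1 - x)\<^sup>2 * (1 / (1 - x))) + complex_of_real ((1 - \<alpha>) / pi\<^sup>2) * (1 / (1 - x)\<^sup>2))"
    by (intro sums_add sums_mult g1 g2)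
  moreover have "complex_of_real (2 * \<alpha> / pi\<^sup>2) * (complex_of_real ((real n + 1) * (real n + 2) / 2) * x ^ n) + complex_of_real ((1 - \<alpha>) / pi\<^sup>2) * (of_nat (Suc n) * x ^ n)
     = complex_of_real (kernel_coeff n) * x ^ n" for n
  proof -
    have "(2 * \<alpha> / pi\<^sup>2) * ((real n + 1) * (real n + 2) / 2) + ((1 - \<alpha>) / pi\<^sup>2) * real (Suc n) = kernel_coeff n"
      by (simp add: kernel_coeff_def field_simps)
    then have "complex_of_real (kernel_coeff n) = complex_of_real (2 * \<alpha> / pi\<^sup>2) * complex_of_real ((real n + 1) * (real n + 2) / 2) + complex_of_real ((1 - \<alpha>) / pi\<^sup>2) * of_nat (Suc n)"
      by (metis of_real_add of_real_mult of_real_of_nat_eq)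
    then show ?thesis by (simp only: distrib_right mult.assoc)
  qed
  moreover have "complex_of_real (2 * \<alpha> / pi\<^sup>2) * (1 / (1 - x)\<^sup>2 * (1 / (1 - x))) + complex_of_real ((1 - \<alpha>) / pi\<^sup>2) * (1 / (1 - x)\<^sup>2) = kernel_fun x"
  proof -
    have "(2 * y / p) * (1 / t\<^sup>2 * (1 / t)) + ((1 - y) / p) * (1 / t\<^sup>2) = ((y + 1) + (y - 1) * (1 - t)) / (p * t ^ 3)"
      if "t \<noteq> 0" "p \<noteq> 0" for y p t :: complex
      using that by (simp add: field_simps power2_eq_square power3_eq_cube)
    from this[of "1 - x" "complex_of_real (pi\<^sup>2)" "complex_of_real \<alpha>"] s1 show ?thesis by (simp add: kernel_fun_def)
  qed
  ultimately show ?thesis by simp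
qed

lemma kernel_coeff_summable: assumes "0 \<le> t" "t < 1" shows "summable (\<lambda>n. kernel_coeff n * t ^ n)"
proof -
  have "summable (\<lambda>n. complex_of_real (kernel_coeff n) * complex_of_real t ^ n)" using kernel_fun_sums[of "complex_of_real t"] assms by (auto simp: sums_iff)
  then have "summable (\<lambda>n. complex_of_real (kernel_coeff n * t ^ n))" by simp
  then show ?thesis by (simp only: summable_complex_of_real)
qed

lemma kernel_coeff_nonneg: "kernel_coeff n \<ge> 0" using \<alpha> by (simp add: kernel_coeff_def)

text \<open>Expand the kernel and integrate term by term: each coefficient times its moment is 1 /
  pi, so the Taylor series of \<open>f\<close> at c remains.\<close>

lemma disc_weighted_reproducing:
  assumes f: "f holomorphic_on ball 0 1" and c: "norm c < 1"
    and i: "integrable lborel (\<lambda>w. indicator (ball 0 1) w *\<^sub>R (max 0 (1 - norm w powr (2 / \<alpha>)) *\<^sub>R f w))"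
  shows "(\<integral>w. indicator (ball 0 1) w *\<^sub>R (max 0 (1 - norm w powr (2 / \<alpha>)) *\<^sub>R (f w * cnj (kernel_fun (w * cnj c)))) \<partial>lborel) = f c / complex_of_real pi"
proof -
  define W where "W t = max 0 (1 - t powr (2 / \<alpha>))" for t :: real
  have W: "W t \<ge> 0" "W t \<le> 1" for t by (auto simp: W_def)
  have [measurable]: "W \<in> borel_measurable borel" unfolding W_def by measurable
  have [measurable]: "ball (0::complex) q \<in> sets borel" for q by auto
  define fw where "fw w = indicator (ball 0 1) w *\<^sub>R (W (norm w) *\<^sub>R f w)" for w
  have ifw: "integrable lborel fw" using i by (simp add: fw_def[abs_def] W_def)
  define F where "F n w = fw w * (complex_of_real (kernel_coeff n) * c ^ n * cnj w ^ n)" for n w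
  have nF: "norm (F n w) \<le> (kernel_coeff n * norm c ^ n) * norm (fw w)" for n w
  proof (cases "norm w < 1")
    case True
    then have "norm w ^ n \<le> 1" by (simp add: power_le_one)
    then have "norm (fw w) * (kernel_coeff n * norm c ^ n * norm w ^ n) \<le> norm (fw w) * (kernel_coeff n * norm c ^ n * 1)"
      using kernel_coeff_nonneg by (intro mult_left_mono) auto
    then show ?thesis using kernel_coeff_nonneg[of n] by (simp add: F_def norm_mult norm_power mult_ac)
  qed (simp add: F_def fw_def)
  have iF: "integrable lborel (F n)" for n
  proof (rule Bochner_Integration.integrable_bound)
    show "integrable lborel (\<lambda>w. (kernel_coeff n * norm c ^ n) * norm (fw w))" using ifw by simp
    show "F n \<in> borel_measurable lborel" unfolding F_def using ifw by measurable
    show "AE w in lborel. norm (F n w) \<le> norm ((kernel_coeff n * norm c ^ n) * norm (fw w))"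
      using nF[of n] kernel_coeff_nonneg[of n] by (intro AE_I2) (simp add: abs_mult)
  qed
  have sumF: "(\<lambda>n. F n w) sums (indicator (ball 0 1) w *\<^sub>R (W (norm w) *\<^sub>R (f w * cnj (kernel_fun (w * cnj c)))))" for w
  proof (cases "norm w < 1")
    case True
    have "norm (w * cnj c) < 1" using mult_strict_mono[of "norm w" 1 "norm c" 1] True c by (simp add: norm_mult)
    from kernel_fun_sums[OF this] have "(\<lambda>n. cnj (complex_of_real (kernel_coeff n) * (w * cnj c) ^ n)) sums cnj (kernel_fun (w * cnj c))" by (simp only: sums_cnj)
    then have "(\<lambda>n. fw w * cnj (complex_of_real (kernel_coeff n) * (w * cnj c) ^ n)) sums (fw w * cnj (kernel_fun (w * cnj c)))" by (rule sums_mult)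
    moreover have "fw w * cnj (complex_of_real (kernel_coeff n) * (w * cnj c) ^ n) = F n w" for n
      by (simp add: F_def power_mult_distrib mult_ac)
    moreover have "fw w * cnj (kernel_fun (w * cnj c)) = indicator (ball 0 1) w *\<^sub>R (W (norm w) *\<^sub>R (f w * cnj (kernel_fun (w * cnj c))))"
      by (simp add: fw_def)
    ultimately show ?thesis by simp
  qed (simp add: F_def fw_def)
  have sc: "summable (\<lambda>n. kernel_coeff n * norm c ^ n)" by (rule kernel_coeff_summable) (use c in auto)
  have "(\<lambda>n. integral\<^sup>L lborel (F n)) sums (\<integral>w. (\<Sum>n. F n w) \<partial>lborel)"
  proof (rule sums_integral[OF iF])
    show "AE w in lborel. summable (\<lambda>n. norm (F n w))"
    proof (rule AE_I2, rule summable_comparison_test)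
      fix w :: complex
      show "summable (\<lambda>n. (kernel_coeff n * norm c ^ n) * norm (fw w))" by (intro summable_mult2 sc)
      show "\<exists>N. \<forall>n\<ge>N. norm (norm (F n w)) \<le> (kernel_coeff n * norm c ^ n) * norm (fw w)" using nF by simp
    qed
    show "summable (\<lambda>n. \<integral>w. norm (F n w) \<partial>lborel)"
    proof (rule summable_comparison_test)
      show "summable (\<lambda>n. (kernel_coeff n * norm c ^ n) * (\<integral>w. norm (fw w) \<partial>lborel))" by (intro summable_mult2 sc)
      have "(\<integral>w. norm (F n w) \<partial>lborel) \<le> (\<integral>w. (kernel_coeff n * norm c ^ n) * norm (fw w) \<partial>lborel)" for n
        by (rule integral_mono) (use iF nF ifw in auto)
      then show "\<exists>N. \<forall>n\<ge>N. norm (\<integral>w. norm (F n w) \<partial>lborel) \<le> (kernel_coeff n * norm c ^ n) * (\<integral>w. norm (fw w) \<partial>lborel)"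
        by (simp add: integral_nonneg_AE)
    qed
  qed
  also have "(\<lambda>w. \<Sum>n. F n w) = (\<lambda>w. indicator (ball 0 1) w *\<^sub>R (W (norm w) *\<^sub>R (f w * cnj (kernel_fun (w * cnj c)))))"
    using sumF by (simp add: sums_iff)
  finally have S: "(\<lambda>n. integral\<^sup>L lborel (F n)) sums (\<integral>w. indicator (ball 0 1) w *\<^sub>R (W (norm w) *\<^sub>R (f w * cnj (kernel_fun (w * cnj c)))) \<partial>lborel)" .
  have "integral\<^sup>L lborel (F n) = (deriv ^^ n) f 0 / fact n * c ^ n / complex_of_real pi" for n
  proof -
    have "integral\<^sup>L lborel (F n) = (\<integral>w. (complex_of_real (kernel_coeff n) * c ^ n) * (indicator (ball 0 1) w *\<^sub>R (W (norm w) *\<^sub>R (f w * cnj w ^ n))) \<partial>lborel)"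
      by (intro Bochner_Integration.integral_cong refl) (simp add: F_def fw_def mult_ac)
    also have "\<dots> = (complex_of_real (kernel_coeff n) * c ^ n) * (\<integral>w. indicator (ball 0 1) w *\<^sub>R (W (norm w) *\<^sub>R (f w * cnj w ^ n)) \<partial>lborel)"
      by (rule integral_mult_right_zero)
    also have "(\<integral>w. indicator (ball 0 1) w *\<^sub>R (W (norm w) *\<^sub>R (f w * cnj w ^ n)) \<partial>lborel) =
       (deriv ^^ n) f 0 / fact n * complex_of_real (\<integral>w. indicator (ball (0::complex) 1) w * (W (norm w) * norm w ^ (2 * n)) \<partial>lborel)"
      by (rule integral_disc_coefficient) (use f W ifw in \<open>auto simp: fw_def[abs_def]\<close>)
    also have "(\<integral>w. indicator (ball (0::complex) 1) w * (W (norm w) * norm w ^ (2 * n)) \<partial>lborel) = pi / ((real n + 1) * (\<alpha> * (real n + 1) + 1))"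
      unfolding W_def by (rule disc_moment[OF \<alpha>])
    also have "(complex_of_real (kernel_coeff n) * c ^ n) * ((deriv ^^ n) f 0 / fact n * complex_of_real (pi / ((real n + 1) * (\<alpha> * (real n + 1) + 1)))) =
       complex_of_real (kernel_coeff n * (pi / ((real n + 1) * (\<alpha> * (real n + 1) + 1)))) * ((deriv ^^ n) f 0 / fact n * c ^ n)"
      by (simp only: of_real_mult mult_ac)
    also have "kernel_coeff n * (pi / ((real n + 1) * (\<alpha> * (real n + 1) + 1))) = 1 / pi"
    proof -
      have "real n + 1 > 0" "\<alpha> * (real n + 1) + 1 > 0" using \<alpha> by (auto intro: add_nonneg_pos)
      moreover have "x * y / pi\<^sup>2 * (pi / (x * y)) = 1 / pi" if "x > 0" "y > 0" for x y :: real
        using that by (simp add: power2_eq_square)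
      ultimately show ?thesis unfolding kernel_coeff_def by blast
    qed
    finally show ?thesis by simp
  qed
  then have S2: "(\<lambda>n. (deriv ^^ n) f 0 / fact n * c ^ n / complex_of_real pi) sums (\<integral>w. indicator (ball 0 1) w *\<^sub>R (W (norm w) *\<^sub>R (f w * cnj (kernel_fun (w * cnj c)))) \<partial>lborel)"
    using S by simp
  have "(\<lambda>n. (deriv ^^ n) f 0 / fact n * c ^ n) sums f c"
    using holomorphic_power_series[OF f, of c] c by simp
  then have "(\<lambda>n. (deriv ^^ n) f 0 / fact n * c ^ n / complex_of_real pi) sums (f c / complex_of_real pi)" by (rule sums_divide)
  with S2 show ?thesis unfolding W_def by (rule sums_unique2)
qed

end

text \<open>\<open>Phi\<close> is the automorphism of the domain lying over the disc automorphism \<open>moeb a\<close>, and \<open>J\<close> is its real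
  Jacobian determinant. It reduces the reproducing formula at \<open>z\<close> to a point with \<open>snd z = 0\<close>.\<close>

locale hartogs_map = hartogs +
  fixes a :: complex
  assumes a: "norm a < 1"
begin

definition del :: real where "del = 1 - (norm a)\<^sup>2"

text \<open>The indicator makes the power a globally Borel function; on the disc,
  \<open>Re_den\<close> keeps the base off the branch cut.\<close>

definition den :: "real \<Rightarrow> complex \<Rightarrow> complex" where
  "den p v = indicator (ball 0 1) v *\<^sub>R (1 + cnj a * v) powr complex_of_real p"

definition chi :: "complex \<Rightarrow> complex" where "chi v = complex_of_real (del powr (\<alpha> / 2)) * den (-\<alpha>) v"

text \<open>On the unit disc, the complex Jacobian determinant of \<open>Phi\<close> up to the
  constant factor \<open>del powr (1 + \<alpha> / 2)\<close>.\<close>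

definition m :: "complex \<Rightarrow> complex" where "m v = den (-(2 + \<alpha>)) v"

definition J :: "complex \<Rightarrow> real" where "J v = del powr (2 + \<alpha>) * (norm (m v))\<^sup>2"

definition rho :: "complex \<Rightarrow> real" where "rho v = (1 - (norm v)\<^sup>2) powr (\<alpha> / 2)"

definition Phi :: "complex \<times> complex \<Rightarrow> complex \<times> complex" where
  "Phi y = (chi (snd y) * fst y, moeb a (snd y))"

lemma del: "del > 0" "del \<le> 1" using a by (auto simp: del_def abs_square_less_1)

lemma Re_den: assumes "norm v < 1" shows "Re (1 + cnj a * v) > 0"
proof -
  have "norm (- cnj a * v) < 1" using mult_strict_mono[of "norm a" 1 "norm v" 1] a assms by (simp add: norm_mult)
  from norm_lt_1_re[OF this] show ?thesis by simp
qed

lemma den_ne: assumes "norm v < 1" shows "1 + cnj a * v \<noteq> 0" "1 + cnj a * v \<notin> \<real>\<^sub>\<le>\<^sub>0"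
proof -
  show "1 + cnj a * v \<noteq> 0" using Re_den[OF assms] by (metis less_irrefl zero_complex.simps(1))
  show "1 + cnj a * v \<notin> \<real>\<^sub>\<le>\<^sub>0" using Re_den[OF assms] by (auto simp: complex_nonpos_Reals_iff)
qed

lemma den_0 [simp]: "den p 0 = 1" by (simp add: den_def)

lemma norm_den: "norm v < 1 \<Longrightarrow> norm (den p v) = norm (1 + cnj a * v) powr p"
  by (simp add: den_def norm_powr_real_powr')

lemma den_nonzero: "norm v < 1 \<Longrightarrow> den p v \<noteq> 0"
  using den_ne[of v] by (simp add: den_def)

lemma chi_nonzero: "norm v < 1 \<Longrightarrow> chi v \<noteq> 0"
  using den_nonzero del by (simp add: chi_def)

lemma den_holomorphic: "den p holomorphic_on ball 0 1"
proof -
  have "(\<lambda>v. (1 + cnj a * v) powr complex_of_real p) holomorphic_on ball 0 1"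
    by (intro holomorphic_intros) (use den_ne in auto)
  then show ?thesis by (rule holomorphic_transform) (simp add: den_def)
qed

lemma den_meas [measurable]: "den p \<in> borel_measurable borel"
proof -
  have "continuous_on (ball 0 1) (\<lambda>v. (1 + cnj a * v) powr complex_of_real p)"
    by (intro holomorphic_on_imp_continuous_on holomorphic_intros) (use den_ne in auto)
  from borel_measurable_continuous_on_indicator[OF _ this] show ?thesis
    unfolding den_def by simp
qed

lemma chi_meas [measurable]: "chi \<in> borel_measurable borel" unfolding chi_def by measurable
lemma m_meas [measurable]: "m \<in> borel_measurable borel" unfolding m_def by measurable
lemma J_meas [measurable]: "J \<in> borel_measurable borel" unfolding J_def by measurable
lemma moeb_meas [measurable]: "moeb a \<in> borel_measurable borel" unfolding moeb_def by measurable

lemma Phi_meas [measurable]: "Phi \<in> borel_measurable borel"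
  unfolding Phi_def by (intro borel_measurable_Pair) measurable

lemma J_nonneg: "J v \<ge> 0" by (simp add: J_def)

lemma norm_chi: "norm v < 1 \<Longrightarrow> norm (chi v) = del powr (\<alpha> / 2) * norm (1 + cnj a * v) powr (-\<alpha>)"
  using del by (simp add: chi_def norm_mult norm_den)

lemma J_eq: assumes v: "norm v < 1"
  shows "J v = (del / (norm (1 + cnj a * v))\<^sup>2)\<^sup>2 * (norm (chi v))\<^sup>2"
proof -
  define n where "n = norm (1 + cnj a * v)"
  have n: "n > 0" using den_ne[OF v] by (simp add: n_def)
  have "J v = del powr (2 + \<alpha>) * (n powr (-(2 + \<alpha>)))\<^sup>2" using v by (simp add: J_def m_def norm_den n_def)
  also have "(n powr (-(2 + \<alpha>)))\<^sup>2 = (n powr (-2))\<^sup>2 * (n powr (-\<alpha>))\<^sup>2"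
    by (simp add: powr_add[symmetric] power_mult_distrib[symmetric])
  also have "del powr (2 + \<alpha>) = del\<^sup>2 * (del powr (\<alpha> / 2))\<^sup>2"
    using del by (simp add: powr_add power2_eq_square[of "del powr (\<alpha> / 2)"] flip: powr_add powr_numeral)
  also have "n powr (-2) = 1 / n\<^sup>2" using n by (simp add: powr_minus_divide)
  finally show ?thesis using n v by (simp add: norm_chi n_def[symmetric] power_divide power_mult_distrib)
qed

text \<open>This is \<open>moeb_ident\<close> raised to the power \<open>\<alpha> / 2\<close>.
  Multiplication by \<open>chi v\<close> carries the fibre over v onto the fibre over
  \<open>moeb a v\<close>, which is why \<open>Phi\<close> preserves the domain.\<close>

lemma chi_rho: assumes v: "norm v < 1" shows "norm (chi v) * rho v = rho (moeb a v)"
proof -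
  define n where "n = norm (1 + cnj a * v)"
  have n: "n > 0" using den_ne[OF v] by (simp add: n_def)
  have v2: "1 - (norm v)\<^sup>2 > 0" using v by (simp add: abs_square_less_1)
  have "rho (moeb a v) = (del * (1 - (norm v)\<^sup>2) / n\<^sup>2) powr (\<alpha> / 2)"
    unfolding rho_def moeb_ident[OF den_ne(1)[OF v]] by (simp add: del_def n_def)
  also have "\<dots> = del powr (\<alpha> / 2) * rho v / (n\<^sup>2) powr (\<alpha> / 2)"
    using del v2 n by (simp add: rho_def powr_mult powr_divide)
  also have "(n\<^sup>2) powr (\<alpha> / 2) = n powr \<alpha>" using n powr_powr[of n 2 "\<alpha> / 2"] by simp
  finally show ?thesis using v n by (simp add: norm_chi n_def[symmetric] powr_minus_divide)
qed

lemma mem_U_rho: assumes "norm v < 1" shows "(w, v) \<in> U \<longleftrightarrow> norm w < rho v"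
proof -
  have x: "1 - (norm v)\<^sup>2 > 0" using assms by (simp add: abs_square_less_1)
  have "rho v \<ge> 0" by (simp add: rho_def)
  have "(rho v)\<^sup>2 = (1 - (norm v)\<^sup>2) powr \<alpha>" using x by (simp add: rho_def power2_eq_square flip: powr_add)
  then have "(w, v) \<in> U \<longleftrightarrow> (norm w)\<^sup>2 < (rho v)\<^sup>2" using assms x by (simp add: mem_U tau_def xx_def)
  also have "\<dots> \<longleftrightarrow> norm w < rho v" using \<open>rho v \<ge> 0\<close> by (metis norm_ge_zero power2_less_imp_less power_strict_mono zero_less_numeral)
  finally show ?thesis .
qed

lemma Phi_U: assumes "y \<in> U" shows "Phi y \<in> U"
proof -
  obtain w v where y: "y = (w, v)" by (metis surj_pair)
  have v: "norm v < 1" using U_ball[OF assms] y by simp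
  have mv: "norm (moeb a v) < 1" using moeb_ball_iff(1)[OF a] v by simp
  have "norm w < rho v" using mem_U_rho[OF v] assms y by simp
  then have "norm (chi v * w) < norm (chi v) * rho v" using chi_nonzero[OF v] by (simp add: norm_mult)
  then show ?thesis unfolding chi_rho[OF v] Phi_def y using mem_U_rho[OF mv] by simp
qed

text \<open>Integrate over fibres: the Moebius change of variables acts on the base and the complex
  dilation by \<open>chi\<close> on each fibre, and their Jacobians multiply to
  \<open>J\<close>.\<close>

lemma nn_integral_Phi:
  assumes q [measurable]: "q \<in> borel_measurable borel" and z: "\<And>w. w \<notin> U \<Longrightarrow> q w = 0"
  shows "(\<integral>\<^sup>+w. q w \<partial>lborel) = (\<integral>\<^sup>+y. indicator U y * (ennreal (J (snd y)) * q (Phi y)) \<partial>lborel)"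
proof -
  have [measurable]: "ball (0::complex) r \<in> sets borel" for r by auto
  have q2 [measurable]: "q \<in> borel_measurable (borel \<Otimes>\<^sub>M borel)" by (simp add: borel_prod)
  have U2 [measurable]: "U \<in> sets (borel \<Otimes>\<^sub>M borel)" using U_meas by (simp only: borel_prod)
  define I where "I v = (\<integral>\<^sup>+w. q (w, v) \<partial>lborel)" for v
  have I_m [measurable]: "I \<in> borel_measurable borel"
  proof -
    have "(\<lambda>v. \<integral>\<^sup>+w. q (w, v) \<partial>lborel) \<in> borel_measurable borel"
      by (rule lborel.borel_measurable_nn_integral) measurable
    then show ?thesis by (simp add: I_def[abs_def])
  qed
  have "(\<integral>\<^sup>+w. q w \<partial>lborel) = (\<integral>\<^sup>+w. q w \<partial>(lborel \<Otimes>\<^sub>M lborel))" by (simp only: lborel_prod)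
  also have "\<dots> = (\<integral>\<^sup>+v. I v \<partial>lborel)"
    unfolding I_def by (rule lborel_pair.nn_integral_snd[symmetric]) simp
  also have "\<dots> = (\<integral>\<^sup>+v. indicator (ball 0 1) v * I v \<partial>lborel)"
  proof (rule nn_integral_cong)
    fix v :: complex
    show "I v = indicator (ball 0 1) v * I v"
    proof (cases "norm v < 1")
      case False
      then have "q (w, v) = 0" for w using z[of "(w, v)"] U_ball[of "(w, v)"] by auto
      then show ?thesis using False by (simp add: I_def)
    qed simp
  qed
  also have "\<dots> = (\<integral>\<^sup>+v. indicator (ball 0 1) v * (ennreal ((del / (norm (1 + cnj a * v))\<^sup>2)\<^sup>2) * I (moeb a v)) \<partial>lborel)"
    unfolding del_def by (rule area_moeb_nn[OF a I_m])
  also have "\<dots> = (\<integral>\<^sup>+v. \<integral>\<^sup>+w. (indicator U (w, v) * (ennreal (J v) * q (Phi (w, v)))) \<partial>lborel \<partial>lborel)"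
  proof (rule nn_integral_cong)
    fix v :: complex
    show "indicator (ball 0 1) v * (ennreal ((del / (norm (1 + cnj a * v))\<^sup>2)\<^sup>2) * I (moeb a v)) =
      (\<integral>\<^sup>+w. (indicator U (w, v) * (ennreal (J v) * q (Phi (w, v)))) \<partial>lborel)"
    proof (cases "norm v < 1")
      case True
      have mv: "norm (moeb a v) < 1" using moeb_ball_iff(1)[OF a] True by simp
      have r: "rho v \<ge> 0" by (simp add: rho_def)
      have "I (moeb a v) = (\<integral>\<^sup>+w. indicator (ball 0 (norm (chi v) * rho v)) w * q (w, moeb a v) \<partial>lborel)"
        unfolding I_def chi_rho[OF True]
      proof (rule nn_integral_cong)
        fix w show "q (w, moeb a v) = indicator (ball 0 (rho (moeb a v))) w * q (w, moeb a v)"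
          using mem_U_rho[OF mv, of w] z[of "(w, moeb a v)"] by (simp add: indicator_def)
      qed
      also have "\<dots> = (\<integral>\<^sup>+w. indicator (ball 0 (rho v)) w * (ennreal ((norm (chi v))\<^sup>2) * q (chi v * w, moeb a v)) \<partial>lborel)"
        by (rule area_disc_nn[OF r chi_nonzero[OF True]]) measurable
      also have "\<dots> = (\<integral>\<^sup>+w. ennreal ((norm (chi v))\<^sup>2) * (indicator U (w, v) * q (Phi (w, v))) \<partial>lborel)"
        by (rule nn_integral_cong) (simp add: indicator_def mem_U_rho[OF True] Phi_def)
      finally have "ennreal ((del / (norm (1 + cnj a * v))\<^sup>2)\<^sup>2) * I (moeb a v) =
        (\<integral>\<^sup>+w. ennreal ((del / (norm (1 + cnj a * v))\<^sup>2)\<^sup>2) * (ennreal ((norm (chi v))\<^sup>2) * (indicator U (w, v) * q (Phi (w, v)))) \<partial>lborel)"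
        by (simp add: nn_integral_cmult)
      also have "\<dots> = (\<integral>\<^sup>+w. (indicator U (w, v) * (ennreal (J v) * q (Phi (w, v)))) \<partial>lborel)"
        by (rule nn_integral_cong) (simp add: J_eq[OF True] ennreal_mult' mult_ac)
      finally show ?thesis using True by simp
    next
      case False
      then have "indicator U (w, v) = (0 :: ennreal)" for w using U_ball[of "(w, v)"] by (auto simp: indicator_def)
      then show ?thesis using False by simp
    qed
  qed
  also have "\<dots> = (\<integral>\<^sup>+y. indicator U y * (ennreal (J (snd y)) * q (Phi y)) \<partial>(lborel \<Otimes>\<^sub>M lborel))"
    by (subst lborel_pair.nn_integral_snd[symmetric]) (simp_all add: lborel_prod)
  finally show ?thesis by (simp only: lborel_prod)
qed

text \<open>Restates the nonnegative formula as an equality of measures, so that complex integrals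
  and integrability can be transported as well.\<close>

lemma distr_Phi:
  "distr (density lborel (\<lambda>y. ennreal (indicator U y * J (snd y)))) borel Phi = density lborel (\<lambda>y. ennreal (indicator U y))"
proof (rule measure_eqI)
  fix B assume "B \<in> sets (distr (density lborel (\<lambda>y. ennreal (indicator U y * J (snd y)))) borel Phi)"
  then have B [measurable]: "B \<in> sets borel" by simp
  have "emeasure (distr (density lborel (\<lambda>y. ennreal (indicator U y * J (snd y)))) borel Phi) B =
    emeasure (density lborel (\<lambda>y. ennreal (indicator U y * J (snd y)))) (Phi -` B)"
    by (subst emeasure_distr) auto
  also have "\<dots> = (\<integral>\<^sup>+y. ennreal (indicator U y * J (snd y)) * indicator (Phi -` B) y \<partial>lborel)"
    by (rule emeasure_density) (use measurable_sets[OF Phi_meas B] in auto)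
  also have "\<dots> = (\<integral>\<^sup>+y. indicator U y * (ennreal (J (snd y)) * (indicator U (Phi y) * indicator B (Phi y))) \<partial>lborel)"
    by (rule nn_integral_cong) (use Phi_U in \<open>auto simp: indicator_def\<close>)
  also have "\<dots> = (\<integral>\<^sup>+w. indicator U w * indicator B w \<partial>lborel)"
    by (rule nn_integral_Phi[symmetric]) auto
  also have "\<dots> = emeasure (density lborel (\<lambda>y. ennreal (indicator U y))) B"
    by (subst emeasure_density) (auto simp: ennreal_indicator)
  finally show "emeasure (distr (density lborel (\<lambda>y. ennreal (indicator U y * J (snd y)))) borel Phi) B =
    emeasure (density lborel (\<lambda>y. ennreal (indicator U y))) B" .
qed simp

lemma integral_Phi:
  fixes q :: "complex \<times> complex \<Rightarrow> complex"
  assumes q [measurable]: "q \<in> borel_measurable borel" and z: "\<And>w. w \<notin> U \<Longrightarrow> q w = 0"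
  shows "(\<integral>w. q w \<partial>lborel) = (\<integral>y. (indicator U y * J (snd y)) *\<^sub>R q (Phi y) \<partial>lborel)"
    and "integrable lborel q \<longleftrightarrow> integrable lborel (\<lambda>y. (indicator U y * J (snd y)) *\<^sub>R q (Phi y))"
proof -
  have eq: "(\<lambda>w. indicator U w *\<^sub>R q w) = q" using z by (auto simp: indicator_def fun_eq_iff)
  have nn: "AE y in lborel. 0 \<le> indicator U y * J (snd y)" by (simp add: J_nonneg)
  have [measurable]: "(\<lambda>y. indicator U y * J (snd y)) \<in> borel_measurable lborel" by measurable
  have "(\<integral>w. q w \<partial>lborel) = (\<integral>w. q w \<partial>density lborel (\<lambda>y. ennreal (indicator U y)))"
    by (subst integral_density) (auto simp: eq)
  also have "\<dots> = (\<integral>y. q (Phi y) \<partial>density lborel (\<lambda>y. ennreal (indicator U y * J (snd y))))"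
    unfolding distr_Phi[symmetric] by (rule integral_distr) auto
  also have "\<dots> = (\<integral>y. (indicator U y * J (snd y)) *\<^sub>R q (Phi y) \<partial>lborel)"
    by (rule integral_density) (use nn in auto)
  finally show "(\<integral>w. q w \<partial>lborel) = (\<integral>y. (indicator U y * J (snd y)) *\<^sub>R q (Phi y) \<partial>lborel)" .
  have "integrable lborel q \<longleftrightarrow> integrable (density lborel (\<lambda>y. ennreal (indicator U y))) q"
    by (subst integrable_density) (auto simp: eq)
  also have "\<dots> \<longleftrightarrow> integrable (density lborel (\<lambda>y. ennreal (indicator U y * J (snd y)))) (\<lambda>y. q (Phi y))"
    unfolding distr_Phi[symmetric] by (rule integrable_distr_eq) auto
  also have "\<dots> \<longleftrightarrow> integrable lborel (\<lambda>y. (indicator U y * J (snd y)) *\<^sub>R q (Phi y))"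
    by (rule integrable_density) (use nn in auto)
  finally show "integrable lborel q \<longleftrightarrow> integrable lborel (\<lambda>y. (indicator U y * J (snd y)) *\<^sub>R q (Phi y))" .
qed

text \<open>Transformation rule of the kernel: the factor \<open>cnj (m v)\<close> of the Jacobian
  cancels the power of \<open>A\<close>. What remains is a holomorphic factor times a conjugate
  kernel that depends on \<open>fst y\<close> alone.\<close>

lemma kernel_transform:
  assumes z: "z \<in> U" "snd z = a" and y: "y \<in> U"
  shows "J (snd y) *\<^sub>R G z (Phi y) = m (snd y) * cnj (kernel_fun (fst y * cnj (fst z / complex_of_real (del powr (\<alpha> / 2)))))"
proof -
  define v where "v = snd y"
  define d where "d = 1 + cnj a * v"
  have v: "norm v < 1" using U_ball[OF y] by (simp add: v_def)
  have d: "d \<noteq> 0" "d \<notin> \<real>\<^sub>\<le>\<^sub>0" using den_ne[OF v] by (auto simp: d_def)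
  have "cnj (A z (Phi y)) = 1 - cnj a * moeb a v" using z by (simp add: A_def Phi_def v_def)
  also have "\<dots> = complex_of_real del / d"
  proof -
    have "1 - cnj a * ((v + a) / d) = (d - cnj a * (v + a)) / d" using d by (simp add: diff_divide_distrib)
    also have "d - cnj a * (v + a) = 1 - a * cnj a" by (simp add: d_def algebra_simps)
    also have "\<dots> = complex_of_real del" by (simp only: del_def of_real_diff complex_norm_square of_real_1)
    finally show ?thesis by (simp add: moeb_def d_def)
  qed
  finally have cA: "cnj (A z (Phi y)) = complex_of_real del / d" .
  have pw: "cnj (A z (Phi y) powr complex_of_real p) = complex_of_real (del powr p) * den (-p) v" for p
  proof -
    have "cnj (A z (Phi y) powr complex_of_real p) = cnj (A z (Phi y)) powr complex_of_real p"
      using cnj_A_powr[OF z(1) Phi_U[OF y]] cnj_A[of z "Phi y"] by metis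
    also have "\<dots> = (complex_of_real del * inverse d) powr complex_of_real p" unfolding cA by (simp add: field_simps)
    also have "\<dots> = complex_of_real del powr complex_of_real p * inverse d powr complex_of_real p"
    proof -
      \<comment> \<open>Logarithms add here because one factor is a positive real; for two general
        complex factors the principal branch may jump.\<close>
      have "Ln (complex_of_real del * inverse d) = complex_of_real (ln del) + Ln (inverse d)"
        using Ln_times_of_real[OF del(1), of "inverse d"] Ln_of_real[OF del(1)] d by simp
      then show ?thesis using del d by (simp add: powr_def Ln_of_real distrib_left exp_add)
    qed
    also have "inverse d powr complex_of_real p = d powr complex_of_real (-p)"
      using d by (simp add: powr_def Ln_inverse)
    also have "complex_of_real del powr complex_of_real p = complex_of_real (del powr p)"
      using del by (simp add: powr_of_real)
    finally show ?thesis using v by (simp add: den_def d_def)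
  qed
  define e where "e = complex_of_real (del powr (\<alpha> / 2))"
  have e: "e \<noteq> 0" "cnj e = e" "e * e = complex_of_real (del powr \<alpha>)" using del by (auto simp: e_def simp flip: of_real_mult powr_add)
  have cs: "cnj (s z (Phi y)) = fst y * cnj (fst z / e)"
  proof -
    have "cnj (s z (Phi y)) = cnj (fst z) * (chi v * fst y) / (complex_of_real (del powr \<alpha>) * den (-\<alpha>) v)"
      by (simp add: s_def pw) (simp add: Phi_def v_def)
    also have "\<dots> = cnj (fst z) * (e * den (-\<alpha>) v * fst y) / (e * e * den (-\<alpha>) v)"
    proof -
      have "chi v = e * den (-\<alpha>) v" by (simp add: chi_def e_def)
      then show ?thesis by (simp only: e(3))
    qed
    also have "\<dots> = fst y * cnj (fst z / e)" using e(1,2) den_nonzero[OF v, of "-\<alpha>"] by (simp add: field_simps)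
    finally show ?thesis .
  qed
  have ms: "complex_of_real (J v) = complex_of_real (del powr (2 + \<alpha>)) * (m v * cnj (m v))"
    using complex_norm_square[of "m v"] by (simp add: J_def)
  have A2: "A z (Phi y) powr complex_of_real (2 + \<alpha>) = complex_of_real (del powr (2 + \<alpha>)) * cnj (m v)"
    using arg_cong[OF pw[of "2 + \<alpha>"], of cnj] by (simp add: m_def)
  have "cnj (kernel_fun (cnj (s z (Phi y)))) = (complex_of_real (\<alpha> + 1) + complex_of_real (\<alpha> - 1) * s z (Phi y)) / (complex_of_real (pi\<^sup>2) * (1 - s z (Phi y)) ^ 3)"
    by (simp add: kernel_fun_def)
  moreover have "G z (Phi y) = (complex_of_real (\<alpha> + 1) + complex_of_real (\<alpha> - 1) * s z (Phi y)) /
      (complex_of_real (pi\<^sup>2) * A z (Phi y) powr complex_of_real (2 + \<alpha>) * (1 - s z (Phi y)) ^ 3)"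
    using z Phi_U[OF y] by (simp add: G_def)
  ultimately have "G z (Phi y) = cnj (kernel_fun (cnj (s z (Phi y)))) / A z (Phi y) powr complex_of_real (2 + \<alpha>)"
    by (simp add: field_simps)
  then have "complex_of_real (J v) * G z (Phi y) = m v * cnj (kernel_fun (cnj (s z (Phi y))))"
    unfolding ms A2 using del den_nonzero[OF v, of "-(2 + \<alpha>)"] by (simp add: m_def[symmetric])
  then show ?thesis unfolding cs by (simp add: scaleR_conv_of_real v_def e_def)
qed

lemma m_bounds: assumes v: "norm v < 1" shows "norm (m v) \<ge> 2 powr (-(2 + \<alpha>))"
proof -
  have "norm (1 + cnj a * v) \<le> 1 + norm a * norm v" using norm_triangle_ineq[of 1 "cnj a * v"] by (simp add: norm_mult)
  also have "\<dots> \<le> 2" using mult_mono[of "norm a" 1 "norm v" 1] a v by simp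
  finally have "norm (1 + cnj a * v) powr (-(2 + \<alpha>)) \<ge> 2 powr (-(2 + \<alpha>))"
    using den_ne[OF v] \<alpha> by (intro powr_mono2') auto
  then show ?thesis using v by (simp add: m_def norm_den)
qed

text \<open>Slices in the other direction: the first coordinate is fixed and the second runs over a
  disc, as the mean value property requires.\<close>

lemma mem_U_sqrt: "(w, v) \<in> U \<longleftrightarrow> norm v < sqrt (1 - norm w powr (2 / \<alpha>))"
proof -
  have "(w, v) \<in> U \<longleftrightarrow> (norm v)\<^sup>2 < 1 - norm w powr (2 / \<alpha>)" by (auto simp: U_dom_def)
  also have "\<dots> \<longleftrightarrow> sqrt ((norm v)\<^sup>2) < sqrt (1 - norm w powr (2 / \<alpha>))" by (simp only: real_sqrt_less_iff)
  finally show ?thesis by simp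
qed

lemma kernel_fun_bound: assumes "norm x \<le> r" "r < 1"
  shows "norm (kernel_fun x) \<le> (\<alpha> + 1 + \<bar>\<alpha> - 1\<bar>) / (pi\<^sup>2 * (1 - r) ^ 3)"
proof -
  have 1: "norm (1 - x) \<ge> 1 - r" using norm_triangle_ineq2[of 1 x] assms by simp
  have "norm (complex_of_real (\<alpha> - 1) * x) \<le> \<bar>\<alpha> - 1\<bar> * 1"
    using assms unfolding norm_mult norm_of_real by (intro mult_left_mono) auto
  then have 2: "norm (complex_of_real (\<alpha> - 1) * x) \<le> \<bar>\<alpha> - 1\<bar>" by simp
  have 3: "norm (complex_of_real (\<alpha> + 1) + complex_of_real (\<alpha> - 1) * x) \<le> \<alpha> + 1 + \<bar>\<alpha> - 1\<bar>"
  proof -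
    have "norm (complex_of_real (\<alpha> + 1)) = \<alpha> + 1" using \<alpha> by (simp only: norm_of_real)
    then show ?thesis using 2 norm_triangle_ineq[of "complex_of_real (\<alpha> + 1)" "complex_of_real (\<alpha> - 1) * x"] by linarith
  qed
  have "norm (kernel_fun x) = norm (complex_of_real (\<alpha> + 1) + complex_of_real (\<alpha> - 1) * x) / (pi\<^sup>2 * norm (1 - x) ^ 3)"
    by (simp add: kernel_fun_def norm_divide norm_mult norm_power)
  also have "\<dots> \<le> (\<alpha> + 1 + \<bar>\<alpha> - 1\<bar>) / (pi\<^sup>2 * (1 - r) ^ 3)"
    using 1 3 assms by (intro frac_le mult_left_mono power_mono mult_pos_pos) auto
  finally show ?thesis .
qed

text \<open>After \<open>Phi\<close> the kernel involves only the first coordinate, so the second is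
  integrated out by the mean value property. The slice area becomes the weight of
  \<open>disc_weighted_reproducing\<close>, which recovers the value at \<open>(c, 0)\<close>, a
  point that \<open>Phi\<close> maps to \<open>z\<close>.\<close>

lemma reproducing_at:
  assumes f [measurable]: "f \<in> borel_measurable borel" and f0: "\<And>w. w \<notin> U \<Longrightarrow> f w = 0"
    and fi: "integrable lborel f" and fh: "holomorphic2_on f U"
    and z: "z \<in> U" "snd z = a"
  shows "(\<integral>w. f w * G z w \<partial>lborel) = f z"
proof -
  have [measurable]: "ball (0::complex) r \<in> sets borel" for r by auto
  define c where "c = fst z / complex_of_real (del powr (\<alpha> / 2))"
  have xxz: "xx z = del" using z by (simp add: xx_def del_def)
  have c: "norm c < 1"
  proof -
    have "(norm c)\<^sup>2 = tau z"
      using del by (simp add: c_def norm_divide power_divide tau_def xxz power2_eq_square[of "del powr (\<alpha> / 2)"] flip: powr_add)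
    then have "(norm c)\<^sup>2 < 1" using U_bounds(5)[OF z(1)] by simp
    then show ?thesis by (simp add: abs_square_less_1)
  qed
  define F where "F y = f (Phi y) * m (snd y)" for y
  define Ck where "Ck = (\<alpha> + 1 + \<bar>\<alpha> - 1\<bar>) / (pi\<^sup>2 * (1 - norm c) ^ 3)"
  have Fm [measurable]: "F \<in> borel_measurable borel" unfolding F_def by measurable
  have kb: "norm (kernel_fun (w * cnj c)) \<le> Ck" if "norm w < 1" for w
    unfolding Ck_def
  proof (rule kernel_fun_bound[OF _ c])
    show "norm (w * cnj c) \<le> norm c" using that mult_right_mono[of "norm w" 1 "norm c"] by (simp add: norm_mult)
  qed
  have km [measurable]: "kernel_fun \<in> borel_measurable borel" unfolding kernel_fun_def by measurable
  have Fi: "integrable lborel (\<lambda>y. indicator U y *\<^sub>R F y)"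
  proof (rule Bochner_Integration.integrable_bound)
    \<comment> \<open>\<open>J\<close> is a multiple of the squared modulus of \<open>m\<close>,
      which is bounded below, so the modulus of \<open>m\<close> is at most \<open>B * J\<close>;
      integrability of \<open>f\<close> thus passes to \<open>F\<close>.\<close>
    define B where "B = 1 / (del powr (2 + \<alpha>) * 2 powr (-(2 + \<alpha>)))"
    show "integrable lborel (\<lambda>y. B * norm ((indicator U y * J (snd y)) *\<^sub>R f (Phi y)))"
      by (intro integrable_mult_right integrable_norm integral_Phi(2)[OF f f0, THEN iffD1] fi)
    show "(\<lambda>y. indicator U y *\<^sub>R F y) \<in> borel_measurable lborel" by measurable
    show "AE y in lborel. norm (indicator U y *\<^sub>R F y) \<le> norm (B * norm ((indicator U y * J (snd y)) *\<^sub>R f (Phi y)))"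
    proof (rule AE_I2)
      fix y
      show "norm (indicator U y *\<^sub>R F y) \<le> norm (B * norm ((indicator U y * J (snd y)) *\<^sub>R f (Phi y)))"
      proof (cases "y \<in> U")
        case True
        have v: "norm (snd y) < 1" using U_ball[OF True] by simp
        define D where "D = del powr (2 + \<alpha>)"
        define k where "k = (2::real) powr (-(2 + \<alpha>))"
        have D: "D > 0" "k > 0" using del by (simp_all add: D_def k_def)
        have mk: "k \<le> norm (m (snd y))" using m_bounds[OF v] by (simp add: k_def)
        have "norm (m (snd y)) = (1 / (D * k)) * (D * (norm (m (snd y)) * k))" using D by simp
        also have "\<dots> \<le> (1 / (D * k)) * (D * (norm (m (snd y)) * norm (m (snd y))))"
          using mk D by (intro mult_left_mono) auto
        finally have "norm (m (snd y)) \<le> B * J (snd y)"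
          by (simp add: B_def J_def D_def k_def power2_eq_square)
        then have "norm (f (Phi y)) * norm (m (snd y)) \<le> norm (f (Phi y)) * (B * J (snd y))"
          by (rule mult_left_mono) simp
        moreover have "B \<ge> 0" by (simp add: B_def)
        ultimately show ?thesis using True J_nonneg[of "snd y"] by (simp add: F_def norm_mult mult_ac)
      qed simp
    qed
  qed
  define Q where "Q y = (indicator U y *\<^sub>R F y) * cnj (kernel_fun (fst y * cnj c))" for y
  have Qm [measurable]: "Q \<in> borel_measurable borel" unfolding Q_def by measurable
  have Qi: "integrable lborel Q"
  proof (rule Bochner_Integration.integrable_bound)
    show "integrable lborel (\<lambda>y. Ck * norm (indicator U y *\<^sub>R F y))"
      by (intro integrable_mult_right integrable_norm Fi)
    show "AE y in lborel. norm (Q y) \<le> norm (Ck * norm (indicator U y *\<^sub>R F y))"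
    proof (rule AE_I2)
      fix y
      show "norm (Q y) \<le> norm (Ck * norm (indicator U y *\<^sub>R F y))"
      proof (cases "y \<in> U")
        case True
        have "norm (F y) * norm (kernel_fun (fst y * cnj c)) \<le> norm (F y) * Ck"
          using U_ball[OF True] by (intro mult_left_mono kb) auto
        also have "\<dots> \<le> \<bar>Ck\<bar> * norm (F y)" by (simp add: mult.commute mult_right_mono)
        finally show ?thesis using True by (simp add: Q_def norm_mult)
      qed (simp add: Q_def)
    qed
  qed simp
  have "(\<integral>w. f w * G z w \<partial>lborel) = (\<integral>y. (indicator U y * J (snd y)) *\<^sub>R (f (Phi y) * G z (Phi y)) \<partial>lborel)"
  proof (rule integral_Phi(1))
    have "(\<lambda>w. (\<lambda>(z, w). G z w) (z, w)) \<in> borel_measurable borel" using G_meas by measurable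
    then show "(\<lambda>w. f w * G z w) \<in> borel_measurable borel" by simp
  qed (simp add: f0)
  also have "\<dots> = (\<integral>y. Q y \<partial>lborel)"
  proof (rule Bochner_Integration.integral_cong[OF refl])
    fix y
    show "(indicator U y * J (snd y)) *\<^sub>R (f (Phi y) * G z (Phi y)) = Q y"
    proof (cases "y \<in> U")
      case True
      have "(indicator U y * J (snd y)) *\<^sub>R (f (Phi y) * G z (Phi y)) = f (Phi y) * (J (snd y) *\<^sub>R G z (Phi y))"
        using True by simp
      then show ?thesis unfolding kernel_transform[OF z True] using True by (simp add: Q_def F_def c_def mult.assoc)
    qed (simp add: Q_def)
  qed
  also have "\<dots> = (\<integral>y. Q y \<partial>(lborel \<Otimes>\<^sub>M lborel))" by (simp only: lborel_prod)
  also have "\<dots> = (\<integral>w. (\<integral>v. Q (w, v) \<partial>lborel) \<partial>lborel)"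
    using lborel_pair.integral_fst[of "\<lambda>w v. Q (w, v)"] Qi by (simp add: lborel_prod)
  finally have I1: "(\<integral>w. f w * G z w \<partial>lborel) = (\<integral>w. (\<integral>v. Q (w, v) \<partial>lborel) \<partial>lborel)" .
  define R where "R w = sqrt (1 - norm w powr (2 / \<alpha>))" for w :: complex
  define W where "W w = max 0 (1 - norm w powr (2 / \<alpha>))" for w :: complex
  define ft where "ft w = F (w, 0)" for w
  define S where "S w = (\<integral>v. indicator U (w, v) *\<^sub>R F (w, v) \<partial>lborel)" for w
  have R0: "R w > 0 \<longleftrightarrow> norm w < 1" for w
  proof -
    have "R w > 0 \<longleftrightarrow> (w, 0) \<in> U" unfolding mem_U_sqrt R_def by simp
    also have "\<dots> \<longleftrightarrow> norm w < 1" by (simp add: mem_U tau_def xx_def abs_square_less_1)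
    finally show ?thesis .
  qed
  have ind: "indicator U (w, v) = (indicator (ball 0 (R w)) v :: real)" for w v
    by (simp add: indicator_def mem_U_sqrt R_def)
  have holF: "(\<lambda>l. F (p l, q l)) holomorphic_on T"
    if "open T" "p holomorphic_on T" "q holomorphic_on T" "\<And>l. l \<in> T \<Longrightarrow> (p l, q l) \<in> U" for p q T
  proof -
    have q1: "q ` T \<subseteq> ball 0 1" using that(4) U_ball by fastforce
    have dn: "(\<lambda>l. den k (q l)) holomorphic_on T" for k
      using holomorphic_on_compose_gen[OF that(3) den_holomorphic q1] by (simp add: o_def)
    have mo: "(\<lambda>l. moeb a (q l)) holomorphic_on T"
      unfolding moeb_def using q1 den_ne(1) by (intro holomorphic_intros that) (auto simp: image_subset_iff)
    have "(\<lambda>l. f (chi (q l) * p l, moeb a (q l))) holomorphic_on T"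
    proof (rule holomorphic2_curve[OF fh _ mo that(1)])
      show "(\<lambda>l. chi (q l) * p l) holomorphic_on T" unfolding chi_def by (intro holomorphic_intros dn that)
      show "(chi (q l) * p l, moeb a (q l)) \<in> U" if "l \<in> T" for l
        using Phi_U[OF \<open>\<And>l. l \<in> T \<Longrightarrow> (p l, q l) \<in> U\<close>[OF that]] by (simp add: Phi_def)
    qed
    from holomorphic_on_mult[OF this dn[of "-(2 + \<alpha>)"]] show ?thesis by (simp only: F_def Phi_def m_def fst_conv snd_conv)
  qed
  have fth: "ft holomorphic_on ball 0 1"
    unfolding ft_def by (rule holF) (auto simp: mem_U tau_def xx_def abs_square_less_1)
  have Fi2: "integrable lborel (\<lambda>(w, v). indicator U (w, v) *\<^sub>R F (w, v))" using Fi by (simp add: case_prod_beta')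
  have Si: "integrable lborel S"
    using lborel_pair.integrable_fst[of "\<lambda>w v. indicator U (w, v) *\<^sub>R F (w, v)"] Fi2 by (simp add: lborel_prod S_def[abs_def])
  \<comment> \<open>Fubini gives integrability on almost every slice, hence the almost everywhere
    form of the mean value step.\<close>
  have slice: "AE w in lborel. integrable lborel (\<lambda>v. indicator U (w, v) *\<^sub>R F (w, v))"
    using lborel_pair.AE_integrable_fst[of "\<lambda>w v. indicator U (w, v) *\<^sub>R F (w, v)"] Fi2 by (simp add: lborel_prod)
  have AS: "AE w in lborel. S w = indicator (ball 0 1) w *\<^sub>R (complex_of_real (pi * W w) * ft w)"
    using slice
  proof eventually_elim
    case (elim w)
    show ?case
    proof (cases "norm w < 1")
      case True
      have Rw: "R w > 0" using R0 True by simp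
      have "(\<lambda>v. F (w, v)) holomorphic_on ball 0 (R w)"
        by (rule holF) (auto simp: mem_U_sqrt R_def)
      then have "S w = complex_of_real (pi * (R w)\<^sup>2) * F (w, 0)"
        unfolding S_def ind using elim[unfolded ind] by (intro holomorphic_disc_mean[OF Rw])
      moreover have "(R w)\<^sup>2 = W w" using Rw by (simp add: R_def W_def)
      ultimately show ?thesis using True by (simp add: ft_def)
    next
      case False
      have "indicator U (w, v) = (0::real)" for v using U_ball[of "(w, v)"] False by (auto simp: indicator_def)
      then show ?thesis using False by (simp add: S_def)
    qed
  qed
  have Wm [measurable]: "W \<in> borel_measurable borel" unfolding W_def by measurable
  have ftm [measurable]: "(\<lambda>w. indicator (ball 0 1) w *\<^sub>R ft w) \<in> borel_measurable borel"
    by (intro borel_measurable_continuous_on_indicator holomorphic_on_imp_continuous_on fth) auto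
  have Wfm: "(\<lambda>w. indicator (ball 0 1) w *\<^sub>R (complex_of_real (pi * W w) * ft w)) \<in> borel_measurable lborel"
  proof -
    have "(\<lambda>w. complex_of_real (pi * W w) * (indicator (ball 0 1) w *\<^sub>R ft w)) \<in> borel_measurable lborel" by measurable
    then show ?thesis by (simp only: mult_scaleR_right)
  qed
  have iW: "integrable lborel (\<lambda>w. indicator (ball 0 1) w *\<^sub>R (W w *\<^sub>R ft w))"
  proof -
    have "integrable lborel (\<lambda>w. indicator (ball 0 1) w *\<^sub>R (complex_of_real (pi * W w) * ft w))"
      using integrable_cong_AE_imp[OF Si Wfm] AS by (simp add: eq_commute)
    then have "integrable lborel (\<lambda>w. complex_of_real (1 / pi) * (indicator (ball 0 1) w *\<^sub>R (complex_of_real (pi * W w) * ft w)))"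
      by (rule integrable_mult_right)
    moreover have "complex_of_real (1 / pi) * (indicator (ball 0 1) w *\<^sub>R (complex_of_real (pi * W w) * ft w)) = indicator (ball 0 1) w *\<^sub>R (W w *\<^sub>R ft w)" for w
      by (simp add: scaleR_conv_of_real)
    ultimately show ?thesis by simp
  qed
  have "(\<integral>v. Q (w, v) \<partial>lborel) = S w * cnj (kernel_fun (w * cnj c))" for w
    unfolding S_def Q_def by (simp only: fst_conv integral_mult_left_zero)
  then have "(\<integral>w. f w * G z w \<partial>lborel) = (\<integral>w. S w * cnj (kernel_fun (w * cnj c)) \<partial>lborel)"
    unfolding I1 by simp
  also have "\<dots> = (\<integral>w. (indicator (ball 0 1) w *\<^sub>R (complex_of_real (pi * W w) * ft w)) * cnj (kernel_fun (w * cnj c)) \<partial>lborel)"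
  proof (rule integral_cong_AE)
    show "(\<lambda>w. S w * cnj (kernel_fun (w * cnj c))) \<in> borel_measurable lborel"
      using borel_measurable_integrable[OF Si] by measurable
    show "(\<lambda>w. (indicator (ball 0 1) w *\<^sub>R (complex_of_real (pi * W w) * ft w)) * cnj (kernel_fun (w * cnj c))) \<in> borel_measurable lborel"
      using Wfm by measurable
    show "AE w in lborel. S w * cnj (kernel_fun (w * cnj c)) = (indicator (ball 0 1) w *\<^sub>R (complex_of_real (pi * W w) * ft w)) * cnj (kernel_fun (w * cnj c))"
      using AS by eventually_elim (simp only:)
  qed
  also have "\<dots> = (\<integral>w. complex_of_real pi * (indicator (ball 0 1) w *\<^sub>R (W w *\<^sub>R (ft w * cnj (kernel_fun (w * cnj c))))) \<partial>lborel)"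
    by (intro Bochner_Integration.integral_cong refl) (simp add: scaleR_conv_of_real mult_ac)
  also have "\<dots> = complex_of_real pi * (\<integral>w. indicator (ball 0 1) w *\<^sub>R (W w *\<^sub>R (ft w * cnj (kernel_fun (w * cnj c)))) \<partial>lborel)"
    by (rule integral_mult_right_zero)
  also have "(\<integral>w. indicator (ball 0 1) w *\<^sub>R (W w *\<^sub>R (ft w * cnj (kernel_fun (w * cnj c)))) \<partial>lborel) = ft c / complex_of_real pi"
    unfolding W_def by (rule disc_weighted_reproducing[OF fth c iW[unfolded W_def]])
  also have "complex_of_real pi * (ft c / complex_of_real pi) = ft c" by simp
  \<comment> \<open>\<open>Phi\<close> sends \<open>(c, 0)\<close> to \<open>z\<close>, and the
    Jacobian factor satisfies \<open>m 0 = 1\<close>.\<close>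
  also have "ft c = f z"
  proof -
    have "Phi (c, 0) = z" using del z by (cases z) (simp add: Phi_def chi_def c_def moeb_def)
    then show ?thesis by (simp add: ft_def F_def m_def)
  qed
  finally show ?thesis .
qed

end

context hartogs
begin

lemma G_repr:
  assumes f: "f \<in> bergman_space U" and z: "z \<in> U"
  shows "(\<integral>w. f w * G z w \<partial>lborel) = f z"
proof -
  interpret D: finite_domain U by unfold_locales (rule U_open U_fin)+
  interpret hartogs_map \<alpha> "snd z" by unfold_locales (rule U_bounds(1)[OF z])
  have fH: "f \<in> D.H" by (rule D.bergman_H[OF f])
  show ?thesis
    by (rule reproducing_at[OF D.H_meas[OF fH] D.H_D(2)[OF fH] D.H_integrable[OF fH] _ z refl])
      (use f in \<open>auto simp: bergman_space_def\<close>)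
qed

text \<open>Done in two stages, because the near estimate needs the L2 norm of the kernel, which
  comes from the reproducing property inside the \<open>schur_kernel\<close> interpretation.\<close>

lemma localized_kernel_U: "\<exists>C. localized_kernel U G h C"
proof -
  obtain C where C: "C \<ge> 0" "\<And>z. (\<integral>\<^sup>+w. ennreal (norm (G z w) * h w) \<partial>lborel) \<le> ennreal (C * h z)"
    using G_schur by blast
  interpret S: schur_kernel U G h C
  proof unfold_locales
    show "G z w = 0" if "z \<notin> U \<or> w \<notin> U" for z w using that by (auto simp: G_def)
  qed (fact U_open U_fin G_meas G_herm cont_G G_locbd G_hol G_repr G_diag(1) h_meas h_pos h_nonneg C)+
  have "(\<integral>\<^sup>+w. ennreal ((norm (G w z))\<^sup>2) \<partial>lborel) = ennreal (Re (G z z))" if z: "z \<in> U" for z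
  proof -
    have "(\<integral>\<^sup>+w. ennreal ((norm (S.K z w))\<^sup>2) \<partial>lborel) = ennreal ((l2norm lborel (S.K z))\<^sup>2)"
      by (rule nn_integral_sqint[OF S.H_D(1)[OF S.K_H]])
    moreover have "(l2norm lborel (S.K z))\<^sup>2 = Re (G z z)" by (metis S.K_norm(1)[OF z] Re_complex_of_real)
    ultimately show ?thesis by (simp add: S.K_def)
  qed
  then have "localized_kernel U G h C" by unfold_locales (rule kernel_near_far)
  then show ?thesis by blast
qed

end

theorem corollary5p2:
  fixes \<alpha> :: real and u :: "complex \<times> complex \<Rightarrow> complex"
  assumes "\<alpha> > 0" and "\<alpha> \<noteq> 1"
    and "u \<in> Linf_space (U_dom \<alpha>)"
  shows "compact_on_bergman (U_dom \<alpha>) (toeplitz (U_dom \<alpha>) u) \<longleftrightarrow>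
    ((\<lambda>z. L2_norm_on (U_dom \<alpha>) (toeplitz (U_dom \<alpha>) u (normalized_kernel (U_dom \<alpha>) z))) \<longlongrightarrow> 0)
      ((\<lambda>z. skwarczynski_dist (U_dom \<alpha>) z 0) going_to (at 1) within U_dom \<alpha>)"
proof -
  interpret hartogs \<alpha> by unfold_locales (rule assms(1))
  obtain C where "localized_kernel (U_dom \<alpha>) G h C" using localized_kernel_U by blast
  then interpret localized_kernel "U_dom \<alpha>" G h C .
  show ?thesis by (rule toeplitz_compact_iff[OF assms(3) zero_U G_zero_const])
qed

end
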